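(* Let $1\le p\le+\infty$. 1. For every integer $N\ge0$ the following continuous embeddings hold: $$\mathcal{L}^{N}_{1(p,N)}(\mathbb{R}^n)\hookrightarrow C^{N-1,1}(\mathbb{R}^n)\ \text{ if }N\ge1,\qquad \mathcal{L}^{0}_{1(p,0)}(\mathbb{R}^n)\hookrightarrow L^\infty(\mathbb{R}^n)\ \text{ if }N=0 .$$ 2. For every integer $N\ge 0$ and every $f\in\mathcal{L}^{N}_{1(p,N)}(\mathbb{R}^n)$ there exists a unique $\dot P^N_\infty(f)\in\dot{\mathcal{P}}_N$ such that for all $x_0\in\mathbb{R}^n$ $$\lim_{r\to\infty}\dot P^N_{x_0,r}(f)=\dot P^N_\infty(f)\quad\text{in }\mathcal{P}_N .$$ Furthermore $\dot P^N_\infty:\mathcal{L}^{N}_{1(p,N)}(\mathbb{R}^n)\to\dot{\mathcal{P}}_N$ is a projection, with the property $$D^\alpha\dot P^N_\infty(f)=\dot P^{N-|\alpha|}_\infty(D^\alpha f)\qquad\text{for all multi-indices }|\alpha|\le N .$$ 3. For all $g,f\in\mathcal{L}^{1}_{1(p,1)}(\mathbb{R}^n)$ and $k=1,\dots,n$, $$\dot P^1_\infty(g\,\partial_kf)=\dot P^1_\infty(g)\,\partial_k\dot P^1_\infty(f)=\dot P^1_\infty(g)\,\dot P^0_\infty(\partial_kf).$$ In addition, for $g\in C^{0,1}(\mathbb{R}^n)$ and all $f\in\mathcal{L}^{0}_{1(p,0)}(\mathbb{R}^n)$, $$\dot P^0_\infty(g\,\partial_kf):=\lim_{r\to\infty}P^0_{0,r}(g\,\partial_kf)=0,\qquad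 k=1,\dots,n,$$ where $g\,\partial_kf=\partial_k(gf)-(\partial_kg)f\in\mathcal{S}'$. 4. For all $v\in\mathcal{L}^{1}_{1(p,1)}(\mathbb{R}^n;\mathbb{R}^n)$ with $\nabla\cdot v=0$ almost everywhere in $\mathbb{R}^n$ and all $f\in\mathcal{L}^{1}_{1(p,1)}(\mathbb{R}^n)$, $$\dot P^0_\infty(\nabla v\cdot\nabla f)=\dot P^0_\infty(\nabla v)\cdot\dot P^0_\infty(\nabla f),$$ i.e. $\dot P^0_\infty(\partial_kv\cdot\nabla f)=\dot P^0_\infty(\partial_kv)\cdot\dot P^0_\infty(\nabla f)$ for $k=1,\dots,n$.
   Context: $B(x,r)$ is the ball of radius $r$ centred at $x$ in $\mathbb{R}^n$, $B(r)=B(0,r)$. For an integer $N\ge0$, $\mathcal{P}_N$ (resp. $\dot{\mathcal{P}}_N$) is the finite-dimensional space of polynomials on $\mathbb{R}^n$ of degree $\le N$ (resp. homogeneous polynomials of degree $N$, including $0$), with any norm. For $f\in L^p_{loc}(\mathbb{R}^n)$, $$\operatorname{osc}_{p,N}(f;x_0,r)=|B(r)|^{-1/p}\inf_{P\in\mathcal{P}_N}\|f-P\|_{L^p(B(x_0,r))}.$$ $\mathcal{L}^{N}_{1(p,N)}(\mathbb{R}^n)$ is the space of $f\in L^p_{loc}(\mathbb{R}^n)$ with $|f|_{\mathcal{L}^{N}_{1(p,N)}}=\sup_{x_0\in\mathbb{R}^n}\sum_{j\in\mathbb{Z}}2^{-Nj}\operatorname{osc}_{p,N}(f;x_0,2^j)<+\infty$,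 with norm $|f|_{\mathcal{L}^{N}_{1(p,N)}}+\|f\|_{L^p(B(1))}$. $C^{N-1,1}(\mathbb{R}^n)$ denotes the functions whose derivatives of order $N-1$ are (globally) Lipschitz, equivalently $D^Nf\in L^\infty(\mathbb{R}^n)$ (functions themselves may grow polynomially); in particular $C^{0,1}(\mathbb{R}^n)$ is the space of globally Lipschitz functions. The embedding for $N\ge1$ includes the bound $\|D^Nf\|_\infty\le c\,\|f\|_{\mathcal{L}^N_{1(p,N)}}$. $\mathcal{S}'$ is the space of tempered distributions. Let $\varphi\in C_c^\infty(B(1))$ be a fixed standard mollifier (nonnegative, radial, $\int\varphi=1$), $\varphi_r(y)=r^{-n}\varphi(y/r)$. For $f\in\mathcal{S}'$ (or $f \in L^1_{loc}$) and a multi-index $\alpha$, $[f]^\alpha_{x,r}=(f*D^\alpha\varphi_r)(x)$, and $$\dot P^N_{x_0,r}(f)(x)=\sum_{|\alpha|=N}\frac1{\alpha!}[f]^\alpha_{x_0,r}\,x^\alpha .$$ In particular $P^0_{x_0,r}(f)=\dot P^0_{x_0,r}(f)=[f]^0_{x_0,r}$. For any distribution $h$ appearing above (such as $D^\alpha f$, $g\,\partial_kf$, $\partial_kv\cdot\nabla f$), $\dot P^M_\infty(h)$ denotes $\lim_{r\to\infty}\dot P^M_{x_0,r}(h)$, the assertion including that this limit exists and is independent of $x_0$ (in the second identity of part 3, $x_0=0$). These operators act componentwise on vector fields. *)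

theory Defs
  imports "HOL-Analysis.Analysis" "HOL-Probability.Essential_Supremum"
begin

section \<open>Multi-indices and classical derivatives\<close>

type_synonym 'n mindex = "'n \<Rightarrow> nat"

definition msize :: "'n::finite mindex \<Rightarrow> nat" where
  "msize \<alpha> = (\<Sum>i\<in>UNIV. \<alpha> i)"

definition mfact :: "'n::finite mindex \<Rightarrow> real" where
  "mfact \<alpha> = (\<Prod>i\<in>UNIV. fact (\<alpha> i))"

definition munit :: "'n \<Rightarrow> 'n mindex" where
  "munit k = (\<lambda>i. if i = k then 1 else 0)"

definition mpower :: "real ^ 'n \<Rightarrow> 'n::finite mindex \<Rightarrow> real" where
  "mpower x \<alpha> = (\<Prod>i\<in>UNIV. (x $ i) ^ \<alpha> i)"

definition partial :: "'n::finite \<Rightarrow> (real ^ 'n \<Rightarrow> real) \<Rightarrow> real ^ 'n \<Rightarrow> real" where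
  "partial i f = (\<lambda>x. frechet_derivative f (at x) (axis i 1))"

text \<open>The partial derivatives are taken in the order of some fixed enumeration of the
  index type; for functions of class \<open>C\<^sup>k\<close> with \<open>k \<ge> msize \<alpha>\<close> (the only ones
  to which this is applied) the order is immaterial.\<close>

definition mderiv :: "'n::finite mindex \<Rightarrow> (real ^ 'n \<Rightarrow> real) \<Rightarrow> real ^ 'n \<Rightarrow> real" where
  "mderiv \<alpha> f = foldr (\<lambda>i g. (partial i ^^ \<alpha> i) g) (SOME ks. distinct ks \<and> set ks = UNIV) f"

primrec Ck :: "nat \<Rightarrow> (real ^ 'n::finite \<Rightarrow> real) \<Rightarrow> bool" where
  "Ck 0 f \<longleftrightarrow> continuous_on UNIV f"
| "Ck (Suc k) f \<longleftrightarrow> f differentiable_on UNIV \<and> (\<forall>i. Ck k (partial i f))"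

definition smooth :: "(real ^ 'n::finite \<Rightarrow> real) \<Rightarrow> bool" where
  "smooth f \<longleftrightarrow> (\<forall>k. Ck k f)"


section \<open>Polynomials\<close>

definition polys :: "nat \<Rightarrow> (real ^ 'n::finite \<Rightarrow> real) set" where
  "polys N = {P. \<exists>a. P = (\<lambda>x. \<Sum>\<alpha> | msize \<alpha> \<le> N. a \<alpha> * mpower x \<alpha>)}"

definition hpolys :: "nat \<Rightarrow> (real ^ 'n::finite \<Rightarrow> real) set" where
  "hpolys N = {P. \<exists>a. P = (\<lambda>x. \<Sum>\<alpha> | msize \<alpha> = N. a \<alpha> * mpower x \<alpha>)}"

text \<open>A norm on the finite-dimensional space \<open>polys N\<close>; any other norm on it is
  equivalent.\<close>

definition poly_norm :: "(real ^ 'n::finite \<Rightarrow> real) \<Rightarrow> real" where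
  "poly_norm P = (SUP x\<in>cball 0 1. \<bar>P x\<bar>)"


section \<open>Lebesgue spaces\<close>

text \<open>Functions are representatives of their classes modulo null sets. The exponent \<open>p\<close>
  ranges over \<open>[1,\<infinity>]\<close>, with \<open>1/p = enn2real (inverse p)\<close>, which is \<open>0\<close> for \<open>p = \<infinity>\<close>.
  All norms take values in \<open>[0,\<infinity>]\<close>.\<close>

definition ennpowr :: "ennreal \<Rightarrow> real \<Rightarrow> ennreal" where
  "ennpowr t s = (if t = \<infinity> then \<infinity> else ennreal (enn2real t powr s))"

definition Lp_norm :: "ennreal \<Rightarrow> (real ^ 'n::finite) set \<Rightarrow> (real ^ 'n \<Rightarrow> real) \<Rightarrow> ennreal" where
  "Lp_norm p A f =
    (if p = \<infinity> then esssup (restrict_space lebesgue A) (\<lambda>x. ennreal \<bar>f x\<bar>)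
     else ennpowr (\<integral>\<^sup>+x\<in>A. ennreal (\<bar>f x\<bar> powr enn2real p) \<partial>lebesgue) (enn2real (inverse p)))"

definition Lp_loc :: "ennreal \<Rightarrow> (real ^ 'n::finite \<Rightarrow> real) set" where
  "Lp_loc p = {f \<in> borel_measurable lebesgue. \<forall>K. compact K \<longrightarrow> Lp_norm p K f < \<infinity>}"


section \<open>The generalized Campanato spaces\<close>

definition osc ::
  "ennreal \<Rightarrow> nat \<Rightarrow> (real ^ 'n::finite \<Rightarrow> real) \<Rightarrow> real ^ 'n \<Rightarrow> real \<Rightarrow> ennreal" where
  "osc p N f x0 r =
    ennreal (measure lebesgue (ball (0 :: real ^ 'n) r) powr (- enn2real (inverse p)))
    * (INF P\<in>polys N. Lp_norm p (ball x0 r) (\<lambda>x. f x - P x))"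

definition camp_seminorm :: "ennreal \<Rightarrow> nat \<Rightarrow> (real ^ 'n::finite \<Rightarrow> real) \<Rightarrow> ennreal" where
  "camp_seminorm p N f =
    (SUP x0. \<Sum>\<^sub>\<infinity>j\<in>(UNIV :: int set). ennreal (2 powi (- int N * j)) * osc p N f x0 (2 powi j))"

definition camp :: "ennreal \<Rightarrow> nat \<Rightarrow> (real ^ 'n::finite \<Rightarrow> real) set" where
  "camp p N = {f \<in> Lp_loc p. camp_seminorm p N f < \<infinity>}"

definition camp_norm :: "ennreal \<Rightarrow> nat \<Rightarrow> (real ^ 'n::finite \<Rightarrow> real) \<Rightarrow> ennreal" where
  "camp_norm p N f = camp_seminorm p N f + Lp_norm p (ball 0 1) f"


section \<open>The spaces $C^{k,1}$\<close>

definition Ck1 :: "nat \<Rightarrow> (real ^ 'n::finite \<Rightarrow> real) set" where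
  "Ck1 k = {F. Ck k F \<and> (\<forall>\<alpha>. msize \<alpha> = k \<longrightarrow> (\<exists>L. L-lipschitz_on UNIV (mderiv \<alpha> F)))}"

definition lip_seminorm :: "(real ^ 'n::finite \<Rightarrow> real) \<Rightarrow> ennreal" where
  "lip_seminorm F = (SUP (x, y)\<in>{(x, y). x \<noteq> y}. ennreal (\<bar>F x - F y\<bar> / dist x y))"

text \<open>Members of \<open>Ck1 k\<close> may grow polynomially, so the derivatives of order at most \<open>k\<close>
  are only measured at the origin.\<close>

definition Ck1_norm :: "nat \<Rightarrow> (real ^ 'n::finite \<Rightarrow> real) \<Rightarrow> ennreal" where
  "Ck1_norm k F =
    (\<Sum>\<alpha> | msize \<alpha> \<le> k. ennreal \<bar>mderiv \<alpha> F 0\<bar>) + (\<Sum>\<alpha> | msize \<alpha> = k. lip_seminorm (mderiv \<alpha> F))"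


section \<open>Test functions, weak derivatives and tempered distributions\<close>

definition test_fun :: "(real ^ 'n::finite \<Rightarrow> real) \<Rightarrow> bool" where
  "test_fun \<psi> \<longleftrightarrow> smooth \<psi> \<and> compact (closure {x. \<psi> x \<noteq> 0})"

definition has_wderiv ::
  "'n::finite mindex \<Rightarrow> (real ^ 'n \<Rightarrow> real) \<Rightarrow> (real ^ 'n \<Rightarrow> real) \<Rightarrow> bool" where
  "has_wderiv \<alpha> f h \<longleftrightarrow> f \<in> Lp_loc 1 \<and> h \<in> Lp_loc 1 \<and>
    (\<forall>\<psi>. test_fun \<psi> \<longrightarrow>
      (LINT x|lebesgue. f x * mderiv \<alpha> \<psi> x) = (-1) ^ msize \<alpha> * (LINT x|lebesgue. h x * \<psi> x))"

text \<open>A representative of the weak derivative, which is unique up to null sets.\<close>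

definition wderiv :: "'n::finite mindex \<Rightarrow> (real ^ 'n \<Rightarrow> real) \<Rightarrow> real ^ 'n \<Rightarrow> real" where
  "wderiv \<alpha> f = (SOME h. has_wderiv \<alpha> f h)"

definition schwartz :: "(real ^ 'n::finite \<Rightarrow> real) set" where
  "schwartz = {\<psi>. smooth \<psi> \<and> (\<forall>\<alpha> \<beta>. bounded (range (\<lambda>x. mpower x \<alpha> * mderiv \<beta> \<psi> x)))}"

text \<open>A distribution is represented as a functional on functions, of which only the values on
  \<open>schwartz\<close> (or just on \<open>test_fun\<close>s, for locally integrable functions without
  growth restriction) are meaningful.\<close>

type_synonym 'n distr = "(real ^ 'n \<Rightarrow> real) \<Rightarrow> real"

definition tempered :: "'n::finite distr \<Rightarrow> bool" where
  "tempered T \<longleftrightarrow>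
    (\<forall>\<psi>\<in>schwartz. \<forall>\<eta>\<in>schwartz. \<forall>a b. T (\<lambda>x. a * \<psi> x + b * \<eta> x) = a * T \<psi> + b * T \<eta>) \<and>
    (\<exists>C m. \<forall>\<psi>\<in>schwartz. \<bar>T \<psi>\<bar> \<le>
      C * (\<Sum>\<alpha> | msize \<alpha> \<le> m. \<Sum>\<beta> | msize \<beta> \<le> m. (SUP x. \<bar>mpower x \<alpha> * mderiv \<beta> \<psi> x\<bar>)))"

definition reg :: "(real ^ 'n::finite \<Rightarrow> real) \<Rightarrow> 'n distr" where
  "reg f = (\<lambda>\<psi>. LINT x|lebesgue. f x * \<psi> x)"

definition dderiv :: "'n::finite mindex \<Rightarrow> 'n distr \<Rightarrow> 'n distr" where
  "dderiv \<alpha> T = (\<lambda>\<psi>. (-1) ^ msize \<alpha> * T (mderiv \<alpha> \<psi>))"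

definition conv :: "'n::finite distr \<Rightarrow> (real ^ 'n \<Rightarrow> real) \<Rightarrow> real ^ 'n \<Rightarrow> real" where
  "conv T \<psi> x = T (\<lambda>y. \<psi> (x - y))"

text \<open>The distribution \<open>g \<partial>\<^sub>k f = \<partial>\<^sub>k (g f) - (\<partial>\<^sub>k g) f\<close>, for Lipschitz \<open>g\<close>
  and \<open>f\<close> not necessarily weakly differentiable.\<close>

definition mult_dpartial ::
  "(real ^ 'n \<Rightarrow> real) \<Rightarrow> 'n::finite \<Rightarrow> (real ^ 'n \<Rightarrow> real) \<Rightarrow> 'n distr" where
  "mult_dpartial g k f =
    (\<lambda>\<psi>. dderiv (munit k) (reg (\<lambda>x. g x * f x)) \<psi> - reg (\<lambda>x. wderiv (munit k) g x * f x) \<psi>)"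


section \<open>Mollified Taylor polynomials and their limits\<close>

definition mollifier :: "(real ^ 'n::finite \<Rightarrow> real) \<Rightarrow> bool" where
  "mollifier \<phi> \<longleftrightarrow> test_fun \<phi> \<and> closure {x. \<phi> x \<noteq> 0} \<subseteq> ball 0 1 \<and> (\<forall>x. 0 \<le> \<phi> x) \<and>
    (\<forall>x y. norm x = norm y \<longrightarrow> \<phi> x = \<phi> y) \<and> (LINT x|lebesgue. \<phi> x) = 1"

definition rescale :: "(real ^ 'n::finite \<Rightarrow> real) \<Rightarrow> real \<Rightarrow> real ^ 'n \<Rightarrow> real" where
  "rescale \<phi> r = (\<lambda>y. \<phi> (y /\<^sub>R r) / r ^ CARD('n))"

definition moment ::
  "(real ^ 'n \<Rightarrow> real) \<Rightarrow> 'n::finite mindex \<Rightarrow> real ^ 'n \<Rightarrow> real \<Rightarrow> 'n distr \<Rightarrow> real" where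
  "moment \<phi> \<alpha> x r T = conv T (mderiv \<alpha> (rescale \<phi> r)) x"

definition Pdot ::
  "(real ^ 'n \<Rightarrow> real) \<Rightarrow> nat \<Rightarrow> real ^ 'n \<Rightarrow> real \<Rightarrow> 'n::finite distr \<Rightarrow> real ^ 'n \<Rightarrow> real" where
  "Pdot \<phi> N x0 r T = (\<lambda>x. \<Sum>\<alpha> | msize \<alpha> = N. 1 / mfact \<alpha> * moment \<phi> \<alpha> x0 r T * mpower x \<alpha>)"

definition Pdot_tendsto ::
  "(real ^ 'n \<Rightarrow> real) \<Rightarrow> nat \<Rightarrow> real ^ 'n \<Rightarrow> 'n::finite distr \<Rightarrow> (real ^ 'n \<Rightarrow> real) \<Rightarrow> bool" where
  "Pdot_tendsto \<phi> N x0 T Q \<longleftrightarrow>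
    ((\<lambda>r. poly_norm (\<lambda>x. Pdot \<phi> N x0 r T x - Q x)) \<longlongrightarrow> 0) at_top"

definition has_Pinf ::
  "(real ^ 'n \<Rightarrow> real) \<Rightarrow> nat \<Rightarrow> 'n::finite distr \<Rightarrow> (real ^ 'n \<Rightarrow> real) \<Rightarrow> bool" where
  "has_Pinf \<phi> N T Q \<longleftrightarrow> Q \<in> hpolys N \<and> (\<forall>x0. Pdot_tendsto \<phi> N x0 T Q)"

definition Pinf_exists :: "(real ^ 'n \<Rightarrow> real) \<Rightarrow> nat \<Rightarrow> 'n::finite distr \<Rightarrow> bool" where
  "Pinf_exists \<phi> N T \<longleftrightarrow> (\<exists>!Q. has_Pinf \<phi> N T Q)"

text \<open>Only meaningful together with \<open>Pinf_exists\<close>.\<close>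

definition Pinf ::
  "(real ^ 'n \<Rightarrow> real) \<Rightarrow> nat \<Rightarrow> 'n::finite distr \<Rightarrow> real ^ 'n \<Rightarrow> real" where
  "Pinf \<phi> N T = (THE Q. has_Pinf \<phi> N T Q)"

definition linear_projection ::
  "('a \<Rightarrow> real) set \<Rightarrow> ('a \<Rightarrow> real) set \<Rightarrow> (('a \<Rightarrow> real) \<Rightarrow> ('a \<Rightarrow> real)) \<Rightarrow> bool" where
  "linear_projection V W Pr \<longleftrightarrow>
    W \<subseteq> V \<and> (\<forall>f\<in>V. Pr f \<in> W) \<and>
    (\<forall>f\<in>V. \<forall>g\<in>V. \<forall>a b. (\<lambda>x. a * f x + b * g x) \<in> V \<and>
      Pr (\<lambda>x. a * f x + b * g x) = (\<lambda>x. a * Pr f x + b * Pr g x)) \<and>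
    (\<forall>w\<in>W. Pr w = w)"

end

theory Submission
  imports Defs
begin

text \<open>
  Membership in a Campanato space is used through one consequence only. By Hoelder's inequality, the
  \<open>L\<^sup>1\<close> distance of \<open>f\<close> on the ball \<open>B(x,2^j)\<close> to the polynomials of degree \<open>N\<close>, divided by
  \<open>2^(j(n+N))\<close>, is at most a constant times \<open>2^(-Nj) osc(f;x,2^j)\<close>; so these numbers are summable over
  the integers \<open>j\<close>, with a bound \<open>K\<close> that does not depend on \<open>x\<close> (\<open>camp_summable_osc\<close>). All later
  arguments concern functions with this property, called \<open>summable_osc\<close>.

  Let \<open>\<Phi>\<close> be a test function with integral one and vanishing moments of the orders \<open>1\<close> to \<open>N\<close>. Then
  \<open>f * D^\<alpha> \<Phi>\<^sub>r\<close> is the exact derivative \<open>D^\<alpha> f\<close> if \<open>f\<close> is a polynomial of degree \<open>N\<close>. Subtracting a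
  nearly optimal polynomial shows that two such mollified derivatives at comparable scales differ at
  most by a multiple of the scaled distance of \<open>f\<close> to the polynomials (\<open>mollified_derivative_compare\<close>),
  and these differences can be telescoped over dyadic scales. At large scales, for \<open>|\<alpha>| = N\<close>, the limit
  exists and does not depend on the point (\<open>mollified_large_scale\<close>); a derivative of order \<open>N\<close> leaves
  only constants of a polynomial of degree \<open>N\<close>, so the given mollifier \<open>\<phi>\<close> can play the role of \<open>\<Phi>\<close>
  here, and the limit is the polynomial at infinity of the second part. At small scales the mollified
  derivatives converge (\<open>mollified_small_scale\<close>): uniformly below the order \<open>N\<close>, and boundedly for the
  order \<open>N\<close>, because at a fixed scale they are close to their limits at large scales. Hence \<open>f\<close> has a
  representative of class \<open>C^(N-1,1)\<close> and bounded weak derivatives of order \<open>N\<close>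
  (\<open>summable_osc_regularity\<close>), which is the first part.

  For \<open>N = 1\<close> the polynomial at infinity is the blow-down of \<open>f\<close>: on \<open>B(x0,R)\<close> the function differs from
  an affine function with the limiting slope by \<open>o(R)\<close> in the mean (\<open>blow_down\<close>), and by an integration
  by parts \<open>\<partial>\<^sub>k f\<close> tends weakly, at scale \<open>R\<close>, to the constant slope (\<open>weak_blow_down\<close>). In a product
  \<open>g \<partial>\<^sub>k f\<close> tested with a derivative of \<open>\<phi>\<^sub>R\<close> the factor \<open>g\<close> can be replaced by its blow-down, because
  \<open>\<partial>\<^sub>k f\<close> is bounded; the blow-down is smooth and can be absorbed into the test function, after which only
  the weak limit of \<open>\<partial>\<^sub>k f\<close> matters (\<open>moment_product_tendsto\<close>). For a divergence free field \<open>v\<close> one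
  has \<open>\<partial>\<^sub>k v \<cdot> \<nabla>f = div (f \<partial>\<^sub>k v)\<close>, so the mollification of the left hand side is a sum of first
  order moments of the products \<open>f \<partial>\<^sub>k v\<^sub>i\<close>, which are covered by the same limit theorem with the roles of
  the two functions exchanged (\<open>has_Pinf_div_free_product\<close>).

  For \<open>N = 0\<close> and a Lipschitz function \<open>g\<close>, the bounded weak derivative of \<open>g\<close> is a weak limit of
  difference quotients (\<open>Lipschitz_has_wderiv\<close>). The distribution \<open>g \<partial>\<^sub>k f\<close> vanishes if \<open>f\<close> is constant, and at
  large scales \<open>f\<close> is close in the mean to its constant at infinity (\<open>mult_dpartial_tendsto_0\<close>).
\<close>

section \<open>Smooth functions and iterated partial derivatives\<close>

lemma partial_eqI:
  assumes "(f has_derivative f') (at x)"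
  shows "partial i f x = f' (axis i 1)"
  using frechet_derivative_at[OF assms] by (simp add: partial_def)

lemma Ck_imp_continuous: "Ck k f \<Longrightarrow> continuous_on UNIV f"
  by (cases k) (auto intro: differentiable_imp_continuous_on)

lemma Ck_SucD: "Ck (Suc k) f \<Longrightarrow> Ck k f"
  by (induction k arbitrary: f) (auto intro: differentiable_imp_continuous_on)

lemma smooth_imp_has_derivative:
  assumes "smooth f"
  shows "(f has_derivative frechet_derivative f (at x)) (at x)"
proof -
  have "Ck (Suc 0) f" using assms by (simp only: smooth_def)
  then show ?thesis
    by (simp add: differentiable_on_def flip: frechet_derivative_works)
qed

lemma smooth_partial: "smooth f \<Longrightarrow> smooth (partial i f)"
  unfolding smooth_def by (metis Ck.simps(2))

lemma smooth_imp_continuous: "smooth f \<Longrightarrow> continuous_on UNIV f"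
  unfolding smooth_def using Ck_imp_continuous by blast

lemma smooth_imp_borel: "smooth f \<Longrightarrow> f \<in> borel_measurable borel"
  by (intro borel_measurable_continuous_onI smooth_imp_continuous)

lemma frechet_derivative_partials:
  fixes f :: "real ^ 'n::finite \<Rightarrow> real"
  assumes "(f has_derivative f') (at x)"
  shows "f' h = (\<Sum>i\<in>UNIV. h $ i * partial i f x)"
proof -
  interpret linear f' using assms by (rule has_derivative_linear)
  have "f' h = f' (\<Sum>i\<in>UNIV. h $ i *\<^sub>R axis i 1)"
    by (simp add: basis_expansion flip: scalar_mult_eq_scaleR)
  also have "\<dots> = (\<Sum>i\<in>UNIV. h $ i * f' (axis i 1))"
    by (simp add: sum scale)
  finally show ?thesis using partial_eqI[OF assms] by simp
qed

lemma smooth_has_derivative: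
  assumes "smooth f"
  shows "(f has_derivative (\<lambda>h. \<Sum>i\<in>UNIV. h $ i * partial i f x)) (at x)"
proof -
  have "frechet_derivative f (at x) = (\<lambda>h. \<Sum>i\<in>UNIV. h $ i * partial i f x)"
    using frechet_derivative_partials[OF smooth_imp_has_derivative[OF assms]] by blast
  then show ?thesis using smooth_imp_has_derivative[OF assms, of x] by simp
qed

text \<open>This rule shows the smoothness of a whole family of functions at once, without a count of derivatives.\<close>

lemma smooth_coinduct:
  assumes "P f" "\<And>f x. P f \<Longrightarrow> f differentiable (at x)" "\<And>f i. P f \<Longrightarrow> P (partial i f)"
  shows "smooth f"
proof -
  have "Ck k f" if "P f" for k f
    using that
  proof (induction k arbitrary: f)
    case 0
    then show ?case
      using assms(2) by (auto simp: differentiable_on_def differentiable_imp_continuous_within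
          continuous_on_eq_continuous_within)
  next
    case (Suc k)
    then show ?case using assms(2,3) by (auto simp: differentiable_on_def)
  qed
  then show ?thesis using assms(1) by (simp add: smooth_def)
qed

lemma partial_add:
  assumes "f differentiable (at x)" "g differentiable (at x)"
  shows "partial i (\<lambda>x. f x + g x) x = partial i f x + partial i g x"
  using partial_eqI[OF has_derivative_add[OF frechet_derivative_works[THEN iffD1, OF assms(1)]
     frechet_derivative_works[THEN iffD1, OF assms(2)]]] by (simp add: partial_def)

lemma partial_mult:
  assumes "f differentiable (at x)" "g differentiable (at x)"
  shows "partial i (\<lambda>x. f x * g x) x = partial i f x * g x + f x * partial i g x"
  using partial_eqI[OF has_derivative_mult[OF frechet_derivative_works[THEN iffD1, OF assms(1)]
     frechet_derivative_works[THEN iffD1, OF assms(2)]]] by (simp add: partial_def algebra_simps)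

lemma partial_const [simp]: "partial i (\<lambda>x. c) = (\<lambda>x. 0)"
  by (rule ext, rule partial_eqI[of _ "\<lambda>h. 0", simplified]) auto

lemma partial_coord: "partial i (\<lambda>x. x $ j) = (\<lambda>x. if i = j then 1 else 0)"
proof
  fix x :: "real ^ 'a"
  have "((\<lambda>x. x $ j) has_derivative (\<lambda>h. h $ j)) (at x)"
    by (rule bounded_linear_imp_has_derivative[OF bounded_linear_vec_nth])
  from partial_eqI[OF this, of i] show "partial i (\<lambda>x. x $ j) x = (if i = j then 1 else 0)"
    by (simp add: axis_def)
qed

lemma smooth_differentiable: "smooth f \<Longrightarrow> f differentiable (at x)"
  using smooth_imp_has_derivative differentiableI by blast

lemma partial_affine:
  fixes f :: "real ^ 'n::finite \<Rightarrow> real"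
  assumes "smooth f"
  shows "partial i (\<lambda>y. f (a + c *\<^sub>R y)) = (\<lambda>y. c * partial i f (a + c *\<^sub>R y))"
proof
  fix y :: "real ^ 'n"
  have "((\<lambda>y. f (a + c *\<^sub>R y)) has_derivative
      (\<lambda>h. frechet_derivative f (at (a + c *\<^sub>R y)) (c *\<^sub>R h))) (at y)"
    by (rule has_derivative_compose[of "\<lambda>y. a + c *\<^sub>R y" "\<lambda>h. c *\<^sub>R h" y UNIV f])
       (auto intro!: derivative_eq_intros smooth_imp_has_derivative assms)
  from partial_eqI[OF this, of i]
  show "partial i (\<lambda>y. f (a + c *\<^sub>R y)) y = c * partial i f (a + c *\<^sub>R y)"
    using linear_scale[OF has_derivative_linear[OF smooth_imp_has_derivative[OF assms]]]
    by (simp add: partial_def)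
qed

lemma smooth_const [simp]: "smooth (\<lambda>x. c)"
  by (rule smooth_coinduct[of "\<lambda>f. \<exists>c. f = (\<lambda>x. c)"]) auto

lemma smooth_coord [simp]: "smooth (\<lambda>x. x $ j)"
  by (rule smooth_coinduct[of "\<lambda>f. smooth f \<or> f = (\<lambda>x. x $ j)"])
     (auto simp: smooth_differentiable smooth_partial partial_coord
       intro: bounded_linear_imp_differentiable bounded_linear_vec_nth)

lemma Ck_add: "Ck k f \<Longrightarrow> Ck k g \<Longrightarrow> Ck k (\<lambda>x. f x + g x)"
proof (induction k arbitrary: f g)
  case 0 then show ?case by (simp add: continuous_on_add continuous_on_mult)
next
  case (Suc k)
  have "partial i (\<lambda>x. f x + g x) = (\<lambda>x. partial i f x + partial i g x)" for i
    using Suc.prems by (auto intro!: partial_add ext simp: differentiable_on_def)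
  then show ?case using Suc by (simp add: differentiable_on_add)
qed

lemma Ck_mult: "Ck k f \<Longrightarrow> Ck k g \<Longrightarrow> Ck k (\<lambda>x. f x * g x)"
proof (induction k arbitrary: f g)
  case 0 then show ?case by (simp add: continuous_on_add continuous_on_mult)
next
  case (Suc k)
  have "partial i (\<lambda>x. f x * g x) = (\<lambda>x. partial i f x * g x + f x * partial i g x)" for i
    using Suc.prems by (auto intro!: partial_mult ext simp: differentiable_on_def)
  moreover have "Ck k f" "Ck k g" using Suc.prems by (auto intro: Ck_SucD simp del: Ck.simps)
  ultimately show ?case using Suc.prems
    by (auto intro: differentiable_on_mult intro!: Ck_add Suc.IH)
qed

lemma smooth_add [intro]: "smooth f \<Longrightarrow> smooth g \<Longrightarrow> smooth (\<lambda>x. f x + g x)"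
  by (simp add: smooth_def Ck_add)

lemma smooth_mult [intro]: "smooth f \<Longrightarrow> smooth g \<Longrightarrow> smooth (\<lambda>x. f x * g x)"
  by (simp add: smooth_def Ck_mult)

lemma smooth_cmult: "smooth f \<Longrightarrow> smooth (\<lambda>x. c * f x)"
  by (intro smooth_mult) auto

lemma smooth_sum: "(\<And>j. j \<in> J \<Longrightarrow> smooth (f j)) \<Longrightarrow> smooth (\<lambda>x. \<Sum>j\<in>J. f j x)"
  by (induction J rule: infinite_finite_induct) auto

lemma smooth_prod: "(\<And>j. j \<in> J \<Longrightarrow> smooth (f j)) \<Longrightarrow> smooth (\<lambda>x. \<Prod>j\<in>J. f j x)"
  by (induction J rule: infinite_finite_induct) auto

lemma smooth_power: "smooth f \<Longrightarrow> smooth (\<lambda>x. f x ^ k)"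
  by (induction k) auto

lemma smooth_affine: 
  assumes "smooth f" shows "smooth (\<lambda>y. f (a + c *\<^sub>R y))"
proof -
  have "Ck k f \<Longrightarrow> smooth f \<Longrightarrow> Ck k (\<lambda>y. f (a + c *\<^sub>R y))" for k and f :: "real ^ 'a \<Rightarrow> real"
  proof (induction k arbitrary: f)
    case 0 then show ?case
      by (simp, intro continuous_on_compose2[of UNIV f UNIV "\<lambda>y. a + c *\<^sub>R y"]) (auto intro!: continuous_intros)
  next
    case (Suc k)
    have "(\<lambda>y. f (a + c *\<^sub>R y)) differentiable (at y)" for y
      by (rule differentiable_compose[of f "\<lambda>y. a + c *\<^sub>R y"])
        (auto intro!: smooth_differentiable derivative_intros Suc.prems)
    then show ?case using Suc.prems
      by (auto simp: differentiable_on_def partial_affine intro!: Ck_mult Suc.IH smooth_partial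
         smooth_const[unfolded smooth_def, rule_format])
  qed
  with assms show ?thesis by (auto simp: smooth_def)
qed

lemma smooth_reflect: "smooth f \<Longrightarrow> smooth (\<lambda>y. f (x - y))"
  using smooth_affine[of f x "-1"] by simp

lemma partial_reflect: "smooth f \<Longrightarrow> partial i (\<lambda>y. f (x - y)) = (\<lambda>y. - partial i f (x - y))"
  using partial_affine[of f i x "-1"] by simp

text \<open>Schwarz's theorem: the second difference of \<open>f\<close> in the directions \<open>i\<close> and \<open>j\<close> is, by
  two applications of the mean value theorem, a value of either mixed derivative.\<close>

lemma second_difference:
  fixes f :: "real ^ 'n::finite \<Rightarrow> real"
  assumes f: "smooth f" and h: "0 < h"
  shows "\<exists>s t. 0 < s \<and> s < h \<and> 0 < t \<and> t < h \<and>
    f (x + h *\<^sub>R axis i 1 + h *\<^sub>R axis j 1) - f (x + h *\<^sub>R axis i 1) - f (x + h *\<^sub>R axis j 1) + f x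
    = h * h * partial j (partial i f) (x + s *\<^sub>R axis i 1 + t *\<^sub>R axis j 1)"
proof -
  have der: "((\<lambda>s. g (y + s *\<^sub>R axis k 1)) has_real_derivative partial k g (y + s *\<^sub>R axis k 1)) (at s)"
    if "smooth g" for g y k s
  proof -
    have "((\<lambda>s. g (y + s *\<^sub>R axis k 1)) has_derivative
      (\<lambda>r. frechet_derivative g (at (y + s *\<^sub>R axis k 1)) (r *\<^sub>R axis k 1))) (at s)"
      by (rule has_derivative_compose[of "\<lambda>s. y + s *\<^sub>R axis k 1" "\<lambda>r. r *\<^sub>R axis k 1" s UNIV g])
        (auto intro!: derivative_eq_intros smooth_imp_has_derivative that)
    then show ?thesis
      using linear_scale[OF has_derivative_linear[OF smooth_imp_has_derivative[OF that]]]
      by (simp add: has_field_derivative_def partial_def mult.commute[of _ "frechet_derivative _ _ _"])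
  qed
  let ?u = "\<lambda>s. f ((x + h *\<^sub>R axis j 1) + s *\<^sub>R axis i 1) - f (x + s *\<^sub>R axis i 1)"
  have "\<exists>s. 0 < s \<and> s < h \<and> ?u h - ?u 0 = (h - 0) *
     (partial i f ((x + h *\<^sub>R axis j 1) + s *\<^sub>R axis i 1) - partial i f (x + s *\<^sub>R axis i 1))"
    using h by (intro MVT2 DERIV_diff der f)
  then obtain s where s: "0 < s" "s < h" "?u h - ?u 0 = h *
     (partial i f ((x + h *\<^sub>R axis j 1) + s *\<^sub>R axis i 1) - partial i f (x + s *\<^sub>R axis i 1))"
    by auto
  have "\<exists>t. 0 < t \<and> t < h \<and> partial i f ((x + s *\<^sub>R axis i 1) + h *\<^sub>R axis j 1)
      - partial i f ((x + s *\<^sub>R axis i 1) + 0 *\<^sub>R axis j 1)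
     = (h - 0) * partial j (partial i f) ((x + s *\<^sub>R axis i 1) + t *\<^sub>R axis j 1)"
    using h by (intro MVT2 der smooth_partial f)
  then obtain t where t: "0 < t" "t < h" "partial i f ((x + s *\<^sub>R axis i 1) + h *\<^sub>R axis j 1)
      - partial i f ((x + s *\<^sub>R axis i 1))
     = h * partial j (partial i f) ((x + s *\<^sub>R axis i 1) + t *\<^sub>R axis j 1)"
    by auto
  have "?u h - ?u 0 = h * h * partial j (partial i f) (x + s *\<^sub>R axis i 1 + t *\<^sub>R axis j 1)"
    using s(3) t(3) by (simp add: add_ac)
  with s t show ?thesis
    by (intro exI[of _ s] exI[of _ t]) (simp add: add_ac)
qed

lemma partial_commute:
  fixes f :: "real ^ 'n::finite \<Rightarrow> real"
  assumes f: "smooth f"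
  shows "partial i (partial j f) = partial j (partial i f)"
proof
  fix x
  have lim: "((\<lambda>h. D (x + s h *\<^sub>R axis i 1 + t h *\<^sub>R axis j 1)) \<longlongrightarrow> D x) (at_right 0)"
    if D: "smooth D" and st: "\<And>h. 0 < h \<Longrightarrow> 0 < s h \<and> s h < h \<and> 0 < t h \<and> t h < h"
    for D :: "real ^ 'n \<Rightarrow> real" and s t :: "real \<Rightarrow> real" and i j
  proof -
    have "(s \<longlongrightarrow> 0) (at_right 0)" "(t \<longlongrightarrow> 0) (at_right 0)"
      by (rule tendsto_sandwich[of "\<lambda>_. 0" _ _ "\<lambda>h. h"];
        auto simp: eventually_at_right_less eventually_at_filter st less_imp_le tendsto_ident_at)+
    then have "((\<lambda>h. x + s h *\<^sub>R axis i 1 + t h *\<^sub>R axis j 1) \<longlongrightarrow> x + 0 *\<^sub>R axis i 1 + 0 *\<^sub>R axis j 1) (at_right 0)"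
      by (intro tendsto_intros)
    then show ?thesis
      using smooth_imp_continuous[OF D]
      by (intro isCont_tendsto_compose[of x D]) (auto simp: continuous_on_eq_continuous_at)
  qed
  obtain s t where st: "\<And>h. 0 < h \<Longrightarrow> 0 < s h \<and> s h < h \<and> 0 < t h \<and> t h < h \<and>
    f (x + h *\<^sub>R axis i 1 + h *\<^sub>R axis j 1) - f (x + h *\<^sub>R axis i 1) - f (x + h *\<^sub>R axis j 1) + f x
    = h * h * partial j (partial i f) (x + s h *\<^sub>R axis i 1 + t h *\<^sub>R axis j 1)"
    using second_difference[OF f, of _ x i j] by metis
  obtain s' t' where st': "\<And>h. 0 < h \<Longrightarrow> 0 < s' h \<and> s' h < h \<and> 0 < t' h \<and> t' h < h \<and>
    f (x + h *\<^sub>R axis j 1 + h *\<^sub>R axis i 1) - f (x + h *\<^sub>R axis j 1) - f (x + h *\<^sub>R axis i 1) + f x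
    = h * h * partial i (partial j f) (x + s' h *\<^sub>R axis j 1 + t' h *\<^sub>R axis i 1)"
    using second_difference[OF f, of _ x j i] by metis
  have eq: "partial i (partial j f) (x + s' h *\<^sub>R axis j 1 + t' h *\<^sub>R axis i 1) =
      partial j (partial i f) (x + s h *\<^sub>R axis i 1 + t h *\<^sub>R axis j 1)" if "0 < h" for h
  proof -
    have "h * h * partial i (partial j f) (x + s' h *\<^sub>R axis j 1 + t' h *\<^sub>R axis i 1) =
      h * h * partial j (partial i f) (x + s h *\<^sub>R axis i 1 + t h *\<^sub>R axis j 1)"
    proof -
      have swap: "x + h *\<^sub>R axis j 1 + h *\<^sub>R axis i 1 = x + h *\<^sub>R axis i 1 + h *\<^sub>R axis j 1"
        by (simp add: add_ac)
      show ?thesis using st[OF that] st'[OF that] unfolding swap by linarith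
    qed
    then show ?thesis using that by simp
  qed
  have 1: "((\<lambda>h. partial i (partial j f) (x + s' h *\<^sub>R axis j 1 + t' h *\<^sub>R axis i 1)) \<longlongrightarrow> partial i (partial j f) x) (at_right 0)"
    using st' by (intro lim smooth_partial f) auto
  have 2: "((\<lambda>h. partial j (partial i f) (x + s h *\<^sub>R axis i 1 + t h *\<^sub>R axis j 1)) \<longlongrightarrow> partial j (partial i f) x) (at_right 0)"
    using st by (intro lim smooth_partial f) auto
  have "((\<lambda>h. partial i (partial j f) (x + s' h *\<^sub>R axis j 1 + t' h *\<^sub>R axis i 1)) \<longlongrightarrow> partial j (partial i f) x) (at_right 0)"
    by (rule Lim_transform_eventually[OF 2]) (auto simp: eventually_at_filter eq)
  then show "partial i (partial j f) x = partial j (partial i f) x"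
    using 1 tendsto_unique trivial_limit_at_right_real by blast
qed

text \<open>Multi-indices are awkward for induction, so derivatives are also indexed by lists of
  directions; for smooth functions only the number of occurrences of each direction matters.\<close>

definition wpartial :: "'n::finite list \<Rightarrow> (real ^ 'n \<Rightarrow> real) \<Rightarrow> real ^ 'n \<Rightarrow> real" where
  "wpartial is f = foldr partial is f"

definition mword :: "'n::finite mindex \<Rightarrow> 'n list" where
  "mword \<alpha> = concat (map (\<lambda>i. replicate (\<alpha> i) i) (SOME ks. distinct ks \<and> set ks = UNIV))"

lemma wpartial_Nil [simp]: "wpartial [] f = f"
  and wpartial_Cons [simp]: "wpartial (i # is) f = partial i (wpartial is f)"
  and wpartial_append: "wpartial (is @ js) f = wpartial is (wpartial js f)"
  by (simp_all add: wpartial_def)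

lemma mderiv_eq_wpartial: "mderiv \<alpha> f = wpartial (mword \<alpha>) f"
proof -
  have [simp]: "wpartial (replicate m i) f = (partial i ^^ m) f" for m and i :: 'a and f
    by (induction m) auto
  have "foldr (\<lambda>i g. (partial i ^^ \<alpha> i) g) ks f = wpartial (concat (map (\<lambda>i. replicate (\<alpha> i) i) ks)) f" for ks
    by (induction ks) (auto simp: wpartial_append)
  then show ?thesis by (simp add: mderiv_def mword_def)
qed

lemma count_mword: "count (mset (mword \<alpha>)) = \<alpha>"
proof -
  have *: "distinct ks \<Longrightarrow> count (mset (concat (map (\<lambda>i. replicate (\<alpha> i) i) ks))) j = (if j \<in> set ks then \<alpha> j else 0)"
    for ks j by (induction ks) auto
  obtain ks :: "'a list" where "set ks = UNIV \<and> distinct ks"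
    using finite_distinct_list[of "UNIV :: 'a set"] by auto
  then have "distinct (SOME ks :: 'a list. distinct ks \<and> set ks = UNIV) \<and>
      set (SOME ks :: 'a list. distinct ks \<and> set ks = UNIV) = UNIV"
    by (intro someI[of "\<lambda>ks. distinct ks \<and> set ks = UNIV" ks]) auto
  then show ?thesis unfolding mword_def by (intro ext) (auto simp: *)
qed

lemma msize_count: "msize (count (mset is)) = length is"
  by (simp add: msize_def flip: size_mset size_multiset_overloaded_eq
        sum.mono_neutral_left[of UNIV "set is" "count (mset is)"] )
     (auto simp: size_multiset_overloaded_eq intro!: sum.mono_neutral_right simp: count_eq_zero_iff)

lemma length_mword: "length (mword \<alpha>) = msize \<alpha>"
  by (metis count_mword msize_count)

lemma smooth_wpartial: "smooth f \<Longrightarrow> smooth (wpartial is f)"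
  by (induction "is") (auto intro: smooth_partial)

lemma wpartial_partial_commute:
  "smooth f \<Longrightarrow> wpartial is (partial i f) = partial i (wpartial is f)"
  by (induction "is") (auto simp: partial_commute smooth_wpartial)

lemma wpartial_remove1:
  "smooth f \<Longrightarrow> i \<in> set is \<Longrightarrow> wpartial is f = partial i (wpartial (remove1 i is) f)"
  by (induction "is") (auto simp: partial_commute smooth_wpartial)

lemma wpartial_mset_cong:
  "smooth f \<Longrightarrow> mset is = mset js \<Longrightarrow> wpartial is f = wpartial js f"
proof (induction "is" arbitrary: js)
  case (Cons i "is")
  have "mset is = mset (remove1 i js)" using Cons.prems(2)
    by (simp flip: Cons.prems(2))
  then have "wpartial is f = wpartial (remove1 i js) f" using Cons by blast
  moreover have "i \<in> set js" using Cons.prems(2) by (metis list.set_intros(1) mset_eq_setD)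
  ultimately show ?case using Cons.prems(1) by (simp add: wpartial_remove1)
qed auto

lemma smooth_mderiv: "smooth f \<Longrightarrow> smooth (mderiv \<alpha> f)"
  by (simp add: mderiv_eq_wpartial smooth_wpartial)

lemma mderiv_mderiv:
  assumes "smooth f" shows "mderiv \<alpha> (mderiv \<beta> f) = mderiv (\<lambda>i. \<alpha> i + \<beta> i) f"
  unfolding mderiv_eq_wpartial wpartial_append[symmetric]
  by (intro wpartial_mset_cong assms multiset_eqI) (simp add: count_mword)

lemma msize_munit [simp]: "msize (munit k) = 1"
  by (simp add: msize_def munit_def)

lemma mderiv_munit: "mderiv (munit k) f = partial k f"
proof -
  have "length (mword (munit k)) = 1" by (simp add: length_mword)
  then obtain i where i: "mword (munit k) = [i]" by (metis One_nat_def length_0_conv length_Suc_conv)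
  then have "i = k" using count_mword[of "munit k"] by (auto simp: munit_def fun_eq_iff split: if_splits)
  then show ?thesis by (simp add: mderiv_eq_wpartial i)
qed

lemma msize_eq_0_iff: "msize \<alpha> = 0 \<longleftrightarrow> \<alpha> = (\<lambda>i. 0)"
  by (auto simp: msize_def)

lemma mderiv_zero [simp]: "mderiv (\<lambda>i. 0) f = f"
proof -
  have "mword (\<lambda>i. 0) = ([] :: 'a list)" using length_mword[of "\<lambda>i. 0"] by (simp add: msize_def)
  then show ?thesis by (simp add: mderiv_eq_wpartial)
qed

lemma wpartial_affine:
  assumes "smooth f"
  shows "wpartial is (\<lambda>y. f (a + c *\<^sub>R y)) = (\<lambda>y. c ^ length is * wpartial is f (a + c *\<^sub>R y))"
proof (induction "is")
  case (Cons i "is")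
  have s: "smooth (\<lambda>y. c ^ length is * wpartial is f y)"
    using assms by (auto intro!: smooth_cmult smooth_wpartial)
  have "partial i (\<lambda>y. c ^ length is * wpartial is f y) = (\<lambda>y. c ^ length is * partial i (wpartial is f) y)"
    by (rule ext) (simp add: partial_mult smooth_differentiable smooth_wpartial assms)
  with Cons partial_affine[OF s, of i a c] show ?case by (auto simp: mult_ac)
qed simp

lemma mderiv_affine:
  "smooth f \<Longrightarrow> mderiv \<alpha> (\<lambda>y. f (a + c *\<^sub>R y)) = (\<lambda>y. c ^ msize \<alpha> * mderiv \<alpha> f (a + c *\<^sub>R y))"
  by (simp add: mderiv_eq_wpartial wpartial_affine length_mword)

lemma mderiv_reflect:
  "smooth f \<Longrightarrow> mderiv \<alpha> (\<lambda>y. f (x - y)) = (\<lambda>y. (-1) ^ msize \<alpha> * mderiv \<alpha> f (x - y))"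
  using mderiv_affine[of f \<alpha> x "-1"] by simp

lemma mderiv_cmult:
  assumes "smooth f" shows "mderiv \<alpha> (\<lambda>y. c * f y) = (\<lambda>y. c * mderiv \<alpha> f y)"
proof -
  have "wpartial is (\<lambda>y. c * f y) = (\<lambda>y. c * wpartial is f y)" for "is"
    by (induction "is") (auto simp: partial_mult smooth_differentiable smooth_wpartial assms)
  then show ?thesis by (simp add: mderiv_eq_wpartial)
qed

lemma mderiv_add:
  assumes "smooth f" "smooth g" shows "mderiv \<alpha> (\<lambda>y. f y + g y) = (\<lambda>y. mderiv \<alpha> f y + mderiv \<alpha> g y)"
proof -
  have "wpartial is (\<lambda>y. f y + g y) = (\<lambda>y. wpartial is f y + wpartial is g y)" for "is"
    by (induction "is") (auto simp: partial_add smooth_differentiable smooth_wpartial assms)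
  then show ?thesis by (simp add: mderiv_eq_wpartial)
qed

lemma mderiv_sum:
  assumes "\<And>j. j \<in> J \<Longrightarrow> smooth (f j)"
  shows "mderiv \<alpha> (\<lambda>y. \<Sum>j\<in>J. f j y) = (\<lambda>y. \<Sum>j\<in>J. mderiv \<alpha> (f j) y)"
proof -
  have z: "mderiv \<alpha> (\<lambda>y. 0) = (\<lambda>y. 0)" using mderiv_cmult[of "\<lambda>y. 0" \<alpha> 0] by simp
  show ?thesis using assms
    by (induction J rule: infinite_finite_induct) (auto simp: z mderiv_add smooth_sum)
qed

section \<open>Test functions and locally integrable functions\<close>

text \<open>The estimates need the radius of a ball that contains the support, not only its compactness.\<close>

definition supp_cball :: "real ^ 'n::finite \<Rightarrow> real \<Rightarrow> (real ^ 'n \<Rightarrow> real) \<Rightarrow> bool" where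
  "supp_cball c R \<psi> \<longleftrightarrow> (\<forall>y. R < dist c y \<longrightarrow> \<psi> y = 0)"

lemma supp_cballD: "supp_cball c R \<psi> \<Longrightarrow> R < dist c y \<Longrightarrow> \<psi> y = 0"
  by (simp add: supp_cball_def)

lemma supp_cball_mult: "supp_cball c R \<psi> \<Longrightarrow> supp_cball c R (\<lambda>y. u y * \<psi> y)"
  by (simp add: supp_cball_def)

lemma supp_cball_reflect: "supp_cball c R \<psi> \<Longrightarrow> supp_cball (x - c) R (\<lambda>y. \<psi> (x - y))"
proof -
  have "dist (x - c) y = dist c (x - y)" for y
  proof -
    have "c - (x - y) = - (x - c - y)" by simp
    then show ?thesis unfolding dist_norm by (metis norm_minus_cancel)
  qed
  then show "supp_cball c R \<psi> \<Longrightarrow> supp_cball (x - c) R (\<lambda>y. \<psi> (x - y))"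
    by (simp add: supp_cball_def)
qed

lemma supp_cball_partial:
  assumes "supp_cball c R \<psi>" shows "supp_cball c R (partial i \<psi>)"
  unfolding supp_cball_def
proof (intro allI impI)
  fix y assume "R < dist c y"
  have "(\<psi> has_derivative (\<lambda>h. 0)) (at y)"
  proof (rule has_derivative_transform_within_open[of "\<lambda>y. 0"])
    show "open (- cball c R)" by auto
    show "y \<in> - cball c R" using \<open>R < dist c y\<close> by auto
    show "0 = \<psi> x" if "x \<in> - cball c R" for x
      using assms that by (simp add: supp_cball_def)
  qed auto
  then show "partial i \<psi> y = 0" by (rule partial_eqI)
qed

lemma supp_cball_wpartial: "supp_cball c R \<psi> \<Longrightarrow> supp_cball c R (wpartial is \<psi>)"
  by (induction "is") (auto intro: supp_cball_partial)

lemma supp_cball_mderiv: "supp_cball c R \<psi> \<Longrightarrow> supp_cball c R (mderiv \<alpha> \<psi>)"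
  by (simp add: mderiv_eq_wpartial supp_cball_wpartial)

lemma test_funI:
  assumes "smooth \<psi>" "supp_cball c R \<psi>" shows "test_fun \<psi>"
proof -
  have "{x. \<psi> x \<noteq> 0} \<subseteq> cball c R"
  proof
    fix x assume "x \<in> {x. \<psi> x \<noteq> 0}"
    then have "\<not> R < dist c x" using supp_cballD[OF assms(2), of x] by auto
    then show "x \<in> cball c R" by simp
  qed
  then have "bounded {x. \<psi> x \<noteq> 0}" using bounded_cball bounded_subset by blast
  then show ?thesis using assms(1) by (simp add: test_fun_def compact_closure)
qed

lemma test_fun_smooth: "test_fun \<psi> \<Longrightarrow> smooth \<psi>"
  by (simp add: test_fun_def)

lemma test_fun_supp:
  assumes "test_fun \<psi>" obtains R where "0 < R" "supp_cball 0 R \<psi>"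
proof -
  have "bounded {x. \<psi> x \<noteq> 0}" using assms
    by (simp add: test_fun_def flip: compact_closure)
  then obtain R where R: "0 < R" "\<And>x. \<psi> x \<noteq> 0 \<Longrightarrow> norm x \<le> R" by (auto simp: bounded_pos)
  then have "supp_cball 0 R \<psi>" 
    by (auto simp: supp_cball_def simp flip: not_le)
  with R(1) show ?thesis by (rule that)
qed

lemma test_fun_partial: "test_fun \<psi> \<Longrightarrow> test_fun (partial i \<psi>)"
  by (rule test_fun_supp, assumption) (auto intro: test_funI smooth_partial supp_cball_partial test_fun_smooth)

lemma test_fun_wpartial: "test_fun \<psi> \<Longrightarrow> test_fun (wpartial is \<psi>)"
  by (induction "is") (auto intro: test_fun_partial)

lemma test_fun_mderiv: "test_fun \<psi> \<Longrightarrow> test_fun (mderiv \<alpha> \<psi>)"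
  by (simp add: mderiv_eq_wpartial test_fun_wpartial)

lemma test_fun_mult: "smooth u \<Longrightarrow> test_fun \<psi> \<Longrightarrow> test_fun (\<lambda>x. u x * \<psi> x)"
  by (rule test_fun_supp, assumption) (auto intro: test_funI supp_cball_mult test_fun_smooth)

lemma test_fun_reflect: "test_fun \<psi> \<Longrightarrow> test_fun (\<lambda>y. \<psi> (x - y))"
  by (rule test_fun_supp, assumption) (auto intro: test_funI smooth_reflect supp_cball_reflect test_fun_smooth)

lemma test_fun_borel: "test_fun \<psi> \<Longrightarrow> \<psi> \<in> borel_measurable borel"
  by (simp add: smooth_imp_borel test_fun_smooth)

lemma continuous_supp_bounded:
  fixes \<psi> :: "real ^ 'n::finite \<Rightarrow> real"
  assumes "continuous_on UNIV \<psi>" "supp_cball c R \<psi>"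
  obtains C where "0 < C" "\<And>x. \<bar>\<psi> x\<bar> \<le> C"
proof -
  have "compact (\<psi> ` cball c R)"
    using assms(1) by (intro compact_continuous_image) (auto intro: continuous_on_subset)
  then obtain C where C: "\<And>x. x \<in> cball c R \<Longrightarrow> \<bar>\<psi> x\<bar> \<le> C"
    using compact_imp_bounded by (force simp: bounded_iff)
  have "\<bar>\<psi> x\<bar> \<le> max 1 C" for x
  proof (cases "x \<in> cball c R")
    case True then show ?thesis using C by fastforce
  next
    case False then show ?thesis using assms(2) by (simp add: supp_cball_def)
  qed
  then show ?thesis by (intro that[of "max 1 C"]) auto
qed

lemma test_fun_bounded:
  assumes "test_fun \<psi>" obtains C where "0 < C" "\<And>x. \<bar>\<psi> x\<bar> \<le> C"
proof -
  obtain R where "supp_cball 0 R \<psi>" using test_fun_supp[OF assms] by blast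
  then show ?thesis
    by (rule continuous_supp_bounded[OF smooth_imp_continuous[OF test_fun_smooth[OF assms]]]) (rule that)
qed

lemma smooth_mean_value:
  assumes "smooth \<psi>"
  shows "\<exists>t. 0 < t \<and> t < 1 \<and> \<psi> (z + h) - \<psi> z = (\<Sum>i\<in>UNIV. h $ i * partial i \<psi> (z + t *\<^sub>R h))"
proof -
  have der: "((\<lambda>t. \<psi> (z + t *\<^sub>R h)) has_real_derivative (\<Sum>i\<in>UNIV. h $ i * partial i \<psi> (z + t *\<^sub>R h))) (at t)" for t
  proof -
    have "((\<lambda>t. \<psi> (z + t *\<^sub>R h)) has_derivative
      (\<lambda>r. \<Sum>i\<in>UNIV. (r *\<^sub>R h) $ i * partial i \<psi> (z + t *\<^sub>R h))) (at t)"
      by (rule has_derivative_compose[OF _ smooth_has_derivative[OF assms]])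
        (auto intro!: derivative_eq_intros)
    moreover have "(\<lambda>r. \<Sum>i\<in>UNIV. (r *\<^sub>R h) $ i * partial i \<psi> (z + t *\<^sub>R h)) =
        (*) (\<Sum>i\<in>UNIV. h $ i * partial i \<psi> (z + t *\<^sub>R h))"
      by (rule ext) (simp add: sum_distrib_left mult_ac)
    ultimately show ?thesis by (simp add: has_field_derivative_def)
  qed
  obtain t where t: "0 < t" "t < 1" "\<psi> (z + 1 *\<^sub>R h) - \<psi> (z + 0 *\<^sub>R h) =
      (1 - 0) * (\<Sum>i\<in>UNIV. h $ i * partial i \<psi> (z + t *\<^sub>R h))"
    using MVT2[OF zero_less_one der] by blast
  show ?thesis
    using t(3) by (intro exI[of _ t] conjI t(1,2)) (simp only: scaleR_one scaleR_zero_left add_0_right diff_zero mult_1_left)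
qed

lemma test_fun_lipschitz:
  assumes \<psi>: "test_fun (\<psi> :: real ^ 'n::finite \<Rightarrow> real)"
  obtains L where "0 < L" "\<And>z h. \<bar>\<psi> (z + h) - \<psi> z\<bar> \<le> L * norm h"
proof -
  have "\<exists>C>0. \<forall>x. \<bar>partial i \<psi> x\<bar> \<le> C" for i
    by (rule test_fun_bounded[OF test_fun_partial[OF \<psi>]]) blast
  then obtain C where C: "\<And>i. 0 < C i" "\<And>i x. \<bar>partial i \<psi> x\<bar> \<le> C i"
    by metis
  have "\<bar>\<psi> (z + h) - \<psi> z\<bar> \<le> (\<Sum>i\<in>UNIV. C i) * norm h" for z h
  proof -
    obtain t where "\<psi> (z + h) - \<psi> z = (\<Sum>i\<in>UNIV. h $ i * partial i \<psi> (z + t *\<^sub>R h))"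
      using smooth_mean_value[OF test_fun_smooth[OF \<psi>]] by blast
    also have "\<bar>\<dots>\<bar> \<le> (\<Sum>i\<in>UNIV. norm h * C i)"
      by (intro order_trans[OF sum_abs] sum_mono)
         (auto simp: abs_mult intro!: mult_mono component_le_norm_cart C)
    finally show ?thesis by (simp add: sum_distrib_left mult.commute)
  qed
  moreover have "0 < (\<Sum>i\<in>UNIV. C i)" using C by (intro sum_pos) auto
  ultimately show ?thesis using that by blast
qed

lemma test_fun_taylor1:
  assumes \<psi>: "test_fun (\<psi> :: real ^ 'n::finite \<Rightarrow> real)"
  obtains K where "0 < K"
    "\<And>z h. \<bar>\<psi> (z + h) - \<psi> z - (\<Sum>i\<in>UNIV. h $ i * partial i \<psi> z)\<bar> \<le> K * (norm h)\<^sup>2"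
proof -
  have "\<exists>L>0. \<forall>z h. \<bar>partial i \<psi> (z + h) - partial i \<psi> z\<bar> \<le> L * norm h" for i
    by (rule test_fun_lipschitz[OF test_fun_partial[OF \<psi>]]) blast
  then obtain L where L: "\<And>i. 0 < L i" "\<And>i z h. \<bar>partial i \<psi> (z + h) - partial i \<psi> z\<bar> \<le> L i * norm h"
    by metis
  have "\<bar>\<psi> (z + h) - \<psi> z - (\<Sum>i\<in>UNIV. h $ i * partial i \<psi> z)\<bar> \<le> (\<Sum>i\<in>UNIV. L i) * (norm h)\<^sup>2" for z h
  proof -
    obtain t where t: "0 < t" "t < 1" "\<psi> (z + h) - \<psi> z = (\<Sum>i\<in>UNIV. h $ i * partial i \<psi> (z + t *\<^sub>R h))"
      using smooth_mean_value[OF test_fun_smooth[OF \<psi>]] by blast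
    have "\<psi> (z + h) - \<psi> z - (\<Sum>i\<in>UNIV. h $ i * partial i \<psi> z) =
       (\<Sum>i\<in>UNIV. h $ i * (partial i \<psi> (z + t *\<^sub>R h) - partial i \<psi> z))"
      unfolding t(3) by (simp add: sum_subtractf right_diff_distrib)
    also have "\<bar>\<dots>\<bar> \<le> (\<Sum>i\<in>UNIV. norm h * (L i * norm h))"
    proof (intro order_trans[OF sum_abs] sum_mono)
      fix i :: 'n
      have "\<bar>partial i \<psi> (z + t *\<^sub>R h) - partial i \<psi> z\<bar> \<le> L i * norm (t *\<^sub>R h)" by (rule L)
      also have "\<dots> \<le> L i * norm h" using t L(1)[of i]
        by (intro mult_left_mono) (auto simp: mult_left_le_one_le)
      finally show "\<bar>h $ i * (partial i \<psi> (z + t *\<^sub>R h) - partial i \<psi> z)\<bar> \<le> norm h * (L i * norm h)"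
        by (auto simp: abs_mult intro!: mult_mono component_le_norm_cart)
    qed
    finally show ?thesis by (simp add: sum_distrib_left mult_ac power2_eq_square)
  qed
  moreover have "0 < (\<Sum>i\<in>UNIV. L i)" using L by (intro sum_pos) auto
  ultimately show ?thesis using that by blast
qed

lemma Lp_norm_1: "Lp_norm 1 A f = (\<integral>\<^sup>+x\<in>A. ennreal \<bar>f x\<bar> \<partial>lebesgue)"
  by (auto simp: Lp_norm_def ennpowr_def powr_one_gt_zero_iff less_top infinity_ennreal_def)

lemma Lp_loc_measurable: "f \<in> Lp_loc p \<Longrightarrow> f \<in> borel_measurable lebesgue"
  by (simp add: Lp_loc_def)

lemma Lp_loc_1_integrable_cball:
  assumes "f \<in> Lp_loc 1"
  shows "integrable lebesgue (\<lambda>x. indicator (cball c R) x * f x)"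
proof (rule integrableI_bounded)
  have [measurable]: "f \<in> borel_measurable lebesgue" using assms by (simp add: Lp_loc_def)
  show "(\<lambda>x. indicator (cball c R) x * f x) \<in> borel_measurable lebesgue"
    by (intro borel_measurable_times borel_measurable_indicator) (auto simp: lmeasurable_cball[THEN fmeasurableD])
  have "(\<integral>\<^sup>+x\<in>cball c R. ennreal \<bar>f x\<bar> \<partial>lebesgue) < \<infinity>"
    using assms by (auto simp: Lp_loc_def Lp_norm_1)
  also have "(\<integral>\<^sup>+x\<in>cball c R. ennreal \<bar>f x\<bar> \<partial>lebesgue) =
     (\<integral>\<^sup>+ x. ennreal (norm (indicator (cball c R) x * f x)) \<partial>lebesgue)"
    by (intro nn_integral_cong) (auto simp: indicator_def)
  finally show "(\<integral>\<^sup>+ x. ennreal (norm (indicator (cball c R) x * f x)) \<partial>lebesgue) < \<infinity>" .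
qed

lemma Lp_loc_1I:
  assumes "f \<in> borel_measurable lebesgue" "\<And>R. integrable lebesgue (\<lambda>x. indicator (cball 0 R) x * f x)"
  shows "f \<in> Lp_loc 1"
proof -
  have "(\<integral>\<^sup>+x\<in>K. ennreal \<bar>f x\<bar> \<partial>lebesgue) < \<infinity>" if K: "compact K" for K
  proof -
    obtain R where R: "K \<subseteq> cball 0 R"
      using bounded_subset_ballD[OF compact_imp_bounded[OF K], of 0] ball_subset_cball by blast
    have "(\<integral>\<^sup>+x\<in>K. ennreal \<bar>f x\<bar> \<partial>lebesgue) \<le> (\<integral>\<^sup>+ x. ennreal (norm (indicator (cball 0 R) x * f x)) \<partial>lebesgue)"
      using R by (intro nn_integral_mono) (auto simp: indicator_def)
    also have "\<dots> < \<infinity>" using assms(2)[of R] by (simp add: integrable_iff_bounded)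
    finally show ?thesis .
  qed
  then show ?thesis using assms(1) by (auto simp: Lp_loc_def Lp_norm_1)
qed

lemma Lp_loc_1_integrable_mult:
  assumes f: "f \<in> Lp_loc 1" and \<psi>: "\<psi> \<in> borel_measurable lebesgue" "supp_cball c R \<psi>" "\<And>x. \<bar>\<psi> x\<bar> \<le> C"
  shows "integrable lebesgue (\<lambda>x. f x * \<psi> x)"
proof (rule Bochner_Integration.integrable_bound)
  show "integrable lebesgue (\<lambda>x. C * (indicator (cball c R) x * f x))"
    using Lp_loc_1_integrable_cball[OF f] by simp
  show "(\<lambda>x. f x * \<psi> x) \<in> borel_measurable lebesgue"
    using Lp_loc_measurable[OF f] \<psi>(1) by measurable
  have "\<bar>f x * \<psi> x\<bar> \<le> \<bar>C * (indicator (cball c R) x * f x)\<bar>" for x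
  proof (cases "x \<in> cball c R")
    case True then show ?thesis using \<psi>(3)[of x]
      by (auto simp: abs_mult mult.commute[of _ "\<bar>f x\<bar>"] intro!: mult_left_mono)
  next
    case False then show ?thesis using \<psi>(2) by (simp add: supp_cball_def)
  qed
  then show "AE x in lebesgue. norm (f x * \<psi> x) \<le> norm (C * (indicator (cball c R) x * f x))"
    by simp
qed

lemma Lp_loc_1_integrable_continuous:
  assumes f: "f \<in> Lp_loc 1" and \<psi>: "continuous_on UNIV \<psi>" "supp_cball c R \<psi>"
  shows "integrable lebesgue (\<lambda>x. f x * \<psi> x)"
proof -
  have "\<psi> \<in> borel_measurable lebesgue"
    using \<psi>(1) by (simp add: borel_measurable_continuous_onI measurable_completion)
  moreover obtain C where "\<And>x. \<bar>\<psi> x\<bar> \<le> C"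
    by (rule continuous_supp_bounded[OF \<psi>]) (rule that)
  ultimately show ?thesis by (intro Lp_loc_1_integrable_mult[OF f _ \<psi>(2)])
qed

lemma Lp_loc_1_integrable_test:
  "f \<in> Lp_loc 1 \<Longrightarrow> test_fun \<psi> \<Longrightarrow> integrable lebesgue (\<lambda>x. f x * \<psi> x)"
  by (rule test_fun_supp, assumption)
     (auto intro: Lp_loc_1_integrable_continuous smooth_imp_continuous test_fun_smooth)

lemma Lp_loc_1_continuous:
  assumes "continuous_on UNIV (f :: real ^ 'n::finite \<Rightarrow> real)" shows "f \<in> Lp_loc 1"
proof (rule Lp_loc_1I)
  have "f \<in> borel_measurable borel" using assms by (rule borel_measurable_continuous_onI)
  then show [measurable]: "f \<in> borel_measurable lebesgue" by (simp add: measurable_completion)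
  show "integrable lebesgue (\<lambda>x. indicator (cball 0 R) x * f x)" for R
  proof -
    have "integrable lborel (\<lambda>x. indicator (cball 0 R) x *\<^sub>R f x)"
      by (intro borel_integrable_compact continuous_on_subset[OF assms]) auto
    then show ?thesis by (simp add: integrable_completion)
  qed
qed

lemma smooth_Lp_loc_1: "smooth u \<Longrightarrow> u \<in> Lp_loc 1"
  by (simp add: Lp_loc_1_continuous smooth_imp_continuous)

lemma test_fun_integrable: "test_fun \<psi> \<Longrightarrow> integrable lebesgue \<psi>"
  using Lp_loc_1_integrable_test[OF Lp_loc_1_continuous, of "\<lambda>_. 1" \<psi>] by simp

lemma integral_mult_bound:
  assumes f: "f \<in> Lp_loc 1" and \<psi>: "supp_cball c R \<psi>" "\<And>x. \<bar>\<psi> x\<bar> \<le> C"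
  shows "\<bar>LINT x|lebesgue. f x * \<psi> x\<bar> \<le> C * (LINT x|lebesgue. indicator (cball c R) x * \<bar>f x\<bar>)"
proof -
  have i: "integrable lebesgue (\<lambda>x. indicator (cball c R) x * \<bar>f x\<bar>)"
    using integrable_abs[OF Lp_loc_1_integrable_cball[OF f]] by (simp add: abs_mult)
  have "\<bar>LINT x|lebesgue. f x * \<psi> x\<bar> \<le> (LINT x|lebesgue. \<bar>f x * \<psi> x\<bar>)" by (rule integral_abs_bound)
  also have "\<dots> \<le> (LINT x|lebesgue. C * (indicator (cball c R) x * \<bar>f x\<bar>))"
  proof (rule integral_mono')
    show "\<bar>f x * \<psi> x\<bar> \<le> C * (indicator (cball c R) x * \<bar>f x\<bar>)" for x
    proof (cases "x \<in> cball c R")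
      case True then show ?thesis using \<psi>(2)[of x]
        by (auto simp: abs_mult mult.commute[of _ "\<bar>f x\<bar>"] intro!: mult_left_mono)
    next
      case False then show ?thesis using \<psi>(1) by (simp add: supp_cball_def)
    qed
    show "0 \<le> C * (indicator (cball c R) x * \<bar>f x\<bar>)" for x
      using \<psi>(2)[of x] by simp
  qed (use i in auto)
  finally show ?thesis by simp
qed

section \<open>Integration by parts and convolution\<close>

lemma lebesgue_integral_lborel:
  "f \<in> borel_measurable borel \<Longrightarrow> (LINT x|lebesgue. f x) = (LINT x|lborel. (f x :: real))"
  by (simp add: integral_completion)

lemma lebesgue_integral_translation:
  fixes f :: "'a::euclidean_space \<Rightarrow> real"
  assumes "f \<in> borel_measurable borel"
  shows "(LINT x|lebesgue. f (a + x)) = (LINT x|lebesgue. f x)"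
proof -
  have "(LINT x|lborel. f x) = (LINT x|distr lborel borel ((+) a). f x)" by (simp add: lborel_distr_plus)
  also have "\<dots> = (LINT x|lborel. f (a + x))" using assms by (subst integral_distr) auto
  finally show ?thesis using assms by (simp add: lebesgue_integral_lborel)
qed

lemma lebesgue_integral_affine:
  fixes f :: "real ^ 'n::finite \<Rightarrow> real"
  assumes f: "f \<in> borel_measurable borel" and c: "c \<noteq> 0"
  shows "(LINT x|lebesgue. f x) = \<bar>c\<bar> ^ CARD('n) * (LINT x|lebesgue. f (a + c *\<^sub>R x))"
proof -
  have "(LINT x|lborel. f x) = (LINT x|density (distr lborel borel (\<lambda>x. a + c *\<^sub>R x)) (\<lambda>x. ennreal (\<bar>c\<bar> ^ CARD('n))). f x)"
    using lborel_affine[OF c, of "a :: real ^ 'n"] by simp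
  also have "\<dots> = \<bar>c\<bar> ^ CARD('n) * (LINT x|lborel. f (a + c *\<^sub>R x))"
    using f by (subst integral_density) (auto simp: integral_distr)
  finally show ?thesis using f by (simp add: lebesgue_integral_lborel)
qed

lemma lebesgue_integral_reflect:
  fixes f :: "real ^ 'n::finite \<Rightarrow> real"
  assumes "f \<in> borel_measurable borel"
  shows "(LINT y|lebesgue. f (x - y)) = (LINT y|lebesgue. f y)"
  using lebesgue_integral_affine[OF assms, of "-1" x] by simp

text \<open>The integral of \<open>\<psi>\<close> is invariant under translations, so the integral of a difference
  quotient vanishes; pass to the limit.\<close>

lemma integral_partial_test_fun:
  assumes \<psi>: "test_fun (\<psi> :: real ^ 'n::finite \<Rightarrow> real)"
  shows "(LINT x|lebesgue. partial i \<psi> x) = 0"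
proof -
  obtain R where R: "0 < R" "supp_cball 0 R \<psi>" using test_fun_supp[OF \<psi>] .
  obtain L where L: "0 < L" "\<And>z h. \<bar>\<psi> (z + h) - \<psi> z\<bar> \<le> L * norm h"
    by (rule test_fun_lipschitz[OF \<psi>]) (rule that)
  define q where "q m x = real (Suc m) * (\<psi> (x + inverse (real (Suc m)) *\<^sub>R axis i 1) - \<psi> x)" for m x
  have [measurable]: "\<psi> \<in> borel_measurable borel" "partial i \<psi> \<in> borel_measurable borel"
    using \<psi> by (auto intro: test_fun_borel test_fun_partial)
  have "(\<lambda>m. LINT x|lebesgue. q m x) \<longlonglongrightarrow> (LINT x|lebesgue. partial i \<psi> x)"
  proof (rule integral_dominated_convergence[where w = "\<lambda>x. indicator (cball 0 (R + 1)) x * L"])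
    show "partial i \<psi> \<in> borel_measurable lebesgue" by (simp add: measurable_completion)
    have "(\<lambda>x. q m x) \<in> borel_measurable borel" for m unfolding q_def by measurable
    then show "q m \<in> borel_measurable lebesgue" for m by (simp add: measurable_completion)
    show "integrable lebesgue (\<lambda>x :: real ^ 'n. indicator (cball 0 (R + 1)) x * L)"
      by (rule Lp_loc_1_integrable_cball[OF Lp_loc_1_continuous[of "\<lambda>_. L"]]) auto
    have "(\<lambda>m. q m x) \<longlonglongrightarrow> partial i \<psi> x" for x
    proof -
      let ?D = "\<lambda>h. \<Sum>i\<in>UNIV. h $ i * partial i \<psi> x"
      have D: "?D (h *\<^sub>R axis i 1) = h * partial i \<psi> x" for h
        by (simp add: axis_def if_distrib[of "\<lambda>u. u * _"] if_distrib[of "\<lambda>u. h * u"] cong: if_cong)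
      have "((\<lambda>h. \<psi> (x + h *\<^sub>R axis i 1)) has_derivative
          (\<lambda>r. \<Sum>k\<in>UNIV. (r *\<^sub>R axis i 1) $ k * partial k \<psi> (x + 0 *\<^sub>R axis i 1))) (at 0)"
        by (rule has_derivative_compose[OF _ smooth_has_derivative[OF test_fun_smooth[OF \<psi>]]])
          (auto intro!: derivative_eq_intros)
      then have "((\<lambda>h. \<psi> (x + h *\<^sub>R axis i 1)) has_derivative (\<lambda>r. partial i \<psi> x * r)) (at 0)"
        unfolding D scaleR_zero_left add_0_right by (simp add: mult.commute)
      then have "(\<lambda>h. (\<psi> (x + h *\<^sub>R axis i 1) - \<psi> x) / h) \<midarrow>0\<rightarrow> partial i \<psi> x"
        by (simp add: DERIV_def flip: has_field_derivative_def)
      moreover have "filterlim (\<lambda>m. inverse (real (Suc m))) (at 0) sequentially"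
        by (simp add: filterlim_at LIMSEQ_inverse_real_of_nat del: of_nat_Suc)
      ultimately have "(\<lambda>m. (\<psi> (x + inverse (real (Suc m)) *\<^sub>R axis i 1) - \<psi> x) / inverse (real (Suc m))) \<longlonglongrightarrow> partial i \<psi> x"
        by (rule filterlim_compose)
      then show ?thesis by (simp add: q_def field_simps)
    qed
    then show "AE x in lebesgue. (\<lambda>m. q m x) \<longlonglongrightarrow> partial i \<psi> x" by simp
    have "\<bar>q m x\<bar> \<le> indicator (cball 0 (R + 1)) x * L" for m x
    proof (cases "norm x \<le> R + 1")
      case True
      have "\<bar>q m x\<bar> \<le> real (Suc m) * (L * norm (inverse (real (Suc m)) *\<^sub>R axis i 1 :: real ^ 'n))"
        unfolding q_def abs_mult by (intro mult_mono L) auto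
      also have "\<dots> = L" by (simp add: field_simps)
      finally show ?thesis using True by simp
    next
      case False
      have "norm (x + inverse (real (Suc m)) *\<^sub>R axis i 1) \<ge> norm x - norm (inverse (real (Suc m)) *\<^sub>R axis i 1 :: real ^ 'n)"
        by (rule norm_diff_ineq)
      moreover have "norm (inverse (real (Suc m)) *\<^sub>R axis i 1 :: real ^ 'n) \<le> 1" by (simp add: field_simps)
      ultimately have "\<psi> (x + inverse (real (Suc m)) *\<^sub>R axis i 1) = 0" "\<psi> x = 0"
        using False R by (auto intro!: supp_cballD[OF R(2)])
      then show ?thesis using False L by (simp add: q_def)
    qed
    then show "AE x in lebesgue. norm (q m x) \<le> indicator (cball 0 (R + 1)) x * L" for m by simp
  qed
  moreover have "(LINT x|lebesgue. q m x) = 0" for m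
  proof -
    have "test_fun (\<lambda>x. \<psi> (inverse (real (Suc m)) *\<^sub>R axis i 1 + x))"
    proof (rule test_funI)
      show "smooth (\<lambda>x. \<psi> (inverse (real (Suc m)) *\<^sub>R axis i 1 + x))"
        using smooth_affine[OF test_fun_smooth[OF \<psi>], of "inverse (real (Suc m)) *\<^sub>R axis i 1" 1] by simp
      show "supp_cball (- inverse (real (Suc m)) *\<^sub>R axis i 1) R (\<lambda>x. \<psi> (inverse (real (Suc m)) *\<^sub>R axis i 1 + x))"
      proof -
        have "dist (- a) x = dist 0 (a + x)" for a x :: "real ^ 'n"
        proof -
          have "0 - (a + x) = - a - x" by simp
          then show ?thesis unfolding dist_norm by metis
        qed
        then show ?thesis using R(2) by (simp add: supp_cball_def)
      qed
    qed
    then have "(LINT x|lebesgue. q m x) = real (Suc m) * ((LINT x|lebesgue. \<psi> (inverse (real (Suc m)) *\<^sub>R axis i 1 + x)) - (LINT x|lebesgue. \<psi> x))"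
      unfolding q_def using \<psi> by (simp add: add.commute test_fun_integrable)
    then show ?thesis by (simp add: lebesgue_integral_translation)
  qed
  ultimately show ?thesis by (simp add: LIMSEQ_const_iff)
qed

lemma integral_by_parts:
  assumes u: "smooth u" and \<psi>: "test_fun \<psi>"
  shows "(LINT x|lebesgue. u x * partial i \<psi> x) = - (LINT x|lebesgue. partial i u x * \<psi> x)"
proof -
  have "partial i (\<lambda>x. u x * \<psi> x) x = partial i u x * \<psi> x + u x * partial i \<psi> x" for x
    using u \<psi> by (intro partial_mult smooth_differentiable) (auto intro: test_fun_smooth)
  moreover have "integrable lebesgue (\<lambda>x. partial i u x * \<psi> x)" "integrable lebesgue (\<lambda>x. u x * partial i \<psi> x)"
    using u \<psi> by (auto intro!: Lp_loc_1_integrable_test smooth_Lp_loc_1 smooth_partial test_fun_partial)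
  ultimately show ?thesis
    using integral_partial_test_fun[OF test_fun_mult[OF u \<psi>], of i] by simp
qed

lemma integral_by_parts_mderiv:
  assumes u: "smooth u" and \<psi>: "test_fun \<psi>"
  shows "(LINT x|lebesgue. u x * mderiv \<alpha> \<psi> x) = (-1) ^ msize \<alpha> * (LINT x|lebesgue. mderiv \<alpha> u x * \<psi> x)"
proof -
  have "(LINT x|lebesgue. u x * wpartial is \<psi> x) = (-1) ^ length is * (LINT x|lebesgue. wpartial is u x * \<psi> x)"
    if "smooth u" for "is" u using that
    by (induction "is" arbitrary: u)
       (auto simp: integral_by_parts test_fun_wpartial \<psi> smooth_partial wpartial_partial_commute)
  then show ?thesis using u by (simp add: mderiv_eq_wpartial length_mword)
qed

lemma conv_reg: "conv (reg f) \<psi> x = (LINT y|lebesgue. f y * \<psi> (x - y))"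
  by (simp add: conv_def reg_def)

text \<open>The second order remainder of \<open>\<psi>\<close>, integrated against \<open>|f|\<close> over a fixed ball, is \<open>O(|h|\<^sup>2)\<close>, so
  local integrability of \<open>f\<close> is enough to differentiate under the integral sign.\<close>

lemma conv_has_derivative:
  assumes f: "f \<in> Lp_loc 1" and \<psi>: "test_fun (\<psi> :: real ^ 'n::finite \<Rightarrow> real)"
  shows "(conv (reg f) \<psi> has_derivative (\<lambda>h. \<Sum>i\<in>UNIV. h $ i * conv (reg f) (partial i \<psi>) x)) (at x)"
proof -
  obtain R where R: "0 < R" "supp_cball 0 R \<psi>" using test_fun_supp[OF \<psi>] .
  obtain K where K: "0 < K"
    "\<And>z h. \<bar>\<psi> (z + h) - \<psi> z - (\<Sum>i\<in>UNIV. h $ i * partial i \<psi> z)\<bar> \<le> K * (norm h)\<^sup>2"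
    by (rule test_fun_taylor1[OF \<psi>]) (rule that)
  define M where "M = (LINT y|lebesgue. indicator (cball x (R + 1)) y * \<bar>f y\<bar>)"
  note int = Lp_loc_1_integrable_test[OF f test_fun_reflect]
  have bd: "\<bar>conv (reg f) \<psi> y - conv (reg f) \<psi> x - (\<Sum>i\<in>UNIV. (y - x) $ i * conv (reg f) (partial i \<psi>) x)\<bar>
      \<le> K * (norm (y - x))\<^sup>2 * M" if "dist y x < 1" for y
  proof -
    define e where "e z = \<psi> (y - z) - \<psi> (x - z) - (\<Sum>i\<in>UNIV. (y - x) $ i * partial i \<psi> (x - z))" for z
    have "conv (reg f) \<psi> y - conv (reg f) \<psi> x - (\<Sum>i\<in>UNIV. (y - x) $ i * conv (reg f) (partial i \<psi>) x)
       = (LINT z|lebesgue. f z * \<psi> (y - z) - f z * \<psi> (x - z) - (\<Sum>i\<in>UNIV. (y - x) $ i * (f z * partial i \<psi> (x - z))))"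
      unfolding conv_reg
      by (subst Bochner_Integration.integral_diff Bochner_Integration.integral_sum Bochner_Integration.integral_mult_right
           | auto intro!: int \<psi> test_fun_partial Bochner_Integration.integrable_diff Bochner_Integration.integrable_sum)+
    also have "\<dots> = (LINT z|lebesgue. f z * e z)"
      by (intro Bochner_Integration.integral_cong) (auto simp: e_def algebra_simps sum_distrib_left)
    also have "\<bar>\<dots>\<bar> \<le> (K * (norm (y - x))\<^sup>2) * M"
      unfolding M_def
    proof (rule integral_mult_bound[OF f])
      show "supp_cball x (R + 1) e"
        unfolding supp_cball_def
      proof (intro allI impI)
        fix z assume z: "R + 1 < dist x z"
        then have "R < dist y z" using that dist_triangle[of x z y] by (simp add: dist_commute)
        then show "e z = 0" using z unfolding e_def
          by (auto simp: supp_cballD[OF R(2)] supp_cballD[OF supp_cball_partial[OF R(2)]] dist_norm norm_minus_commute)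
      qed
      show "\<bar>e z\<bar> \<le> K * (norm (y - x))\<^sup>2" for z
        using K(2)[of "x - z" "y - x"] by (simp add: e_def)
    qed
    finally show ?thesis .
  qed
  show ?thesis
  proof (rule has_derivativeI_sandwich[of 1])
    show "bounded_linear (\<lambda>h. \<Sum>i\<in>UNIV. h $ i * conv (reg f) (partial i \<psi>) x)"
      by (intro bounded_linear_sum bounded_linear_mult_const bounded_linear_vec_nth)
    show "((\<lambda>y. K * norm (y - x) * M) \<longlongrightarrow> 0) (at x)"
      by (auto intro!: tendsto_eq_intros)
    fix y :: "real ^ 'n" assume y: "y \<noteq> x" "dist y x < 1"
    show "norm (conv (reg f) \<psi> y - conv (reg f) \<psi> x - (\<Sum>i\<in>UNIV. (y - x) $ i * conv (reg f) (partial i \<psi>) x)) / norm (y - x)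
       \<le> K * norm (y - x) * M"
      using bd[OF y(2)] y(1) by (simp add: divide_le_eq power2_eq_square mult_ac)
  qed simp
qed

lemma partial_conv:
  fixes f \<psi> :: "real ^ 'n::finite \<Rightarrow> real"
  assumes "f \<in> Lp_loc 1" "test_fun \<psi>"
  shows "partial i (conv (reg f) \<psi>) = conv (reg f) (partial i \<psi>)"
proof
  fix x
  show "partial i (conv (reg f) \<psi>) x = conv (reg f) (partial i \<psi>) x"
    using partial_eqI[OF conv_has_derivative[OF assms], of i x]
    by (simp add: axis_def if_distrib[where f = "\<lambda>u. u * _"] cong: if_cong)
qed

lemma smooth_conv:
  assumes "f \<in> Lp_loc 1" "test_fun \<psi>" shows "smooth (conv (reg f) \<psi>)"
  by (rule smooth_coinduct[of "\<lambda>u. \<exists>\<psi>. test_fun \<psi> \<and> u = conv (reg f) \<psi>"])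
     (use assms in \<open>auto simp: partial_conv intro: test_fun_partial differentiableI conv_has_derivative\<close>)

lemma mderiv_conv:
  assumes "f \<in> Lp_loc 1" "test_fun \<psi>"
  shows "mderiv \<alpha> (conv (reg f) \<psi>) = conv (reg f) (mderiv \<alpha> \<psi>)"
proof -
  have "wpartial is (conv (reg f) \<psi>) = conv (reg f) (wpartial is \<psi>)" for "is"
    by (induction "is") (auto simp: partial_conv assms test_fun_wpartial)
  then show ?thesis by (simp add: mderiv_eq_wpartial)
qed

section \<open>Polynomials\<close>

lemma finite_msize_le [simp]: "finite {\<alpha> :: 'n::finite mindex. msize \<alpha> \<le> N}"
proof -
  have "\<alpha> i \<le> msize \<alpha>" for \<alpha> :: "'n mindex" and i
    unfolding msize_def by (rule member_le_sum) auto
  then have "{\<alpha> :: 'n mindex. msize \<alpha> \<le> N} \<subseteq> PiE UNIV (\<lambda>_. {..N})"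
    by (auto simp: PiE_def Pi_def intro: order_trans)
  then show ?thesis by (rule finite_subset) (auto intro: finite_PiE)
qed

lemma finite_msize_eq [simp]: "finite {\<alpha> :: 'n::finite mindex. msize \<alpha> = N}"
  by (rule finite_subset[OF _ finite_msize_le[of N]]) auto

lemma msize_zero [simp]: "msize (\<lambda>i. 0) = 0"
  by (simp add: msize_def)

lemma mpower_zero [simp]: "mpower x (\<lambda>i. 0) = 1"
  by (simp add: mpower_def)

lemma mpower_add: "mpower x (\<lambda>i. \<alpha> i + \<beta> i) = mpower x \<alpha> * mpower x \<beta>"
  by (simp add: mpower_def power_add prod.distrib)

lemma msize_add: "msize (\<lambda>i. \<alpha> i + \<beta> i) = msize \<alpha> + msize \<beta>"
  by (simp add: msize_def sum.distrib)

lemma mpower_munit [simp]: "mpower x (munit i) = x $ i"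
proof -
  have "mpower x (munit i) = (\<Prod>j\<in>UNIV. if j = i then x $ j else 1)"
    unfolding mpower_def munit_def by (rule prod.cong) auto
  then show ?thesis by simp
qed

lemma mpower_at_zero: "mpower 0 \<alpha> = (if \<alpha> = (\<lambda>i. 0) then 1 else 0)"
  by (auto simp: mpower_def fun_eq_iff)

lemma mpower_scaleR: "mpower (c *\<^sub>R x) \<alpha> = c ^ msize \<alpha> * mpower x \<alpha>"
  by (simp add: mpower_def msize_def power_mult_distrib prod.distrib power_sum)

lemma polys_monomial: "msize \<alpha> \<le> N \<Longrightarrow> (\<lambda>x. mpower x \<alpha>) \<in> polys N"
  unfolding polys_def
  by (intro CollectI exI[of _ "\<lambda>\<beta>. if \<beta> = \<alpha> then 1 else 0"])
     (simp add: if_distrib[of "\<lambda>u. u * _"] cong: if_cong)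

lemma polys_add: "P \<in> polys N \<Longrightarrow> Q \<in> polys N \<Longrightarrow> (\<lambda>x. P x + Q x) \<in> polys N"
  unfolding polys_def
  by (clarsimp, rule_tac x = "\<lambda>\<alpha>. a \<alpha> + aa \<alpha>" in exI) (simp add: algebra_simps sum.distrib)

lemma polys_cmult: "P \<in> polys N \<Longrightarrow> (\<lambda>x. c * P x) \<in> polys N"
  unfolding polys_def
  by (clarsimp, rule_tac x = "\<lambda>\<alpha>. c * a \<alpha>" in exI) (simp add: algebra_simps sum_distrib_left)

lemma polys_const: "(\<lambda>x. c) \<in> polys N"
  using polys_cmult[OF polys_monomial[of "\<lambda>i. 0" N], of c] by (simp add: msize_def)

lemma polys_coord: "(\<lambda>x. x $ i) \<in> polys (Suc 0)"
  using polys_monomial[of "munit i" "Suc 0"] by simp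

lemma polys_sum: "(\<And>j. j \<in> J \<Longrightarrow> P j \<in> polys N) \<Longrightarrow> (\<lambda>x. \<Sum>j\<in>J. P j x) \<in> polys N"
  by (induction J rule: infinite_finite_induct) (auto simp: polys_const intro: polys_add)

lemma polys_mono: "N \<le> M \<Longrightarrow> polys N \<subseteq> polys M"
proof
  fix P :: "real ^ 'a \<Rightarrow> real" assume "N \<le> M" "P \<in> polys N"
  then obtain a where "P = (\<lambda>x. \<Sum>\<alpha> | msize \<alpha> \<le> N. a \<alpha> * mpower x \<alpha>)" by (auto simp: polys_def)
  then show "P \<in> polys M" using \<open>N \<le> M\<close>
    by (auto intro!: polys_sum polys_cmult polys_monomial)
qed

lemma polys_mult:
  assumes "P \<in> polys N" "Q \<in> polys M" shows "(\<lambda>x. P x * Q x) \<in> polys (N + M)"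
proof -
  obtain a b where "P = (\<lambda>x. \<Sum>\<alpha> | msize \<alpha> \<le> N. a \<alpha> * mpower x \<alpha>)"
    "Q = (\<lambda>x. \<Sum>\<alpha> | msize \<alpha> \<le> M. b \<alpha> * mpower x \<alpha>)"
    using assms by (auto simp: polys_def)
  then have eq: "(\<lambda>x. P x * Q x) = (\<lambda>x. \<Sum>\<alpha> | msize \<alpha> \<le> N. \<Sum>\<beta> | msize \<beta> \<le> M.
      (a \<alpha> * b \<beta>) * mpower x (\<lambda>i. \<alpha> i + \<beta> i))"
    by (simp add: sum_product mpower_add mult_ac)
  show ?thesis unfolding eq
    by (intro polys_sum polys_cmult polys_monomial) (auto simp: msize_add)
qed

lemma polys_power:
  assumes "P \<in> polys N" shows "(\<lambda>x. P x ^ k) \<in> polys (k * N)"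
  by (induction k) (auto simp: polys_const intro: polys_mult assms)

lemma polys_prod:
  assumes "finite J" "\<And>j. j \<in> J \<Longrightarrow> P j \<in> polys (N j)"
  shows "(\<lambda>x. \<Prod>j\<in>J. P j x) \<in> polys (\<Sum>j\<in>J. N j)"
  using assms by (induction J rule: finite_induct) (auto simp: polys_const intro: polys_mult)

lemma polys_affine:
  assumes "P \<in> polys N" shows "(\<lambda>y. P (x + c *\<^sub>R y)) \<in> polys N"
proof -
  obtain a where P: "P = (\<lambda>x. \<Sum>\<alpha> | msize \<alpha> \<le> N. a \<alpha> * mpower x \<alpha>)"
    using assms by (auto simp: polys_def)
  have "(\<lambda>y. mpower (x + c *\<^sub>R y) \<alpha>) \<in> polys N" if "msize \<alpha> \<le> N" for \<alpha>
  proof -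
    have lin: "(\<lambda>y. x $ i + c * y $ i) \<in> polys 1" for i
      using polys_coord by (auto intro!: polys_add polys_const polys_cmult)
    then have "(\<lambda>y. (x $ i + c * y $ i) ^ \<alpha> i) \<in> polys (\<alpha> i)" for i
      using polys_power[OF lin[of i], of "\<alpha> i"] by simp
    then have "(\<lambda>y. \<Prod>i\<in>UNIV. (x $ i + c * y $ i) ^ \<alpha> i) \<in> polys (\<Sum>i\<in>UNIV. \<alpha> i)"
      by (intro polys_prod) auto
    moreover have "(\<Sum>i\<in>UNIV. \<alpha> i) \<le> N" using that by (simp add: msize_def)
    ultimately show ?thesis
      using polys_mono by (auto simp: mpower_def)
  qed
  then show ?thesis unfolding P by (intro polys_sum polys_cmult) auto
qed

lemma polys_0_const: "P \<in> polys 0 \<Longrightarrow> P x = P y"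
  by (auto simp: polys_def msize_eq_0_iff)

lemma msize_1_munit:
  assumes "msize (\<alpha> :: 'n::finite mindex) = 1" shows "\<exists>i. \<alpha> = munit i"
proof -
  have "length (mword \<alpha>) = Suc 0" using assms by (simp add: length_mword)
  then obtain i where "mword \<alpha> = [i]" by (auto simp: length_Suc_conv)
  then have "\<alpha> = count (mset [i])" by (metis count_mword)
  moreover have "count (mset [i]) = munit i" by (rule ext) (simp add: munit_def)
  ultimately show ?thesis by (intro exI[of _ i]) (simp only:)
qed

lemma polys_1_affine:
  fixes P :: "real ^ 'n::finite \<Rightarrow> real"
  assumes "P \<in> polys 1"
  shows "\<exists>c q. P = (\<lambda>y. c + (\<Sum>i\<in>UNIV. q i * (y $ i - x $ i)))"
proof -
  obtain a where a: "P = (\<lambda>x. \<Sum>\<alpha> | msize \<alpha> \<le> 1. a \<alpha> * mpower x \<alpha>)"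
    using assms by (auto simp: polys_def)
  have inj: "inj (munit :: 'n \<Rightarrow> 'n mindex)"
    by (rule injI) (auto simp: munit_def fun_eq_iff split: if_splits)
  have set: "{\<alpha> :: 'n mindex. msize \<alpha> \<le> 1} = insert (\<lambda>i. 0) (range munit)"
  proof (intro set_eqI iffI)
    fix \<alpha> :: "'n mindex" assume "\<alpha> \<in> {\<alpha>. msize \<alpha> \<le> 1}"
    then consider "msize \<alpha> = 0" | "msize \<alpha> = 1" by force
    then show "\<alpha> \<in> insert (\<lambda>i. 0) (range munit)"
    proof cases
      case 1
      then have "\<alpha> = (\<lambda>i. 0)" by (simp only: msize_eq_0_iff)
      then show ?thesis by blast
    next
      case 2 then show ?thesis using msize_1_munit by blast
    qed
  next
    fix \<alpha> :: "'n mindex" assume "\<alpha> \<in> insert (\<lambda>i. 0) (range munit)"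
    then show "\<alpha> \<in> {\<alpha>. msize \<alpha> \<le> 1}" by (elim insertE) (auto simp: msize_def munit_def)
  qed
  have "(\<lambda>i. 0) \<noteq> (munit k :: 'n mindex)" for k
    by (rule notI, drule fun_cong[of _ _ k]) (simp add: munit_def)
  then have "(\<lambda>i. 0) \<notin> range (munit :: 'n \<Rightarrow> 'n mindex)" by blast
  then have "P y = a (\<lambda>i. 0) + (\<Sum>i\<in>UNIV. a (munit i) * y $ i)" for y
    unfolding a set by (subst sum.insert) (auto simp: sum.reindex[OF inj])
  then have "P = (\<lambda>y. (a (\<lambda>i. 0) + (\<Sum>i\<in>UNIV. a (munit i) * x $ i)) +
      (\<Sum>i\<in>UNIV. a (munit i) * (y $ i - x $ i)))"
    by (simp add: right_diff_distrib sum_subtractf fun_eq_iff)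
  then show ?thesis
    by (intro exI[of _ "a (\<lambda>i. 0) + (\<Sum>i\<in>UNIV. a (munit i) * x $ i)"] exI[of _ "\<lambda>i. a (munit i)"])
qed

lemma smooth_mpower: "smooth (\<lambda>x. mpower x \<alpha>)"
  unfolding mpower_def by (intro smooth_prod smooth_power smooth_coord)

lemma smooth_polys: "P \<in> polys N \<Longrightarrow> smooth P"
  by (auto simp: polys_def intro!: smooth_sum smooth_cmult smooth_mpower)

lemma partial_coord_power:
  "partial i (\<lambda>x. (x $ j) ^ k) = (\<lambda>x. if i = j then real k * (x $ j) ^ (k - 1) else 0)"
proof (induction k)
  case (Suc k)
  have "partial i (\<lambda>x. x $ j * (x $ j) ^ k) x =
      partial i (\<lambda>x. x $ j) x * (x $ j) ^ k + x $ j * partial i (\<lambda>x. (x $ j) ^ k) x" for x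
    by (intro partial_mult smooth_differentiable smooth_power smooth_coord)
  then show ?case using Suc by (cases k) (auto simp: partial_coord fun_eq_iff algebra_simps)
qed (simp add: fun_eq_iff)

lemma partial_mpower:
  "partial i (\<lambda>x. mpower x \<beta>) = (\<lambda>x. real (\<beta> i) * mpower x (\<lambda>j. \<beta> j - munit i j))"
proof
  fix x :: "real ^ 'a"
  have 0: "partial i (\<lambda>x. \<Prod>j\<in>J. (x $ j) ^ \<beta> j) x = 0" if "finite J" "i \<notin> J" for J
    using that
  proof (induction J rule: finite_induct)
    case (insert j J)
    have "partial i (\<lambda>x. (x $ j) ^ \<beta> j * (\<Prod>j\<in>J. (x $ j) ^ \<beta> j)) x = 
       partial i (\<lambda>x. (x $ j) ^ \<beta> j) x * (\<Prod>j\<in>J. (x $ j) ^ \<beta> j) +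
       (x $ j) ^ \<beta> j * partial i (\<lambda>x. \<Prod>j\<in>J. (x $ j) ^ \<beta> j) x"
      by (intro partial_mult smooth_differentiable smooth_prod smooth_power smooth_coord)
    with insert show ?case by (simp add: partial_coord_power)
  qed simp
  have split: "mpower x \<gamma> = (x $ i) ^ \<gamma> i * (\<Prod>j\<in>UNIV - {i}. (x $ j) ^ \<gamma> j)" for x :: "real ^ 'a" and \<gamma>
    unfolding mpower_def by (subst prod.remove[of UNIV i]) auto
  have "partial i (\<lambda>x. (x $ i) ^ \<beta> i * (\<Prod>j\<in>UNIV - {i}. (x $ j) ^ \<beta> j)) x =
     partial i (\<lambda>x. (x $ i) ^ \<beta> i) x * (\<Prod>j\<in>UNIV - {i}. (x $ j) ^ \<beta> j) +
     (x $ i) ^ \<beta> i * partial i (\<lambda>x. \<Prod>j\<in>UNIV - {i}. (x $ j) ^ \<beta> j) x"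
    by (intro partial_mult smooth_differentiable smooth_prod smooth_power smooth_coord)
  also have "\<dots> = real (\<beta> i) * ((x $ i) ^ (\<beta> i - 1) * (\<Prod>j\<in>UNIV - {i}. (x $ j) ^ \<beta> j))"
    by (simp add: 0 partial_coord_power)
  also have "(\<Prod>j\<in>UNIV - {i}. (x $ j) ^ \<beta> j) = (\<Prod>j\<in>UNIV - {i}. (x $ j) ^ (\<beta> j - munit i j))"
    by (rule prod.cong) (auto simp: munit_def)
  finally show "partial i (\<lambda>x. mpower x \<beta>) x = real (\<beta> i) * mpower x (\<lambda>j. \<beta> j - munit i j)"
    by (subst (1 2) split) (simp add: munit_def)
qed

lemma mfact_pos: "0 < mfact \<alpha>"
  by (simp add: mfact_def prod_pos)

lemma mfact_diff_munit:
  assumes "\<gamma> i \<noteq> 0" shows "mfact \<gamma> = real (\<gamma> i) * mfact (\<lambda>j. \<gamma> j - munit i j)"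
proof -
  have "mfact \<gamma> = fact (\<gamma> i) * (\<Prod>j\<in>UNIV - {i}. fact (\<gamma> j))" for \<gamma> :: "'a mindex"
    unfolding mfact_def by (subst prod.remove[of UNIV i]) auto
  note split = this
  have "(\<Prod>j\<in>UNIV - {i}. fact (\<gamma> j - munit i j)) = (\<Prod>j\<in>UNIV - {i}. (fact (\<gamma> j) :: real))"
    by (rule prod.cong) (auto simp: munit_def)
  then show ?thesis using assms
    by (subst (1 2) split) (simp add: munit_def fact_reduce mult_ac)
qed

lemma mderiv_mpower:
  "mderiv \<alpha> (\<lambda>x. mpower x \<beta>) = (if \<forall>i. \<alpha> i \<le> \<beta> i
     then (\<lambda>x. mfact \<beta> / mfact (\<lambda>i. \<beta> i - \<alpha> i) * mpower x (\<lambda>i. \<beta> i - \<alpha> i)) else (\<lambda>x. 0))"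
proof -
  have "wpartial is (\<lambda>x. mpower x \<beta>) = (if \<forall>i. count (mset is) i \<le> \<beta> i
     then (\<lambda>x. mfact \<beta> / mfact (\<lambda>i. \<beta> i - count (mset is) i) * mpower x (\<lambda>i. \<beta> i - count (mset is) i)) else (\<lambda>x. 0))" for "is"
  proof (induction "is")
    case Nil
    show ?case using mfact_pos[of \<beta>] by simp
  next
    case (Cons i "is")
    let ?\<gamma> = "\<lambda>j. \<beta> j - count (mset is) j"
    have step: "(\<lambda>j. \<beta> j - count (mset (i # is)) j) = (\<lambda>j. ?\<gamma> j - munit i j)"
      by (auto simp: munit_def)
    show ?case
    proof (cases "\<forall>j. count (mset is) j \<le> \<beta> j")
      case False
      then have "\<not> (\<forall>j. count (mset (i # is)) j \<le> \<beta> j)"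
        by (metis (no_types, lifting) count_add_mset le_Suc_eq Suc_leD mset.simps(2))
      with False show ?thesis by (simp only: wpartial_Cons Cons.IH if_False partial_const)
    next
      case True
      have "wpartial (i # is) (\<lambda>x. mpower x \<beta>) = (\<lambda>x. mfact \<beta> / mfact ?\<gamma> * (real (?\<gamma> i) * mpower x (\<lambda>j. ?\<gamma> j - munit i j)))"
      proof -
        have "partial i (\<lambda>x. c * mpower x \<gamma>) x = c * partial i (\<lambda>x. mpower x \<gamma>) x" for c \<gamma> x
          by (subst partial_mult) (auto intro: smooth_differentiable smooth_mpower)
        then have "partial i (\<lambda>x. mfact \<beta> / mfact ?\<gamma> * mpower x ?\<gamma>) =
            (\<lambda>x. mfact \<beta> / mfact ?\<gamma> * (real (?\<gamma> i) * mpower x (\<lambda>j. ?\<gamma> j - munit i j)))"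
          by (intro ext) (simp only: partial_mpower)
        then show ?thesis by (simp only: wpartial_Cons Cons.IH if_P[OF True])
      qed
      also have "\<dots> = (if \<forall>j. count (mset (i # is)) j \<le> \<beta> j
         then (\<lambda>x. mfact \<beta> / mfact (\<lambda>j. ?\<gamma> j - munit i j) * mpower x (\<lambda>j. ?\<gamma> j - munit i j)) else (\<lambda>x. 0))"
      proof (cases "?\<gamma> i = 0")
        case True2: True
        then have "\<not> (\<forall>j. count (mset (i # is)) j \<le> \<beta> j)"
          by (auto intro!: exI[of _ i])
        then show ?thesis by (simp only: if_not_P True2 of_nat_0 mult_zero_left mult_zero_right) simp
      next
        case False
        then have "\<forall>j. count (mset (i # is)) j \<le> \<beta> j" using True by (auto simp: Suc_le_eq)
        moreover have "mfact ?\<gamma> = real (?\<gamma> i) * mfact (\<lambda>j. ?\<gamma> j - munit i j)"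
          using False by (rule mfact_diff_munit[where \<gamma> = ?\<gamma> and i = i])
        ultimately show ?thesis using False by simp
      qed
      finally show ?thesis by (simp only: step)
    qed
  qed
  from this[of "mword \<alpha>"] show ?thesis by (simp only: mderiv_eq_wpartial count_mword)
qed

lemma mderiv_polys:
  assumes "P \<in> polys N" shows "mderiv \<alpha> P \<in> polys (N - msize \<alpha>)"
proof -
  obtain a where P: "P = (\<lambda>x. \<Sum>\<beta> | msize \<beta> \<le> N. a \<beta> * mpower x \<beta>)"
    using assms by (auto simp: polys_def)
  have "mderiv \<alpha> (\<lambda>x. mpower x \<beta>) \<in> polys (N - msize \<alpha>)" if "msize \<beta> \<le> N" for \<beta>
  proof (cases "\<forall>i. \<alpha> i \<le> \<beta> i")
    case True
    then have "msize (\<lambda>i. \<beta> i - \<alpha> i) = msize \<beta> - msize \<alpha>"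
      by (simp add: msize_def sum_subtractf_nat)
    then have "(\<lambda>x. mpower x (\<lambda>i. \<beta> i - \<alpha> i)) \<in> polys (N - msize \<alpha>)"
      using that by (intro polys_monomial) auto
    then show ?thesis by (simp only: mderiv_mpower if_P[OF True] polys_cmult)
  next
    case False then show ?thesis by (simp only: mderiv_mpower if_False polys_const)
  qed
  then show ?thesis unfolding P
    by (subst mderiv_sum)
       (auto intro!: smooth_cmult smooth_mpower polys_sum polys_cmult simp: mderiv_cmult smooth_mpower)
qed

section \<open>Kernels with vanishing moments\<close>

text \<open>Equivalently, averaging against \<open>\<Phi>\<close> reproduces the polynomials of degree \<open>N\<close>; this makes the
  mollification of a function insensitive to the subtraction of such a polynomial.\<close>

definition kernel :: "nat \<Rightarrow> (real ^ 'n::finite \<Rightarrow> real) \<Rightarrow> bool" where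
  "kernel N \<Phi> \<longleftrightarrow> smooth \<Phi> \<and> supp_cball 0 1 \<Phi> \<and>
    (\<forall>\<beta>. msize \<beta> \<le> N \<longrightarrow> (LINT z|lebesgue. mpower z \<beta> * \<Phi> z) = (if \<beta> = (\<lambda>i. 0) then 1 else 0))"

lemma kernel_test_fun: "kernel N \<Phi> \<Longrightarrow> test_fun \<Phi>"
  by (auto simp: kernel_def intro: test_funI)

lemma kernel_mollifier:
  assumes "mollifier \<phi>" shows "kernel 0 \<phi>"
proof -
  have t: "test_fun \<phi>" and c: "closure {x. \<phi> x \<noteq> 0} \<subseteq> ball 0 1" and i: "(LINT x|lebesgue. \<phi> x) = 1"
    using assms unfolding mollifier_def by blast+
  have "\<phi> y = 0" if "1 < dist 0 y" for y
  proof (rule ccontr)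
    assume "\<phi> y \<noteq> 0"
    then have "y \<in> ball 0 1" using c closure_subset[of "{x. \<phi> x \<noteq> 0}"] by blast
    then show False using that by simp
  qed
  then have "supp_cball 0 1 \<phi>" unfolding supp_cball_def by blast
  then show ?thesis unfolding kernel_def using test_fun_smooth[OF t] i
    by (simp add: msize_eq_0_iff)
qed

lemma rescale_affine: "rescale \<Phi> r = (\<lambda>y. (1 / r ^ CARD('n)) * \<Phi> (0 + (1 / r) *\<^sub>R (y :: real ^ 'n::finite)))"
  by (simp add: rescale_def divide_inverse mult.commute fun_eq_iff)

lemma smooth_rescale: "smooth \<Phi> \<Longrightarrow> smooth (rescale \<Phi> r)"
  unfolding rescale_affine by (intro smooth_cmult smooth_affine)

lemma supp_cball_rescale:
  assumes "supp_cball 0 1 \<Phi>" "0 < r" shows "supp_cball 0 r (rescale \<Phi> r)"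
  unfolding supp_cball_def rescale_def
proof (intro allI impI)
  fix y :: "real ^ 'a" assume "r < dist 0 y"
  then have "1 < dist 0 (y /\<^sub>R r)" using assms(2) by (simp add: field_simps)
  then show "\<Phi> (y /\<^sub>R r) / r ^ CARD('a) = 0" using supp_cballD[OF assms(1)] by simp
qed

lemma mderiv_rescale:
  assumes "smooth \<Phi>"
  shows "mderiv \<alpha> (rescale \<Phi> r) = (\<lambda>y. (1 / r ^ (CARD('n) + msize \<alpha>)) * mderiv \<alpha> \<Phi> ((1 / r) *\<^sub>R (y :: real ^ 'n::finite)))"
  unfolding rescale_affine
  using assms by (subst mderiv_cmult) (auto simp: mderiv_affine[of _ _ 0, simplified] smooth_affine[of _ 0, simplified]
      power_add power_divide fun_eq_iff)

lemma test_fun_rescale: "test_fun \<Phi> \<Longrightarrow> supp_cball 0 1 \<Phi> \<Longrightarrow> 0 < r \<Longrightarrow> test_fun (rescale \<Phi> r)"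
  by (rule test_funI[OF smooth_rescale supp_cball_rescale]) (auto intro: test_fun_smooth)

lemma kernel_test_fun_rescale: "kernel N \<Phi> \<Longrightarrow> 0 < r \<Longrightarrow> test_fun (rescale \<Phi> r)"
  by (rule test_fun_rescale) (simp_all add: kernel_test_fun, simp add: kernel_def)

lemma kernel_supp_rescale: "kernel N \<Phi> \<Longrightarrow> 0 < r \<Longrightarrow> supp_cball 0 r (rescale \<Phi> r)"
  by (rule supp_cball_rescale) (simp_all add: kernel_def)

lemma integral_rescale:
  fixes g \<Phi> :: "real ^ 'n::finite \<Rightarrow> real"
  assumes [measurable]: "g \<in> borel_measurable borel" "\<Phi> \<in> borel_measurable borel" and r: "0 < r"
  shows "(LINT y|lebesgue. g y * rescale \<Phi> r (x - y)) = (LINT z|lebesgue. g (x + (- r) *\<^sub>R z) * \<Phi> z)"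
proof -
  have "(LINT y|lebesgue. g y * rescale \<Phi> r (x - y)) =
     \<bar>- r\<bar> ^ CARD('n) * (LINT z|lebesgue. g (x + (- r) *\<^sub>R z) * rescale \<Phi> r (x - (x + (- r) *\<^sub>R z)))"
    using r by (intro lebesgue_integral_affine) (auto simp: rescale_def)
  also have "\<dots> = (LINT z|lebesgue. r ^ CARD('n) * (g (x + (- r) *\<^sub>R z) * rescale \<Phi> r (r *\<^sub>R z)))"
    using r by simp
  also have "\<dots> = (LINT z|lebesgue. g (x + (- r) *\<^sub>R z) * \<Phi> z)"
    using r by (intro Bochner_Integration.integral_cong) (auto simp: rescale_def)
  finally show ?thesis .
qed

lemma kernel_reproduces_polys:
  fixes P \<Phi> :: "real ^ 'n::finite \<Rightarrow> real"
  assumes \<Phi>: "kernel N \<Phi>" and P: "P \<in> polys N" and r: "0 < r"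
  shows "conv (reg P) (rescale \<Phi> r) x = P x"
proof -
  obtain b where b: "(\<lambda>y. P (x + (- r) *\<^sub>R y)) = (\<lambda>y. \<Sum>\<beta> | msize \<beta> \<le> N. b \<beta> * mpower y \<beta>)"
    using polys_affine[OF P] unfolding polys_def by blast
  have "P (x + (- r) *\<^sub>R 0) = (\<Sum>\<beta> | msize \<beta> \<le> N. b \<beta> * mpower 0 \<beta>)" using b by metis
  also have "\<dots> = (\<Sum>\<beta> | msize \<beta> \<le> N. if \<beta> = (\<lambda>i. 0) then b \<beta> else 0)"
    by (rule sum.cong) (auto simp: mpower_at_zero)
  also have "\<dots> = b (\<lambda>i. 0)" by simp
  finally have b0: "b (\<lambda>i. 0) = P x" by simp
  have "conv (reg P) (rescale \<Phi> r) x = (LINT z|lebesgue. P (x + (- r) *\<^sub>R z) * \<Phi> z)"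
    unfolding conv_reg using P \<Phi> r
    by (intro integral_rescale) (auto intro: smooth_imp_borel smooth_polys test_fun_smooth kernel_test_fun)
  also have "\<dots> = (LINT z|lebesgue. (\<Sum>\<beta> | msize \<beta> \<le> N. b \<beta> * (mpower z \<beta> * \<Phi> z)))"
    by (intro Bochner_Integration.integral_cong refl)
       (use b in \<open>simp add: fun_eq_iff sum_distrib_right mult.assoc\<close>)
  also have "\<dots> = (\<Sum>\<beta> | msize \<beta> \<le> N. b \<beta> * (LINT z|lebesgue. mpower z \<beta> * \<Phi> z))"
    using \<Phi> by (subst Bochner_Integration.integral_sum)
      (auto intro!: Lp_loc_1_integrable_test smooth_Lp_loc_1 smooth_mpower kernel_test_fun)
  also have "\<dots> = (\<Sum>\<beta> | msize \<beta> \<le> N. if \<beta> = (\<lambda>i. 0) then b \<beta> else 0)"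
    using \<Phi> by (intro sum.cong) (auto simp: kernel_def)
  also have "\<dots> = P x" using b0 by simp
  finally show ?thesis .
qed

lemma conv_mderiv_smooth:
  assumes u: "smooth u" and \<psi>: "test_fun \<psi>"
  shows "conv (reg u) (mderiv \<alpha> \<psi>) x = conv (reg (mderiv \<alpha> u)) \<psi> x"
proof -
  have "conv (reg u) (mderiv \<alpha> \<psi>) x = (LINT y|lebesgue. (-1) ^ msize \<alpha> * (u y * mderiv \<alpha> (\<lambda>y. \<psi> (x - y)) y))"
    unfolding conv_reg mderiv_reflect[OF test_fun_smooth[OF \<psi>]]
    by (intro Bochner_Integration.integral_cong) (auto simp: power_add[symmetric] mult_2[symmetric] simp flip: mult.assoc power_mult_distrib)
  also have "\<dots> = (-1) ^ msize \<alpha> * (LINT y|lebesgue. u y * mderiv \<alpha> (\<lambda>y. \<psi> (x - y)) y)"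
    by simp
  also have "\<dots> = conv (reg (mderiv \<alpha> u)) \<psi> x"
    unfolding integral_by_parts_mderiv[OF u test_fun_reflect[OF \<psi>]] conv_reg
    by (simp flip: mult.assoc power_mult_distrib)
  finally show ?thesis .
qed

text \<open>Differentiating a kernel lowers the degree of the polynomials it has to reproduce, so top
  order derivatives need no vanishing moments at all.\<close>

lemma kernel_reproduces_mderiv:
  assumes \<Phi>: "kernel M \<Phi>" and P: "P \<in> polys N" and N: "N \<le> M + msize \<alpha>" and r: "0 < r"
  shows "conv (reg P) (mderiv \<alpha> (rescale \<Phi> r)) x = mderiv \<alpha> P x"
proof -
  have "mderiv \<alpha> P \<in> polys M"
    by (rule subsetD[OF polys_mono mderiv_polys[OF P]]) (use N in simp)
  moreover have "test_fun (rescale \<Phi> r)"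
    by (rule kernel_test_fun_rescale[OF \<Phi> r])
  ultimately show ?thesis
    using kernel_reproduces_polys[OF \<Phi> _ r] by (simp add: conv_mderiv_smooth smooth_polys[OF P])
qed

lemma moment_rescale:
  fixes \<Phi> :: "real ^ 'n::finite \<Rightarrow> real"
  assumes "smooth \<Phi>" "0 < r"
  shows "(LINT z|lebesgue. mpower z \<beta> * rescale \<Phi> r z) = r ^ msize \<beta> * (LINT z|lebesgue. mpower z \<beta> * \<Phi> z)"
proof -
  have [measurable]: "\<Phi> \<in> borel_measurable borel" "(\<lambda>z :: real ^ 'n. mpower z \<beta>) \<in> borel_measurable borel"
    by (auto intro!: smooth_imp_borel assms smooth_mpower)
  have "(LINT z|lebesgue. mpower z \<beta> * rescale \<Phi> r z) =
     \<bar>r\<bar> ^ CARD('n) * (LINT z|lebesgue. mpower (0 + r *\<^sub>R z) \<beta> * rescale \<Phi> r (0 + r *\<^sub>R z))"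
    using assms(2) by (intro lebesgue_integral_affine) (auto simp: rescale_def)
  also have "\<dots> = (LINT z|lebesgue. r ^ CARD('n) * (mpower (r *\<^sub>R z) \<beta> * rescale \<Phi> r (r *\<^sub>R z)))"
    using assms(2) by simp
  also have "\<dots> = (LINT z|lebesgue. r ^ msize \<beta> * (mpower z \<beta> * \<Phi> z))"
    using assms(2) by (intro Bochner_Integration.integral_cong) (auto simp: rescale_def mpower_scaleR)
  finally show ?thesis by simp
qed

text \<open>Richardson extrapolation: halving the scale multiplies the moments of order \<open>k\<close> by \<open>2^(-k)\<close>, so
  a suitable combination of two scales kills the moments of the next order.\<close>

lemma ex_kernel:
  fixes \<phi> :: "real ^ 'n::finite \<Rightarrow> real"
  assumes "kernel 0 \<phi>" shows "\<exists>\<Phi> :: real ^ 'n \<Rightarrow> real. kernel N \<Phi>"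
proof (induction N)
  case 0 then show ?case using assms by blast
next
  case (Suc N)
  then obtain \<Phi> :: "real ^ 'n \<Rightarrow> real" where \<Phi>: "kernel N \<Phi>" by blast
  \<comment> \<open>the factor gained by the moments of order \<open>Suc N\<close> when the scale is halved; the weights in \<open>\<Psi>\<close> cancel these moments and have sum \<open>1\<close>\<close>
  define s :: real where "s = (1/2) ^ Suc N"
  have s: "0 < s" "s < 1" unfolding s_def by (simp, rule power_Suc_less_one) auto
  define \<Psi> where "\<Psi> z = (1 / (1 - s)) * rescale \<Phi> (1/2) z + (- s / (1 - s)) * \<Phi> z" for z
  have sm: "smooth \<Phi>" and su: "supp_cball 0 1 \<Phi>" using \<Phi> by (auto simp: kernel_def)
  have suh: "supp_cball 0 (1/2) (rescale \<Phi> (1/2))" by (rule supp_cball_rescale[OF su]) simp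
  have t: "test_fun (rescale \<Phi> (1/2))" "test_fun \<Phi>" 
    using sm su by (auto intro!: test_fun_rescale intro: test_funI)
  have "kernel (Suc N) \<Psi>"
    unfolding kernel_def
  proof (intro conjI allI impI)
    show "smooth \<Psi>" unfolding \<Psi>_def by (intro smooth_add smooth_cmult smooth_rescale sm)
    show "supp_cball 0 1 \<Psi>"
      unfolding supp_cball_def \<Psi>_def
      using supp_cballD[OF su] supp_cballD[OF suh] by auto
    fix \<beta> :: "'n mindex" assume \<beta>: "msize \<beta> \<le> Suc N"
    let ?m = "LINT z|lebesgue. mpower z \<beta> * \<Phi> z"
    have i: "integrable lebesgue (\<lambda>z. mpower z \<beta> * \<Phi> z)" "integrable lebesgue (\<lambda>z. mpower z \<beta> * rescale \<Phi> (1/2) z)"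
      using t by (auto intro!: Lp_loc_1_integrable_test smooth_Lp_loc_1 smooth_mpower)
    have "(LINT z|lebesgue. mpower z \<beta> * \<Psi> z) = (LINT z|lebesgue. 
       (1 / (1 - s)) * (mpower z \<beta> * rescale \<Phi> (1/2) z) + (- s / (1 - s)) * (mpower z \<beta> * \<Phi> z))"
      unfolding \<Psi>_def by (simp add: algebra_simps)
    also have "\<dots> = (1 / (1 - s)) * (LINT z|lebesgue. mpower z \<beta> * rescale \<Phi> (1/2) z) + (- s / (1 - s)) * ?m"
      using i by (subst Bochner_Integration.integral_add) auto
    also have "(LINT z|lebesgue. mpower z \<beta> * rescale \<Phi> (1/2) z) = (1/2) ^ msize \<beta> * ?m"
      by (rule moment_rescale[OF sm]) simp
    also have "(1 / (1 - s)) * ((1/2) ^ msize \<beta> * ?m) + (- s / (1 - s)) * ?m = ((1/2) ^ msize \<beta> - s) / (1 - s) * ?m"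
      by (simp add: diff_divide_distrib left_diff_distrib)
    also have "\<dots> = (if \<beta> = (\<lambda>i. 0) then 1 else 0)"
    proof (cases "msize \<beta> = Suc N")
      case True
      then have "\<beta> \<noteq> (\<lambda>i. 0)" by (auto simp: msize_def)
      with True show ?thesis by (simp add: s_def)
    next
      case False
      then have "?m = (if \<beta> = (\<lambda>i. 0) then 1 else 0)" using \<Phi> \<beta> by (simp add: kernel_def)
      then show ?thesis using s by (auto simp: msize_def)
    qed
    finally show "(LINT z|lebesgue. mpower z \<beta> * \<Psi> z) = (if \<beta> = (\<lambda>i. 0) then 1 else 0)" .
  qed
  then show ?case by blast
qed

lemma mderiv_rescale_bound:
  fixes \<Phi> :: "real ^ 'n::finite \<Rightarrow> real"
  assumes "test_fun \<Phi>"
  shows "\<exists>C>0. \<forall>r>0. \<forall>y. \<bar>mderiv \<alpha> (rescale \<Phi> r) y\<bar> \<le> C / r ^ (CARD('n) + msize \<alpha>)"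
proof -
  obtain C where C: "0 < C" "\<And>x. \<bar>mderiv \<alpha> \<Phi> x\<bar> \<le> C"
    by (rule test_fun_bounded[OF test_fun_mderiv[OF assms]]) (rule that)
  then show ?thesis
    by (intro exI[of _ C]) (auto simp: mderiv_rescale test_fun_smooth[OF assms] abs_mult intro!: divide_right_mono)
qed

section \<open>Best approximation by polynomials\<close>

definition L1dist_ball :: "(real ^ 'n::finite \<Rightarrow> real) \<Rightarrow> (real ^ 'n \<Rightarrow> real) \<Rightarrow> real ^ 'n \<Rightarrow> real \<Rightarrow> real" where
  "L1dist_ball f P z R = (LINT y|lebesgue. indicator (ball z R) y * \<bar>f y - P y\<bar>)"

definition best_L1 :: "nat \<Rightarrow> (real ^ 'n::finite \<Rightarrow> real) \<Rightarrow> real ^ 'n \<Rightarrow> real \<Rightarrow> real" where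
  "best_L1 N f z R = (INF P\<in>polys N. L1dist_ball f P z R)"

lemma Lp_loc_1_diff:
  assumes "f \<in> Lp_loc 1" "g \<in> Lp_loc 1" shows "(\<lambda>x. f x - g x) \<in> Lp_loc 1"
proof (rule Lp_loc_1I)
  show "(\<lambda>x. f x - g x) \<in> borel_measurable lebesgue"
    using assms[THEN Lp_loc_measurable] by measurable
  show "integrable lebesgue (\<lambda>x. indicator (cball 0 R) x * (f x - g x))" for R
    unfolding right_diff_distrib by (intro Bochner_Integration.integrable_diff Lp_loc_1_integrable_cball assms)
qed

lemma integrable_indicator_ball:
  assumes "f \<in> Lp_loc 1" shows "integrable lebesgue (\<lambda>x. indicator (ball z R) x * \<bar>f x\<bar>)"
proof (rule Bochner_Integration.integrable_bound)
  show "integrable lebesgue (\<lambda>x. indicator (cball z R) x * f x)" by (rule Lp_loc_1_integrable_cball[OF assms])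
  show "(\<lambda>x. indicator (ball z R) x * \<bar>f x\<bar>) \<in> borel_measurable lebesgue"
    using Lp_loc_measurable[OF assms]
    by (intro borel_measurable_times borel_measurable_indicator borel_measurable_abs) (auto simp: lmeasurable_ball[THEN fmeasurableD])
qed (auto simp: indicator_def)

lemma L1dist_ball_nonneg: "0 \<le> L1dist_ball f P z R"
  unfolding L1dist_ball_def by (intro Bochner_Integration.integral_nonneg) auto

lemma L1dist_ball_mono:
  assumes "f \<in> Lp_loc 1" "P \<in> Lp_loc 1" "ball z R \<subseteq> ball z' R'"
  shows "L1dist_ball f P z R \<le> L1dist_ball f P z' R'"
  unfolding L1dist_ball_def using assms
  by (intro integral_mono integrable_indicator_ball Lp_loc_1_diff) (auto simp: indicator_def)

lemma best_L1_le: "P \<in> polys N \<Longrightarrow> best_L1 N f z R \<le> L1dist_ball f P z R"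
  unfolding best_L1_def by (rule cINF_lower) (auto intro!: bdd_belowI L1dist_ball_nonneg)

lemma best_L1_greatest: "(\<And>P. P \<in> polys N \<Longrightarrow> c \<le> L1dist_ball f P z R) \<Longrightarrow> c \<le> best_L1 N f z R"
  unfolding best_L1_def using polys_const by (intro cINF_greatest) blast+

lemma best_L1_nonneg: "0 \<le> best_L1 N f z R"
  by (rule best_L1_greatest) (rule L1dist_ball_nonneg)

lemma best_L1_mono:
  assumes "f \<in> Lp_loc 1" "ball z R \<subseteq> ball z' R'"
  shows "best_L1 N f z R \<le> best_L1 N f z' R'"
  by (rule best_L1_greatest)
     (meson L1dist_ball_mono assms best_L1_le order_trans smooth_Lp_loc_1 smooth_polys)

lemma ex_near_best:
  assumes "0 < e" shows "\<exists>P\<in>polys N. L1dist_ball f P z R < best_L1 N f z R + e"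
proof (rule ccontr)
  assume "\<not> ?thesis"
  then have "best_L1 N f z R + e \<le> best_L1 N f z R" by (intro best_L1_greatest) (auto simp: not_less)
  with assms show False by simp
qed

text \<open>The kernel differentiates \<open>P\<close> exactly, so only \<open>f - P\<close> contributes, on the ball of radius \<open>r\<close>, where the
  derivative of the rescaled kernel is \<open>O(r^(-n-|\<alpha>|))\<close>.\<close>

lemma mollified_derivative_near_poly:
  fixes f \<Phi> :: "real ^ 'n::finite \<Rightarrow> real"
  assumes \<Phi>: "kernel M \<Phi>"
  shows "\<exists>C>0. \<forall>f N P r x z R. f \<in> Lp_loc 1 \<and> P \<in> polys N \<and> N \<le> M + msize \<alpha> \<and> 0 < r \<and> cball x r \<subseteq> ball z R \<longrightarrow>
    \<bar>conv (reg f) (mderiv \<alpha> (rescale \<Phi> r)) x - mderiv \<alpha> P x\<bar> \<le> C / r ^ (CARD('n) + msize \<alpha>) * L1dist_ball f P z R"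
proof -
  obtain C where C: "0 < C" "\<And>r y. 0 < r \<Longrightarrow> \<bar>mderiv \<alpha> (rescale \<Phi> r) y\<bar> \<le> C / r ^ (CARD('n) + msize \<alpha>)"
    using mderiv_rescale_bound[OF kernel_test_fun[OF \<Phi>]] by metis
  show ?thesis
  proof (intro exI[of _ C] conjI C(1) allI impI)
    fix f P :: "real ^ 'n \<Rightarrow> real" and r R :: real and x z :: "real ^ 'n" and N
    assume "f \<in> Lp_loc 1 \<and> P \<in> polys N \<and> N \<le> M + msize \<alpha> \<and> 0 < r \<and> cball x r \<subseteq> ball z R"
    then have f: "f \<in> Lp_loc 1" and P: "P \<in> polys N" and N: "N \<le> M + msize \<alpha>" and r: "0 < r" and b: "cball x r \<subseteq> ball z R"
      by auto
    let ?\<psi> = "mderiv \<alpha> (rescale \<Phi> r)"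
    have PL: "P \<in> Lp_loc 1" using P by (intro smooth_Lp_loc_1 smooth_polys)
    have su: "supp_cball 0 r (rescale \<Phi> r)" by (rule kernel_supp_rescale[OF \<Phi> r])
    have t: "test_fun ?\<psi>" by (rule test_fun_mderiv[OF kernel_test_fun_rescale[OF \<Phi> r]])
    have "conv (reg f) ?\<psi> x - mderiv \<alpha> P x = (LINT y|lebesgue. (f y - P y) * ?\<psi> (x - y))"
      unfolding kernel_reproduces_mderiv[OF \<Phi> P N r, symmetric] conv_reg left_diff_distrib
      by (intro Bochner_Integration.integral_diff[symmetric] Lp_loc_1_integrable_test f PL test_fun_reflect t)
    also have "\<bar>\<dots>\<bar> \<le> C / r ^ (CARD('n) + msize \<alpha>) * (LINT y|lebesgue. indicator (cball x r) y * \<bar>f y - P y\<bar>)"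
    proof (rule integral_mult_bound)
      show "supp_cball x r (\<lambda>y. ?\<psi> (x - y))"
        using supp_cball_reflect[OF supp_cball_mderiv[OF su], of x] by simp
    qed (use C r in \<open>auto intro: Lp_loc_1_diff f PL\<close>)
    also have "\<dots> \<le> C / r ^ (CARD('n) + msize \<alpha>) * L1dist_ball f P z R"
      unfolding L1dist_ball_def
    proof (intro mult_left_mono integral_mono)
      show "integrable lebesgue (\<lambda>y. indicator (cball x r) y * \<bar>f y - P y\<bar>)"
        using integrable_abs[OF Lp_loc_1_integrable_cball[OF Lp_loc_1_diff[OF f PL]]] by (simp add: abs_mult)
      show "integrable lebesgue (\<lambda>y. indicator (ball z R) y * \<bar>f y - P y\<bar>)"
        by (intro integrable_indicator_ball Lp_loc_1_diff f PL)
    qed (use b C r in \<open>auto simp: indicator_def\<close>)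
    finally show "\<bar>conv (reg f) ?\<psi> x - mderiv \<alpha> P x\<bar> \<le> C / r ^ (CARD('n) + msize \<alpha>) * L1dist_ball f P z R" .
  qed
qed

text \<open>Both mollified derivatives are close to the derivative of the same polynomial, a nearly best one on a
  ball containing both supports. If \<open>N = |\<alpha>|\<close>, that derivative is constant, so even the centres of the
  two mollifications may differ.\<close>

lemma mollified_derivative_compare:
  fixes f \<Phi> :: "real ^ 'n::finite \<Rightarrow> real"
  assumes \<Phi>: "kernel M \<Phi>"
  shows "\<exists>C>0. \<forall>f N r r' \<rho> x x' z R. f \<in> Lp_loc 1 \<and> N \<le> M + msize \<alpha> \<and> 0 < \<rho> \<and> \<rho> \<le> r \<and> \<rho> \<le> r' \<and>
     cball x r \<subseteq> ball z R \<and> cball x' r' \<subseteq> ball z R \<and> (x = x' \<or> N = msize \<alpha>) \<longrightarrow>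
    \<bar>conv (reg f) (mderiv \<alpha> (rescale \<Phi> r)) x - conv (reg f) (mderiv \<alpha> (rescale \<Phi> r')) x'\<bar>
      \<le> C / \<rho> ^ (CARD('n) + msize \<alpha>) * best_L1 N f z R"
proof -
  obtain C where C: "0 < C" "\<And>f N P r x z R. f \<in> Lp_loc 1 \<and> P \<in> polys N \<and> N \<le> M + msize \<alpha> \<and> 0 < r \<and> cball x r \<subseteq> ball z R \<longrightarrow>
    \<bar>conv (reg f) (mderiv \<alpha> (rescale \<Phi> r)) x - mderiv \<alpha> P x\<bar> \<le> C / r ^ (CARD('n) + msize \<alpha>) * L1dist_ball f P z R"
    using mollified_derivative_near_poly[OF \<Phi>, of \<alpha>] by metis
  show ?thesis
  proof (intro exI[of _ "2 * C"] conjI allI impI)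
    fix f :: "real ^ 'n \<Rightarrow> real" and r r' \<rho> R :: real and x x' z :: "real ^ 'n" and N
    assume "f \<in> Lp_loc 1 \<and> N \<le> M + msize \<alpha> \<and> 0 < \<rho> \<and> \<rho> \<le> r \<and> \<rho> \<le> r' \<and>
     cball x r \<subseteq> ball z R \<and> cball x' r' \<subseteq> ball z R \<and> (x = x' \<or> N = msize \<alpha>)"
    then have f: "f \<in> Lp_loc 1" and N: "N \<le> M + msize \<alpha>" and r: "0 < \<rho>" "\<rho> \<le> r" "\<rho> \<le> r'"
      and b: "cball x r \<subseteq> ball z R" "cball x' r' \<subseteq> ball z R" and x: "x = x' \<or> N = msize \<alpha>" by auto
    let ?k = "CARD('n) + msize \<alpha>"
    let ?d = "\<bar>conv (reg f) (mderiv \<alpha> (rescale \<Phi> r)) x - conv (reg f) (mderiv \<alpha> (rescale \<Phi> r')) x'\<bar>"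
    have mono: "C / s ^ ?k * L1dist_ball f P z R \<le> C / \<rho> ^ ?k * L1dist_ball f P z R" if "\<rho> \<le> s" for s P
      using that r C(1) by (intro mult_right_mono L1dist_ball_nonneg divide_left_mono power_mono mult_pos_pos zero_less_power) auto
    have "\<rho> ^ ?k / (2 * C) * ?d \<le> best_L1 N f z R"
    proof (rule best_L1_greatest)
      fix P :: "real ^ 'n \<Rightarrow> real" assume P: "P \<in> polys N"
      have "mderiv \<alpha> P x = mderiv \<alpha> P x'"
      proof (cases "x = x'")
        case False
        then show ?thesis using x mderiv_polys[OF P, of \<alpha>] polys_0_const by force
      qed simp
      then have "?d \<le> C / r ^ ?k * L1dist_ball f P z R + C / r' ^ ?k * L1dist_ball f P z R"
        using C(2)[of f P N r x z R] C(2)[of f P N r' x' z R] f P N r b by auto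
      also have "\<dots> \<le> 2 * C / \<rho> ^ ?k * L1dist_ball f P z R"
        using mono[OF r(2), of P] mono[OF r(3), of P] by simp
      finally show "\<rho> ^ ?k / (2 * C) * ?d \<le> L1dist_ball f P z R"
        using C(1) r(1) by (simp add: field_simps)
    qed
    then show "?d \<le> 2 * C / \<rho> ^ ?k * best_L1 N f z R"
      using C(1) r(1) by (simp add: field_simps)
  qed (use C in simp)
qed

section \<open>Reduction to the exponent one\<close>

text \<open>The tangent to the graph of the concave function \<open>s \<mapsto> s^(1/q)\<close> at \<open>s = l^q\<close> lies above the graph.
  Integrated over a set and optimized in \<open>l\<close>, this becomes Hoelder's inequality.\<close>

lemma Young_linear:
  fixes t l q :: real
  assumes "1 \<le> q" "0 < l" "0 \<le> t"
  shows "t \<le> (1 / q * l powr (1 - q)) * t powr q + (1 - 1 / q) * l"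
proof (cases "t = 0")
  case True then show ?thesis using assms by (simp add: field_simps)
next
  case False
  have q: "0 < q" using assms by simp
  have "(t powr q * l powr (1 - q)) powr (1 / q) * l powr (1 - 1 / q)
      \<le> 1 / q * (t powr q * l powr (1 - q)) + (1 - 1 / q) * l"
    using assms False by (intro Youngs_inequality_0) auto
  moreover have "(t powr q * l powr (1 - q)) powr (1 / q) * l powr (1 - 1 / q) = t"
  proof -
    have "(t powr q * l powr (1 - q)) powr (1 / q) = t * l powr ((1 - q) * (1 / q))"
      using assms False q by (simp add: powr_mult powr_powr)
    then have "(t powr q * l powr (1 - q)) powr (1 / q) * l powr (1 - 1 / q) = t * l powr ((1 - q) * (1 / q) + (1 - 1 / q))"
      by (simp add: powr_add)
    also have "(1 - q) * (1 / q) + (1 - 1 / q) = 0" using q by (simp add: field_simps)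
    finally show ?thesis using assms by simp
  qed
  ultimately show ?thesis by (simp add: mult_ac)
qed

lemma nn_integral_le_Lp_norm:
  fixes u :: "real ^ 'n::finite \<Rightarrow> real"
  assumes p: "1 \<le> p" and u[measurable]: "u \<in> borel_measurable lebesgue"
    and A[measurable]: "A \<in> sets lebesgue" and m: "emeasure lebesgue A = ennreal m" "0 < m"
  shows "(\<integral>\<^sup>+x\<in>A. ennreal \<bar>u x\<bar> \<partial>lebesgue) \<le> ennreal (m powr (1 - enn2real (inverse p))) * Lp_norm p A u"
proof (cases "p = \<infinity>")
  case True
  let ?E = "esssup (restrict_space lebesgue A) (\<lambda>x. ennreal \<bar>u x\<bar>)"
  have "(\<integral>\<^sup>+x\<in>A. ennreal \<bar>u x\<bar> \<partial>lebesgue) = (\<integral>\<^sup>+x. ennreal \<bar>u x\<bar> \<partial>restrict_space lebesgue A)"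
    by (subst nn_integral_restrict_space) auto
  also have "\<dots> \<le> (\<integral>\<^sup>+x. ?E \<partial>restrict_space lebesgue A)"
    by (intro nn_integral_mono_AE esssup_AE)
  also have "\<dots> = ?E * ennreal m"
    using m by (simp add: emeasure_restrict_space space_restrict_space)
  finally show ?thesis using True m by (simp add: Lp_norm_def mult.commute)
next
  case False
  define q where "q = enn2real p"
  have pq: "p = ennreal q" using False by (simp add: q_def less_top)
  have q: "1 \<le> q"
  proof -
    have "ennreal 1 \<le> ennreal q" using p pq by simp
    then show ?thesis by (metis ennreal_le_iff2 not_one_le_zero)
  qed
  have s: "enn2real (inverse p) = 1 / q"
    using q pq by (simp add: inverse_ennreal inverse_eq_divide)
  let ?I = "\<integral>\<^sup>+x\<in>A. ennreal (\<bar>u x\<bar> powr q) \<partial>lebesgue"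
  show ?thesis
  proof (cases "?I = \<infinity>")
    case True
    then have "Lp_norm p A u = \<infinity>" using False by (simp add: Lp_norm_def ennpowr_def q_def)
    then show ?thesis using m by (simp add: ennreal_mult_top)
  next
    case fin: False
    define a where "a = enn2real ?I"
    have a: "?I = ennreal a" "0 \<le> a" using fin by (auto simp: a_def less_top)
    have Lp: "Lp_norm p A u = ennreal (a powr (1 / q))"
      using False fin by (simp add: Lp_norm_def ennpowr_def s a_def q_def)
    have lin: "ennreal (c * t + d) = ennreal c * ennreal t + ennreal d" if "0 \<le> c" "0 \<le> d" "0 \<le> t" for c d t
      using that by (simp add: ennreal_plus ennreal_mult)
    have main: "(\<integral>\<^sup>+x\<in>A. ennreal \<bar>u x\<bar> \<partial>lebesgue) \<le> ennreal (1 / q * l powr (1 - q) * a + (1 - 1 / q) * l * m)"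
      if l: "0 < l" for l
    proof -
      define c d where "c = 1 / q * l powr (1 - q)" and "d = (1 - 1 / q) * l"
      have cd: "0 \<le> c" "0 \<le> d" using q l by (auto simp: c_def d_def)
      have "(\<integral>\<^sup>+x\<in>A. ennreal \<bar>u x\<bar> \<partial>lebesgue) \<le>
        (\<integral>\<^sup>+x. ennreal c * (ennreal (\<bar>u x\<bar> powr q) * indicator A x) + ennreal d * indicator A x \<partial>lebesgue)"
      proof (rule nn_integral_mono)
        fix x
        have "ennreal \<bar>u x\<bar> \<le> ennreal (c * \<bar>u x\<bar> powr q + d)"
          using Young_linear[OF q l, of "\<bar>u x\<bar>"] by (simp add: ennreal_leI c_def d_def)
        also have "\<dots> = ennreal c * ennreal (\<bar>u x\<bar> powr q) + ennreal d"
          using cd by (intro lin) auto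
        finally show "ennreal \<bar>u x\<bar> * indicator A x \<le>
           ennreal c * (ennreal (\<bar>u x\<bar> powr q) * indicator A x) + ennreal d * indicator A x"
          by (auto simp: indicator_def)
      qed
      also have "\<dots> = ennreal c * ?I + ennreal d * ennreal m"
        by (subst nn_integral_add) (auto simp: nn_integral_cmult nn_integral_cmult_indicator m)
      also have "\<dots> = ennreal (c * a + d * m)"
        using cd a m lin[of c "d * m" a] by (simp add: ennreal_mult)
      finally show ?thesis by (simp add: c_def d_def)
    qed
    have "(\<integral>\<^sup>+x\<in>A. ennreal \<bar>u x\<bar> \<partial>lebesgue) \<le> ennreal (m powr (1 - 1 / q) * a powr (1 / q))"
    proof (cases "a = 0")
      case True
      \<comment> \<open>the bound has no minimizer, but its infimum is approached as \<open>l\<close> tends to \<open>0\<close>\<close>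
      have "((\<lambda>l. ennreal (1 / q * l powr (1 - q) * a + (1 - 1 / q) * l * m)) \<longlongrightarrow> ennreal ((1 - 1 / q) * 0 * m)) (at_right 0)"
        unfolding True by (intro tendsto_intros tendsto_ennrealI) (auto intro!: tendsto_eq_intros)
      then have "(\<integral>\<^sup>+x\<in>A. ennreal \<bar>u x\<bar> \<partial>lebesgue) \<le> ennreal ((1 - 1 / q) * 0 * m)"
        by (rule tendsto_lowerbound[OF _ eventually_mono[OF eventually_at_right_less main]]) (assumption, rule trivial_limit_at_right_real)
      then show ?thesis by simp
    next
      case False
      \<comment> \<open>the minimizer of the bound\<close>
      define l where "l = (a / m) powr (1 / q)"
      have l: "0 < l" using False a m by (simp add: l_def)
      have lq: "l powr (- q) = m / a" and am: "a = l powr q * m"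
        using False a m q by (auto simp: l_def powr_powr powr_minus_divide)
      have "1 / q * l powr (1 - q) * a + (1 - 1 / q) * l * m = l * m"
      proof -
        have "l powr (1 - q) * a = l * m"
          using lq l False a by (simp add: powr_diff powr_minus_divide field_simps)
        then have "1 / q * l powr (1 - q) * a = 1 / q * (l * m)" by (simp only: mult.assoc)
        then show ?thesis by (simp add: algebra_simps)
      qed
      moreover have "l * m = m powr (1 - 1 / q) * a powr (1 / q)"
        using m a by (simp add: l_def powr_divide powr_diff)
      ultimately show ?thesis using main[OF l] by simp
    qed
    then show ?thesis using s Lp by (simp add: ennreal_mult)
  qed
qed

lemma emeasure_ball_lebesgue: "emeasure lebesgue (ball x R) = ennreal (measure lebesgue (ball x R))"
  using lmeasurable_ball[of x R] by (simp add: emeasure_eq_measure2)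

lemma measure_ball_lebesgue:
  assumes "0 < R"
  shows "measure lebesgue (ball (x :: real ^ 'n::finite) R) = R ^ CARD('n) * measure lebesgue (ball (0 :: real ^ 'n) 1)"
  using content_ball_conv_unit_ball[of R x] assms by simp

lemma measure_unit_ball_pos: "0 < measure lebesgue (ball (0 :: real ^ 'n::finite) 1)"
  using content_ball_pos[of 1 "0 :: real ^ 'n"] by simp

lemma Lp_loc_subset_1:
  assumes p: "1 \<le> p" and f: "f \<in> Lp_loc p" shows "f \<in> Lp_loc 1"
proof (rule Lp_loc_1I)
  show fm[measurable]: "f \<in> borel_measurable lebesgue" using f by (simp add: Lp_loc_def)
  fix R :: real
  define Q where "Q = max R 1"
  have Q: "0 < Q" "R \<le> Q" by (auto simp: Q_def)
  have cm: "cball 0 Q \<in> sets lebesgue" for Q :: real by (auto simp: lmeasurable_cball[THEN fmeasurableD])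
  have pos: "0 < measure lebesgue (cball (0 :: real ^ 'a) Q)"
    using content_cball_pos[OF Q(1), of "0 :: real ^ 'a"] by simp
  have "(\<integral>\<^sup>+x\<in>cball 0 Q. ennreal \<bar>f x\<bar> \<partial>lebesgue) \<le>
     ennreal (measure lebesgue (cball (0 :: real ^ 'a) Q) powr (1 - enn2real (inverse p))) * Lp_norm p (cball 0 Q) f"
    using pos by (intro nn_integral_le_Lp_norm p cm fm) (auto simp: emeasure_eq_measure2[OF lmeasurable_cball])
  also have "\<dots> < \<infinity>" using f by (auto simp: Lp_loc_def ennreal_mult_less_top)
  finally have "(\<integral>\<^sup>+x\<in>cball 0 Q. ennreal \<bar>f x\<bar> \<partial>lebesgue) < \<infinity>" .
  moreover have "(\<integral>\<^sup>+ x. ennreal (norm (indicator (cball 0 R) x * f x)) \<partial>lebesgue) \<le> (\<integral>\<^sup>+x\<in>cball 0 Q. ennreal \<bar>f x\<bar> \<partial>lebesgue)"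
    using Q by (intro nn_integral_mono) (auto simp: indicator_def)
  ultimately have "(\<integral>\<^sup>+ x. ennreal (norm (indicator (cball 0 R) x * f x)) \<partial>lebesgue) < \<infinity>"
    by (rule le_less_trans[rotated])
  then show "integrable lebesgue (\<lambda>x. indicator (cball 0 R) x * f x)"
    using cm by (intro integrableI_bounded borel_measurable_times borel_measurable_indicator fm) auto
qed

lemma L1dist_ball_le_Lp_norm:
  fixes f P :: "real ^ 'n::finite \<Rightarrow> real"
  assumes p: "1 \<le> p" and f: "f \<in> Lp_loc 1" and P: "P \<in> Lp_loc 1" and R: "0 < R"
  shows "ennreal (L1dist_ball f P x R) \<le>
    ennreal (measure lebesgue (ball (0 :: real ^ 'n) R) powr (1 - enn2real (inverse p))) * Lp_norm p (ball x R) (\<lambda>x. f x - P x)"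
proof -
  have m: "measure lebesgue (ball x R) = measure lebesgue (ball (0 :: real ^ 'n) R)"
    using measure_ball_lebesgue[OF R, of x] measure_ball_lebesgue[OF R, of "0 :: real ^ 'n"] by simp
  have "ennreal (L1dist_ball f P x R) = (\<integral>\<^sup>+y. ennreal (indicator (ball x R) y * \<bar>f y - P y\<bar>) \<partial>lebesgue)"
    unfolding L1dist_ball_def
    by (intro nn_integral_eq_integral[symmetric] integrable_indicator_ball Lp_loc_1_diff f P) auto
  also have "\<dots> = (\<integral>\<^sup>+y\<in>ball x R. ennreal \<bar>f y - P y\<bar> \<partial>lebesgue)"
    by (intro nn_integral_cong) (auto simp: indicator_def)
  also have "\<dots> \<le> ennreal (measure lebesgue (ball (0 :: real ^ 'n) R) powr (1 - enn2real (inverse p))) * Lp_norm p (ball x R) (\<lambda>x. f x - P x)"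
    using R measure_unit_ball_pos[where 'n = 'n]
    by (intro nn_integral_le_Lp_norm p Lp_loc_measurable[OF Lp_loc_1_diff[OF f P]])
       (auto simp: emeasure_ball_lebesgue m lmeasurable_ball[THEN fmeasurableD] measure_ball_lebesgue)
  finally show ?thesis .
qed

lemma best_L1_le_osc:
  fixes f :: "real ^ 'n::finite \<Rightarrow> real"
  assumes p: "1 \<le> p" and f: "f \<in> Lp_loc 1" and R: "0 < R"
  shows "ennreal (best_L1 N f x R) \<le> ennreal (measure lebesgue (ball (0 :: real ^ 'n) R)) * osc p N f x R"
proof -
  let ?m = "measure lebesgue (ball (0 :: real ^ 'n) R)" and ?s = "enn2real (inverse p)"
  have m: "0 < ?m" using R measure_unit_ball_pos[where 'n = 'n] by (simp add: measure_ball_lebesgue)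
  define c where "c = ?m powr (1 - ?s)"
  have c: "0 < c" "c = ?m * ?m powr (- ?s)"
    using m by (auto simp: c_def powr_diff powr_minus_divide)
  have "ennreal (best_L1 N f x R / c) \<le> Lp_norm p (ball x R) (\<lambda>x. f x - P x)" if P: "P \<in> polys N" for P
  proof -
    have "ennreal (best_L1 N f x R / c) = ennreal (1 / c) * ennreal (best_L1 N f x R)"
      using c(1) by (simp add: best_L1_nonneg flip: ennreal_mult)
    also have "\<dots> \<le> ennreal (1 / c) * (ennreal c * Lp_norm p (ball x R) (\<lambda>x. f x - P x))"
      using order_trans[OF ennreal_leI[OF best_L1_le[OF P]] L1dist_ball_le_Lp_norm[OF p f smooth_Lp_loc_1[OF smooth_polys[OF P]] R]]
      unfolding c_def by (intro mult_left_mono) auto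
    also have "\<dots> = Lp_norm p (ball x R) (\<lambda>x. f x - P x)"
      using c(1) by (simp flip: mult.assoc ennreal_mult)
    finally show ?thesis .
  qed
  then have "ennreal (best_L1 N f x R / c) \<le> (INF P\<in>polys N. Lp_norm p (ball x R) (\<lambda>x. f x - P x))"
    by (rule INF_greatest)
  then have "ennreal c * ennreal (best_L1 N f x R / c) \<le> ennreal c * (INF P\<in>polys N. Lp_norm p (ball x R) (\<lambda>x. f x - P x))"
    by (rule mult_left_mono) simp
  moreover have "ennreal c * ennreal (best_L1 N f x R / c) = ennreal (best_L1 N f x R)"
    using c(1) by (simp add: best_L1_nonneg flip: ennreal_mult)
  ultimately show ?thesis
    unfolding c(2) using m by (simp add: osc_def ennreal_mult mult.assoc)
qed

section \<open>Summable oscillation\<close>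

text \<open>The only information used about a function in a Campanato space: at every point its scaled
  distances to the polynomials of degree \<open>N\<close>, over the balls of dyadic radius, sum up to at most \<open>K\<close>.
  The small and the large radii are recorded separately, because they are used for different limits.\<close>

definition scaled_best :: "nat \<Rightarrow> (real ^ 'n::finite \<Rightarrow> real) \<Rightarrow> real ^ 'n \<Rightarrow> real \<Rightarrow> real" where
  "scaled_best N f x r = best_L1 N f x r / r ^ (CARD('n) + N)"

definition summable_osc :: "nat \<Rightarrow> real \<Rightarrow> (real ^ 'n::finite \<Rightarrow> real) \<Rightarrow> bool" where
  "summable_osc N K f \<longleftrightarrow> f \<in> Lp_loc 1 \<and>
    (\<forall>x m. (\<Sum>i<m. scaled_best N f x (2 ^ i)) \<le> K \<and> (\<Sum>i<m. scaled_best N f x ((1 / 2) ^ i)) \<le> K)"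

lemma scaled_best_nonneg: "0 \<le> r \<Longrightarrow> 0 \<le> scaled_best N f x r"
  by (simp add: scaled_best_def best_L1_nonneg)

lemma summable_osc_Lp_loc: "summable_osc N K f \<Longrightarrow> f \<in> Lp_loc 1"
  by (simp add: summable_osc_def)

lemma summable_osc_nonneg: "summable_osc N K f \<Longrightarrow> 0 \<le> K"
  unfolding summable_osc_def by (drule conjunct2, drule spec, drule spec[of _ 0]) simp

lemma summable_osc_large:
  "summable_osc N K f \<Longrightarrow> summable (\<lambda>i. scaled_best N f x (2 ^ i))"
  by (rule summableI_nonneg_bounded[of _ K]) (auto simp: summable_osc_def scaled_best_nonneg)

lemma summable_osc_small:
  "summable_osc N K f \<Longrightarrow> summable (\<lambda>i. scaled_best N f x ((1 / 2) ^ i))"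
  by (rule summableI_nonneg_bounded[of _ K]) (auto simp: summable_osc_def scaled_best_nonneg)

lemma sum_segment_le:
  fixes v :: "nat \<Rightarrow> real"
  assumes "\<And>i. 0 \<le> v i" "\<And>m. (\<Sum>i<m. v i) \<le> K"
  shows "(\<Sum>i\<in>{m..<k}. v i) \<le> K"
proof -
  have "(\<Sum>i\<in>{m..<k}. v i) \<le> (\<Sum>i<k. v i)" using assms(1) by (intro sum_mono2) auto
  then show ?thesis using assms(2)[of k] by simp
qed

text \<open>Hoelder's inequality costs \<open>|B(r)|^(1-1/p)\<close>, which together with the normalization of the oscillation
  leaves \<open>|B(r)|\<close>; its part \<open>r^n\<close> is absorbed by the scaling, and the measure of the unit ball remains.\<close>

lemma camp_summable_osc:
  fixes f :: "real ^ 'n::finite \<Rightarrow> real"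
  assumes p: "1 \<le> p" and f: "f \<in> camp p N"
  shows "summable_osc N (measure lebesgue (ball (0 :: real ^ 'n) 1) * enn2real (camp_seminorm p N f)) f"
proof -
  let ?w = "measure lebesgue (ball (0 :: real ^ 'n) 1)" and ?S = "enn2real (camp_seminorm p N f)"
  have f1: "f \<in> Lp_loc 1" using f p by (auto simp: camp_def intro: Lp_loc_subset_1)
  have S: "camp_seminorm p N f = ennreal ?S" using f by (simp add: camp_def less_top)
  have w: "0 < ?w" by (rule measure_unit_ball_pos)
  have J: "(\<Sum>j\<in>J. scaled_best N f x (2 powi j)) \<le> ?w * ?S" if J: "finite J" for J x
  proof -
    have "ennreal (\<Sum>j\<in>J. scaled_best N f x (2 powi j) / ?w) = (\<Sum>j\<in>J. ennreal (scaled_best N f x (2 powi j) / ?w))"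
      using w by (intro sum_ennreal[symmetric]) (simp add: scaled_best_nonneg)
    also have "\<dots> \<le> (\<Sum>j\<in>J. ennreal (2 powi (- int N * j)) * osc p N f x (2 powi j))"
    proof (rule sum_mono)
      fix j :: int
      let ?r = "2 powi j :: real"
      have r: "0 < ?r" by simp
      have m: "measure lebesgue (ball (0 :: real ^ 'n) ?r) = ?r ^ CARD('n) * ?w"
        by (rule measure_ball_lebesgue[OF r])
      have pw: "2 powi (- int N * j) = 1 / ?r ^ N"
        by (simp add: power_int_minus power_int_mult mult.commute[of "int N"] divide_inverse)
      have "ennreal (scaled_best N f x ?r / ?w) = ennreal (1 / ?r ^ N / (?r ^ CARD('n) * ?w)) * ennreal (best_L1 N f x ?r)"
        using r w by (subst ennreal_mult[symmetric]) (auto simp: scaled_best_def best_L1_nonneg power_add mult_ac)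
      also have "\<dots> \<le> ennreal (1 / ?r ^ N / (?r ^ CARD('n) * ?w)) * (ennreal (?r ^ CARD('n) * ?w) * osc p N f x ?r)"
        using best_L1_le_osc[OF p f1 r, of N x] unfolding m by (intro mult_left_mono) auto
      also have "\<dots> = ennreal (1 / ?r ^ N / (?r ^ CARD('n) * ?w) * (?r ^ CARD('n) * ?w)) * osc p N f x ?r"
        using r w by (subst ennreal_mult) (auto simp: mult.assoc)
      also have "1 / ?r ^ N / (?r ^ CARD('n) * ?w) * (?r ^ CARD('n) * ?w) = 2 powi (- int N * j)"
        using w r unfolding pw by simp
      finally show "ennreal (scaled_best N f x ?r / ?w) \<le> ennreal (2 powi (- int N * j)) * osc p N f x ?r" .
    qed
    also have "\<dots> = (\<Sum>\<^sub>\<infinity>j\<in>J. ennreal (2 powi (- int N * j)) * osc p N f x (2 powi j))"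
      using J by simp
    also have "\<dots> \<le> (\<Sum>\<^sub>\<infinity>j\<in>UNIV. ennreal (2 powi (- int N * j)) * osc p N f x (2 powi j))"
      by (intro infsum_mono_neutral nonneg_summable_on_complete) auto
    also have "\<dots> \<le> camp_seminorm p N f" unfolding camp_seminorm_def by (rule SUP_upper) simp
    also note S
    finally have "(\<Sum>j\<in>J. scaled_best N f x (2 powi j) / ?w) \<le> ?S"
      by (simp only: ennreal_le_iff[OF enn2real_nonneg])
    then show ?thesis using w by (simp add: field_simps flip: sum_divide_distrib)
  qed
  have "(\<Sum>i<m. scaled_best N f x (2 ^ i)) \<le> ?w * ?S" for x m
    using J[of "int ` {..<m}" x] by (simp add: sum.reindex)
  moreover have "(\<Sum>i<m. scaled_best N f x ((1 / 2) ^ i)) \<le> ?w * ?S" for x m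
  proof -
    have "inj_on (\<lambda>i. - int i) {..<m}" by (auto simp: inj_on_def)
    then have "(\<Sum>j\<in>(\<lambda>i. - int i) ` {..<m}. scaled_best N f x (2 powi j)) = (\<Sum>i<m. scaled_best N f x ((1 / 2) ^ i))"
      by (simp add: sum.reindex power_int_minus power_one_over inverse_eq_divide)
    then show ?thesis using J[of "(\<lambda>i. - int i) ` {..<m}" x] by simp
  qed
  ultimately show ?thesis using f1 by (simp add: summable_osc_def)
qed

section \<open>Limits of mollified derivatives at large and small scales\<close>

lemma tendsto_dyadic_bound:
  fixes h :: "real \<Rightarrow> real"
  assumes "\<And>R. R0 \<le> R \<Longrightarrow> \<exists>i. R < 2 ^ i \<and> \<bar>h R\<bar> \<le> v i" and v: "v \<longlonglongrightarrow> 0"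
  shows "(h \<longlongrightarrow> 0) at_top"
proof (rule tendstoI)
  fix e :: real assume "0 < e"
  then obtain i0 where i0: "\<And>i. i0 \<le> i \<Longrightarrow> v i < e"
    using order_tendstoD(2)[OF v] by (auto simp: eventually_sequentially)
  have "dist (h R) 0 < e" if R: "max R0 (2 ^ i0) \<le> R" for R
  proof -
    have R': "R0 \<le> R" "2 ^ i0 \<le> R" using R by linarith+
    obtain i where i: "R < 2 ^ i" "\<bar>h R\<bar> \<le> v i" using assms(1)[OF R'(1)] by blast
    have "(2 :: real) ^ i0 < 2 ^ i" using R'(2) i(1) by (rule le_less_trans)
    then have "i0 < i" by (rule power_less_imp_less_exp[rotated]) simp
    then show ?thesis using i0[of i] i(2) by simp
  qed
  then show "\<forall>\<^sub>F R in at_top. dist (h R) 0 < e"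
    unfolding eventually_at_top_linorder by blast
qed

lemma ex_dyadic:
  fixes R :: real assumes "1 \<le> R" shows "\<exists>i. 2 ^ i / 2 \<le> R \<and> R < 2 ^ i"
proof -
  obtain i where i: "R < 2 ^ i" "\<And>j. R < 2 ^ j \<Longrightarrow> i \<le> j"
    using ex_least_nat_le[of "\<lambda>i. R < 2 ^ i"] real_arch_pow[of 2 R] by (metis not_le one_less_numeral_iff semiring_norm(76))
  have "i \<noteq> 0" using i(1) assms by (metis not_le power_0)
  then obtain j where "i = Suc j" by (cases i) auto
  then show ?thesis using i(1) i(2)[of j] by (intro exI[of _ i]) (auto simp: not_less[symmetric])
qed

lemma scaled_best_tendsto_0:
  fixes f :: "real ^ 'n::finite \<Rightarrow> real"
  assumes "summable_osc N K f"
  shows "((\<lambda>R. scaled_best N f x R) \<longlongrightarrow> 0) at_top"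
proof (rule tendsto_dyadic_bound)
  let ?k = "CARD('n) + N"
  show "(\<lambda>i. 2 ^ ?k * scaled_best N f x (2 ^ i)) \<longlonglongrightarrow> 0"
    using summable_LIMSEQ_zero[OF summable_osc_large[OF assms]] by (auto intro: tendsto_eq_intros)
  fix R :: real assume R: "1 \<le> R"
  then obtain i where i: "2 ^ i / 2 \<le> R" "R < 2 ^ i" using ex_dyadic by blast
  have "scaled_best N f x R \<le> best_L1 N f x (2 ^ i) / (2 ^ i / 2) ^ ?k"
    unfolding scaled_best_def using i R
    by (intro frac_le best_L1_mono summable_osc_Lp_loc[OF assms] best_L1_nonneg power_mono) auto
  also have "\<dots> = 2 ^ ?k * scaled_best N f x (2 ^ i)" by (simp add: scaled_best_def power_divide)
  finally show "\<exists>i. R < 2 ^ i \<and> \<bar>scaled_best N f x R\<bar> \<le> 2 ^ ?k * scaled_best N f x (2 ^ i)"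
    using i R scaled_best_nonneg[of R N f x] by auto
qed

text \<open>Consecutive dyadic scales are compared on a ball of twice the radius, so the differences are summable
  and the limit exists along the powers of two; intermediate scales and different points are compared
  in the same way. The order \<open>N\<close> of the derivative allows any degree \<open>M\<close> of the kernel. The bound of
  the limit and its distance to the mollified derivative at scale \<open>1/2\<close> provide the starting point for
  the top order estimates at small scales.\<close>

lemma mollified_large_scale:
  fixes \<Phi> :: "real ^ 'n::finite \<Rightarrow> real"
  assumes \<Phi>: "kernel M \<Phi>" and N: "msize \<alpha> = N"
  shows "\<exists>C>0. \<forall>f K. summable_osc N K f \<longrightarrow> (\<exists>a. \<bar>a\<bar> \<le> C * (K + L1dist_ball f (\<lambda>x. 0) 0 1) \<and>
    (\<forall>x. ((\<lambda>R. conv (reg f) (mderiv \<alpha> (rescale \<Phi> R)) x) \<longlongrightarrow> a) at_top) \<and>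
    (\<forall>x. \<bar>conv (reg f) (mderiv \<alpha> (rescale \<Phi> (1/2))) x - a\<bar> \<le> C * K))"
proof -
  let ?k = "CARD('n) + N"
  obtain C where C: "0 < C" "\<And>f N r r' \<rho> x x' z R. f \<in> Lp_loc 1 \<and> N \<le> M + msize \<alpha> \<and> 0 < \<rho> \<and> \<rho> \<le> r \<and> \<rho> \<le> r' \<and>
     cball x r \<subseteq> ball z R \<and> cball x' r' \<subseteq> ball z R \<and> (x = x' \<or> N = msize \<alpha>) \<Longrightarrow>
    \<bar>conv (reg f) (mderiv \<alpha> (rescale \<Phi> r)) x - conv (reg f) (mderiv \<alpha> (rescale \<Phi> r')) x'\<bar>
      \<le> C / \<rho> ^ (CARD('n) + msize \<alpha>) * best_L1 N f z R"
    using mollified_derivative_compare[OF \<Phi>, of \<alpha>] by metis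
  obtain C0 where C0: "0 < C0" "\<And>f N P r x z R. f \<in> Lp_loc 1 \<and> P \<in> polys N \<and> N \<le> M + msize \<alpha> \<and> 0 < r \<and> cball x r \<subseteq> ball z R \<Longrightarrow>
    \<bar>conv (reg f) (mderiv \<alpha> (rescale \<Phi> r)) x - mderiv \<alpha> P x\<bar> \<le> C0 / r ^ (CARD('n) + msize \<alpha>) * L1dist_ball f P z R"
    using mollified_derivative_near_poly[OF \<Phi>, of \<alpha>] by metis
  define D where "D = C * 4 ^ ?k + C0 * 2 ^ ?k"
  have D: "0 < D" "C * 4 ^ ?k \<le> D" "C0 * 2 ^ ?k \<le> D" using C(1) C0(1) by (auto simp: D_def add_pos_pos)
  show ?thesis
  proof (rule exI[of _ D], intro conjI D(1) allI impI)
    fix f :: "real ^ 'n \<Rightarrow> real" and K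
    assume so: "summable_osc N K f"
    have f: "f \<in> Lp_loc 1" using so by (rule summable_osc_Lp_loc)
    define m where "m x r = conv (reg f) (mderiv \<alpha> (rescale \<Phi> r)) x" for x r
    \<comment> \<open>half a dyadic number as scale, so that the closed supports fit into the open dyadic balls\<close>
    have up: "\<bar>m x (2 ^ Suc i / 2) - m x (2 ^ i / 2)\<bar> \<le> C * 4 ^ ?k * scaled_best N f x (2 ^ Suc i)" for x i
    proof -
      have "\<bar>m x (2 ^ Suc i / 2) - m x (2 ^ i / 2)\<bar> \<le> C / (2 ^ i / 2) ^ (CARD('n) + msize \<alpha>) * best_L1 N f x (2 ^ Suc i)"
        unfolding m_def by (rule C(2)) (simp add: f N cball_subset_ball_iff)
      also have "\<dots> = C * 4 ^ ?k * scaled_best N f x (2 ^ Suc i)"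
      proof -
        have e: "(2 :: real) ^ i / 2 = 2 ^ Suc i / 4" by simp
        show ?thesis unfolding e by (simp only: N scaled_best_def power_divide) simp
      qed
      finally show ?thesis .
    qed
    have sm: "summable (\<lambda>i. C * 4 ^ ?k * scaled_best N f x (2 ^ Suc i))" for x
      by (intro summable_mult iffD2[OF summable_Suc_iff[of "\<lambda>i. scaled_best N f x (2 ^ i)"]] summable_osc_large[OF so])
    have "summable (\<lambda>i. m x (2 ^ Suc i / 2) - m x (2 ^ i / 2))" for x
      by (rule summable_comparison_test'[OF sm]) (use up in auto)
    then have tele: "(\<lambda>i. m x (2 ^ i / 2)) \<longlonglongrightarrow> m x (1 / 2) + (\<Sum>i. m x (2 ^ Suc i / 2) - m x (2 ^ i / 2))" for x
    proof -
      fix x assume *: "\<And>x. summable (\<lambda>i. m x (2 ^ Suc i / 2) - m x (2 ^ i / 2))"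
      have "(\<lambda>k. \<Sum>i<k. m x (2 ^ Suc i / 2) - m x (2 ^ i / 2)) \<longlonglongrightarrow> (\<Sum>i. m x (2 ^ Suc i / 2) - m x (2 ^ i / 2))"
        using * by (rule summable_LIMSEQ)
      then have "(\<lambda>k. m x (2 ^ k / 2) - m x (2 ^ 0 / 2)) \<longlonglongrightarrow> (\<Sum>i. m x (2 ^ Suc i / 2) - m x (2 ^ i / 2))"
        unfolding sum_lessThan_telescope[of "\<lambda>i. m x (2 ^ i / 2)"] .
      from tendsto_add[OF tendsto_const[of "m x (1/2)"] this] show "(\<lambda>i. m x (2 ^ i / 2)) \<longlonglongrightarrow> m x (1 / 2) + (\<Sum>i. m x (2 ^ Suc i / 2) - m x (2 ^ i / 2))"
        by simp
    qed
    define a where "a x = m x (1 / 2) + (\<Sum>i. m x (2 ^ Suc i / 2) - m x (2 ^ i / 2))" for x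
    have dist_a: "\<bar>m x (1 / 2) - a x\<bar> \<le> C * 4 ^ ?k * K" for x
    proof -
      have "\<bar>m x (2 ^ j / 2) - m x (2 ^ 0 / 2)\<bar> \<le> C * 4 ^ ?k * K" for j
      proof -
        have "\<bar>m x (2 ^ j / 2) - m x (2 ^ 0 / 2)\<bar> = \<bar>\<Sum>i<j. m x (2 ^ Suc i / 2) - m x (2 ^ i / 2)\<bar>"
          unfolding sum_lessThan_telescope[of "\<lambda>i. m x (2 ^ i / 2)"] ..
        also have "\<dots> \<le> (\<Sum>i<j. C * 4 ^ ?k * scaled_best N f x (2 ^ Suc i))"
          by (intro order_trans[OF sum_abs] sum_mono up)
        also have "\<dots> = C * 4 ^ ?k * (\<Sum>i<j. scaled_best N f x (2 ^ Suc i))" by (simp add: sum_distrib_left)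
        also have "\<dots> \<le> C * 4 ^ ?k * (\<Sum>i<Suc j. scaled_best N f x (2 ^ i))"
          using C(1) by (intro mult_left_mono) (simp_all add: sum.lessThan_Suc_shift scaled_best_nonneg del: sum.lessThan_Suc)
        also have "\<dots> \<le> C * 4 ^ ?k * K"
          using C(1) so by (intro mult_left_mono) (simp_all add: summable_osc_def del: sum.lessThan_Suc)
        finally show ?thesis .
      qed
      then show ?thesis
        using tendsto_upperbound[OF tendsto_rabs[OF tendsto_diff[OF tele[folded a_def] tendsto_const[of "m x (1/2)"]]]]
        by (simp add: abs_minus_commute)
    qed
    have lim: "((\<lambda>R. m x R) \<longlongrightarrow> a x) at_top" for x
    proof -
      have "((\<lambda>R. m x R - a x) \<longlongrightarrow> 0) at_top"
      proof (rule tendsto_dyadic_bound)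
        show "(\<lambda>i. C * 2 ^ ?k * scaled_best N f x (2 ^ i) + \<bar>m x (2 ^ i / 2) - a x\<bar>) \<longlonglongrightarrow> 0"
          using tendsto_add[OF tendsto_mult_left[OF summable_LIMSEQ_zero[OF summable_osc_large[OF so]], of "C * 2 ^ ?k" x]
            tendsto_rabs_zero[OF LIM_zero[OF tele[folded a_def, of x]]]] by simp
        fix R :: real assume "1 \<le> R"
        then obtain i where i: "2 ^ i / 2 \<le> R" "R < 2 ^ i" using ex_dyadic by blast
        have "\<bar>m x R - m x (2 ^ i / 2)\<bar> \<le> C / (2 ^ i / 2) ^ (CARD('n) + msize \<alpha>) * best_L1 N f x (2 ^ i)"
          unfolding m_def by (rule C(2)) (use i in \<open>simp add: f N cball_subset_ball_iff\<close>)
        also have "\<dots> = C * 2 ^ ?k * scaled_best N f x (2 ^ i)" by (simp add: N scaled_best_def power_divide)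
        finally show "\<exists>i. R < 2 ^ i \<and> \<bar>m x R - a x\<bar> \<le> C * 2 ^ ?k * scaled_best N f x (2 ^ i) + \<bar>m x (2 ^ i / 2) - a x\<bar>"
          using i by (intro exI[of _ i]) auto
      qed
      from tendsto_add[OF this tendsto_const[of "a x"]] show ?thesis by simp
    qed
    have indep: "a x = a 0" for x
    proof -
      have "((\<lambda>R. m x R - m 0 R) \<longlongrightarrow> 0) at_top"
      proof (rule Lim_null_comparison)
        show "((\<lambda>R. C * 3 ^ ?k * scaled_best N f 0 (3 * R)) \<longlongrightarrow> 0) at_top"
          using filterlim_compose[OF scaled_best_tendsto_0[OF so, of 0] filterlim_tendsto_pos_mult_at_top[OF tendsto_const[of 3] _ filterlim_ident]]
          by (auto intro!: tendsto_eq_intros)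
        have "norm (m x R - m 0 R) \<le> C * 3 ^ ?k * scaled_best N f 0 (3 * R)" if R: "max 1 (norm x) \<le> R" for R
        proof -
          have "cball x R \<subseteq> ball 0 (3 * R)"
          proof
            fix y assume "y \<in> cball x R"
            then have "norm y \<le> norm x + R" using norm_triangle_ineq[of x "y - x"] by (simp add: dist_norm norm_minus_commute)
            then show "y \<in> ball 0 (3 * R)" using R by simp
          qed
          then have "\<bar>m x R - m 0 R\<bar> \<le> C / R ^ (CARD('n) + msize \<alpha>) * best_L1 N f 0 (3 * R)"
            unfolding m_def by (intro C(2)) (use R in \<open>auto simp: f N\<close>)
          also have "\<dots> = C * 3 ^ ?k * scaled_best N f 0 (3 * R)" by (simp add: N scaled_best_def power_mult_distrib)
          finally show ?thesis by simp
        qed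
        then show "\<forall>\<^sub>F R in at_top. norm (m x R - m 0 R) \<le> C * 3 ^ ?k * scaled_best N f 0 (3 * R)"
          unfolding eventually_at_top_linorder by blast
      qed
      then have "a x - a 0 = 0"
        using tendsto_diff[OF lim[of x] lim[of 0]] tendsto_unique trivial_limit_at_top_linorder by blast
      then show ?thesis by simp
    qed
    have K: "0 \<le> K" by (rule summable_osc_nonneg[OF so])
    show "\<exists>a. \<bar>a\<bar> \<le> D * (K + L1dist_ball f (\<lambda>x. 0) 0 1) \<and>
      (\<forall>x. ((\<lambda>R. conv (reg f) (mderiv \<alpha> (rescale \<Phi> R)) x) \<longlongrightarrow> a) at_top) \<and>
      (\<forall>x. \<bar>conv (reg f) (mderiv \<alpha> (rescale \<Phi> (1/2))) x - a\<bar> \<le> D * K)"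
    proof (intro exI[of _ "a 0"] conjI allI)
      have DK: "C * 4 ^ ?k * K \<le> D * K" using D(2) K by (rule mult_right_mono)
      have "\<bar>m 0 (1/2) - mderiv \<alpha> (\<lambda>x. 0) 0\<bar> \<le> C0 / (1/2) ^ (CARD('n) + msize \<alpha>) * L1dist_ball f (\<lambda>x. 0) 0 1"
        unfolding m_def by (rule C0(2)[where N = N]) (auto simp: f N polys_const)
      moreover have "mderiv \<alpha> (\<lambda>x. 0) = (\<lambda>x. 0)" using mderiv_cmult[of "\<lambda>x. 0" \<alpha> 0] by simp
      moreover have "C0 / (1/2) ^ (CARD('n) + msize \<alpha>) * L1dist_ball f (\<lambda>x. 0) 0 1 \<le> D * L1dist_ball f (\<lambda>x. 0) 0 1"
        using D(3) by (intro mult_right_mono L1dist_ball_nonneg) (simp add: N power_one_over)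
      ultimately show "\<bar>a 0\<bar> \<le> D * (K + L1dist_ball f (\<lambda>x. 0) 0 1)"
        using dist_a[of 0] DK by (simp add: distrib_left)
      show "((\<lambda>R. conv (reg f) (mderiv \<alpha> (rescale \<Phi> R)) x) \<longlongrightarrow> a 0) at_top" for x
        using lim[of x] by (simp add: indep[of x] m_def)
      show "\<bar>conv (reg f) (mderiv \<alpha> (rescale \<Phi> (1/2))) x - a 0\<bar> \<le> D * K" for x
        using dist_a[of x] DK by (simp add: indep[of x] m_def)
    qed
  qed
qed

text \<open>The scale is a quarter of a dyadic number, so that the compared kernels live in the dyadic balls.\<close>

definition small_scale :: "nat \<Rightarrow> real" where
  "small_scale i = (1 / 2) ^ i / 4"

lemma small_scale_pos: "0 < small_scale i" and small_scale_le: "small_scale i \<le> 1 / 4"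
  by (simp_all add: small_scale_def power_le_one)

lemma small_scale_lim: "small_scale \<longlonglongrightarrow> 0"
  unfolding small_scale_def by (auto intro!: tendsto_eq_intros LIMSEQ_power_zero)

text \<open>The same telescoping towards small scales. The surplus \<open>N - |\<alpha>|\<close> of powers of the scale gives a
  geometric rate below the order \<open>N\<close>; at the order \<open>N\<close> there remain convergence and a uniform bound.\<close>

lemma mollified_small_scale:
  fixes \<Phi> :: "real ^ 'n::finite \<Rightarrow> real"
  assumes \<Phi>: "kernel N \<Phi>" and N: "msize \<alpha> \<le> N"
  shows "\<exists>C>0. \<forall>f K. summable_osc N K f \<longrightarrow> (\<forall>x.
     convergent (\<lambda>i. conv (reg f) (mderiv \<alpha> (rescale \<Phi> (small_scale i))) x) \<and>
     (\<forall>i j. i \<le> j \<longrightarrow> \<bar>conv (reg f) (mderiv \<alpha> (rescale \<Phi> (small_scale j))) x - conv (reg f) (mderiv \<alpha> (rescale \<Phi> (small_scale i))) x\<bar>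
        \<le> C * K * ((1 / 2) ^ i) ^ (N - msize \<alpha>)) \<and>
     \<bar>conv (reg f) (mderiv \<alpha> (rescale \<Phi> (small_scale 0))) x - conv (reg f) (mderiv \<alpha> (rescale \<Phi> (1 / 2))) x\<bar> \<le> C * K)"
proof -
  let ?k = "CARD('n) + msize \<alpha>"
  obtain C where C: "0 < C" "\<And>f N' r r' \<rho> x x' z R. f \<in> Lp_loc 1 \<and> N' \<le> N + msize \<alpha> \<and> 0 < \<rho> \<and> \<rho> \<le> r \<and> \<rho> \<le> r' \<and>
     cball x r \<subseteq> ball z R \<and> cball x' r' \<subseteq> ball z R \<and> (x = x' \<or> N' = msize \<alpha>) \<Longrightarrow>
    \<bar>conv (reg f) (mderiv \<alpha> (rescale \<Phi> r)) x - conv (reg f) (mderiv \<alpha> (rescale \<Phi> r')) x'\<bar>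
      \<le> C / \<rho> ^ (CARD('n) + msize \<alpha>) * best_L1 N' f z R"
    using mollified_derivative_compare[OF \<Phi>, of \<alpha>] by metis
  define D where "D = C * 8 ^ ?k"
  have D: "0 < D" using C(1) by (simp add: D_def)
  show ?thesis
  proof (rule exI[of _ D], intro conjI D(1) allI impI)
    fix f :: "real ^ 'n \<Rightarrow> real" and K x
    assume so: "summable_osc N K f"
    have f: "f \<in> Lp_loc 1" using so by (rule summable_osc_Lp_loc)
    define m where "m r = conv (reg f) (mderiv \<alpha> (rescale \<Phi> r)) x" for r
    let ?q = "\<lambda>i. ((1 / 2 :: real) ^ i) ^ (N - msize \<alpha>)"
    have step: "\<bar>m (small_scale (Suc i)) - m (small_scale i)\<bar> \<le> D * (?q i * scaled_best N f x ((1 / 2) ^ i))" for i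
    proof -
      have "\<bar>m (small_scale (Suc i)) - m (small_scale i)\<bar> \<le> C / small_scale (Suc i) ^ ?k * best_L1 N f x ((1 / 2) ^ i)"
        unfolding m_def by (rule C(2)) (simp add: f small_scale_def cball_subset_ball_iff)
      also have "C / small_scale (Suc i) ^ ?k * best_L1 N f x ((1 / 2) ^ i) = D * (?q i * scaled_best N f x ((1 / 2) ^ i))"
      proof -
        have "CARD('n) + N = ?k + (N - msize \<alpha>)" and "small_scale (Suc i) = (1 / 2) ^ i / 8"
          using N by (simp_all add: small_scale_def)
        then show ?thesis
          unfolding scaled_best_def D_def by (simp only: power_add power_divide) (simp add: field_simps)
      qed
      finally show ?thesis .
    qed
    have K: "0 \<le> K" by (rule summable_osc_nonneg[OF so])
    have seg: "(\<Sum>k\<in>{i..<j}. scaled_best N f x ((1 / 2) ^ k)) \<le> K" for i j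
      using so by (intro sum_segment_le) (auto simp: scaled_best_nonneg summable_osc_def)
    show "\<bar>conv (reg f) (mderiv \<alpha> (rescale \<Phi> (small_scale j))) x - conv (reg f) (mderiv \<alpha> (rescale \<Phi> (small_scale i))) x\<bar>
        \<le> D * K * ?q i" if "i \<le> j" for i j
    proof -
      have "\<bar>m (small_scale j) - m (small_scale i)\<bar> = \<bar>\<Sum>k\<in>{i..<j}. m (small_scale (Suc k)) - m (small_scale k)\<bar>"
        using sum_Suc_diff'[OF that, of "\<lambda>k. m (small_scale k)"] by simp
      also have "\<dots> \<le> (\<Sum>k\<in>{i..<j}. D * (?q k * scaled_best N f x ((1 / 2) ^ k)))"
        by (intro order_trans[OF sum_abs] sum_mono step)
      also have "\<dots> \<le> (\<Sum>k\<in>{i..<j}. D * (?q i * scaled_best N f x ((1 / 2) ^ k)))"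
        using D by (intro sum_mono mult_left_mono mult_right_mono power_mono power_decreasing) (auto simp: scaled_best_nonneg)
      also have "\<dots> = D * ?q i * (\<Sum>k\<in>{i..<j}. scaled_best N f x ((1 / 2) ^ k))"
        by (simp add: sum_distrib_left mult.assoc)
      also have "\<dots> \<le> D * ?q i * K" using D by (intro mult_left_mono seg) auto
      finally show ?thesis by (simp add: m_def mult_ac)
    qed
    have "summable (\<lambda>i. m (small_scale (Suc i)) - m (small_scale i))"
    proof (rule summable_comparison_test'[of "\<lambda>i. D * scaled_best N f x ((1 / 2) ^ i)" 0])
      show "summable (\<lambda>i. D * scaled_best N f x ((1 / 2) ^ i))"
        by (intro summable_mult summable_osc_small[OF so])
      fix i
      have "?q i \<le> 1" by (intro power_le_one) (auto intro: power_le_one)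
      then have "D * (?q i * scaled_best N f x ((1 / 2) ^ i)) \<le> D * (1 * scaled_best N f x ((1 / 2) ^ i))"
        using D by (intro mult_left_mono mult_right_mono) (auto simp: scaled_best_nonneg)
      then show "norm (m (small_scale (Suc i)) - m (small_scale i)) \<le> D * scaled_best N f x ((1 / 2) ^ i)"
        using step[of i] by simp
    qed
    then have "convergent (\<lambda>k. \<Sum>i<k. m (small_scale (Suc i)) - m (small_scale i))"
      by (simp add: summable_iff_convergent)
    then have "convergent (\<lambda>k. m (small_scale k) - m (small_scale 0))"
      unfolding sum_lessThan_telescope[of "\<lambda>i. m (small_scale i)"] .
    then have "convergent (\<lambda>k. m (small_scale k) - m (small_scale 0) + m (small_scale 0))"
      by (intro convergent_add convergent_const)
    then show "convergent (\<lambda>i. conv (reg f) (mderiv \<alpha> (rescale \<Phi> (small_scale i))) x)"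
      by (simp add: m_def)
    have "\<bar>m (small_scale 0) - m (1 / 2)\<bar> \<le> C / (1 / 4) ^ ?k * best_L1 N f x 1"
      unfolding m_def by (rule C(2)) (simp add: f small_scale_def cball_subset_ball_iff)
    also have "\<dots> \<le> D * K"
    proof (rule mult_mono)
      show "C / (1 / 4) ^ ?k \<le> D"
        unfolding D_def using C(1) by (simp add: power_one_over power_mono)
      show "best_L1 N f x 1 \<le> K" using seg[of 0 1] by (simp add: scaled_best_def)
    qed (use D in \<open>auto simp: best_L1_nonneg\<close>)
    finally show "\<bar>conv (reg f) (mderiv \<alpha> (rescale \<Phi> (small_scale 0))) x - conv (reg f) (mderiv \<alpha> (rescale \<Phi> (1 / 2))) x\<bar> \<le> D * K"
      by (simp add: m_def)
  qed
qed

section \<open>The fundamental lemma of the calculus of variations\<close>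

text \<open>A product of complete measures is not complete, so Fubini's theorem is applied to Borel
  representatives.\<close>

lemma Lp_loc_1_borel_version:
  assumes "f \<in> Lp_loc 1"
  shows "\<exists>f'. f' \<in> borel_measurable borel \<and> (AE x in lebesgue. f x = f' x) \<and> f' \<in> Lp_loc 1"
proof -
  have fm: "f \<in> borel_measurable lebesgue" by (rule Lp_loc_measurable[OF assms])
  then obtain f' where f': "f' \<in> borel_measurable lborel" "AE x in lborel. f x = f' x"
    using completion_ex_borel_measurable_real[of f lborel] by blast
  have ae: "AE x in lebesgue. f x = f' x" by (rule AE_completion[OF f'(2)])
  have fm': "f' \<in> borel_measurable lebesgue" using f'(1) by (simp add: measurable_completion)
  have "f' \<in> Lp_loc 1"
  proof (rule Lp_loc_1I[OF fm'])
    fix R :: real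
    have "integrable lebesgue (\<lambda>x. indicator (cball 0 R) x * f x)" by (rule Lp_loc_1_integrable_cball[OF assms])
    moreover have "(\<lambda>x. indicator (cball 0 R) x * f' x) \<in> borel_measurable lebesgue"
      by (intro borel_measurable_times borel_measurable_indicator fm') (auto simp: lmeasurable_cball[THEN fmeasurableD])
    ultimately show "integrable lebesgue (\<lambda>x. indicator (cball 0 R) x * f' x)"
      by (rule Bochner_Integration.integrable_cong_AE_imp) (use ae in \<open>eventually_elim, simp\<close>)
  qed
  with ae f'(1) show ?thesis by auto
qed

lemma integral_mult_cong_AE:
  assumes "AE x in lebesgue. f x = (g x :: real)" "f \<in> borel_measurable lebesgue" "g \<in> borel_measurable lebesgue"
    "\<psi> \<in> borel_measurable lebesgue"
  shows "(LINT x|lebesgue. f x * \<psi> x) = (LINT x|lebesgue. g x * \<psi> x)"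
proof (rule integral_cong_AE)
  show "(\<lambda>x. f x * \<psi> x) \<in> borel_measurable lebesgue" "(\<lambda>x. g x * \<psi> x) \<in> borel_measurable lebesgue"
    using assms by measurable
  show "AE x in lebesgue. f x * \<psi> x = g x * \<psi> x" using assms(1) by eventually_elim simp
qed

lemma test_fun_measurable_lebesgue: "test_fun \<psi> \<Longrightarrow> \<psi> \<in> borel_measurable lebesgue"
  by (simp add: measurable_completion test_fun_borel)

lemma conv_cong_AE:
  assumes "AE x in lebesgue. f x = g x" "f \<in> Lp_loc 1" "g \<in> Lp_loc 1" "test_fun \<psi>"
  shows "conv (reg f) \<psi> x = conv (reg g) \<psi> x"
  unfolding conv_reg
  by (rule integral_mult_cong_AE[OF assms(1) Lp_loc_measurable[OF assms(2)] Lp_loc_measurable[OF assms(3)]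
        test_fun_measurable_lebesgue[OF test_fun_reflect[OF assms(4)]]])

lemma Fubini_conv:
  fixes f \<psi> \<eta> :: "real ^ 'n::finite \<Rightarrow> real"
  assumes f: "f \<in> Lp_loc 1" and \<psi>: "test_fun \<psi>" and \<eta>: "test_fun \<eta>"
  shows "(LINT x|lebesgue. conv (reg f) \<psi> x * \<eta> x) = (LINT y|lebesgue. f y * (LINT x|lebesgue. \<psi> (x - y) * \<eta> x))"
proof -
  obtain f' where f': "f' \<in> borel_measurable borel" "AE x in lebesgue. f x = f' x" "f' \<in> Lp_loc 1"
    using Lp_loc_1_borel_version[OF f] by blast
  note [measurable] = f'(1) test_fun_borel[OF \<psi>] test_fun_borel[OF \<eta>]
  have [measurable]: "cball (0 :: real ^ 'n) r \<in> sets borel" for r by simp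
  obtain R where R: "0 < R" "supp_cball 0 R \<psi>" using test_fun_supp[OF \<psi>] .
  obtain Q where Q: "0 < Q" "supp_cball 0 Q \<eta>" using test_fun_supp[OF \<eta>] .
  obtain C where C: "0 < C" "\<And>x. \<bar>\<psi> x\<bar> \<le> C" by (rule test_fun_bounded[OF \<psi>]) (rule that)
  obtain D where D: "0 < D" "\<And>x. \<bar>\<eta> x\<bar> \<le> D" by (rule test_fun_bounded[OF \<eta>]) (rule that)
  let ?g = "\<lambda>y. indicator (cball 0 (R + Q)) y * f' y"
  have "integrable lebesgue ?g" by (rule Lp_loc_1_integrable_cball[OF f'(3)])
  then have g: "integrable lborel ?g" by (subst (asm) integrable_completion) measurable
  have i: "integrable lborel (indicator (cball (0 :: real ^ 'n) Q) :: _ \<Rightarrow> real)"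
    using emeasure_lborel_cball_finite[of "0 :: real ^ 'n" Q] by (intro integrable_real_indicator) auto
  have dom: "integrable (lborel \<Otimes>\<^sub>M lborel) (\<lambda>(x :: real ^ 'n, y). indicator (cball 0 Q) x * (C * D * ?g y))"
  proof (rule lborel_pair.Fubini_integrable)
    show "(\<lambda>(x :: real ^ 'n, y). indicator (cball 0 Q) x * (C * D * ?g y)) \<in> borel_measurable (lborel \<Otimes>\<^sub>M lborel)" by measurable
    have eq: "(\<lambda>x. LBINT y. norm (case (x, y) of (x, y) \<Rightarrow> indicator (cball (0 :: real ^ 'n) Q) x * (C * D * ?g y))) =
       (\<lambda>x. indicator (cball 0 Q) x * (LBINT y. norm (C * D * ?g y)))"
      by (auto simp: abs_mult)
    show "integrable lborel (\<lambda>x. LBINT y. norm (case (x, y) of (x, y) \<Rightarrow> indicator (cball (0 :: real ^ 'n) Q) x * (C * D * ?g y)))"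
      unfolding eq by (intro integrable_mult_left i)
    show "AE x in lborel. integrable lborel (\<lambda>y. case (x, y) of (x, y) \<Rightarrow> indicator (cball (0 :: real ^ 'n) Q) x * (C * D * ?g y))"
      using g by simp
  qed
  have int: "integrable (lborel \<Otimes>\<^sub>M lborel) (\<lambda>(x, y). f' y * \<psi> (x - y) * \<eta> x)"
  proof (rule Bochner_Integration.integrable_bound[OF dom])
    show "(\<lambda>(x, y). f' y * \<psi> (x - y) * \<eta> x) \<in> borel_measurable (lborel \<Otimes>\<^sub>M lborel)" by measurable
    have "\<bar>f' y * \<psi> (x - y) * \<eta> x\<bar> \<le> \<bar>indicator (cball 0 Q) x * (C * D * ?g y)\<bar>" for x y
    proof (cases "norm x \<le> Q \<and> norm (x - y) \<le> R")
      case True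
      then have "norm y \<le> R + Q" using norm_triangle_ineq4[of x "x - y"] by simp
      have "\<bar>\<psi> (x - y)\<bar> * \<bar>\<eta> x\<bar> \<le> C * D" using C D by (intro mult_mono) auto
      then have "\<bar>f' y\<bar> * (\<bar>\<psi> (x - y)\<bar> * \<bar>\<eta> x\<bar>) \<le> \<bar>f' y\<bar> * (C * D)" by (rule mult_left_mono) simp
      then show ?thesis using True \<open>norm y \<le> R + Q\<close> C(1) D(1) by (simp add: abs_mult mult_ac)
    next
      case False
      then have "\<psi> (x - y) = 0 \<or> \<eta> x = 0" using supp_cballD[OF R(2), of "x - y"] supp_cballD[OF Q(2), of x] by auto
      then show ?thesis by auto
    qed
    then show "AE x in lborel \<Otimes>\<^sub>M lborel. norm (case x of (x, y) \<Rightarrow> f' y * \<psi> (x - y) * \<eta> x)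
       \<le> norm (case x of (x, y) \<Rightarrow> indicator (cball 0 Q) x * (C * D * ?g y))" by (auto simp: split_beta)
  qed
  have "(LINT x|lebesgue. conv (reg f) \<psi> x * \<eta> x) = (LINT x|lebesgue. (LINT y|lborel. f' y * \<psi> (x - y) * \<eta> x))"
  proof (intro Bochner_Integration.integral_cong refl)
    fix x
    have "conv (reg f) \<psi> x = (LINT y|lebesgue. f' y * \<psi> (x - y))"
      using conv_cong_AE[OF f'(2) f f'(3) \<psi>, of x] by (simp only: conv_reg)
    also have "\<dots> = (LINT y|lborel. f' y * \<psi> (x - y))" by (rule lebesgue_integral_lborel) measurable
    finally show "conv (reg f) \<psi> x * \<eta> x = (LINT y|lborel. f' y * \<psi> (x - y) * \<eta> x)" by simp
  qed
  also have "\<dots> = (LINT x|lborel. (LINT y|lborel. f' y * \<psi> (x - y) * \<eta> x))"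
    by (rule lebesgue_integral_lborel) measurable
  also have "\<dots> = (LINT y|lborel. (LINT x|lborel. f' y * \<psi> (x - y) * \<eta> x))"
    using lborel_pair.Fubini_integral[OF int] by simp
  also have "\<dots> = (LINT y|lborel. f' y * (LINT x|lebesgue. \<psi> (x - y) * \<eta> x))"
    by (simp add: lebesgue_integral_lborel mult.assoc)
  also have "\<dots> = (LINT y|lebesgue. f' y * (LINT x|lebesgue. \<psi> (x - y) * \<eta> x))"
    by (subst lebesgue_integral_lborel) (simp_all add: lebesgue_integral_lborel)
  also have "\<dots> = (LINT y|lebesgue. f y * (LINT x|lebesgue. \<psi> (x - y) * \<eta> x))"
  proof (rule integral_mult_cong_AE[symmetric, OF f'(2) Lp_loc_measurable[OF f] Lp_loc_measurable[OF f'(3)]])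
    have "(\<lambda>y. LINT x|lborel. \<psi> (x - y) * \<eta> x) \<in> borel_measurable borel" by measurable
    then show "(\<lambda>y. LINT x|lebesgue. \<psi> (x - y) * \<eta> x) \<in> borel_measurable lebesgue"
      by (simp add: lebesgue_integral_lborel measurable_completion)
  qed
  finally show ?thesis .
qed

lemma measure_cball_lebesgue:
  assumes "0 < R"
  shows "measure lebesgue (cball (x :: real ^ 'n::finite) R) = R ^ CARD('n) * measure lebesgue (ball (0 :: real ^ 'n) 1)"
  using content_cball[of R x] content_ball[of 1 "0 :: real ^ 'n"] assms by simp

lemma kernel_integral: "kernel N \<Phi> \<Longrightarrow> 0 < r \<Longrightarrow> (LINT x|lebesgue. rescale \<Phi> r x) = 1"
proof -
  assume \<Phi>: "kernel N \<Phi>" and r: "0 < r"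
  have "(LINT z|lebesgue. mpower z (\<lambda>i. 0) * \<Phi> z) = 1"
    using \<Phi> unfolding kernel_def by (metis msize_zero zero_le)
  then show ?thesis using moment_rescale[OF test_fun_smooth[OF kernel_test_fun[OF \<Phi>]] r, of "\<lambda>i. 0"] by simp
qed

lemma kernel_rescale_bound:
  fixes \<Phi> :: "real ^ 'n::finite \<Rightarrow> real"
  assumes "kernel N \<Phi>" shows "\<exists>C>0. \<forall>r>0. \<forall>y. \<bar>rescale \<Phi> r y\<bar> \<le> C / r ^ CARD('n)"
  using mderiv_rescale_bound[OF kernel_test_fun[OF assms], of "\<lambda>i. 0"] by simp

lemma integral_indicator_cball_le:
  fixes u :: "real ^ 'n::finite \<Rightarrow> real"
  assumes "u \<in> Lp_loc 1" "\<And>x. dist y x \<le> r \<Longrightarrow> \<bar>u x\<bar> \<le> c" "0 < r" "0 \<le> c"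
  shows "(LINT x|lebesgue. indicator (cball y r) x * \<bar>u x\<bar>) \<le> c * (r ^ CARD('n) * measure lebesgue (ball (0 :: real ^ 'n) 1))"
proof -
  have "(LINT x|lebesgue. indicator (cball y r) x * \<bar>u x\<bar>) \<le> (LINT x|lebesgue. indicator (cball y r) x * c)"
  proof (rule integral_mono)
    show "integrable lebesgue (\<lambda>x. indicator (cball y r) x * \<bar>u x\<bar>)"
      using integrable_abs[OF Lp_loc_1_integrable_cball[OF assms(1)]] by (simp add: abs_mult)
    show "integrable lebesgue (\<lambda>x. indicator (cball y r) x * c)"
      by (rule Lp_loc_1_integrable_cball[OF Lp_loc_1_continuous[of "\<lambda>_. c"]]) auto
  qed (use assms in \<open>auto simp: indicator_def\<close>)
  also have "\<dots> = c * measure lebesgue (cball y r)"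
    by (simp add: mult.commute)
  finally show ?thesis unfolding measure_cball_lebesgue[OF assms(3)] .
qed

text \<open>Mollifications converge weakly: the mollifier is moved to the test function, which it
  approximates uniformly.\<close>

lemma mollification_tendsto:
  fixes f \<Phi> \<psi> :: "real ^ 'n::finite \<Rightarrow> real"
  assumes f: "f \<in> Lp_loc 1" and \<Phi>: "kernel N \<Phi>" and \<psi>: "test_fun \<psi>"
  shows "(\<lambda>i. LINT x|lebesgue. conv (reg f) (rescale \<Phi> (small_scale i)) x * \<psi> x) \<longlonglongrightarrow> (LINT x|lebesgue. f x * \<psi> x)"
proof -
  obtain C where C: "0 < C" "\<And>r y. 0 < r \<Longrightarrow> \<bar>rescale \<Phi> r y\<bar> \<le> C / r ^ CARD('n)"
    using kernel_rescale_bound[OF \<Phi>] by metis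
  obtain R where R: "0 < R" "supp_cball 0 R \<psi>" using test_fun_supp[OF \<psi>] .
  obtain L where L: "0 < L" "\<And>z h. \<bar>\<psi> (z + h) - \<psi> z\<bar> \<le> L * norm h"
    by (rule test_fun_lipschitz[OF \<psi>]) (rule that)
  let ?w = "measure lebesgue (ball (0 :: real ^ 'n) 1)"
  let ?A = "LINT x|lebesgue. indicator (cball 0 (R + 1)) x * \<bar>f x\<bar>"
  have bound: "\<bar>(LINT x|lebesgue. conv (reg f) (rescale \<Phi> r) x * \<psi> x) - (LINT x|lebesgue. f x * \<psi> x)\<bar> \<le> r * (C * L * ?w * ?A)"
    if r: "0 < r" "r \<le> 1" for r
  proof -
    let ?\<Phi> = "rescale \<Phi> r"
    have t: "test_fun ?\<Phi>" and su: "supp_cball 0 r ?\<Phi>"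
      using \<Phi> r by (auto intro: kernel_test_fun_rescale kernel_supp_rescale)
    define \<psi>r where "\<psi>r y = (LINT x|lebesgue. ?\<Phi> (x - y) * \<psi> x)" for y
    have sh: "supp_cball y r (\<lambda>x. ?\<Phi> (x - y))" for y
      using su by (auto simp: supp_cball_def dist_norm norm_minus_commute)
    have sm: "smooth (\<lambda>x. ?\<Phi> (x - y))" for y
      using smooth_affine[OF test_fun_smooth[OF t], of "- y" 1] by simp
    have t': "test_fun (\<lambda>x. ?\<Phi> (x - y))" for y by (rule test_funI[OF sm sh])
    have diff: "\<bar>\<psi>r y - \<psi> y\<bar> \<le> r * (C * L * ?w)" for y
    proof -
      have "(LINT x|lebesgue. ?\<Phi> (x - y)) = 1"
        using lebesgue_integral_translation[OF test_fun_borel[OF t], of "- y"] kernel_integral[OF \<Phi> r(1)] by simp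
      then have "\<psi>r y - \<psi> y = (LINT x|lebesgue. (\<psi> x - \<psi> y) * ?\<Phi> (x - y))"
        unfolding \<psi>r_def left_diff_distrib
        using Lp_loc_1_integrable_test[OF smooth_Lp_loc_1[OF test_fun_smooth[OF \<psi>]] t'[of y]] test_fun_integrable[OF t'[of y]]
        by (subst Bochner_Integration.integral_diff) (auto simp: mult.commute)
      also have "\<bar>\<dots>\<bar> \<le> C / r ^ CARD('n) * (LINT x|lebesgue. indicator (cball y r) x * \<bar>\<psi> x - \<psi> y\<bar>)"
        by (intro integral_mult_bound sh C r Lp_loc_1_diff smooth_Lp_loc_1 smooth_const test_fun_smooth[OF \<psi>])
      also have "\<dots> \<le> C / r ^ CARD('n) * (L * r * (r ^ CARD('n) * ?w))"
      proof (intro mult_left_mono integral_indicator_cball_le Lp_loc_1_diff smooth_Lp_loc_1 smooth_const test_fun_smooth[OF \<psi>] r)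
        fix x assume "dist y x \<le> r"
        have "\<bar>\<psi> x - \<psi> y\<bar> \<le> L * norm (x - y)" using L(2)[of y "x - y"] by simp
        also have "\<dots> \<le> L * r" using \<open>dist y x \<le> r\<close> L(1) by (intro mult_left_mono) (auto simp: dist_norm norm_minus_commute)
        finally show "\<bar>\<psi> x - \<psi> y\<bar> \<le> L * r" .
      qed (use C L r in auto)
      also have "\<dots> = r * (C * L * ?w)" using r by simp
      finally show ?thesis .
    qed
    have su2: "supp_cball 0 (R + 1) (\<lambda>y. \<psi>r y - \<psi> y)"
      unfolding supp_cball_def
    proof (intro allI impI)
      fix y :: "real ^ 'n" assume y: "R + 1 < dist 0 y"
      have z: "?\<Phi> (x - y) * \<psi> x = 0" for x
      proof (cases "norm x \<le> R")
        case True
        then have "r < norm (x - y)" using y r norm_triangle_ineq2[of y x] by (simp add: norm_minus_commute)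
        then show ?thesis using supp_cballD[OF su, of "x - y"] by simp
      next
        case False then show ?thesis using supp_cballD[OF R(2), of x] by simp
      qed
      have "\<psi>r y = 0" unfolding \<psi>r_def z by simp
      then show "\<psi>r y - \<psi> y = 0" using supp_cballD[OF R(2), of y] y by simp
    qed
    have "\<psi>r \<in> borel_measurable borel"
      unfolding \<psi>r_def using test_fun_borel[OF t] test_fun_borel[OF \<psi>] by (simp add: lebesgue_integral_lborel)
    then have \<psi>m: "\<psi>r \<in> borel_measurable lebesgue" by (simp add: measurable_completion)
    have im: "(\<lambda>y. \<psi>r y - \<psi> y) \<in> borel_measurable lebesgue"
      using \<psi>m test_fun_measurable_lebesgue[OF \<psi>] by measurable
    have i1: "integrable lebesgue (\<lambda>y. f y * (\<psi>r y - \<psi> y))"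
      by (rule Lp_loc_1_integrable_mult[OF f im su2 diff])
    have i2: "integrable lebesgue (\<lambda>y. f y * \<psi> y)" by (rule Lp_loc_1_integrable_test[OF f \<psi>])
    have "(LINT x|lebesgue. conv (reg f) ?\<Phi> x * \<psi> x) - (LINT x|lebesgue. f x * \<psi> x) =
        (LINT y|lebesgue. f y * \<psi>r y) - (LINT x|lebesgue. f x * \<psi> x)"
      unfolding Fubini_conv[OF f t \<psi>] \<psi>r_def ..
    also have "(LINT y|lebesgue. f y * \<psi>r y) = (LINT y|lebesgue. f y * (\<psi>r y - \<psi> y) + f y * \<psi> y)"
      by (simp add: algebra_simps)
    also have "\<dots> = (LINT y|lebesgue. f y * (\<psi>r y - \<psi> y)) + (LINT y|lebesgue. f y * \<psi> y)"
      by (rule Bochner_Integration.integral_add[OF i1 i2])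
    finally have "\<bar>(LINT x|lebesgue. conv (reg f) ?\<Phi> x * \<psi> x) - (LINT x|lebesgue. f x * \<psi> x)\<bar> = \<bar>LINT y|lebesgue. f y * (\<psi>r y - \<psi> y)\<bar>"
      by simp
    also have "\<dots> \<le> r * (C * L * ?w) * ?A" by (rule integral_mult_bound[OF f su2 diff])
    finally show ?thesis by (simp add: mult_ac)
  qed
  have "(\<lambda>i. (LINT x|lebesgue. conv (reg f) (rescale \<Phi> (small_scale i)) x * \<psi> x) - (LINT x|lebesgue. f x * \<psi> x)) \<longlonglongrightarrow> 0"
  proof (rule Lim_null_comparison)
    show "(\<lambda>i. small_scale i * (C * L * ?w * ?A)) \<longlonglongrightarrow> 0"
      using tendsto_mult_right[OF small_scale_lim, of "C * L * ?w * ?A"] by simp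
    have "small_scale i \<le> 1" for i using small_scale_le[of i] by simp
    then show "\<forall>\<^sub>F i in sequentially. norm ((LINT x|lebesgue. conv (reg f) (rescale \<Phi> (small_scale i)) x * \<psi> x) - (LINT x|lebesgue. f x * \<psi> x))
        \<le> small_scale i * (C * L * ?w * ?A)"
      using bound[OF small_scale_pos] by simp
  qed
  then show ?thesis by (rule LIM_zero_cancel)
qed

text \<open>The indicator of a box is the almost everywhere limit of its own mollifications, which are uniformly
  bounded test functions.\<close>

lemma integral_box_eq_0:
  fixes h \<Phi> :: "real ^ 'n::finite \<Rightarrow> real"
  assumes h: "h \<in> Lp_loc 1" and 0: "\<And>\<psi>. test_fun \<psi> \<Longrightarrow> (LINT x|lebesgue. h x * \<psi> x) = 0"
    and \<Phi>: "kernel N \<Phi>"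
  shows "(LINT x|lebesgue. h x * indicator (box a b) x) = 0"
proof -
  let ?I = "indicator (box a b) :: real ^ 'n \<Rightarrow> real"
  define \<theta> where "\<theta> i = conv (reg ?I) (rescale \<Phi> (small_scale i))" for i
  obtain C where C: "0 < C" "\<And>r y. 0 < r \<Longrightarrow> \<bar>rescale \<Phi> r y\<bar> \<le> C / r ^ CARD('n)"
    using kernel_rescale_bound[OF \<Phi>] by metis
  obtain R where R: "0 < R" "box a b \<subseteq> cball 0 R"
    using bounded_box[of a b] by (metis bounded_subset_ballD ball_subset_cball subset_trans)
  have Im: "?I \<in> borel_measurable lebesgue" by (simp add: borel_measurable_indicator measurable_completion)
  have I: "?I \<in> Lp_loc 1"
  proof (rule Lp_loc_1I[OF Im])
    fix r :: real
    have "integrable lebesgue (\<lambda>x :: real ^ 'n. indicator (cball 0 r) x * (1 :: real))"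
      by (rule Lp_loc_1_integrable_cball[OF Lp_loc_1_continuous[of "\<lambda>_. 1"]]) auto
    then show "integrable lebesgue (\<lambda>x. indicator (cball 0 r) x * ?I x)"
      by (rule Bochner_Integration.integrable_bound)
         (auto simp: indicator_def intro!: borel_measurable_times Im[unfolded indicator_def] measurable_completion)
  qed
  have t: "test_fun (rescale \<Phi> (small_scale i))" and su: "supp_cball 0 (small_scale i) (rescale \<Phi> (small_scale i))" for i
    using \<Phi> small_scale_pos by (auto intro: kernel_test_fun_rescale kernel_supp_rescale)
  have \<theta>s: "supp_cball 0 (R + 1) (\<theta> i)" for i
    unfolding supp_cball_def
  proof (intro allI impI)
    fix x :: "real ^ 'n" assume x: "R + 1 < dist 0 x"
    have z: "?I y * rescale \<Phi> (small_scale i) (x - y) = 0" for y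
    proof (cases "y \<in> box a b")
      case True
      then have "norm y \<le> R" using R by auto
      then have "small_scale i < norm (x - y)" using x small_scale_le[of i] norm_triangle_ineq2[of x y] by simp
      then show ?thesis using supp_cballD[OF su, of i "x - y"] by simp
    qed simp
    show "\<theta> i x = 0" unfolding \<theta>_def conv_reg z by simp
  qed
  have \<theta>t: "test_fun (\<theta> i)" for i
    unfolding \<theta>_def by (rule test_funI[OF smooth_conv[OF I t] \<theta>s[unfolded \<theta>_def]])
  let ?w = "measure lebesgue (ball (0 :: real ^ 'n) 1)"
  have \<theta>b: "\<bar>\<theta> i x\<bar> \<le> C * ?w" for i x
  proof -
    have "\<bar>\<theta> i x\<bar> \<le> C / small_scale i ^ CARD('n) * (LINT y|lebesgue. indicator (cball x (small_scale i)) y * \<bar>?I y\<bar>)"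
      unfolding \<theta>_def conv_reg
    proof (rule integral_mult_bound[OF I])
      show "supp_cball x (small_scale i) (\<lambda>y. rescale \<Phi> (small_scale i) (x - y))"
        using supp_cball_reflect[OF su, of x] by simp
    qed (rule C(2)[OF small_scale_pos])
    also have "\<dots> \<le> C / small_scale i ^ CARD('n) * (1 * (small_scale i ^ CARD('n) * ?w))"
      using small_scale_pos[of i] C(1) by (intro mult_left_mono integral_indicator_cball_le I) (auto simp: indicator_def)
    also have "\<dots> = C * ?w" using small_scale_pos[of i] by simp
    finally show ?thesis .
  qed
  have lim1: "(\<lambda>i. \<theta> i x) \<longlonglongrightarrow> 1" if x: "x \<in> box a b" for x
  proof -
    obtain e where e: "0 < e" "ball x e \<subseteq> box a b" using x open_box open_contains_ball by blast
    have "\<forall>\<^sub>F i in sequentially. small_scale i < e" by (rule order_tendstoD(2)[OF small_scale_lim e(1)])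
    then have "\<forall>\<^sub>F i in sequentially. \<theta> i x = 1"
    proof eventually_elim
      case (elim i)
      have z: "?I y * rescale \<Phi> (small_scale i) (x - y) = rescale \<Phi> (small_scale i) (x - y)" for y
      proof (cases "y \<in> box a b")
        case False
        then have "\<not> norm (x - y) < e" using e(2) by (auto simp: dist_norm subset_iff)
        then have "small_scale i < norm (x - y)" using elim by simp
        then show ?thesis using supp_cballD[OF su, of i "x - y"] by simp
      qed simp
      have "\<theta> i x = (LINT y|lebesgue. rescale \<Phi> (small_scale i) (x - y))"
        unfolding \<theta>_def conv_reg z ..
      also have "\<dots> = 1"
        using lebesgue_integral_reflect[OF test_fun_borel[OF t], of i x] kernel_integral[OF \<Phi> small_scale_pos, of i] by simp
      finally show ?case .
    qed
    then show ?thesis by (rule tendsto_eventually)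
  qed
  have lim0: "(\<lambda>i. \<theta> i x) \<longlonglongrightarrow> 0" if x: "x \<notin> cbox a b" for x
  proof -
    obtain e where e: "0 < e" "ball x e \<subseteq> - cbox a b"
      by (rule openE[of "- cbox a b" x]) (use x in \<open>auto simp: open_Compl closed_cbox\<close>)
    have "\<forall>\<^sub>F i in sequentially. small_scale i < e" by (rule order_tendstoD(2)[OF small_scale_lim e(1)])
    then have "\<forall>\<^sub>F i in sequentially. \<theta> i x = 0"
    proof eventually_elim
      case (elim i)
      have z: "?I y * rescale \<Phi> (small_scale i) (x - y) = 0" for y
      proof (cases "y \<in> box a b")
        case True
        then have "y \<in> cbox a b" using box_subset_cbox by blast
        then have "\<not> norm (x - y) < e" using e(2) by (auto simp: dist_norm subset_iff)
        then have "small_scale i < norm (x - y)" using elim by simp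
        then show ?thesis using supp_cballD[OF su, of i "x - y"] by simp
      qed simp
      show ?case unfolding \<theta>_def conv_reg z by simp
    qed
    then show ?thesis by (rule tendsto_eventually)
  qed
  have "(\<lambda>i. LINT x|lebesgue. h x * \<theta> i x) \<longlonglongrightarrow> (LINT x|lebesgue. h x * ?I x)"
  proof (rule integral_dominated_convergence[where w = "\<lambda>x. C * ?w * \<bar>indicator (cball 0 (R + 1)) x * h x\<bar>"])
    have hm: "h \<in> borel_measurable lebesgue" by (rule Lp_loc_measurable[OF h])
    show "(\<lambda>x. h x * ?I x) \<in> borel_measurable lebesgue" by (intro borel_measurable_times hm Im)
    show "(\<lambda>x. h x * \<theta> i x) \<in> borel_measurable lebesgue" for i
      by (intro borel_measurable_times hm test_fun_measurable_lebesgue \<theta>t)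
    show "integrable lebesgue (\<lambda>x. C * ?w * \<bar>indicator (cball 0 (R + 1)) x * h x\<bar>)"
      by (intro integrable_mult_right integrable_abs Lp_loc_1_integrable_cball h)
    have "negligible (cbox a b - box a b)" by (rule negligible_frontier_interval)
    then have "AE x in lebesgue. x \<notin> cbox a b - box a b"
      by (intro AE_not_in) (simp add: negligible_iff_null_sets)
    then show "AE x in lebesgue. (\<lambda>i. h x * \<theta> i x) \<longlonglongrightarrow> h x * ?I x"
    proof eventually_elim
      case (elim x)
      then have "(\<lambda>i. \<theta> i x) \<longlonglongrightarrow> ?I x"
        using lim0[of x] lim1[of x] box_subset_cbox[of a b] by (cases "x \<in> box a b") auto
      then show ?case by (intro tendsto_mult tendsto_const)
    qed
    have "\<bar>h x * \<theta> i x\<bar> \<le> C * ?w * \<bar>indicator (cball 0 (R + 1)) x * h x\<bar>" for i x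
    proof (cases "x \<in> cball 0 (R + 1)")
      case True
      then show ?thesis using \<theta>b[of i x] by (simp add: abs_mult mult.commute[of "\<bar>h x\<bar>"] mult_right_mono)
    next
      case False then show ?thesis using supp_cballD[OF \<theta>s, of x i] by simp
    qed
    then show "AE x in lebesgue. norm (h x * \<theta> i x) \<le> C * ?w * \<bar>indicator (cball 0 (R + 1)) x * h x\<bar>" for i by simp
  qed
  then show ?thesis using 0[OF \<theta>t] by (simp add: LIMSEQ_const_iff)
qed

text \<open>The positive and the negative part of \<open>h\<close> have the same integral over every box. Boxes generate the
  Borel sets, so the two parts are densities of the same measure.\<close>

lemma fundamental_lemma_variations:
  fixes h \<Phi> :: "real ^ 'n::finite \<Rightarrow> real"
  assumes h: "h \<in> Lp_loc 1" and 0: "\<And>\<psi>. test_fun \<psi> \<Longrightarrow> (LINT x|lebesgue. h x * \<psi> x) = 0"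
    and \<Phi>: "kernel N \<Phi>"
  shows "AE x in lebesgue. h x = 0"
proof -
  obtain h' where h': "h' \<in> borel_measurable borel" "AE x in lebesgue. h x = h' x" "h' \<in> Lp_loc 1"
    using Lp_loc_1_borel_version[OF h] by blast
  note [measurable] = h'(1)
  have box: "integrable lborel (\<lambda>x. h' x * indicator (box a b) x)" "(LINT x|lborel. h' x * indicator (box a b) x) = 0" for a b
  proof -
    have Im: "(indicator (box a b) :: _ \<Rightarrow> real) \<in> borel_measurable lebesgue" by (simp add: borel_measurable_indicator measurable_completion)
    obtain R where R: "box a b \<subseteq> cball 0 R"
      using bounded_box[of a b] by (metis bounded_subset_ballD ball_subset_cball subset_trans)
    have "supp_cball 0 R (indicator (box a b) :: _ \<Rightarrow> real)" using R by (auto simp: supp_cball_def indicator_def)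
    then have "integrable lebesgue (\<lambda>x. h' x * indicator (box a b) x)"
      by (rule Lp_loc_1_integrable_mult[OF h'(3) Im, of 0 R 1]) (auto simp: indicator_def)
    then show "integrable lborel (\<lambda>x. h' x * indicator (box a b) x)" by (subst (asm) integrable_completion) measurable
    have "(LINT x|lborel. h' x * indicator (box a b) x) = (LINT x|lebesgue. h' x * indicator (box a b) x)"
      by (rule lebesgue_integral_lborel[symmetric]) measurable
    also have "\<dots> = (LINT x|lebesgue. h x * indicator (box a b) x)"
      by (rule integral_mult_cong_AE[symmetric, OF h'(2) Lp_loc_measurable[OF h] Lp_loc_measurable[OF h'(3)] Im])
    also have "\<dots> = 0" by (rule integral_box_eq_0[OF h 0 \<Phi>])
    finally show "(LINT x|lborel. h' x * indicator (box a b) x) = 0" .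
  qed
  have eqI: "A = B" if "A \<noteq> \<infinity>" "B \<noteq> \<infinity>" "enn2real A = enn2real B" for A B :: ennreal
    using that by (metis ennreal_enn2real infinity_ennreal_def less_top)
  let ?p = "\<lambda>x. ennreal (h' x)" and ?m = "\<lambda>x. ennreal (- h' x)"
  have part: "(\<integral>\<^sup>+x. ?p x * indicator (box a b) x \<partial>lborel) = (\<integral>\<^sup>+x. ?m x * indicator (box a b) x \<partial>lborel)"
    "(\<integral>\<^sup>+x. ?p x * indicator (box a b) x \<partial>lborel) \<noteq> \<infinity>" for a b
  proof -
    have e: "(\<integral>\<^sup>+x. ?p x * indicator (box a b) x \<partial>lborel) = (\<integral>\<^sup>+x. ennreal (h' x * indicator (box a b) x) \<partial>lborel)"
      "(\<integral>\<^sup>+x. ?m x * indicator (box a b) x \<partial>lborel) = (\<integral>\<^sup>+x. ennreal (- (h' x * indicator (box a b) x)) \<partial>lborel)"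
      by (auto intro!: nn_integral_cong simp: indicator_def)
    have f: "(\<integral>\<^sup>+x. ennreal (h' x * indicator (box a b) x) \<partial>lborel) \<noteq> \<infinity>"
       "(\<integral>\<^sup>+x. ennreal (- (h' x * indicator (box a b) x)) \<partial>lborel) \<noteq> \<infinity>"
      using box(1)[of a b] unfolding real_integrable_def by auto
    then show "(\<integral>\<^sup>+x. ?p x * indicator (box a b) x \<partial>lborel) \<noteq> \<infinity>" by (simp only: e not_False_eq_True)
    have "enn2real (\<integral>\<^sup>+x. ennreal (h' x * indicator (box a b) x) \<partial>lborel) = enn2real (\<integral>\<^sup>+x. ennreal (- (h' x * indicator (box a b) x)) \<partial>lborel)"
      using box(2)[of a b] real_lebesgue_integral_def[OF box(1)[of a b]] by simp
    then show "(\<integral>\<^sup>+x. ?p x * indicator (box a b) x \<partial>lborel) = (\<integral>\<^sup>+x. ?m x * indicator (box a b) x \<partial>lborel)"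
      unfolding e by (rule eqI[OF f])
  qed
  have "density lborel ?p = density lborel ?m"
  proof (rule measure_eqI_generator_eq[where E = "range (\<lambda>(a, b). box a b)" and \<Omega> = UNIV and A = "\<lambda>k. box (- real k *\<^sub>R One) (real k *\<^sub>R One)"])
    show "Int_stable (range (\<lambda>(a, b). box a b :: (real ^ 'n) set))" by (auto simp: Int_stable_def box_Int_box)
    show "emeasure (density lborel ?p) X = emeasure (density lborel ?m) X" if "X \<in> range (\<lambda>(a, b). box a b)" for X
      using that part(1) by (auto simp: emeasure_density)
    show "sets (density lborel ?p) = sigma_sets UNIV (range (\<lambda>(a, b). box a b))"
         "sets (density lborel ?m) = sigma_sets UNIV (range (\<lambda>(a, b). box a b))"
      by (simp_all add: borel_eq_box)
    show "emeasure (density lborel ?p) (box (- real k *\<^sub>R One) (real k *\<^sub>R One)) \<noteq> \<infinity>" for k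
      using part(2) by (simp add: emeasure_density)
    show "(\<Union>k. box (- real k *\<^sub>R One) (real k *\<^sub>R One)) = (UNIV :: (real ^ 'n) set)"
      using UN_box_eq_UNIV by simp
  qed auto
  then have "AE x in lborel. ?p x = ?m x" by (intro sigma_finite_measure.density_unique[OF sigma_finite_lborel]) auto
  then have "AE x in lborel. h' x = 0"
    by eventually_elim (metis ennreal_eq_0_iff ennreal_inj linear neg_0_le_iff_le neg_equal_zero neg_le_0_iff_le)
  then have "AE x in lebesgue. h' x = 0" by (rule AE_completion)
  with h'(2) show ?thesis by eventually_elim simp
qed

lemma has_wderiv_unique:
  fixes f \<Phi> :: "real ^ 'n::finite \<Rightarrow> real"
  assumes \<Phi>: "kernel N \<Phi>" and h: "has_wderiv \<alpha> f h" and h': "has_wderiv \<alpha> f h'"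
  shows "AE x in lebesgue. h x = h' x"
proof -
  have L: "h \<in> Lp_loc 1" "h' \<in> Lp_loc 1" using h h' by (auto simp: has_wderiv_def)
  have "AE x in lebesgue. h x - h' x = 0"
  proof (rule fundamental_lemma_variations[OF Lp_loc_1_diff[OF L] _ \<Phi>])
    fix \<psi> :: "real ^ 'n \<Rightarrow> real" assume \<psi>: "test_fun \<psi>"
    have "(-1 :: real) ^ msize \<alpha> * (LINT x|lebesgue. h x * \<psi> x) = (-1) ^ msize \<alpha> * (LINT x|lebesgue. h' x * \<psi> x)"
      using h h' \<psi> by (simp add: has_wderiv_def)
    then show "(LINT x|lebesgue. (h x - h' x) * \<psi> x) = 0"
      unfolding left_diff_distrib using L \<psi> by (simp add: Lp_loc_1_integrable_test)
  qed
  then show ?thesis by eventually_elim simp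
qed

lemma has_wderiv_wderiv: "has_wderiv \<alpha> f h \<Longrightarrow> has_wderiv \<alpha> f (wderiv \<alpha> f)"
  unfolding wderiv_def by (rule someI[of "\<lambda>h. has_wderiv \<alpha> f h"])

section \<open>Regularity\<close>

definition mollified :: "(real ^ 'n::finite \<Rightarrow> real) \<Rightarrow> (real ^ 'n \<Rightarrow> real) \<Rightarrow> 'n mindex \<Rightarrow> nat \<Rightarrow> real ^ 'n \<Rightarrow> real" where
  "mollified \<Phi> f \<alpha> i = conv (reg f) (mderiv \<alpha> (rescale \<Phi> (small_scale i)))"

definition mollified_lim :: "(real ^ 'n::finite \<Rightarrow> real) \<Rightarrow> (real ^ 'n \<Rightarrow> real) \<Rightarrow> 'n mindex \<Rightarrow> real ^ 'n \<Rightarrow> real" where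
  "mollified_lim \<Phi> f \<alpha> x = lim (\<lambda>i. mollified \<Phi> f \<alpha> i x)"

text \<open>At scale \<open>1/2\<close> a mollified derivative of order \<open>N\<close> is close to its limit at large scales, which is the
  same at all points and can be estimated at the origin; this makes the top order bound uniform. The
  lower derivatives may grow, and are estimated at the origin only.\<close>

lemma mollified_bounds_fixed:
  fixes \<Phi> :: "real ^ 'n::finite \<Rightarrow> real"
  assumes \<Phi>: "kernel N \<Phi>" and \<alpha>: "msize \<alpha> \<le> N"
  shows "\<exists>C>0. \<forall>f K. summable_osc N K f \<longrightarrow>
    (\<forall>x. (\<lambda>i. mollified \<Phi> f \<alpha> i x) \<longlonglongrightarrow> mollified_lim \<Phi> f \<alpha> x) \<and>
    (\<forall>x i j. i \<le> j \<longrightarrow> \<bar>mollified \<Phi> f \<alpha> j x - mollified \<Phi> f \<alpha> i x\<bar> \<le> C * K * ((1 / 2) ^ i) ^ (N - msize \<alpha>)) \<and>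
    (\<forall>i. \<bar>mollified \<Phi> f \<alpha> i 0\<bar> \<le> C * (K + L1dist_ball f (\<lambda>x. 0) 0 1)) \<and>
    (msize \<alpha> = N \<longrightarrow> (\<forall>i x. \<bar>mollified \<Phi> f \<alpha> i x\<bar> \<le> C * (K + L1dist_ball f (\<lambda>x. 0) 0 1)))"
proof -
  let ?m = "\<lambda>f r x. conv (reg f) (mderiv \<alpha> (rescale \<Phi> r)) x"
  let ?A = "\<lambda>f. L1dist_ball f (\<lambda>x. 0) 0 1"
  obtain C where C: "0 < C" "\<And>f K x. summable_osc N K f \<Longrightarrow> convergent (\<lambda>i. ?m f (small_scale i) x)"
     "\<And>f K x i j. summable_osc N K f \<Longrightarrow> i \<le> j \<Longrightarrow> \<bar>?m f (small_scale j) x - ?m f (small_scale i) x\<bar> \<le> C * K * ((1 / 2) ^ i) ^ (N - msize \<alpha>)"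
     "\<And>f K x. summable_osc N K f \<Longrightarrow> \<bar>?m f (small_scale 0) x - ?m f (1 / 2) x\<bar> \<le> C * K"
    using mollified_small_scale[OF \<Phi> \<alpha>] by blast
  obtain C0 where C0: "0 < C0" "\<And>f N' P r x z R. f \<in> Lp_loc 1 \<and> P \<in> polys N' \<and> N' \<le> N + msize \<alpha> \<and> 0 < r \<and> cball x r \<subseteq> ball z R \<Longrightarrow>
    \<bar>?m f r x - mderiv \<alpha> P x\<bar> \<le> C0 / r ^ (CARD('n) + msize \<alpha>) * L1dist_ball f P z R"
    using mollified_derivative_near_poly[OF \<Phi>, of \<alpha>] by metis
  have "\<exists>C1>0. \<forall>f K. msize \<alpha> = N \<and> summable_osc N K f \<longrightarrow> (\<forall>x. \<bar>?m f (1 / 2) x\<bar> \<le> C1 * (K + ?A f))"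
  proof (cases "msize \<alpha> = N")
    case True
    obtain C2 where C2: "0 < C2" "\<And>f K. summable_osc N K f \<Longrightarrow> (\<exists>a. \<bar>a\<bar> \<le> C2 * (K + ?A f) \<and> (\<forall>x. \<bar>?m f (1/2) x - a\<bar> \<le> C2 * K))"
      using mollified_large_scale[OF \<Phi> True] by blast
    show ?thesis
    proof (intro exI[of _ "2 * C2"] conjI allI impI)
      fix f :: "real ^ 'n \<Rightarrow> real" and K x assume "msize \<alpha> = N \<and> summable_osc N K f"
      then have so: "summable_osc N K f" by simp
      obtain a where "\<bar>a\<bar> \<le> C2 * (K + ?A f)" "\<bar>?m f (1/2) x - a\<bar> \<le> C2 * K" using C2(2)[OF so] by blast
      moreover have "0 \<le> C2 * ?A f" using C2(1) by (simp add: L1dist_ball_nonneg)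
      ultimately show "\<bar>?m f (1/2) x\<bar> \<le> 2 * C2 * (K + ?A f)" by (simp add: distrib_left)
    qed (use C2 in simp)
  next
    case False then show ?thesis by (intro exI[of _ 1]) simp
  qed
  then obtain C1 where C1: "0 < C1" "\<And>f K x. msize \<alpha> = N \<Longrightarrow> summable_osc N K f \<Longrightarrow> \<bar>?m f (1 / 2) x\<bar> \<le> C1 * (K + ?A f)"
    by blast
  define D where "D = 2 * C + C0 * 2 ^ (CARD('n) + msize \<alpha>) + C1"
  have D: "0 < D" "2 * C \<le> D" using C(1) C0(1) C1(1) by (auto simp: D_def add_pos_pos)
  show ?thesis
  proof (intro exI[of _ D] conjI D(1) allI impI)
    fix f :: "real ^ 'n \<Rightarrow> real" and K assume so: "summable_osc N K f"
    note f = summable_osc_Lp_loc[OF so] and K = summable_osc_nonneg[OF so]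
    have A: "0 \<le> ?A f" by (rule L1dist_ball_nonneg)
    show "(\<lambda>i. mollified \<Phi> f \<alpha> i x) \<longlonglongrightarrow> mollified_lim \<Phi> f \<alpha> x" for x
      using C(2)[OF so] unfolding mollified_lim_def mollified_def by (simp add: convergent_LIMSEQ_iff)
    show "\<bar>mollified \<Phi> f \<alpha> j x - mollified \<Phi> f \<alpha> i x\<bar> \<le> D * K * ((1 / 2) ^ i) ^ (N - msize \<alpha>)" if "i \<le> j" for x i j
    proof -
      have "C * K * ((1 / 2) ^ i) ^ (N - msize \<alpha>) \<le> D * K * ((1 / 2) ^ i) ^ (N - msize \<alpha>)"
        using D(2) C(1) K by (intro mult_right_mono) auto
      then show ?thesis using C(3)[OF so that, of x] by (simp add: mollified_def)
    qed
    have half: "\<bar>mollified \<Phi> f \<alpha> i x - ?m f (1 / 2) x\<bar> \<le> 2 * C * K" for i x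
    proof -
      have "((1 / 2 :: real) ^ 0) ^ (N - msize \<alpha>) = 1" by simp
      then have "\<bar>?m f (small_scale i) x - ?m f (small_scale 0) x\<bar> \<le> C * K"
        using C(3)[OF so le0, of i x] by (simp only: mult_1_right)
      then show ?thesis using C(4)[OF so, of x] unfolding mollified_def by linarith
    qed
    have z: "mderiv \<alpha> (\<lambda>x. 0) = (\<lambda>x. 0)" using mderiv_cmult[of "\<lambda>x. 0" \<alpha> 0] by simp
    show "\<bar>mollified \<Phi> f \<alpha> i 0\<bar> \<le> D * (K + ?A f)" for i
    proof -
      have "\<bar>?m f (1/2) 0 - mderiv \<alpha> (\<lambda>x. 0) 0\<bar> \<le> C0 / (1/2) ^ (CARD('n) + msize \<alpha>) * ?A f"
        by (rule C0(2)[of f "\<lambda>x. 0" N]) (simp add: f polys_const cball_subset_ball_iff)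
      then have "\<bar>?m f (1/2) 0\<bar> \<le> C0 * 2 ^ (CARD('n) + msize \<alpha>) * ?A f" by (simp add: z power_one_over)
      then have "\<bar>mollified \<Phi> f \<alpha> i 0\<bar> \<le> 2 * C * K + C0 * 2 ^ (CARD('n) + msize \<alpha>) * ?A f" using half[of i 0] by linarith
      also have "\<dots> \<le> D * K + D * ?A f"
        using C(1) C0(1) C1(1) K A by (intro add_mono mult_right_mono) (auto simp: D_def)
      finally show ?thesis by (simp add: distrib_left)
    qed
    show "\<bar>mollified \<Phi> f \<alpha> i x\<bar> \<le> D * (K + ?A f)" if N: "msize \<alpha> = N" for i x
    proof -
      have "\<bar>mollified \<Phi> f \<alpha> i x\<bar> \<le> 2 * C * K + C1 * (K + ?A f)" using half[of i x] C1(2)[OF N so, of x] by linarith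
      also have "\<dots> \<le> 2 * C * (K + ?A f) + C1 * (K + ?A f)" using C(1) C1(1) A by (intro add_mono mult_left_mono) auto
      also have "\<dots> = (2 * C + C1) * (K + ?A f)" by (simp add: distrib_right)
      also have "\<dots> \<le> D * (K + ?A f)" using C0(1) K A by (intro mult_right_mono) (auto simp: D_def)
      finally show ?thesis .
    qed
  qed
qed

text \<open>One constant serves the finitely many multi-indices of size at most \<open>N\<close>.\<close>

lemma mollified_bounds:
  fixes \<Phi> :: "real ^ 'n::finite \<Rightarrow> real"
  assumes \<Phi>: "kernel N \<Phi>"
  obtains C where "0 < C"
    "\<And>f K \<alpha> x. summable_osc N K f \<Longrightarrow> msize \<alpha> \<le> N \<Longrightarrow> (\<lambda>i. mollified \<Phi> f \<alpha> i x) \<longlonglongrightarrow> mollified_lim \<Phi> f \<alpha> x"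
    "\<And>f K \<alpha> x i j. summable_osc N K f \<Longrightarrow> msize \<alpha> \<le> N \<Longrightarrow> i \<le> j \<Longrightarrow>
       \<bar>mollified \<Phi> f \<alpha> j x - mollified \<Phi> f \<alpha> i x\<bar> \<le> C * K * ((1 / 2) ^ i) ^ (N - msize \<alpha>)"
    "\<And>f K \<alpha> i. summable_osc N K f \<Longrightarrow> msize \<alpha> \<le> N \<Longrightarrow> \<bar>mollified \<Phi> f \<alpha> i 0\<bar> \<le> C * (K + L1dist_ball f (\<lambda>x. 0) 0 1)"
    "\<And>f K \<alpha> i x. summable_osc N K f \<Longrightarrow> msize \<alpha> = N \<Longrightarrow> \<bar>mollified \<Phi> f \<alpha> i x\<bar> \<le> C * (K + L1dist_ball f (\<lambda>x. 0) 0 1)"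
proof -
  let ?P = "\<lambda>\<alpha> C f K.
    (\<forall>x. (\<lambda>i. mollified \<Phi> f \<alpha> i x) \<longlonglongrightarrow> mollified_lim \<Phi> f \<alpha> x) \<and>
    (\<forall>x i j. i \<le> j \<longrightarrow> \<bar>mollified \<Phi> f \<alpha> j x - mollified \<Phi> f \<alpha> i x\<bar> \<le> C * K * ((1 / 2) ^ i) ^ (N - msize \<alpha>)) \<and>
    (\<forall>i. \<bar>mollified \<Phi> f \<alpha> i 0\<bar> \<le> C * (K + L1dist_ball f (\<lambda>x. 0) 0 1)) \<and>
    (msize \<alpha> = N \<longrightarrow> (\<forall>i x. \<bar>mollified \<Phi> f \<alpha> i x\<bar> \<le> C * (K + L1dist_ball f (\<lambda>x. 0) 0 1)))"
  have "\<forall>\<alpha>. \<exists>C. msize \<alpha> \<le> N \<longrightarrow> 0 < C \<and> (\<forall>f K. summable_osc N K f \<longrightarrow> ?P \<alpha> C f K)"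
    using mollified_bounds_fixed[OF \<Phi>] by blast
  from choice[OF this] obtain c where
    c0: "\<forall>\<alpha>. msize \<alpha> \<le> N \<longrightarrow> 0 < c \<alpha> \<and> (\<forall>f K. summable_osc N K f \<longrightarrow> ?P \<alpha> (c \<alpha>) f K)" ..
  have c: "0 < c \<alpha>" if "msize \<alpha> \<le> N" for \<alpha>
    by (rule c0[THEN spec, THEN mp, OF that, THEN conjunct1])
  have cP: "?P \<alpha> (c \<alpha>) f K" if "msize \<alpha> \<le> N" "summable_osc N K f" for \<alpha> f K
    by (rule c0[THEN spec, THEN mp, OF that(1), THEN conjunct2, THEN spec, THEN spec, THEN mp, OF that(2)])
  define C where "C = 1 + (\<Sum>\<alpha> | msize \<alpha> \<le> N. c \<alpha>)"
  have le: "c \<alpha> \<le> C" if "msize \<alpha> \<le> N" for \<alpha>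
  proof -
    have "c \<alpha> \<le> (\<Sum>\<alpha> | msize \<alpha> \<le> N. c \<alpha>)" using that c by (intro member_le_sum) (auto intro: less_imp_le)
    then show ?thesis by (simp add: C_def)
  qed
  have pos: "0 < C" unfolding C_def using c by (intro add_pos_nonneg sum_nonneg) (auto intro: less_imp_le)
  show ?thesis
  proof (rule that[OF pos])
    fix f :: "real ^ 'n \<Rightarrow> real" and K x i and \<alpha> :: "'n mindex"
    assume so: "summable_osc N K f"
    note K = summable_osc_nonneg[OF so]
    have A: "0 \<le> L1dist_ball f (\<lambda>x. 0) 0 1" by (rule L1dist_ball_nonneg)
    have mono: "c \<alpha> * (K + L1dist_ball f (\<lambda>x. 0) 0 1) \<le> C * (K + L1dist_ball f (\<lambda>x. 0) 0 1)" if "msize \<alpha> \<le> N"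
      using le[OF that] K A by (intro mult_right_mono) auto
    { assume a: "msize \<alpha> \<le> N"
      show "(\<lambda>i. mollified \<Phi> f \<alpha> i x) \<longlonglongrightarrow> mollified_lim \<Phi> f \<alpha> x" using cP[OF a so] by blast
      show "\<bar>mollified \<Phi> f \<alpha> i 0\<bar> \<le> C * (K + L1dist_ball f (\<lambda>x. 0) 0 1)"
        using cP[OF a so] mono[OF a] order_trans by blast
      fix j assume ij: "i \<le> j"
      have "c \<alpha> * K * ((1 / 2) ^ i) ^ (N - msize \<alpha>) \<le> C * K * ((1 / 2) ^ i) ^ (N - msize \<alpha>)"
        using le[OF a] K by (intro mult_right_mono) auto
      moreover have "\<bar>mollified \<Phi> f \<alpha> j x - mollified \<Phi> f \<alpha> i x\<bar> \<le> c \<alpha> * K * ((1 / 2) ^ i) ^ (N - msize \<alpha>)"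
        using cP[OF a so] ij by blast
      ultimately show "\<bar>mollified \<Phi> f \<alpha> j x - mollified \<Phi> f \<alpha> i x\<bar> \<le> C * K * ((1 / 2) ^ i) ^ (N - msize \<alpha>)" by linarith }
    assume a: "msize \<alpha> = N"
    then have a': "msize \<alpha> \<le> N" by simp
    show "\<bar>mollified \<Phi> f \<alpha> i x\<bar> \<le> C * (K + L1dist_ball f (\<lambda>x. 0) 0 1)"
      using cP[OF a' so] a mono[OF a'] order_trans by blast
  qed
qed

lemma smooth_mollified:
  "f \<in> Lp_loc 1 \<Longrightarrow> kernel N \<Phi> \<Longrightarrow> smooth (mollified \<Phi> f \<alpha> i)"
  unfolding mollified_def
  by (intro smooth_conv test_fun_mderiv kernel_test_fun_rescale small_scale_pos)

lemma mderiv_mollified: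
  assumes "f \<in> Lp_loc 1" "kernel N \<Phi>"
  shows "mderiv \<beta> (mollified \<Phi> f \<alpha> i) = mollified \<Phi> f (\<lambda>j. \<beta> j + \<alpha> j) i"
  unfolding mollified_def
  using assms kernel_test_fun_rescale[OF assms(2) small_scale_pos, of i]
  by (simp add: mderiv_conv test_fun_mderiv mderiv_mderiv test_fun_smooth)

lemma mollified_zero: "mollified \<Phi> f (\<lambda>j. 0) i = conv (reg f) (rescale \<Phi> (small_scale i))"
  by (simp add: mollified_def)

lemma bounded_Lp_loc_1:
  fixes h :: "real ^ 'n::finite \<Rightarrow> real"
  assumes m: "h \<in> borel_measurable lebesgue" and M: "\<And>x. \<bar>h x\<bar> \<le> M"
  shows "h \<in> Lp_loc 1"
proof (rule Lp_loc_1I[OF m])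
  fix R :: real
  show "integrable lebesgue (\<lambda>x. indicator (cball 0 R) x * h x)"
  proof (rule Bochner_Integration.integrable_bound)
    show "integrable lebesgue (\<lambda>x :: real ^ 'n. indicator (cball 0 R) x * M)"
      by (rule Lp_loc_1_integrable_cball[OF Lp_loc_1_continuous[of "\<lambda>_. M"]]) auto
    show "(\<lambda>x. indicator (cball 0 R) x * h x) \<in> borel_measurable lebesgue"
      by (intro borel_measurable_times borel_measurable_indicator m) (auto simp: lmeasurable_cball[THEN fmeasurableD])
    have "\<bar>h x\<bar> \<le> \<bar>M\<bar>" for x using M[of x] by simp
    then show "AE x in lebesgue. norm (indicator (cball 0 R) x * h x) \<le> norm (indicator (cball 0 R) x * M)"
      by (auto simp: indicator_def)
  qed
qed

lemma smooth_measurable_lebesgue: "smooth u \<Longrightarrow> u \<in> borel_measurable lebesgue"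
  by (simp add: measurable_completion smooth_imp_borel)

text \<open>Dominated convergence in the integration by parts formula for the mollifications: their derivatives
  converge on one side, and the mollifications themselves converge weakly on the other.\<close>

lemma mollified_lim_wderiv:
  fixes f \<Phi> :: "real ^ 'n::finite \<Rightarrow> real"
  assumes f: "f \<in> Lp_loc 1" and \<Phi>: "kernel N \<Phi>"
    and lim: "\<And>x. (\<lambda>i. mollified \<Phi> f \<alpha> i x) \<longlonglongrightarrow> h x" and M: "\<And>i x. \<bar>mollified \<Phi> f \<alpha> i x\<bar> \<le> M"
  shows "has_wderiv \<alpha> f h" "\<And>x. \<bar>h x\<bar> \<le> M"
proof -
  show hM: "\<bar>h x\<bar> \<le> M" for x
    by (rule LIMSEQ_le_const2[OF tendsto_rabs[OF lim]]) (use M in auto)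
  have sm: "smooth (mollified \<Phi> f \<alpha> i)" for i by (rule smooth_mollified[OF f \<Phi>])
  have hm: "h \<in> borel_measurable lebesgue"
    by (rule borel_measurable_LIMSEQ_real[OF lim]) (rule smooth_measurable_lebesgue[OF sm])
  have h: "h \<in> Lp_loc 1" by (rule bounded_Lp_loc_1[OF hm hM])
  have "(LINT x|lebesgue. f x * mderiv \<alpha> \<psi> x) = (-1) ^ msize \<alpha> * (LINT x|lebesgue. h x * \<psi> x)" if \<psi>: "test_fun \<psi>" for \<psi>
  proof -
    have eq: "(LINT x|lebesgue. conv (reg f) (rescale \<Phi> (small_scale i)) x * mderiv \<alpha> \<psi> x) =
        (-1) ^ msize \<alpha> * (LINT x|lebesgue. mollified \<Phi> f \<alpha> i x * \<psi> x)" for i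
      using integral_by_parts_mderiv[OF smooth_mollified[OF f \<Phi>, of "\<lambda>j. 0" i] \<psi>, of \<alpha>]
      by (simp add: mderiv_mollified[OF f \<Phi>]) (simp add: mollified_zero)
    have "(\<lambda>i. LINT x|lebesgue. mollified \<Phi> f \<alpha> i x * \<psi> x) \<longlonglongrightarrow> (LINT x|lebesgue. h x * \<psi> x)"
    proof (rule integral_dominated_convergence[where w = "\<lambda>x. M * \<bar>\<psi> x\<bar>"])
      note \<psi>m = test_fun_measurable_lebesgue[OF \<psi>]
      show "(\<lambda>x. h x * \<psi> x) \<in> borel_measurable lebesgue" by (intro borel_measurable_times hm \<psi>m)
      show "(\<lambda>x. mollified \<Phi> f \<alpha> i x * \<psi> x) \<in> borel_measurable lebesgue" for i
        by (intro borel_measurable_times smooth_measurable_lebesgue sm \<psi>m)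
      show "integrable lebesgue (\<lambda>x. M * \<bar>\<psi> x\<bar>)" by (intro integrable_mult_right integrable_abs test_fun_integrable \<psi>)
      show "AE x in lebesgue. (\<lambda>i. mollified \<Phi> f \<alpha> i x * \<psi> x) \<longlonglongrightarrow> h x * \<psi> x"
        by (intro AE_I2 tendsto_mult tendsto_const lim)
      show "AE x in lebesgue. norm (mollified \<Phi> f \<alpha> i x * \<psi> x) \<le> M * \<bar>\<psi> x\<bar>" for i
        by (simp add: abs_mult mult_right_mono M)
    qed
    then have "(\<lambda>i. (-1) ^ msize \<alpha> * (LINT x|lebesgue. mollified \<Phi> f \<alpha> i x * \<psi> x)) \<longlonglongrightarrow> (-1) ^ msize \<alpha> * (LINT x|lebesgue. h x * \<psi> x)"
      by (intro tendsto_mult tendsto_const)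
    with mollification_tendsto[OF f \<Phi> test_fun_mderiv[OF \<psi>, of \<alpha>]] show ?thesis
      unfolding eq by (rule LIMSEQ_unique)
  qed
  with f h show "has_wderiv \<alpha> f h" by (simp add: has_wderiv_def)
qed

lemma Ck_wpartialI:
  assumes "\<And>is. length is < k \<Longrightarrow> wpartial is F differentiable_on UNIV"
    "\<And>is. length is = k \<Longrightarrow> continuous_on UNIV (wpartial is F)"
  shows "Ck k F"
  using assms
proof (induction k arbitrary: F)
  case 0
  then show ?case using "0.prems"(2)[of "[]"] by simp
next
  case (Suc k)
  have "Ck k (partial i F)" for i
  proof (rule Suc.IH)
    have e: "wpartial is (partial i F) = wpartial (is @ [i]) F" for "is" by (simp add: wpartial_append)
    show "wpartial is (partial i F) differentiable_on UNIV" if "length is < k" for "is"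
      unfolding e using that by (intro Suc.prems(1)) simp
    show "continuous_on UNIV (wpartial is (partial i F))" if "length is = k" for "is"
      unfolding e using that by (intro Suc.prems(2)) simp
  qed
  then show ?case using Suc.prems(1)[of "[]"] by simp
qed

lemma tendsto_imp_uniform_tail:
  fixes u :: "nat \<Rightarrow> real"
  assumes "u \<longlonglongrightarrow> l" "\<And>j. i \<le> j \<Longrightarrow> \<bar>u j - u i\<bar> \<le> c" shows "\<bar>u i - l\<bar> \<le> c"
proof -
  have "(\<lambda>j. \<bar>u j - u i\<bar>) \<longlonglongrightarrow> \<bar>l - u i\<bar>" by (intro tendsto_intros assms(1))
  then have "\<bar>l - u i\<bar> \<le> c" by (rule LIMSEQ_le_const2) (use assms(2) in blast)
  then show ?thesis by (simp add: abs_minus_commute)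
qed

text \<open>Below the top order the mollified derivatives converge uniformly, so their limits may be differentiated
  term by term; those of order \<open>N - 1\<close> have Lipschitz limits because the mollified derivatives of order
  \<open>N\<close> are bounded. The limit of the mollifications themselves is \<open>f\<close> almost everywhere by the
  fundamental lemma.\<close>

theorem summable_osc_regularity:
  fixes \<Phi> :: "real ^ 'n::finite \<Rightarrow> real"
  assumes \<Phi>: "kernel N \<Phi>"
  shows "\<exists>C>0. \<forall>f K. summable_osc N K f \<longrightarrow>
    (\<forall>\<alpha>. msize \<alpha> = N \<longrightarrow> (\<exists>h. has_wderiv \<alpha> f h \<and> (\<forall>x. (\<lambda>i. mollified \<Phi> f \<alpha> i x) \<longlonglongrightarrow> h x) \<and>
       (\<forall>i x. \<bar>mollified \<Phi> f \<alpha> i x\<bar> \<le> C * (K + L1dist_ball f (\<lambda>x. 0) 0 1)))) \<and>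
    (1 \<le> N \<longrightarrow> (\<exists>F. Ck (N - 1) F \<and> (AE x in lebesgue. f x = F x) \<and>
      (\<forall>\<alpha>. msize \<alpha> \<le> N - 1 \<longrightarrow> \<bar>mderiv \<alpha> F 0\<bar> \<le> C * (K + L1dist_ball f (\<lambda>x. 0) 0 1)) \<and>
      (\<forall>\<alpha>. msize \<alpha> = N - 1 \<longrightarrow> (C * (K + L1dist_ball f (\<lambda>x. 0) 0 1))-lipschitz_on UNIV (mderiv \<alpha> F)) \<and>
      (\<forall>x i. \<bar>mollified \<Phi> f (\<lambda>j. 0) i x - F x\<bar> \<le> C * K * (1 / 2) ^ i)))"
proof -
  obtain C where C: "0 < C"
    "\<And>f K \<alpha> x. summable_osc N K f \<Longrightarrow> msize \<alpha> \<le> N \<Longrightarrow> (\<lambda>i. mollified \<Phi> f \<alpha> i x) \<longlonglongrightarrow> mollified_lim \<Phi> f \<alpha> x"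
    "\<And>f K \<alpha> x i j. summable_osc N K f \<Longrightarrow> msize \<alpha> \<le> N \<Longrightarrow> i \<le> j \<Longrightarrow>
       \<bar>mollified \<Phi> f \<alpha> j x - mollified \<Phi> f \<alpha> i x\<bar> \<le> C * K * ((1 / 2) ^ i) ^ (N - msize \<alpha>)"
    "\<And>f K \<alpha> i. summable_osc N K f \<Longrightarrow> msize \<alpha> \<le> N \<Longrightarrow> \<bar>mollified \<Phi> f \<alpha> i 0\<bar> \<le> C * (K + L1dist_ball f (\<lambda>x. 0) 0 1)"
    "\<And>f K \<alpha> i x. summable_osc N K f \<Longrightarrow> msize \<alpha> = N \<Longrightarrow> \<bar>mollified \<Phi> f \<alpha> i x\<bar> \<le> C * (K + L1dist_ball f (\<lambda>x. 0) 0 1)"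
    by (rule mollified_bounds[OF \<Phi>]) (rule that)
  \<comment> \<open>a bound of the gradient sums the bounds of the partial derivatives\<close>
  define D where "D = C * real CARD('n)"
  have card: "1 \<le> real CARD('n)" by simp
  have D: "0 < D" "C \<le> D" using C(1) card by (auto simp: D_def)
  show ?thesis
  proof (rule exI[of _ D], intro conjI D(1) allI impI)
    fix f :: "real ^ 'n \<Rightarrow> real" and K assume so: "summable_osc N K f"
    note f = summable_osc_Lp_loc[OF so] and K = summable_osc_nonneg[OF so]
    let ?A = "L1dist_ball f (\<lambda>x. 0) 0 1"
    have A: "0 \<le> ?A" by (rule L1dist_ball_nonneg)
    have DA: "C * (K + ?A) \<le> D * (K + ?A)" using D(2) K A by (intro mult_right_mono) auto
    let ?m = "mollified \<Phi> f" and ?l = "mollified_lim \<Phi> f"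
    show "\<exists>h. has_wderiv \<alpha> f h \<and> (\<forall>x. (\<lambda>i. ?m \<alpha> i x) \<longlonglongrightarrow> h x) \<and> (\<forall>i x. \<bar>?m \<alpha> i x\<bar> \<le> D * (K + ?A))"
      if \<alpha>: "msize \<alpha> = N" for \<alpha>
    proof (intro exI[of _ "?l \<alpha>"] conjI allI)
      have \<alpha>': "msize \<alpha> \<le> N" using \<alpha> by simp
      show "has_wderiv \<alpha> f (?l \<alpha>)"
        by (rule mollified_lim_wderiv(1)[OF f \<Phi> C(2)[OF so \<alpha>'] C(5)[OF so \<alpha>]])
      show "(\<lambda>i. ?m \<alpha> i x) \<longlonglongrightarrow> ?l \<alpha> x" for x by (rule C(2)[OF so \<alpha>'])
      show "\<bar>?m \<alpha> i x\<bar> \<le> D * (K + ?A)" for i x using C(5)[OF so \<alpha>, of i x] DA by linarith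
    qed
    assume N: "1 \<le> N"
    have tail: "\<bar>?m \<alpha> i x - ?l \<alpha> x\<bar> \<le> C * K * (1 / 2) ^ i" if \<alpha>: "msize \<alpha> \<le> N - 1" for \<alpha> i x
    proof -
      have \<alpha>': "msize \<alpha> \<le> N" using \<alpha> by simp
      have "((1 / 2 :: real) ^ i) ^ (N - msize \<alpha>) \<le> ((1 / 2) ^ i) ^ 1"
        using \<alpha> N by (intro power_decreasing) (auto intro: power_le_one)
      then have "C * K * ((1 / 2 :: real) ^ i) ^ (N - msize \<alpha>) \<le> C * K * (1 / 2) ^ i"
        using C(1) K by (intro mult_left_mono) auto
      then show ?thesis
        using C(3)[OF so \<alpha>'] by (intro tendsto_imp_uniform_tail[OF C(2)[OF so \<alpha>']]) (meson order_trans)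
    qed
    let ?w = "\<lambda>is. count (mset is) :: 'n mindex"
    have part: "partial k (?m (?w is) i) = ?m (?w (k # is)) i" for k "is" i
    proof -
      have "(\<lambda>j. munit k j + ?w is j) = ?w (k # is)" by (auto simp: munit_def)
      then show ?thesis using mderiv_mollified[OF f \<Phi>, of "munit k" "?w is" i] by (simp only: mderiv_munit)
    qed
    have len: "msize (?w is) = length is" for "is" by (rule msize_count)
    have deriv: "(?l (?w is) has_derivative (\<lambda>h. \<Sum>k\<in>UNIV. h $ k * ?l (?w (k # is)) x)) (at x)"
      if "length is < N - 1" for "is" x
    proof -
      have "\<exists>g. \<forall>x\<in>UNIV. (\<lambda>i. ?m (?w is) i x) \<longlonglongrightarrow> g x \<and>
          (g has_derivative (\<lambda>h. \<Sum>k\<in>UNIV. h $ k * ?l (?w (k # is)) x)) (at x within UNIV)"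
      proof (rule has_derivative_sequence[where ?x0.0 = 0])
        show "(?m (?w is) i has_derivative (\<lambda>h. \<Sum>k\<in>UNIV. h $ k * ?m (?w (k # is)) i x)) (at x within UNIV)" for i x
          using smooth_has_derivative[OF smooth_mollified[OF f \<Phi>, of "?w is" i], of x] by (simp only: part)
        show "(\<lambda>i. ?m (?w is) i 0) \<longlonglongrightarrow> ?l (?w is) 0" using that by (intro C(2)[OF so]) (simp add: len)
        fix e :: real assume e: "0 < e"
        have "(\<lambda>i. real CARD('n) * (C * K * (1 / 2) ^ i)) \<longlonglongrightarrow> real CARD('n) * (C * K * 0)"
          by (intro tendsto_intros LIMSEQ_power_zero) simp
        then have "\<forall>\<^sub>F i in sequentially. real CARD('n) * (C * K * (1 / 2) ^ i) < e"
          using e by (intro order_tendstoD(2)) auto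
        then show "\<forall>\<^sub>F i in sequentially. \<forall>x\<in>UNIV. \<forall>h. norm ((\<Sum>k\<in>UNIV. h $ k * ?m (?w (k # is)) i x) - (\<Sum>k\<in>UNIV. h $ k * ?l (?w (k # is)) x)) \<le> e * norm h"
        proof (eventually_elim, intro ballI allI)
          fix i and x h :: "real ^ 'n"
          assume i: "real CARD('n) * (C * K * (1 / 2) ^ i) < e"
          have "(\<Sum>k\<in>UNIV. h $ k * ?m (?w (k # is)) i x) - (\<Sum>k\<in>UNIV. h $ k * ?l (?w (k # is)) x) =
            (\<Sum>k\<in>UNIV. h $ k * (?m (?w (k # is)) i x - ?l (?w (k # is)) x))"
            by (simp only: sum_subtractf right_diff_distrib)
          also have "\<bar>\<dots>\<bar> \<le> (\<Sum>k\<in>(UNIV :: 'n set). norm h * (C * K * (1 / 2) ^ i))"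
          proof (intro order_trans[OF sum_abs] sum_mono)
            fix k :: 'n
            have "\<bar>?m (?w (k # is)) i x - ?l (?w (k # is)) x\<bar> \<le> C * K * (1 / 2) ^ i"
              by (rule tail) (use that in \<open>simp only: len, simp\<close>)
            then show "\<bar>h $ k * (?m (?w (k # is)) i x - ?l (?w (k # is)) x)\<bar> \<le> norm h * (C * K * (1 / 2) ^ i)"
              unfolding abs_mult by (intro mult_mono component_le_norm_cart) auto
          qed
          also have "\<dots> = real CARD('n) * (C * K * (1 / 2) ^ i) * norm h" by simp
          also have "\<dots> \<le> e * norm h" using i by (intro mult_right_mono) auto
          finally show "norm ((\<Sum>k\<in>UNIV. h $ k * ?m (?w (k # is)) i x) - (\<Sum>k\<in>UNIV. h $ k * ?l (?w (k # is)) x)) \<le> e * norm h"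
            by simp
        qed
      qed auto
      then obtain g where g: "\<And>x. (\<lambda>i. ?m (?w is) i x) \<longlonglongrightarrow> g x"
        "\<And>x. (g has_derivative (\<lambda>h. \<Sum>k\<in>UNIV. h $ k * ?l (?w (k # is)) x)) (at x)" by auto
      have "g x = ?l (?w is) x" for x
        by (rule LIMSEQ_unique[OF g(1) C(2)[OF so]]) (use that in \<open>simp add: len\<close>)
      then have "g = ?l (?w is)" by (rule ext)
      then show ?thesis using g(2)[of x] by (simp only:)
    qed
    define F where "F = ?l (\<lambda>j. 0)"
    have wF: "wpartial is F = ?l (?w is)" if "length is \<le> N - 1" for "is"
      using that
    proof (induction "is")
      case Nil
      have "?w [] = (\<lambda>j. 0)" by auto
      then show ?case unfolding F_def by (simp only: wpartial_Nil)
    next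
      case (Cons k "is")
      have "partial k (?l (?w is)) x = ?l (?w (k # is)) x" for x
      proof -
        have "length is < N - 1" using Cons.prems by simp
        then have "partial k (?l (?w is)) x = (\<Sum>j\<in>UNIV. axis k 1 $ j * ?l (?w (j # is)) x)"
          by (rule partial_eqI[OF deriv])
        also have "\<dots> = (\<Sum>j\<in>UNIV. if j = k then ?l (?w (j # is)) x else 0)"
          by (rule sum.cong) (auto simp: axis_def)
        finally show ?thesis by (simp only: sum.delta finite UNIV_I if_True)
      qed
      then show ?case using Cons by (auto simp only: wpartial_Cons length_Cons)
    qed
    have DF: "mderiv \<alpha> F = ?l \<alpha>" if "msize \<alpha> \<le> N - 1" for \<alpha>
      using wF[of "mword \<alpha>"] that by (simp only: mderiv_eq_wpartial length_mword count_mword)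
    have lip: "(D * (K + ?A))-lipschitz_on UNIV (?l (?w is))" if l: "length is = N - 1" for "is"
    proof (rule lipschitz_onI)
      have l': "msize (?w is) \<le> N" using l by (simp add: len)
      fix x y :: "real ^ 'n"
      have "\<bar>?m (?w is) i x - ?m (?w is) i y\<bar> \<le> D * (K + ?A) * dist x y" for i
      proof -
        obtain t where "?m (?w is) i (y + (x - y)) - ?m (?w is) i y = (\<Sum>k\<in>UNIV. (x - y) $ k * partial k (?m (?w is) i) (y + t *\<^sub>R (x - y)))"
          using smooth_mean_value[OF smooth_mollified[OF f \<Phi>, of "?w is" i]] by blast
        then have "\<bar>?m (?w is) i x - ?m (?w is) i y\<bar> = \<bar>\<Sum>k\<in>UNIV. (x - y) $ k * ?m (?w (k # is)) i (y + t *\<^sub>R (x - y))\<bar>"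
          by (simp only: part) simp
        also have "\<dots> \<le> (\<Sum>k\<in>(UNIV :: 'n set). norm (x - y) * (C * (K + ?A)))"
        proof (intro order_trans[OF sum_abs] sum_mono)
          fix k :: 'n
          have "\<bar>?m (?w (k # is)) i (y + t *\<^sub>R (x - y))\<bar> \<le> C * (K + ?A)"
            by (rule C(5)[OF so]) (use l N in \<open>simp only: len, simp\<close>)
          then show "\<bar>(x - y) $ k * ?m (?w (k # is)) i (y + t *\<^sub>R (x - y))\<bar> \<le> norm (x - y) * (C * (K + ?A))"
            unfolding abs_mult by (intro mult_mono component_le_norm_cart) auto
        qed
        also have "\<dots> = D * (K + ?A) * dist x y" by (simp add: D_def dist_norm)
        finally show ?thesis .
      qed
      then show "dist (?l (?w is) x) (?l (?w is) y) \<le> D * (K + ?A) * dist x y"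
        unfolding dist_real_def
        by (intro LIMSEQ_le_const2[OF tendsto_rabs[OF tendsto_diff[OF C(2)[OF so l'] C(2)[OF so l']]]]) blast
    qed (use D K A in auto)
    show "\<exists>F. Ck (N - 1) F \<and> (AE x in lebesgue. f x = F x) \<and>
      (\<forall>\<alpha>. msize \<alpha> \<le> N - 1 \<longrightarrow> \<bar>mderiv \<alpha> F 0\<bar> \<le> D * (K + ?A)) \<and>
      (\<forall>\<alpha>. msize \<alpha> = N - 1 \<longrightarrow> (D * (K + ?A))-lipschitz_on UNIV (mderiv \<alpha> F)) \<and>
      (\<forall>x i. \<bar>?m (\<lambda>j. 0) i x - F x\<bar> \<le> D * K * (1 / 2) ^ i)"
    proof (intro exI[of _ F] conjI allI impI)
      show CF: "Ck (N - 1) F"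
      proof (rule Ck_wpartialI)
        show "wpartial is F differentiable_on UNIV" if "length is < N - 1" for "is"
          using deriv[OF that] wF[of "is"] that by (auto simp: differentiable_on_def differentiable_def simp del: count_mset)
        show "continuous_on UNIV (wpartial is F)" if "length is = N - 1" for "is"
          using lipschitz_on_continuous_on[OF lip[OF that]] wF[of "is"] that by simp
      qed
      show tF: "\<bar>?m (\<lambda>j. 0) i x - F x\<bar> \<le> D * K * (1 / 2) ^ i" for x i
      proof -
        have "C * K * (1 / 2) ^ i \<le> D * K * (1 / 2) ^ i" using D(2) K by (intro mult_right_mono) auto
        then show ?thesis using tail[of "\<lambda>j. 0" i x] by (simp add: F_def)
      qed
      show "\<bar>mderiv \<alpha> F 0\<bar> \<le> D * (K + ?A)" if "msize \<alpha> \<le> N - 1" for \<alpha>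
      proof -
        have a: "msize \<alpha> \<le> N" using that by simp
        have "\<bar>?l \<alpha> 0\<bar> \<le> C * (K + ?A)"
          by (rule LIMSEQ_le_const2[OF tendsto_rabs[OF C(2)[OF so a]]]) (use C(4)[OF so a] in blast)
        then show ?thesis using DA by (simp add: DF[OF that])
      qed
      show "(D * (K + ?A))-lipschitz_on UNIV (mderiv \<alpha> F)" if "msize \<alpha> = N - 1" for \<alpha>
        using lip[of "mword \<alpha>"] that DF[of \<alpha>] by (simp only: length_mword count_mword)
      have FL: "F \<in> Lp_loc 1" by (rule Lp_loc_1_continuous[OF Ck_imp_continuous[OF CF]])
      have "AE x in lebesgue. f x - F x = 0"
      proof (rule fundamental_lemma_variations[OF Lp_loc_1_diff[OF f FL] _ \<Phi>])
        fix \<psi> :: "real ^ 'n \<Rightarrow> real" assume \<psi>: "test_fun \<psi>"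
        have i: "integrable lebesgue (\<lambda>x. ?m (\<lambda>j. 0) i x * \<psi> x)" "integrable lebesgue (\<lambda>x. F x * \<psi> x)" for i
          by (intro Lp_loc_1_integrable_test smooth_Lp_loc_1 smooth_mollified[OF f \<Phi>] FL \<psi>)+
        have "(\<lambda>i. (LINT x|lebesgue. ?m (\<lambda>j. 0) i x * \<psi> x) - (LINT x|lebesgue. F x * \<psi> x)) \<longlonglongrightarrow> 0"
        proof (rule Lim_null_comparison)
          have "(\<lambda>i. D * K * (1 / 2) ^ i * (LINT x|lebesgue. \<bar>\<psi> x\<bar>)) \<longlonglongrightarrow> D * K * 0 * (LINT x|lebesgue. \<bar>\<psi> x\<bar>)"
            by (intro tendsto_intros LIMSEQ_power_zero) simp
          then show "(\<lambda>i. D * K * (1 / 2) ^ i * (LINT x|lebesgue. \<bar>\<psi> x\<bar>)) \<longlonglongrightarrow> 0" by simp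
          have "\<bar>(LINT x|lebesgue. ?m (\<lambda>j. 0) i x * \<psi> x) - (LINT x|lebesgue. F x * \<psi> x)\<bar> \<le> D * K * (1 / 2) ^ i * (LINT x|lebesgue. \<bar>\<psi> x\<bar>)" for i
          proof -
            have "(LINT x|lebesgue. ?m (\<lambda>j. 0) i x * \<psi> x) - (LINT x|lebesgue. F x * \<psi> x) = (LINT x|lebesgue. (?m (\<lambda>j. 0) i x - F x) * \<psi> x)"
              unfolding left_diff_distrib by (rule Bochner_Integration.integral_diff[OF i, symmetric])
            also have "\<bar>\<dots>\<bar> \<le> (LINT x|lebesgue. \<bar>(?m (\<lambda>j. 0) i x - F x) * \<psi> x\<bar>)" by (rule integral_abs_bound)
            also have "\<dots> \<le> (LINT x|lebesgue. D * K * (1 / 2) ^ i * \<bar>\<psi> x\<bar>)"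
            proof (rule integral_mono')
              show "integrable lebesgue (\<lambda>x. D * K * (1 / 2) ^ i * \<bar>\<psi> x\<bar>)"
                by (intro integrable_mult_right integrable_abs test_fun_integrable \<psi>)
              show "\<bar>(?m (\<lambda>j. 0) i x - F x) * \<psi> x\<bar> \<le> D * K * (1 / 2) ^ i * \<bar>\<psi> x\<bar>" for x
                unfolding abs_mult by (intro mult_right_mono tF) simp
            qed (use D K in simp)
            finally show ?thesis by simp
          qed
          then show "\<forall>\<^sub>F i in sequentially. norm ((LINT x|lebesgue. ?m (\<lambda>j. 0) i x * \<psi> x) - (LINT x|lebesgue. F x * \<psi> x)) \<le> D * K * (1 / 2) ^ i * (LINT x|lebesgue. \<bar>\<psi> x\<bar>)"
            by simp
        qed
        from LIM_zero_cancel[OF this] mollification_tendsto[OF f \<Phi> \<psi>]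
        have "(LINT x|lebesgue. F x * \<psi> x) = (LINT x|lebesgue. f x * \<psi> x)"
          unfolding mollified_zero by (rule LIMSEQ_unique)
        then show "(LINT x|lebesgue. (f x - F x) * \<psi> x) = 0"
          unfolding left_diff_distrib using Lp_loc_1_integrable_test[OF f \<psi>] i(2) by simp
      qed
      then show "AE x in lebesgue. f x = F x" by eventually_elim simp
    qed
  qed
qed

section \<open>Limits of mollified Taylor polynomials\<close>

lemma abs_mpower_le_1: "norm x \<le> 1 \<Longrightarrow> \<bar>mpower x \<alpha>\<bar> \<le> 1"
  unfolding mpower_def abs_prod power_abs
  by (intro prod_le_1) (auto intro!: power_le_one intro: order_trans[OF component_le_norm_cart])

lemma poly_norm_upper:
  assumes "continuous_on UNIV P" "norm x \<le> 1" shows "\<bar>P x\<bar> \<le> poly_norm P"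
proof -
  have "compact (P ` cball 0 1)"
    by (intro compact_continuous_image continuous_on_subset[OF assms(1)]) auto
  then obtain B where "\<And>x. x \<in> cball 0 1 \<Longrightarrow> \<bar>P x\<bar> \<le> B"
    using compact_imp_bounded by (force simp: bounded_iff)
  then show ?thesis unfolding poly_norm_def
    by (intro cSUP_upper bdd_aboveI2[of _ _ B]) (use assms(2) in auto)
qed

lemma poly_norm_le: "(\<And>x. norm x \<le> 1 \<Longrightarrow> \<bar>P x\<bar> \<le> B) \<Longrightarrow> poly_norm P \<le> B"
  unfolding poly_norm_def by (rule cSUP_least) auto

lemma Pdot_tendstoI:
  fixes \<phi> :: "real ^ 'n::finite \<Rightarrow> real"
  assumes "\<And>\<alpha>. msize \<alpha> = N \<Longrightarrow> ((\<lambda>r. moment \<phi> \<alpha> x0 r T) \<longlongrightarrow> c \<alpha>) at_top"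
  shows "Pdot_tendsto \<phi> N x0 T (\<lambda>x. \<Sum>\<alpha> | msize \<alpha> = N. 1 / mfact \<alpha> * c \<alpha> * mpower x \<alpha>)"
  unfolding Pdot_tendsto_def
proof (rule tendsto_sandwich)
  let ?b = "\<lambda>r. \<Sum>\<alpha> | msize \<alpha> = N. 1 / mfact \<alpha> * \<bar>moment \<phi> \<alpha> x0 r T - c \<alpha>\<bar>"
  let ?d = "\<lambda>r x. Pdot \<phi> N x0 r T x - (\<Sum>\<alpha> | msize \<alpha> = N. 1 / mfact \<alpha> * c \<alpha> * mpower x \<alpha>)"
  have eq: "?d r = (\<lambda>x. \<Sum>\<alpha> | msize \<alpha> = N. 1 / mfact \<alpha> * (moment \<phi> \<alpha> x0 r T - c \<alpha>) * mpower x \<alpha>)" for r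
    by (simp add: Pdot_def algebra_simps diff_divide_distrib sum_subtractf fun_eq_iff)
  have cont: "continuous_on UNIV (?d r)" for r
    unfolding eq by (intro smooth_imp_continuous smooth_sum smooth_cmult smooth_mpower)
  have "0 \<le> poly_norm (?d r)" for r
    using poly_norm_upper[OF cont, of 0 r] by simp
  then show "\<forall>\<^sub>F r in at_top. 0 \<le> poly_norm (?d r)" by simp
  have "poly_norm (?d r) \<le> ?b r" for r
    unfolding eq
  proof (rule poly_norm_le)
    fix x :: "real ^ 'n" assume x: "norm x \<le> 1"
    show "\<bar>\<Sum>\<alpha> | msize \<alpha> = N. 1 / mfact \<alpha> * (moment \<phi> \<alpha> x0 r T - c \<alpha>) * mpower x \<alpha>\<bar> \<le> ?b r"
    proof (intro order_trans[OF sum_abs] sum_mono)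
      fix \<alpha> :: "'n mindex"
      have "\<bar>1 / mfact \<alpha> * (moment \<phi> \<alpha> x0 r T - c \<alpha>) * mpower x \<alpha>\<bar> =
         1 / mfact \<alpha> * \<bar>moment \<phi> \<alpha> x0 r T - c \<alpha>\<bar> * \<bar>mpower x \<alpha>\<bar>"
        using mfact_pos[of \<alpha>] by (simp add: abs_mult)
      also have "\<dots> \<le> 1 / mfact \<alpha> * \<bar>moment \<phi> \<alpha> x0 r T - c \<alpha>\<bar> * 1"
        using mfact_pos[of \<alpha>] by (intro mult_left_mono abs_mpower_le_1 x) auto
      finally show "\<bar>1 / mfact \<alpha> * (moment \<phi> \<alpha> x0 r T - c \<alpha>) * mpower x \<alpha>\<bar> \<le> 1 / mfact \<alpha> * \<bar>moment \<phi> \<alpha> x0 r T - c \<alpha>\<bar>"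
        by simp
    qed
  qed
  then show "\<forall>\<^sub>F r in at_top. poly_norm (?d r) \<le> ?b r" by simp
  have "(?b \<longlongrightarrow> (\<Sum>\<alpha> | msize (\<alpha> :: 'n mindex) = N. 1 / mfact \<alpha> * 0)) at_top"
  proof (rule tendsto_sum)
    fix \<alpha> :: "'n mindex" assume "\<alpha> \<in> {\<alpha>. msize \<alpha> = N}"
    then have "((\<lambda>r. moment \<phi> \<alpha> x0 r T) \<longlongrightarrow> c \<alpha>) at_top" by (intro assms) simp
    then show "((\<lambda>r. 1 / mfact \<alpha> * \<bar>moment \<phi> \<alpha> x0 r T - c \<alpha>\<bar>) \<longlongrightarrow> 1 / mfact \<alpha> * 0) at_top"
      by (intro tendsto_mult tendsto_const tendsto_rabs_zero LIM_zero)
  qed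
  then show "(?b \<longlongrightarrow> 0) at_top" by simp
qed simp

lemma hpolys_subset_polys: "hpolys N \<subseteq> polys N"
  by (auto simp: hpolys_def intro!: polys_sum polys_cmult polys_monomial)

lemma hpolys_homogeneous: "Q \<in> hpolys N \<Longrightarrow> Q (c *\<^sub>R x) = c ^ N * Q x"
  by (auto simp: hpolys_def mpower_scaleR sum_distrib_left mult_ac intro!: sum.cong)

lemma has_PinfI:
  fixes \<phi> :: "real ^ 'n::finite \<Rightarrow> real"
  assumes "\<And>\<alpha> x0. msize \<alpha> = N \<Longrightarrow> ((\<lambda>r. moment \<phi> \<alpha> x0 r T) \<longlongrightarrow> c \<alpha>) at_top"
  shows "has_Pinf \<phi> N T (\<lambda>x. \<Sum>\<alpha> | msize \<alpha> = N. 1 / mfact \<alpha> * c \<alpha> * mpower x \<alpha>)"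
  unfolding has_Pinf_def
proof (intro conjI allI Pdot_tendstoI assms)
  show "(\<lambda>x. \<Sum>\<alpha> | msize \<alpha> = N. 1 / mfact \<alpha> * c \<alpha> * mpower x \<alpha>) \<in> hpolys N"
    unfolding hpolys_def by (rule CollectI, rule exI[of _ "\<lambda>\<alpha>. 1 / mfact \<alpha> * c \<alpha>"]) simp
qed

text \<open>The convergence determines the limit on the unit ball, and homogeneity determines it elsewhere.\<close>

lemma has_Pinf_unique:
  fixes \<phi> :: "real ^ 'n::finite \<Rightarrow> real"
  assumes Q: "has_Pinf \<phi> N T Q" and Q': "has_Pinf \<phi> N T Q'"
  shows "Q = Q'"
proof
  fix x :: "real ^ 'n"
  have hom: "Q \<in> hpolys N" "Q' \<in> hpolys N" using Q Q' by (auto simp: has_Pinf_def)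
  have sm: "smooth Q" "smooth Q'" using hom hpolys_subset_polys smooth_polys by blast+
  let ?n = "\<lambda>r Q. poly_norm (\<lambda>x. Pdot \<phi> N 0 r T x - Q x)"
  have cont: "continuous_on UNIV (\<lambda>x. Pdot \<phi> N 0 r T x - P x)" if "smooth P" for r and P :: "real ^ 'n \<Rightarrow> real"
    unfolding Pdot_def
    by (intro continuous_on_diff smooth_imp_continuous smooth_sum smooth_cmult smooth_mpower that)
  have ball: "Q y = Q' y" if y: "norm y \<le> 1" for y
  proof -
    have "\<bar>Q y - Q' y\<bar> \<le> ?n r Q + ?n r Q'" for r
      using poly_norm_upper[OF cont[OF sm(1)] y, of r] poly_norm_upper[OF cont[OF sm(2)] y, of r] by linarith
    moreover have "((\<lambda>r. ?n r Q + ?n r Q') \<longlongrightarrow> 0 + 0) at_top"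
      using Q Q' by (intro tendsto_add) (auto simp: has_Pinf_def Pdot_tendsto_def)
    ultimately have "\<bar>Q y - Q' y\<bar> \<le> 0 + 0" by (intro tendsto_lowerbound) auto
    then show ?thesis by simp
  qed
  define c where "c = norm x + 1"
  have c: "0 < c" by (simp add: c_def add_nonneg_pos)
  have "norm (x /\<^sub>R c) \<le> 1" using c by (simp add: c_def field_simps)
  from ball[OF this] have "c ^ N * Q (x /\<^sub>R c) = c ^ N * Q' (x /\<^sub>R c)" by simp
  then show "Q x = Q' x" using c by (simp flip: hpolys_homogeneous[OF hom(1)] hpolys_homogeneous[OF hom(2)])
qed

lemma has_Pinf_imp_Pinf: "has_Pinf \<phi> N T Q \<Longrightarrow> Pinf \<phi> N T = Q"
  unfolding Pinf_def by (rule the_equality) (auto intro: has_Pinf_unique)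

lemma has_Pinf_imp_ex1: "has_Pinf \<phi> N T Q \<Longrightarrow> \<exists>!Q. has_Pinf \<phi> N T Q"
  by (auto intro: has_Pinf_unique)

lemma has_Pinf_imp_exists: "has_Pinf \<phi> N T Q \<Longrightarrow> Pinf_exists \<phi> N T"
  unfolding Pinf_exists_def by (rule has_Pinf_imp_ex1)

text \<open>For the functions considered the limit does not depend on the centre; the origin is a representative.\<close>

definition lim_moment :: "(real ^ 'n::finite \<Rightarrow> real) \<Rightarrow> (real ^ 'n \<Rightarrow> real) \<Rightarrow> 'n mindex \<Rightarrow> real" where
  "lim_moment \<phi> f \<alpha> = Lim at_top (\<lambda>r. moment \<phi> \<alpha> 0 r (reg f))"

lemma moment_tendsto_lim_moment:
  assumes \<phi>: "kernel M \<phi>" and so: "summable_osc N K f" and \<alpha>: "msize \<alpha> = N"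
  shows "((\<lambda>r. moment \<phi> \<alpha> x r (reg f)) \<longlongrightarrow> lim_moment \<phi> f \<alpha>) at_top"
proof -
  obtain a where a: "\<And>x. ((\<lambda>R. conv (reg f) (mderiv \<alpha> (rescale \<phi> R)) x) \<longlongrightarrow> a) at_top"
    using mollified_large_scale[OF \<phi> \<alpha>] so by blast
  then have "lim_moment \<phi> f \<alpha> = a"
    unfolding lim_moment_def moment_def by (intro tendsto_Lim a) simp
  then show ?thesis using a[of x] by (simp add: moment_def)
qed

definition Taylor_inf :: "(real ^ 'n::finite \<Rightarrow> real) \<Rightarrow> nat \<Rightarrow> (real ^ 'n \<Rightarrow> real) \<Rightarrow> real ^ 'n \<Rightarrow> real" where
  "Taylor_inf \<phi> N f = (\<lambda>x. \<Sum>\<alpha> | msize \<alpha> = N. 1 / mfact \<alpha> * lim_moment \<phi> f \<alpha> * mpower x \<alpha>)"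

lemma has_Pinf_reg:
  assumes "kernel M \<phi>" "summable_osc N K f" shows "has_Pinf \<phi> N (reg f) (Taylor_inf \<phi> N f)"
  unfolding Taylor_inf_def by (rule has_PinfI) (rule moment_tendsto_lim_moment[OF assms])

lemma moment_dderiv:
  assumes \<phi>: "kernel M \<phi>" and r: "0 < r"
  shows "moment \<phi> \<beta> x r (dderiv \<alpha> (reg f)) = moment \<phi> (\<lambda>i. \<alpha> i + \<beta> i) x r (reg f)"
proof -
  have sm: "smooth (rescale \<phi> r)" by (rule test_fun_smooth[OF kernel_test_fun_rescale[OF \<phi> r]])
  have "mderiv \<alpha> (\<lambda>y. mderiv \<beta> (rescale \<phi> r) (x - y)) = (\<lambda>y. (-1) ^ msize \<alpha> * mderiv (\<lambda>i. \<alpha> i + \<beta> i) (rescale \<phi> r) (x - y))"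
    by (simp only: mderiv_reflect[OF smooth_mderiv[OF sm]] mderiv_mderiv[OF sm])
  then have "moment \<phi> \<beta> x r (dderiv \<alpha> (reg f)) = (-1) ^ msize \<alpha> *
      (LINT y|lebesgue. (-1) ^ msize \<alpha> * (f y * mderiv (\<lambda>i. \<alpha> i + \<beta> i) (rescale \<phi> r) (x - y)))"
    by (simp add: moment_def conv_def dderiv_def reg_def mult_ac)
  also have "\<dots> = ((-1) ^ msize \<alpha> * (-1) ^ msize \<alpha>) * (LINT y|lebesgue. f y * mderiv (\<lambda>i. \<alpha> i + \<beta> i) (rescale \<phi> r) (x - y))"
    by (simp only: integral_mult_right_zero mult.assoc)
  also have "(-1 :: real) ^ msize \<alpha> * (-1) ^ msize \<alpha> = 1" by (simp flip: power_mult_distrib)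
  finally show ?thesis by (simp add: moment_def conv_def reg_def)
qed

text \<open>The factor \<open>1/\<alpha>!\<close> of a Taylor coefficient makes differentiation a mere shift of the index.\<close>

lemma mderiv_Taylor_inf:
  fixes \<phi> :: "real ^ 'n::finite \<Rightarrow> real"
  assumes \<alpha>: "msize \<alpha> \<le> N"
  shows "mderiv \<alpha> (Taylor_inf \<phi> N f) =
    (\<lambda>x. \<Sum>\<beta> | msize \<beta> = N - msize \<alpha>. 1 / mfact \<beta> * lim_moment \<phi> f (\<lambda>i. \<alpha> i + \<beta> i) * mpower x \<beta>)"
proof
  fix x :: "real ^ 'n"
  let ?S = "{\<gamma> :: 'n mindex. msize \<gamma> = N \<and> (\<forall>i. \<alpha> i \<le> \<gamma> i)}"
  have fin: "finite {\<gamma> :: 'n mindex. msize \<gamma> = N}" by simp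
  have "mderiv \<alpha> (Taylor_inf \<phi> N f) x = (\<Sum>\<gamma> | msize \<gamma> = N. 1 / mfact \<gamma> * lim_moment \<phi> f \<gamma> * mderiv \<alpha> (\<lambda>x. mpower x \<gamma>) x)"
    unfolding Taylor_inf_def
    by (subst mderiv_sum) (simp_all only: mderiv_cmult smooth_mpower smooth_cmult)
  also have "\<dots> = (\<Sum>\<gamma>\<in>?S. 1 / mfact \<gamma> * lim_moment \<phi> f \<gamma> * mderiv \<alpha> (\<lambda>x. mpower x \<gamma>) x)"
    by (rule sum.mono_neutral_right[OF fin]) (auto simp: mderiv_mpower)
  also have "\<dots> = (\<Sum>\<gamma>\<in>?S. 1 / mfact (\<lambda>i. \<gamma> i - \<alpha> i) * lim_moment \<phi> f \<gamma> * mpower x (\<lambda>i. \<gamma> i - \<alpha> i))"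
  proof (rule sum.cong[OF refl])
    fix \<gamma> assume "\<gamma> \<in> ?S"
    then have le: "\<forall>i. \<alpha> i \<le> \<gamma> i" by blast
    show "1 / mfact \<gamma> * lim_moment \<phi> f \<gamma> * mderiv \<alpha> (\<lambda>x. mpower x \<gamma>) x =
      1 / mfact (\<lambda>i. \<gamma> i - \<alpha> i) * lim_moment \<phi> f \<gamma> * mpower x (\<lambda>i. \<gamma> i - \<alpha> i)"
      using mfact_pos[of \<gamma>] by (simp only: mderiv_mpower if_P[OF le]) simp
  qed
  also have "\<dots> = (\<Sum>\<beta> | msize \<beta> = N - msize \<alpha>. 1 / mfact \<beta> * lim_moment \<phi> f (\<lambda>i. \<alpha> i + \<beta> i) * mpower x \<beta>)"
  proof (rule sum.reindex_bij_witness[where i = "\<lambda>\<beta> i. \<alpha> i + \<beta> i" and j = "\<lambda>\<gamma> i. \<gamma> i - \<alpha> i"])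
    fix \<gamma> assume g: "\<gamma> \<in> ?S"
    then have e: "(\<lambda>i. \<alpha> i + (\<gamma> i - \<alpha> i)) = \<gamma>" by auto
    then show "(\<lambda>i. \<alpha> i + (\<gamma> i - \<alpha> i)) = \<gamma>" .
    have "msize \<alpha> + msize (\<lambda>i. \<gamma> i - \<alpha> i) = msize \<gamma>" using msize_add[of \<alpha> "\<lambda>i. \<gamma> i - \<alpha> i"] e by simp
    then show "(\<lambda>i. \<gamma> i - \<alpha> i) \<in> {\<beta>. msize \<beta> = N - msize \<alpha>}" using g by auto
    show "1 / mfact (\<lambda>i. \<gamma> i - \<alpha> i) * lim_moment \<phi> f (\<lambda>i. \<alpha> i + (\<gamma> i - \<alpha> i)) * mpower x (\<lambda>i. \<gamma> i - \<alpha> i) =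
       1 / mfact (\<lambda>i. \<gamma> i - \<alpha> i) * lim_moment \<phi> f \<gamma> * mpower x (\<lambda>i. \<gamma> i - \<alpha> i)" by (simp only: e)
  next
    fix \<beta> :: "'n mindex" assume "\<beta> \<in> {\<beta>. msize \<beta> = N - msize \<alpha>}"
    then show "(\<lambda>i. \<alpha> i + \<beta> i) \<in> ?S" using \<alpha> by (simp add: msize_add)
    show "(\<lambda>i. \<alpha> i + \<beta> i - \<alpha> i) = \<beta>" by simp
  qed
  finally show "mderiv \<alpha> (Taylor_inf \<phi> N f) x =
    (\<Sum>\<beta> | msize \<beta> = N - msize \<alpha>. 1 / mfact \<beta> * lim_moment \<phi> f (\<lambda>i. \<alpha> i + \<beta> i) * mpower x \<beta>)" .
qed

lemma has_Pinf_dderiv: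
  fixes \<phi> :: "real ^ 'n::finite \<Rightarrow> real"
  assumes \<phi>: "kernel M \<phi>" and so: "summable_osc N K f" and \<alpha>: "msize \<alpha> \<le> N"
  shows "has_Pinf \<phi> (N - msize \<alpha>) (dderiv \<alpha> (reg f)) (mderiv \<alpha> (Taylor_inf \<phi> N f))"
  unfolding mderiv_Taylor_inf[OF \<alpha>]
proof (rule has_PinfI)
  fix \<beta> :: "'n mindex" and x0 assume "msize \<beta> = N - msize \<alpha>"
  then have "msize (\<lambda>i. \<alpha> i + \<beta> i) = N" using \<alpha> by (simp add: msize_add)
  from moment_tendsto_lim_moment[OF \<phi> so this, of x0]
  show "((\<lambda>r. moment \<phi> \<beta> x0 r (dderiv \<alpha> (reg f))) \<longlongrightarrow> lim_moment \<phi> f (\<lambda>i. \<alpha> i + \<beta> i)) at_top"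
    by (rule Lim_transform_eventually)
       (use eventually_gt_at_top[of 0] in \<open>eventually_elim, simp add: moment_dderiv[OF \<phi>]\<close>)
qed

text \<open>A distribution enters the mollified Taylor polynomials through test functions only.\<close>

lemma has_Pinf_cong:
  assumes \<phi>: "kernel M \<phi>" and "\<And>\<psi>. test_fun \<psi> \<Longrightarrow> T \<psi> = T' \<psi>" and "has_Pinf \<phi> N T Q"
  shows "has_Pinf \<phi> N T' Q"
proof -
  have m: "moment \<phi> \<alpha> x r T = moment \<phi> \<alpha> x r T'" if "0 < r" for \<alpha> x r
    unfolding moment_def conv_def
    by (intro assms(2) test_fun_reflect test_fun_mderiv kernel_test_fun_rescale[OF \<phi>] that)
  have P: "Pdot \<phi> N x0 r T = Pdot \<phi> N x0 r T'" if "0 < r" for x0 r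
    unfolding Pdot_def m[OF that] ..
  have "Pdot_tendsto \<phi> N x0 T' Q" if "Pdot_tendsto \<phi> N x0 T Q" for x0
    using that unfolding Pdot_tendsto_def
    by (rule Lim_transform_eventually)
       (use eventually_gt_at_top[of 0] in \<open>eventually_elim, simp add: P\<close>)
  with assms(3) show ?thesis by (simp add: has_Pinf_def)
qed

lemma has_Pinf_wderiv:
  assumes \<phi>: "kernel M \<phi>" and so: "summable_osc 1 K f" and w: "has_wderiv (munit k) f h"
  shows "has_Pinf \<phi> 0 (reg h) (partial k (Taylor_inf \<phi> 1 f))"
proof -
  have "has_Pinf \<phi> 0 (dderiv (munit k) (reg f)) (partial k (Taylor_inf \<phi> 1 f))"
    using has_Pinf_dderiv[OF \<phi> so, of "munit k"] by (simp add: mderiv_munit)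
  then show ?thesis
    by (rule has_Pinf_cong[OF \<phi>, rotated]) (use w in \<open>simp add: has_wderiv_def dderiv_def reg_def\<close>)
qed

section \<open>Campanato spaces as vector spaces\<close>

lemma ennpowr_mono: "0 \<le> s \<Longrightarrow> a \<le> b \<Longrightarrow> ennpowr a s \<le> ennpowr b s"
  by (cases "b = \<infinity>") (auto simp: ennpowr_def less_top top_unique intro!: ennreal_leI powr_mono2 enn2real_mono)

lemma ennpowr_add_le:
  assumes s: "0 \<le> s" "s \<le> 1" and D: "0 < D"
  shows "ennpowr (ennreal D * (a + b)) s \<le> ennreal ((2 * D) powr s) * (ennpowr a s + ennpowr b s)"
proof (cases "a = \<infinity> \<or> b = \<infinity>")
  case True
  then show ?thesis using D by (auto simp: ennpowr_def ennreal_mult_top)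
next
  case False
  define x y where "x = enn2real a" and "y = enn2real b"
  have xy: "a = ennreal x" "b = ennreal y" "0 \<le> x" "0 \<le> y" using False by (auto simp: x_def y_def less_top)
  have "(D * (x + y)) powr s \<le> (2 * D) powr s * (x powr s + y powr s)"
  proof -
    have "(D * (x + y)) powr s \<le> (2 * D * max x y) powr s"
      using xy D s by (intro powr_mono2) (auto simp: mult_le_cancel_left max_def)
    also have "\<dots> = (2 * D) powr s * (max x y) powr s" using D xy by (simp add: powr_mult)
    also have "\<dots> \<le> (2 * D) powr s * (x powr s + y powr s)"
      by (intro mult_left_mono) (auto simp: max_def)
    finally show ?thesis .
  qed
  then have "ennreal ((D * (x + y)) powr s) \<le> ennreal ((2 * D) powr s * (x powr s + y powr s))" by (rule ennreal_leI)
  also have "\<dots> = ennreal ((2 * D) powr s) * (ennreal (x powr s) + ennreal (y powr s))"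
    by (subst ennreal_mult) (auto simp: ennreal_plus)
  finally have le: "ennreal ((D * (x + y)) powr s) \<le> ennreal ((2 * D) powr s) * (ennreal (x powr s) + ennreal (y powr s))" .
  have fin: "ennpowr (ennreal z) s = ennreal (z powr s)" if "0 \<le> z" for z
    using that by (simp add: ennpowr_def)
  have "ennreal D * (a + b) = ennreal (D * (x + y))"
    using xy D by (simp add: ennreal_mult ennreal_plus)
  then show ?thesis using le xy D by (simp only: fin) (simp add: fin)
qed

text \<open>Some constant is enough for the space to be closed under linear combinations, and it comes from
  \<open>(s + t)^q \<le> 2^q (s^q + t^q)\<close> instead of Minkowski's inequality.\<close>

lemma Lp_norm_lincomb:
  fixes u v :: "real ^ 'n::finite \<Rightarrow> real"
  assumes p: "1 \<le> p"
  shows "\<exists>C>0. \<forall>u v A. u \<in> borel_measurable lebesgue \<and> v \<in> borel_measurable lebesgue \<and> A \<in> sets lebesgue \<longrightarrow>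
     Lp_norm p A (\<lambda>x :: real ^ 'n. a * u x + b * v x) \<le> ennreal C * (Lp_norm p A u + Lp_norm p A v)"
proof (cases "p = \<infinity>")
  case True
  show ?thesis
  proof (intro exI[of _ "max \<bar>a\<bar> \<bar>b\<bar> + 1"] conjI allI impI)
    fix u v :: "real ^ 'n \<Rightarrow> real" and A :: "(real ^ 'n) set"
    assume "u \<in> borel_measurable lebesgue \<and> v \<in> borel_measurable lebesgue \<and> A \<in> sets lebesgue"
    then have [measurable]: "u \<in> borel_measurable lebesgue" "v \<in> borel_measurable lebesgue" by auto
    let ?M = "restrict_space lebesgue A" and ?C = "max \<bar>a\<bar> \<bar>b\<bar> + 1"
    let ?U = "esssup ?M (\<lambda>x. ennreal \<bar>u x\<bar>)" and ?V = "esssup ?M (\<lambda>x. ennreal \<bar>v x\<bar>)"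
    have [measurable]: "u \<in> borel_measurable ?M" "v \<in> borel_measurable ?M"
      by (intro measurable_restrict_space1; measurable)+
    have "esssup ?M (\<lambda>x. ennreal \<bar>a * u x + b * v x\<bar>) \<le> ennreal ?C * (?U + ?V)"
    proof (rule esssup_I)
      show "(\<lambda>x. ennreal \<bar>a * u x + b * v x\<bar>) \<in> borel_measurable ?M" by measurable
      have "AE x in ?M. ennreal \<bar>u x\<bar> \<le> ?U" "AE x in ?M. ennreal \<bar>v x\<bar> \<le> ?V" by (rule esssup_AE)+
      then show "AE x in ?M. ennreal \<bar>a * u x + b * v x\<bar> \<le> ennreal ?C * (?U + ?V)"
      proof eventually_elim
        case (elim x)
        have "\<bar>a * u x + b * v x\<bar> \<le> \<bar>a\<bar> * \<bar>u x\<bar> + \<bar>b\<bar> * \<bar>v x\<bar>" by (simp add: abs_mult[symmetric] abs_triangle_ineq)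
        also have "\<dots> \<le> ?C * \<bar>u x\<bar> + ?C * \<bar>v x\<bar>" by (intro add_mono mult_right_mono) auto
        finally have "ennreal \<bar>a * u x + b * v x\<bar> \<le> ennreal (?C * (\<bar>u x\<bar> + \<bar>v x\<bar>))"
          by (simp add: ennreal_leI distrib_left)
        also have "\<dots> = ennreal ?C * (ennreal \<bar>u x\<bar> + ennreal \<bar>v x\<bar>)"
          by (subst ennreal_mult) (auto simp: ennreal_plus)
        also have "\<dots> \<le> ennreal ?C * (?U + ?V)" by (intro mult_left_mono add_mono elim) auto
        finally show ?case .
      qed
    qed
    then show "Lp_norm p A (\<lambda>x. a * u x + b * v x) \<le> ennreal ?C * (Lp_norm p A u + Lp_norm p A v)"
      using True by (simp add: Lp_norm_def)
  qed (auto simp: add_nonneg_pos)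
next
  case False
  define q where "q = enn2real p"
  have pq: "p = ennreal q" using False by (simp add: q_def less_top)
  have "ennreal 1 \<le> ennreal q" using p pq by simp
  then have q: "1 \<le> q" by (metis ennreal_le_iff2 not_one_le_zero)
  define s where "s = enn2real (inverse p)"
  have s: "s = 1 / q" "0 \<le> s" "s \<le> 1"
    using q pq by (auto simp: s_def inverse_ennreal inverse_eq_divide)
  define D where "D = (2 * (max \<bar>a\<bar> \<bar>b\<bar> + 1)) powr q"
  have m: "0 < max \<bar>a\<bar> \<bar>b\<bar> + 1" by (auto simp: add_nonneg_pos)
  have D: "0 < D" using m by (simp add: D_def)
  show ?thesis
  proof (intro exI[of _ "(2 * D) powr s"] conjI allI impI)
    show "0 < (2 * D) powr s" using D by simp
    fix u v :: "real ^ 'n \<Rightarrow> real" and A :: "(real ^ 'n) set"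
    assume "u \<in> borel_measurable lebesgue \<and> v \<in> borel_measurable lebesgue \<and> A \<in> sets lebesgue"
    then have [measurable]: "u \<in> borel_measurable lebesgue" "v \<in> borel_measurable lebesgue" "A \<in> sets lebesgue" by auto
    have pt: "\<bar>a * t + b * t'\<bar> powr q \<le> D * (\<bar>t\<bar> powr q + \<bar>t'\<bar> powr q)" for t t'
    proof -
      let ?c = "max \<bar>a\<bar> \<bar>b\<bar> + 1"
      have "\<bar>a * t + b * t'\<bar> \<le> \<bar>a\<bar> * \<bar>t\<bar> + \<bar>b\<bar> * \<bar>t'\<bar>" by (simp add: abs_mult[symmetric] abs_triangle_ineq)
      also have "\<dots> \<le> ?c * max \<bar>t\<bar> \<bar>t'\<bar> + ?c * max \<bar>t\<bar> \<bar>t'\<bar>" by (intro add_mono mult_mono) auto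
      finally have "\<bar>a * t + b * t'\<bar> powr q \<le> (2 * ?c * max \<bar>t\<bar> \<bar>t'\<bar>) powr q"
        using q by (intro powr_mono2) (auto simp: algebra_simps)
      also have "\<dots> = D * (max \<bar>t\<bar> \<bar>t'\<bar>) powr q" unfolding D_def using m by (subst powr_mult) auto
      also have "\<dots> \<le> D * (\<bar>t\<bar> powr q + \<bar>t'\<bar> powr q)" using D by (intro mult_left_mono) (auto simp: max_def)
      finally show ?thesis .
    qed
    let ?I = "\<lambda>u. \<integral>\<^sup>+x\<in>A. ennreal (\<bar>u x\<bar> powr q) \<partial>lebesgue"
    have "?I (\<lambda>x. a * u x + b * v x) \<le> (\<integral>\<^sup>+x. ennreal D * (ennreal (\<bar>u x\<bar> powr q) * indicator A x + ennreal (\<bar>v x\<bar> powr q) * indicator A x) \<partial>lebesgue)"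
    proof (rule nn_integral_mono)
      fix x
      have "ennreal (\<bar>a * u x + b * v x\<bar> powr q) \<le> ennreal D * (ennreal (\<bar>u x\<bar> powr q) + ennreal (\<bar>v x\<bar> powr q))"
        using ennreal_leI[OF pt[of "u x" "v x"]] D by (simp add: ennreal_mult ennreal_plus)
      then show "ennreal (\<bar>a * u x + b * v x\<bar> powr q) * indicator A x \<le>
        ennreal D * (ennreal (\<bar>u x\<bar> powr q) * indicator A x + ennreal (\<bar>v x\<bar> powr q) * indicator A x)"
        by (auto simp: indicator_def)
    qed
    also have "\<dots> = ennreal D * (?I u + ?I v)"
      by (subst nn_integral_cmult) (auto simp: nn_integral_add)
    finally have "ennpowr (?I (\<lambda>x. a * u x + b * v x)) s \<le> ennpowr (ennreal D * (?I u + ?I v)) s"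
      by (rule ennpowr_mono[OF s(2)])
    also have "\<dots> \<le> ennreal ((2 * D) powr s) * (ennpowr (?I u) s + ennpowr (?I v) s)"
      by (rule ennpowr_add_le[OF s(2,3) D])
    finally show "Lp_norm p A (\<lambda>x. a * u x + b * v x) \<le> ennreal ((2 * D) powr s) * (Lp_norm p A u + Lp_norm p A v)"
      using False by (simp add: Lp_norm_def s_def q_def)
  qed
qed

lemma INF_add_INF_le:
  fixes u v :: "'a \<Rightarrow> ennreal"
  assumes "A \<noteq> {}" "0 < C" and le: "\<And>P Q. P \<in> A \<Longrightarrow> Q \<in> A \<Longrightarrow> X \<le> ennreal C * (u P + v Q)"
  shows "X \<le> ennreal C * ((INF P\<in>A. u P) + (INF Q\<in>A. v Q))"
proof (rule ennreal_le_epsilon)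
  fix e :: real
  assume fin: "ennreal C * ((INF P\<in>A. u P) + (INF Q\<in>A. v Q)) < top" and e: "0 < e"
  define d where "d = e / (2 * C)"
  have d: "0 < d" using e assms(2) by (simp add: d_def)
  have fin': "(INF P\<in>A. u P) < top" "(INF Q\<in>A. v Q) < top"
    using fin assms(2) by (auto simp: ennreal_mult_less_top)
  have near: "\<exists>P\<in>A. w P < (INF P\<in>A. w P) + ennreal d" if "(INF P\<in>A. w P) < top" for w :: "'a \<Rightarrow> ennreal"
  proof -
    have "z < z + ennreal d" if "z < top" for z
      using that d by (cases z) (auto simp: ennreal_less_iff simp flip: ennreal_plus)
    then have "(INF P\<in>A. w P) < (INF P\<in>A. w P) + ennreal d" using that by blast
    then show ?thesis by (simp add: INF_less_iff)
  qed
  obtain P Q where PQ: "P \<in> A" "Q \<in> A" "u P < (INF P\<in>A. u P) + ennreal d" "v Q < (INF Q\<in>A. v Q) + ennreal d"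
    using near[OF fin'(1)] near[OF fin'(2)] by blast
  have "X \<le> ennreal C * (u P + v Q)" by (rule le[OF PQ(1,2)])
  also have "\<dots> \<le> ennreal C * (((INF P\<in>A. u P) + ennreal d) + ((INF Q\<in>A. v Q) + ennreal d))"
    using PQ by (intro mult_left_mono add_mono) auto
  also have "\<dots> = ennreal C * ((INF P\<in>A. u P) + (INF Q\<in>A. v Q)) + ennreal C * (ennreal d + ennreal d)"
    by (simp add: distrib_left add_ac)
  also have "ennreal C * (ennreal d + ennreal d) = ennreal e"
    using d assms(2) e by (simp add: d_def flip: ennreal_plus ennreal_mult)
  finally show "X \<le> ennreal C * ((INF P\<in>A. u P) + (INF Q\<in>A. v Q)) + ennreal e" .
qed

lemma camp_lincomb:
  fixes f g :: "real ^ 'n::finite \<Rightarrow> real"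
  assumes p: "1 \<le> p" and f: "f \<in> camp p N" and g: "g \<in> camp p N"
  shows "(\<lambda>x. a * f x + b * g x) \<in> camp p N"
proof -
  obtain C where C: "0 < C" "\<And>u v A. u \<in> borel_measurable lebesgue \<Longrightarrow> v \<in> borel_measurable lebesgue \<Longrightarrow> A \<in> sets lebesgue \<Longrightarrow>
     Lp_norm p A (\<lambda>x :: real ^ 'n. a * u x + b * v x) \<le> ennreal C * (Lp_norm p A u + Lp_norm p A v)"
    using Lp_norm_lincomb[OF p] by blast
  have fg: "f \<in> Lp_loc p" "g \<in> Lp_loc p" "camp_seminorm p N f < \<infinity>" "camp_seminorm p N g < \<infinity>"
    using f g by (auto simp: camp_def)
  have m: "f \<in> borel_measurable lebesgue" "g \<in> borel_measurable lebesgue" using fg by (auto simp: Lp_loc_def)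
  have "(\<lambda>x. a * f x + b * g x) \<in> Lp_loc p"
    unfolding Lp_loc_def
  proof (intro CollectI conjI allI impI)
    show "(\<lambda>x. a * f x + b * g x) \<in> borel_measurable lebesgue" using m by measurable
    fix K :: "(real ^ 'n) set" assume K: "compact K"
    have "Lp_norm p K (\<lambda>x. a * f x + b * g x) \<le> ennreal C * (Lp_norm p K f + Lp_norm p K g)"
      by (intro C m) (simp add: K lmeasurable_compact fmeasurableD)
    also have "\<dots> < \<infinity>" using fg K by (auto simp: Lp_loc_def ennreal_mult_less_top)
    finally show "Lp_norm p K (\<lambda>x. a * f x + b * g x) < \<infinity>" .
  qed
  moreover have osc: "osc p N (\<lambda>x. a * f x + b * g x) x r \<le> ennreal C * (osc p N f x r + osc p N g x r)" for x r
  proof -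
    have "(INF P\<in>polys N. Lp_norm p (ball x r) (\<lambda>x. a * f x + b * g x - P x)) \<le>
       ennreal C * ((INF P\<in>polys N. Lp_norm p (ball x r) (\<lambda>x. f x - P x)) + (INF Q\<in>polys N. Lp_norm p (ball x r) (\<lambda>x. g x - Q x)))"
    proof (rule INF_add_INF_le)
      show "polys N \<noteq> ({} :: (real ^ 'n \<Rightarrow> real) set)" using polys_const by blast
      fix P Q :: "real ^ 'n \<Rightarrow> real" assume P: "P \<in> polys N" and Q: "Q \<in> polys N"
      have mP: "P \<in> borel_measurable lebesgue" "Q \<in> borel_measurable lebesgue"
        using P Q by (auto intro: smooth_measurable_lebesgue smooth_polys)
      have "(\<lambda>x. a * P x + b * Q x) \<in> polys N" by (intro polys_add polys_cmult P Q)
      then have "(INF P\<in>polys N. Lp_norm p (ball x r) (\<lambda>x. a * f x + b * g x - P x)) \<le>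
          Lp_norm p (ball x r) (\<lambda>x. a * f x + b * g x - (a * P x + b * Q x))" by (rule INF_lower)
      also have "(\<lambda>x. a * f x + b * g x - (a * P x + b * Q x)) = (\<lambda>x. a * (f x - P x) + b * (g x - Q x))"
        by (simp add: algebra_simps)
      also have "Lp_norm p (ball x r) \<dots> \<le> ennreal C * (Lp_norm p (ball x r) (\<lambda>x. f x - P x) + Lp_norm p (ball x r) (\<lambda>x. g x - Q x))"
        by (intro C borel_measurable_diff m mP) (simp add: lmeasurable_ball fmeasurableD)
      finally show "(INF P\<in>polys N. Lp_norm p (ball x r) (\<lambda>x. a * f x + b * g x - P x)) \<le>
        ennreal C * (Lp_norm p (ball x r) (\<lambda>x. f x - P x) + Lp_norm p (ball x r) (\<lambda>x. g x - Q x))" .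
    qed (rule C(1))
    then show ?thesis unfolding osc_def
      by (subst distrib_left[symmetric], subst mult.left_commute) (intro mult_left_mono, auto)
  qed
  moreover have "camp_seminorm p N (\<lambda>x. a * f x + b * g x) \<le> ennreal C * (camp_seminorm p N f + camp_seminorm p N g)"
    unfolding camp_seminorm_def[of p N "\<lambda>x. a * f x + b * g x"]
  proof (intro SUP_least infsum_le_finite_sums nonneg_summable_on_complete)
    fix x :: "real ^ 'n" and J :: "int set" assume J: "finite J"
    have part: "(\<Sum>j\<in>J. ennreal (2 powi (- int N * j)) * osc p N h x (2 powi j)) \<le> camp_seminorm p N h" for h
    proof -
      have "(\<Sum>j\<in>J. ennreal (2 powi (- int N * j)) * osc p N h x (2 powi j)) = (\<Sum>\<^sub>\<infinity>j\<in>J. ennreal (2 powi (- int N * j)) * osc p N h x (2 powi j))"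
        using J by simp
      also have "\<dots> \<le> (\<Sum>\<^sub>\<infinity>j\<in>UNIV. ennreal (2 powi (- int N * j)) * osc p N h x (2 powi j))"
        by (intro infsum_mono_neutral nonneg_summable_on_complete) auto
      also have "\<dots> \<le> camp_seminorm p N h" unfolding camp_seminorm_def by (rule SUP_upper) simp
      finally show ?thesis .
    qed
    have "(\<Sum>j\<in>J. ennreal (2 powi (- int N * j)) * osc p N (\<lambda>x. a * f x + b * g x) x (2 powi j)) \<le>
      (\<Sum>j\<in>J. ennreal C * (ennreal (2 powi (- int N * j)) * osc p N f x (2 powi j) + ennreal (2 powi (- int N * j)) * osc p N g x (2 powi j)))"
    proof (rule sum_mono)
      fix j
      show "ennreal (2 powi (- int N * j)) * osc p N (\<lambda>x. a * f x + b * g x) x (2 powi j) \<le>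
        ennreal C * (ennreal (2 powi (- int N * j)) * osc p N f x (2 powi j) + ennreal (2 powi (- int N * j)) * osc p N g x (2 powi j))"
        using mult_left_mono[OF osc[of x "2 powi j"], of "ennreal (2 powi (- int N * j))"]
        by (simp only: zero_le distrib_left mult.left_commute)
    qed
    also have "\<dots> = ennreal C * ((\<Sum>j\<in>J. ennreal (2 powi (- int N * j)) * osc p N f x (2 powi j)) + (\<Sum>j\<in>J. ennreal (2 powi (- int N * j)) * osc p N g x (2 powi j)))"
      by (simp only: sum_distrib_left[symmetric] sum.distrib)
    also have "\<dots> \<le> ennreal C * (camp_seminorm p N f + camp_seminorm p N g)" by (intro mult_left_mono add_mono part) simp
    finally show "(\<Sum>j\<in>J. ennreal (2 powi (- int N * j)) * osc p N (\<lambda>x. a * f x + b * g x) x (2 powi j)) \<le>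
       ennreal C * (camp_seminorm p N f + camp_seminorm p N g)" .
  qed simp
  then have "camp_seminorm p N (\<lambda>x. a * f x + b * g x) < \<infinity>"
    by (rule le_less_trans) (use fg in \<open>auto simp: ennreal_mult_less_top\<close>)
  ultimately show ?thesis by (simp add: camp_def)
qed

lemma continuous_Lp_loc:
  fixes f :: "real ^ 'n::finite \<Rightarrow> real"
  assumes p: "1 \<le> p" and f: "continuous_on UNIV f" shows "f \<in> Lp_loc p"
  unfolding Lp_loc_def
proof (intro CollectI conjI allI impI)
  show m[measurable]: "f \<in> borel_measurable lebesgue"
    using f by (simp add: measurable_completion borel_measurable_continuous_onI)
  fix K :: "(real ^ 'n) set" assume K: "compact K"
  then have [measurable]: "K \<in> sets lebesgue" by (simp add: lmeasurable_compact fmeasurableD)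
  have "compact (f ` K)" by (intro compact_continuous_image continuous_on_subset[OF f] K) auto
  then obtain B where B: "\<And>x. x \<in> K \<Longrightarrow> \<bar>f x\<bar> \<le> B" using compact_imp_bounded by (force simp: bounded_iff)
  show "Lp_norm p K f < \<infinity>"
  proof (cases "p = \<infinity>")
    case True
    have "esssup (restrict_space lebesgue K) (\<lambda>x. ennreal \<bar>f x\<bar>) \<le> ennreal B"
    proof (rule esssup_I)
      show "(\<lambda>x. ennreal \<bar>f x\<bar>) \<in> borel_measurable (restrict_space lebesgue K)"
        by (intro measurable_restrict_space1) measurable
      show "AE x in restrict_space lebesgue K. ennreal \<bar>f x\<bar> \<le> ennreal B"
        by (rule AE_I2) (auto simp: space_restrict_space intro!: ennreal_leI B)
    qed
    then show ?thesis using True by (simp add: Lp_norm_def le_less_trans[OF _ ennreal_less_top])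
  next
    case False
    have "(\<integral>\<^sup>+x\<in>K. ennreal (\<bar>f x\<bar> powr enn2real p) \<partial>lebesgue) \<le> (\<integral>\<^sup>+x\<in>K. ennreal (\<bar>B\<bar> powr enn2real p) \<partial>lebesgue)"
    proof (rule nn_integral_mono)
      fix x
      have "\<bar>f x\<bar> powr enn2real p \<le> \<bar>B\<bar> powr enn2real p" if "x \<in> K"
        using B[OF that] by (intro powr_mono2) auto
      then show "ennreal (\<bar>f x\<bar> powr enn2real p) * indicator K x \<le> ennreal (\<bar>B\<bar> powr enn2real p) * indicator K x"
        by (auto simp: indicator_def intro!: ennreal_leI)
    qed
    also have "\<dots> < \<infinity>"
      using emeasure_compact_finite[OF K] K by (simp add: nn_integral_cmult_indicator ennreal_mult_less_top borel_compact)
    finally have "(\<integral>\<^sup>+x\<in>K. ennreal (\<bar>f x\<bar> powr enn2real p) \<partial>lebesgue) \<noteq> \<infinity>" by auto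
    then show ?thesis using False by (simp add: Lp_norm_def ennpowr_def)
  qed
qed

lemma polys_subset_camp:
  fixes P :: "real ^ 'n::finite \<Rightarrow> real"
  assumes p: "1 \<le> p" and P: "P \<in> polys N" shows "P \<in> camp p N"
proof -
  have "osc p N P x r = 0" for x r
  proof -
    have "Lp_norm p (ball x r) (\<lambda>x. P x - P x) = 0"
    proof (cases "p = \<infinity>")
      case True
      have "esssup (restrict_space lebesgue (ball x r)) (\<lambda>x. ennreal \<bar>P x - P x\<bar>) \<le> 0"
        by (rule esssup_I) auto
      then show ?thesis using True by (simp add: Lp_norm_def)
    next
      case False
      then show ?thesis by (simp add: Lp_norm_def ennpowr_def)
    qed
    then have "(INF Q\<in>polys N. Lp_norm p (ball x r) (\<lambda>x. P x - Q x)) \<le> 0" using INF_lower[OF P] by metis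
    then show ?thesis by (simp add: osc_def)
  qed
  then have "camp_seminorm p N P = 0" by (simp add: camp_seminorm_def)
  then show ?thesis using continuous_Lp_loc[OF p smooth_imp_continuous[OF smooth_polys[OF P]]] by (simp add: camp_def)
qed

text \<open>A derivative of order \<open>N\<close> of \<open>w\<close> is constant, and kernels reproduce constants, so the moments do not
  depend on the scale and return the Taylor coefficients of \<open>w\<close>.\<close>

lemma has_Pinf_hpolys:
  fixes w \<phi> :: "real ^ 'n::finite \<Rightarrow> real"
  assumes \<phi>: "kernel M \<phi>" and w: "w \<in> hpolys N"
  shows "has_Pinf \<phi> N (reg w) w"
proof -
  obtain a where a: "w = (\<lambda>x. \<Sum>\<alpha> | msize \<alpha> = N. a \<alpha> * mpower x \<alpha>)" using w by (auto simp: hpolys_def)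
  have wP: "w \<in> polys N" using w hpolys_subset_polys by blast
  have D: "mderiv \<alpha> w x = mfact \<alpha> * a \<alpha>" if \<alpha>: "msize \<alpha> = N" for \<alpha> x
  proof -
    have mono: "mderiv \<alpha> (\<lambda>x. mpower x \<beta>) x = (if \<beta> = \<alpha> then mfact \<alpha> else 0)" if \<beta>: "msize \<beta> = N" for \<beta>
    proof (cases "\<forall>i. \<alpha> i \<le> \<beta> i")
      case True
      then have "(\<Sum>i\<in>UNIV. \<beta> i - \<alpha> i) = msize \<beta> - msize \<alpha>" by (simp add: msize_def sum_subtractf_nat)
      then have "\<beta> i - \<alpha> i = 0" for i using \<alpha> \<beta> by simp
      then have "\<beta> = \<alpha>" using True by (auto simp: fun_eq_iff intro: antisym)
      then show ?thesis by (simp add: mderiv_mpower) (simp add: mfact_def)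
    next
      case False
      then have "\<beta> \<noteq> \<alpha>" by blast
      then show ?thesis by (simp only: mderiv_mpower if_not_P[OF False] if_False)
    qed
    have "mderiv \<alpha> w x = (\<Sum>\<beta> | msize \<beta> = N. a \<beta> * mderiv \<alpha> (\<lambda>x. mpower x \<beta>) x)"
      unfolding a by (subst mderiv_sum) (auto intro: smooth_cmult smooth_mpower simp: mderiv_cmult smooth_mpower)
    also have "\<dots> = (\<Sum>\<beta> | msize \<beta> = N. if \<beta> = \<alpha> then mfact \<alpha> * a \<alpha> else 0)"
      by (rule sum.cong) (auto simp: mono)
    finally show ?thesis using \<alpha> by simp
  qed
  have "has_Pinf \<phi> N (reg w) (\<lambda>x. \<Sum>\<alpha> | msize \<alpha> = N. 1 / mfact \<alpha> * (mfact \<alpha> * a \<alpha>) * mpower x \<alpha>)"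
  proof (rule has_PinfI)
    fix \<alpha> :: "'n mindex" and x0 assume \<alpha>: "msize \<alpha> = N"
    have "\<forall>\<^sub>F r in at_top. mfact \<alpha> * a \<alpha> = moment \<phi> \<alpha> x0 r (reg w)"
      using eventually_gt_at_top[of 0]
      by eventually_elim (simp add: moment_def kernel_reproduces_mderiv[OF \<phi> wP] \<alpha> D)
    then show "((\<lambda>r. moment \<phi> \<alpha> x0 r (reg w)) \<longlongrightarrow> mfact \<alpha> * a \<alpha>) at_top"
      by (rule Lim_transform_eventually[OF tendsto_const])
  qed
  moreover have "(\<lambda>x. \<Sum>\<alpha> | msize \<alpha> = N. 1 / mfact \<alpha> * (mfact \<alpha> * a \<alpha>) * mpower x \<alpha>) = w"
  proof -
    have "mfact \<alpha> \<noteq> 0" for \<alpha> :: "'n mindex" using mfact_pos[of \<alpha>] by simp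
    then show ?thesis unfolding a by (intro ext sum.cong) auto
  qed
  ultimately show ?thesis by simp
qed

lemma has_Pinf_lincomb:
  fixes f g \<phi> :: "real ^ 'n::finite \<Rightarrow> real"
  assumes \<phi>: "kernel M \<phi>" and f: "summable_osc N K f" and g: "summable_osc N L g"
  shows "has_Pinf \<phi> N (reg (\<lambda>x. a * f x + b * g x)) (\<lambda>x. a * Taylor_inf \<phi> N f x + b * Taylor_inf \<phi> N g x)"
proof -
  have "has_Pinf \<phi> N (reg (\<lambda>x. a * f x + b * g x))
    (\<lambda>x. \<Sum>\<alpha> | msize \<alpha> = N. 1 / mfact \<alpha> * (a * lim_moment \<phi> f \<alpha> + b * lim_moment \<phi> g \<alpha>) * mpower x \<alpha>)"
  proof (rule has_PinfI)
    fix \<alpha> :: "'n mindex" and x0 assume \<alpha>: "msize \<alpha> = N"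
    have "((\<lambda>r. a * moment \<phi> \<alpha> x0 r (reg f) + b * moment \<phi> \<alpha> x0 r (reg g)) \<longlongrightarrow> a * lim_moment \<phi> f \<alpha> + b * lim_moment \<phi> g \<alpha>) at_top"
      by (intro tendsto_intros moment_tendsto_lim_moment[OF \<phi> f \<alpha>] moment_tendsto_lim_moment[OF \<phi> g \<alpha>])
    moreover have "\<forall>\<^sub>F r in at_top. a * moment \<phi> \<alpha> x0 r (reg f) + b * moment \<phi> \<alpha> x0 r (reg g) = moment \<phi> \<alpha> x0 r (reg (\<lambda>x. a * f x + b * g x))"
      using eventually_gt_at_top[of 0]
    proof eventually_elim
      case (elim r)
      let ?\<psi> = "mderiv \<alpha> (rescale \<phi> r)"
      have t: "test_fun (\<lambda>y. ?\<psi> (x0 - y))"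
        by (intro test_fun_reflect test_fun_mderiv kernel_test_fun_rescale[OF \<phi> elim])
      have i: "integrable lebesgue (\<lambda>y. f y * ?\<psi> (x0 - y))" "integrable lebesgue (\<lambda>y. g y * ?\<psi> (x0 - y))"
        by (intro Lp_loc_1_integrable_test t summable_osc_Lp_loc[OF f] summable_osc_Lp_loc[OF g])+
      have "moment \<phi> \<alpha> x0 r (reg (\<lambda>x. a * f x + b * g x)) = (LINT y|lebesgue. a * (f y * ?\<psi> (x0 - y)) + b * (g y * ?\<psi> (x0 - y)))"
        unfolding moment_def conv_reg by (simp add: algebra_simps)
      then show ?case using i by (simp add: moment_def conv_reg)
    qed
    ultimately show "((\<lambda>r. moment \<phi> \<alpha> x0 r (reg (\<lambda>x. a * f x + b * g x))) \<longlongrightarrow> a * lim_moment \<phi> f \<alpha> + b * lim_moment \<phi> g \<alpha>) at_top"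
      by (rule Lim_transform_eventually)
  qed
  moreover have "(\<lambda>x. \<Sum>\<alpha> | msize \<alpha> = N. 1 / mfact \<alpha> * (a * lim_moment \<phi> f \<alpha> + b * lim_moment \<phi> g \<alpha>) * mpower x \<alpha>) =
     (\<lambda>x. a * Taylor_inf \<phi> N f x + b * Taylor_inf \<phi> N g x)"
    unfolding Taylor_inf_def by (simp add: sum_distrib_left sum.distrib algebra_simps add_divide_distrib)
  ultimately show ?thesis by simp
qed

theorem linear_projection_Pinf:
  fixes \<phi> :: "real ^ 'n::finite \<Rightarrow> real"
  assumes p: "1 \<le> p" and \<phi>: "kernel M \<phi>"
  shows "linear_projection (camp p N) (hpolys N) (\<lambda>f. Pinf \<phi> N (reg f))"
  unfolding linear_projection_def
proof (intro conjI ballI allI)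
  note so = camp_summable_osc[OF p]
  show "hpolys N \<subseteq> camp p N" using hpolys_subset_polys polys_subset_camp[OF p] by blast
  show "Pinf \<phi> N (reg f) \<in> hpolys N" if "f \<in> camp p N" for f
    using has_Pinf_reg[OF \<phi> so[OF that]] has_Pinf_imp_Pinf by (metis has_Pinf_def)
  show "Pinf \<phi> N (reg w) = w" if "w \<in> hpolys N" for w
    by (rule has_Pinf_imp_Pinf[OF has_Pinf_hpolys[OF \<phi> that]])
  fix f g :: "real ^ 'n \<Rightarrow> real" and a b assume f: "f \<in> camp p N" and g: "g \<in> camp p N"
  show "(\<lambda>x. a * f x + b * g x) \<in> camp p N" by (rule camp_lincomb[OF p f g])
  show "Pinf \<phi> N (reg (\<lambda>x. a * f x + b * g x)) = (\<lambda>x. a * Pinf \<phi> N (reg f) x + b * Pinf \<phi> N (reg g) x)"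
    unfolding has_Pinf_imp_Pinf[OF has_Pinf_reg[OF \<phi> so[OF f]]] has_Pinf_imp_Pinf[OF has_Pinf_reg[OF \<phi> so[OF g]]]
    by (rule has_Pinf_imp_Pinf[OF has_Pinf_lincomb[OF \<phi> so[OF f] so[OF g]]])
qed

section \<open>Blow-down of functions with summable first order oscillation\<close>

lemma partial_Taylor_inf_1:
  fixes k :: "'n::finite"
  shows "partial k (Taylor_inf \<phi> 1 f) = (\<lambda>x. lim_moment \<phi> f (munit k))"
proof -
  have "{\<beta> :: 'n mindex. msize \<beta> = 0} = {\<lambda>i. 0}" by (auto simp: msize_eq_0_iff)
  then show ?thesis
    using mderiv_Taylor_inf[of "munit k" 1 \<phi> f] by (simp add: mderiv_munit mfact_def)
qed

definition linear_at :: "('n::finite \<Rightarrow> real) \<Rightarrow> real ^ 'n \<Rightarrow> real ^ 'n \<Rightarrow> real" where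
  "linear_at b x0 y = (\<Sum>i\<in>UNIV. b i * (y $ i - x0 $ i))"

lemma linear_at_polys: "linear_at b x0 \<in> polys 1"
proof -
  have "(\<lambda>y. \<Sum>i\<in>UNIV. b i * (y $ i + - (x0 $ i))) \<in> polys 1"
    using polys_coord by (intro polys_sum polys_cmult polys_add polys_const) simp
  then show ?thesis by (simp add: linear_at_def[abs_def])
qed

lemma smooth_linear_at: "smooth (linear_at b x0)"
  by (rule smooth_polys[OF linear_at_polys])

lemma partial_linear_at: "partial k (linear_at b x0) = (\<lambda>y. b k)"
proof
  fix y
  have "((\<lambda>y. \<Sum>i\<in>UNIV. b i * (y $ i - x0 $ i)) has_derivative (\<lambda>h. \<Sum>i\<in>UNIV. b i * h $ i)) (at y)"
    by (auto intro!: derivative_eq_intros bounded_linear_imp_has_derivative[OF bounded_linear_vec_nth])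
  from partial_eqI[OF this, of k] show "partial k (linear_at b x0) y = b k"
    by (simp add: linear_at_def[abs_def] axis_def if_distrib[where f = "\<lambda>u. _ * u"] cong: if_cong)
qed

lemma abs_linear_at_le: "\<bar>linear_at b x0 y\<bar> \<le> (\<Sum>i\<in>UNIV. \<bar>b i\<bar>) * dist x0 y"
proof -
  have "\<bar>linear_at b x0 y\<bar> \<le> (\<Sum>i\<in>UNIV. \<bar>b i\<bar> * dist x0 y)"
    unfolding linear_at_def
  proof (intro order_trans[OF sum_abs] sum_mono)
    fix i
    have "\<bar>(y - x0) $ i\<bar> \<le> norm (y - x0)" by (rule component_le_norm_cart)
    then show "\<bar>b i * (y $ i - x0 $ i)\<bar> \<le> \<bar>b i\<bar> * dist x0 y"
      by (simp add: abs_mult dist_norm norm_minus_commute mult_left_mono)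
  qed
  then show ?thesis by (simp add: sum_distrib_right)
qed

lemma Lipschitz_mollification_bound:
  fixes f F \<Phi> :: "real ^ 'n::finite \<Rightarrow> real"
  assumes \<Phi>: "kernel M \<Phi>" and f: "f \<in> Lp_loc 1" and ae: "AE x in lebesgue. f x = F x"
    and lip: "L-lipschitz_on UNIV F"
  shows "\<exists>C>0. \<forall>r>0. \<forall>x. \<bar>conv (reg f) (rescale \<Phi> r) x - F x\<bar> \<le> C * r"
proof -
  obtain B where B: "0 < B" "\<And>r y. 0 < r \<Longrightarrow> \<bar>rescale \<Phi> r y\<bar> \<le> B / r ^ CARD('n)"
    using kernel_rescale_bound[OF \<Phi>] by metis
  let ?w = "measure lebesgue (ball (0 :: real ^ 'n) 1)"
  have w: "0 < ?w" by (rule measure_unit_ball_pos)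
  have L: "0 \<le> L" using lip by (simp add: lipschitz_on_nonneg)
  have FL: "F \<in> Lp_loc 1" by (rule Lp_loc_1_continuous[OF lipschitz_on_continuous_on[OF lip]])
  show ?thesis
  proof (intro exI[of _ "B * (L * ?w) + 1"] conjI allI impI)
    fix r :: real and x :: "real ^ 'n" assume r: "0 < r"
    let ?\<psi> = "rescale \<Phi> r"
    have t: "test_fun ?\<psi>" and su: "supp_cball 0 r ?\<psi>"
      using \<Phi> r by (auto intro: kernel_test_fun_rescale kernel_supp_rescale)
    have one: "(LINT y|lebesgue. ?\<psi> (x - y)) = 1"
      using lebesgue_integral_reflect[OF test_fun_borel[OF t], of x] kernel_integral[OF \<Phi> r] by simp
    have "conv (reg f) ?\<psi> x = (LINT y|lebesgue. F y * ?\<psi> (x - y))"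
      using conv_cong_AE[OF ae f FL t, of x] by (simp only: conv_reg)
    then have "conv (reg f) ?\<psi> x - F x = (LINT y|lebesgue. (F y - F x) * ?\<psi> (x - y))"
      unfolding left_diff_distrib
      using Lp_loc_1_integrable_test[OF FL test_fun_reflect[OF t]] test_fun_integrable[OF test_fun_reflect[OF t]] one
      by (subst Bochner_Integration.integral_diff) auto
    also have "\<bar>\<dots>\<bar> \<le> B / r ^ CARD('n) * (LINT y|lebesgue. indicator (cball x r) y * \<bar>F y - F x\<bar>)"
    proof (rule integral_mult_bound)
      show "(\<lambda>y. F y - F x) \<in> Lp_loc 1" by (intro Lp_loc_1_diff FL smooth_Lp_loc_1 smooth_const)
      show "supp_cball x r (\<lambda>y. ?\<psi> (x - y))" using supp_cball_reflect[OF su, of x] by simp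
    qed (rule B(2)[OF r])
    also have "\<dots> \<le> B / r ^ CARD('n) * (L * r * (r ^ CARD('n) * ?w))"
    proof (intro mult_left_mono integral_indicator_cball_le Lp_loc_1_diff FL smooth_Lp_loc_1 smooth_const r)
      fix y assume "dist x y \<le> r"
      have "\<bar>F y - F x\<bar> \<le> L * dist y x" using lipschitz_onD[OF lip, of y x] by (simp add: dist_real_def)
      also have "\<dots> \<le> L * r" using \<open>dist x y \<le> r\<close> L by (intro mult_left_mono) (auto simp: dist_commute)
      finally show "\<bar>F y - F x\<bar> \<le> L * r" .
    qed (use B L r in auto)
    also have "\<dots> = B * (L * ?w) * r" using r by simp
    also have "\<dots> \<le> (B * (L * ?w) + 1) * r" using r by (simp add: distrib_right)
    finally show "\<bar>conv (reg f) ?\<psi> x - F x\<bar> \<le> (B * (L * ?w) + 1) * r" .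
  qed (use B L w in \<open>auto intro!: add_nonneg_pos mult_nonneg_nonneg\<close>)
qed

lemma integral_linear_ball:
  fixes x0 :: "real ^ 'n::finite"
  assumes R: "0 < R"
  shows "(LINT y|lebesgue. indicator (ball x0 R) y * \<bar>c + linear_at d x0 y\<bar>)
    \<le> (\<bar>c\<bar> + R * (\<Sum>i\<in>UNIV. \<bar>d i\<bar>)) * (R ^ CARD('n) * measure lebesgue (ball (0 :: real ^ 'n) 1))"
proof -
  have sm: "smooth (\<lambda>y. c + linear_at d x0 y)" by (intro smooth_add smooth_const smooth_linear_at)
  have "(LINT y|lebesgue. indicator (ball x0 R) y * \<bar>c + linear_at d x0 y\<bar>) \<le> (LINT y|lebesgue. indicator (cball x0 R) y * \<bar>c + linear_at d x0 y\<bar>)"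
  proof (rule integral_mono)
    show "integrable lebesgue (\<lambda>y. indicator (cball x0 R) y * \<bar>c + linear_at d x0 y\<bar>)"
      using integrable_abs[OF Lp_loc_1_integrable_cball[OF smooth_Lp_loc_1[OF sm], of x0 R]] by (simp add: abs_mult)
    show "integrable lebesgue (\<lambda>y. indicator (ball x0 R) y * \<bar>c + linear_at d x0 y\<bar>)"
      by (intro integrable_indicator_ball smooth_Lp_loc_1 sm)
  qed (auto simp: indicator_def)
  also have "\<dots> \<le> (\<bar>c\<bar> + R * (\<Sum>i\<in>UNIV. \<bar>d i\<bar>)) * (R ^ CARD('n) * measure lebesgue (ball (0 :: real ^ 'n) 1))"
  proof (intro integral_indicator_cball_le smooth_Lp_loc_1 sm R)
    fix y assume y: "dist x0 y \<le> R"
    have "\<bar>c + linear_at d x0 y\<bar> \<le> \<bar>c\<bar> + (\<Sum>i\<in>UNIV. \<bar>d i\<bar>) * dist x0 y" using abs_linear_at_le[of d x0 y] by linarith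
    also have "\<dots> \<le> \<bar>c\<bar> + (\<Sum>i\<in>UNIV. \<bar>d i\<bar>) * R" using y by (intro add_mono mult_left_mono sum_nonneg) auto
    finally show "\<bar>c + linear_at d x0 y\<bar> \<le> \<bar>c\<bar> + R * (\<Sum>i\<in>UNIV. \<bar>d i\<bar>)" by (simp add: mult.commute)
  qed (use R in \<open>auto intro!: add_nonneg_nonneg mult_nonneg_nonneg sum_nonneg\<close>)
  finally show ?thesis .
qed

lemma L1dist_ball_triangle:
  assumes "f \<in> Lp_loc 1" "P \<in> Lp_loc 1" "Q \<in> Lp_loc 1"
  shows "L1dist_ball f Q z R \<le> L1dist_ball f P z R + (LINT y|lebesgue. indicator (ball z R) y * \<bar>P y - Q y\<bar>)"
proof -
  have i: "integrable lebesgue (\<lambda>y. indicator (ball z R) y * \<bar>f y - P y\<bar>)"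
    "integrable lebesgue (\<lambda>y. indicator (ball z R) y * \<bar>P y - Q y\<bar>)"
    "integrable lebesgue (\<lambda>y. indicator (ball z R) y * \<bar>f y - Q y\<bar>)"
    by (intro integrable_indicator_ball Lp_loc_1_diff assms)+
  have "L1dist_ball f Q z R \<le> (LINT y|lebesgue. indicator (ball z R) y * \<bar>f y - P y\<bar> + indicator (ball z R) y * \<bar>P y - Q y\<bar>)"
    unfolding L1dist_ball_def
    by (intro integral_mono i Bochner_Integration.integrable_add) (auto simp: indicator_def)
  also have "\<dots> = L1dist_ball f P z R + (LINT y|lebesgue. indicator (ball z R) y * \<bar>P y - Q y\<bar>)"
    unfolding L1dist_ball_def by (rule Bochner_Integration.integral_add[OF i(1,2)])
  finally show ?thesis .
qed

text \<open>The slope of the best approximating affine function converges by the convergence of the moments.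
  Its value at the centre is \<open>o(R)\<close>: it is close to the mollification of \<open>f\<close> at the much smaller
  scale \<open>\<delta> R\<close>, which by Lipschitz continuity is within \<open>O(\<delta> R)\<close> of the value of \<open>f\<close>.\<close>

theorem blow_down:
  fixes f \<phi> :: "real ^ 'n::finite \<Rightarrow> real"
  assumes \<phi>: "kernel 0 \<phi>" and so: "summable_osc 1 K f"
  shows "((\<lambda>R. L1dist_ball f (linear_at (\<lambda>i. lim_moment \<phi> f (munit i)) x0) x0 R / R ^ (CARD('n) + 1)) \<longlongrightarrow> 0) at_top"
proof (rule tendstoI)
  let ?b = "\<lambda>i. lim_moment \<phi> f (munit i)" and ?w = "measure lebesgue (ball (0 :: real ^ 'n) 1)" and ?k = "CARD('n) + 1"
  fix e :: real assume e: "0 < e"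
  note f = summable_osc_Lp_loc[OF so]
  have w: "0 < ?w" by (rule measure_unit_ball_pos)
  obtain \<Phi> :: "real ^ 'n \<Rightarrow> real" where \<Phi>: "kernel 1 \<Phi>" using ex_kernel[OF \<phi>] by blast
  have "\<exists>F L. L-lipschitz_on UNIV F \<and> (AE x in lebesgue. f x = F x)"
  proof -
    obtain C where C: "\<exists>F. Ck (1 - 1) F \<and> (AE x in lebesgue. f x = F x) \<and>
      (\<forall>\<alpha>. msize \<alpha> \<le> 1 - 1 \<longrightarrow> \<bar>mderiv \<alpha> F 0\<bar> \<le> C * (K + L1dist_ball f (\<lambda>x. 0) 0 1)) \<and>
      (\<forall>\<alpha>. msize \<alpha> = 1 - 1 \<longrightarrow> (C * (K + L1dist_ball f (\<lambda>x. 0) 0 1))-lipschitz_on UNIV (mderiv \<alpha> F)) \<and>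
      (\<forall>x i. \<bar>mollified \<Phi> f (\<lambda>j. 0) i x - F x\<bar> \<le> C * K * (1 / 2) ^ i)"
      using summable_osc_regularity[OF \<Phi>] so by blast
    then obtain F where F: "AE x in lebesgue. f x = F x"
      "\<forall>\<alpha>. msize \<alpha> = 1 - 1 \<longrightarrow> (C * (K + L1dist_ball f (\<lambda>x. 0) 0 1))-lipschitz_on UNIV (mderiv \<alpha> F)" by blast
    have "(C * (K + L1dist_ball f (\<lambda>x. 0) 0 1))-lipschitz_on UNIV (mderiv (\<lambda>i. 0) F)"
      by (rule F(2)[rule_format]) simp
    then show ?thesis using F(1) by auto
  qed
  then obtain F L where F: "L-lipschitz_on UNIV F" "AE x in lebesgue. f x = F x" by blast
  obtain C1 where C1: "0 < C1" "\<And>r x. 0 < r \<Longrightarrow> \<bar>conv (reg f) (rescale \<Phi> r) x - F x\<bar> \<le> C1 * r"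
    using Lipschitz_mollification_bound[OF \<Phi> f F(2,1)] by blast
  obtain C0 where C0: "0 < C0" "\<And>f N P r x z R. f \<in> Lp_loc 1 \<and> P \<in> polys N \<and> N \<le> 1 + msize (\<lambda>i :: 'n. 0) \<and> 0 < r \<and> cball x r \<subseteq> ball z R \<Longrightarrow>
    \<bar>conv (reg f) (mderiv (\<lambda>i. 0) (rescale \<Phi> r)) x - mderiv (\<lambda>i. 0) P x\<bar> \<le> C0 / r ^ (CARD('n) + msize (\<lambda>i :: 'n. 0)) * L1dist_ball f P z R"
    using mollified_derivative_near_poly[OF \<Phi>, of "\<lambda>i. 0"] by metis
  have "\<forall>i. \<exists>C>0. \<forall>f N P r x z R. f \<in> Lp_loc 1 \<and> P \<in> polys N \<and> N \<le> 0 + msize (munit i) \<and> 0 < r \<and> cball x r \<subseteq> ball z R \<longrightarrow>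
    \<bar>conv (reg f) (mderiv (munit i) (rescale \<phi> r)) x - mderiv (munit i) P x\<bar> \<le> C / r ^ (CARD('n) + msize (munit i)) * L1dist_ball f P z R"
    using mollified_derivative_near_poly[OF \<phi>] by blast
  then obtain D where D: "\<And>i. 0 < D i" "\<And>i f N P r x z R. f \<in> Lp_loc 1 \<and> P \<in> polys N \<and> N \<le> 0 + msize (munit i) \<and> 0 < r \<and> cball x r \<subseteq> ball z R \<Longrightarrow>
    \<bar>conv (reg f) (mderiv (munit i) (rescale \<phi> r)) x - mderiv (munit i) P x\<bar> \<le> D i / r ^ (CARD('n) + msize (munit i)) * L1dist_ball f P z R"
    by metis
  \<comment> \<open>the scale at which the Lipschitz bound contributes at most half of \<open>e\<close>\<close>
  define \<delta> where "\<delta> = min (1 / 2) (e / (2 * ?w * C1))"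
  have \<delta>: "0 < \<delta>" "\<delta> < 1" "?w * C1 * \<delta> \<le> e / 2"
  proof -
    show "0 < \<delta>" "\<delta> < 1" using e w C1(1) by (auto simp: \<delta>_def)
    have "?w * C1 * \<delta> \<le> ?w * C1 * (e / (2 * ?w * C1))" using w C1(1) by (intro mult_left_mono) (auto simp: \<delta>_def)
    also have "\<dots> = e / 2" using w C1(1) by simp
    finally show "?w * C1 * \<delta> \<le> e / 2" .
  qed
  let ?m = "\<lambda>i R. moment \<phi> (munit i) x0 (R / 2) (reg f)"
  \<comment> \<open>\<open>A\<close> collects the contributions of the best approximation, \<open>G\<close> everything that tends to zero for fixed \<open>\<delta>\<close>\<close>
  define A where "A = 1 + ?w * (C0 / \<delta> ^ CARD('n) + (\<Sum>i\<in>UNIV. D i * 2 ^ ?k))"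
  define G where "G R = A * (scaled_best 1 f x0 R + 1 / R ^ ?k) + ?w * (\<bar>F x0\<bar> / R + (\<Sum>i\<in>UNIV. \<bar>?m i R - ?b i\<bar>))" for R
  have half: "filterlim (\<lambda>R :: real. R / 2) at_top at_top"
    using filterlim_tendsto_pos_mult_at_top[OF tendsto_const[of "1/2 :: real"] _ filterlim_ident] by simp
  have "(G \<longlongrightarrow> A * (0 + 0) + ?w * (0 + (\<Sum>i\<in>(UNIV :: 'n set). 0))) at_top"
    unfolding G_def
  proof (intro tendsto_add tendsto_mult tendsto_const tendsto_sum scaled_best_tendsto_0[OF so])
    show "((\<lambda>R :: real. 1 / R ^ ?k) \<longlongrightarrow> 0) at_top"
      by (intro tendsto_divide_0[OF tendsto_const] filterlim_at_top_imp_at_infinity filterlim_pow_at_top filterlim_ident) simp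
    show "((\<lambda>R. \<bar>F x0\<bar> / R) \<longlongrightarrow> 0) at_top"
      by (intro tendsto_divide_0[OF tendsto_const] filterlim_at_top_imp_at_infinity filterlim_ident)
    show "((\<lambda>R. \<bar>?m i R - ?b i\<bar>) \<longlongrightarrow> 0) at_top" for i
      by (intro tendsto_rabs_zero LIM_zero filterlim_compose[OF moment_tendsto_lim_moment[OF \<phi> so] half]) simp
  qed
  then have "\<forall>\<^sub>F R in at_top. G R < e / 2" using e by (intro order_tendstoD(2)) auto
  then show "\<forall>\<^sub>F R in at_top. dist (L1dist_ball f (linear_at ?b x0) x0 R / R ^ ?k) 0 < e"
    using eventually_gt_at_top[of 0]
  proof eventually_elim
    case (elim R)
    note R = elim(2)
    obtain P where P: "P \<in> polys 1" "L1dist_ball f P x0 R < best_L1 1 f x0 R + 1"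
      using ex_near_best[of 1 1 f x0 R] by auto
    let ?E = "L1dist_ball f P x0 R"
    obtain c q where cq: "P = (\<lambda>y. c + (\<Sum>i\<in>UNIV. q i * (y $ i - x0 $ i)))"
      using polys_1_affine[OF P(1), of x0] by blast
    then have Pl: "P = (\<lambda>y. c + linear_at q x0 y)" by (simp add: linear_at_def)
    have q: "mderiv (munit i) P x0 = q i" for i
    proof -
      have "partial i P x0 = partial i (\<lambda>y. c) x0 + partial i (linear_at q x0) x0"
        unfolding Pl by (intro partial_add smooth_differentiable smooth_const smooth_linear_at)
      then show ?thesis by (simp add: mderiv_munit partial_linear_at)
    qed
    have slope: "\<bar>q i - ?b i\<bar> \<le> D i * 2 ^ ?k * (?E / R ^ ?k) + \<bar>?m i R - ?b i\<bar>" for i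
    proof -
      have "\<bar>?m i R - q i\<bar> \<le> D i / (R / 2) ^ (CARD('n) + msize (munit i)) * ?E"
        unfolding moment_def q[symmetric] using R f P(1)
        by (intro D(2)[of f P 1]) (simp add: cball_subset_ball_iff)
      also have "\<dots> = D i * 2 ^ ?k * (?E / R ^ ?k)" by (simp add: power_divide)
      finally show ?thesis by linarith
    qed
    have center: "\<bar>c\<bar> \<le> \<bar>F x0\<bar> + C1 * (\<delta> * R) + C0 / \<delta> ^ CARD('n) * (?E / R ^ CARD('n))"
    proof -
      have "\<bar>conv (reg f) (rescale \<Phi> (\<delta> * R)) x0 - P x0\<bar> \<le> C0 / (\<delta> * R) ^ CARD('n) * ?E"
        using C0(2)[of f P 1 "\<delta> * R" x0 x0 R] f P(1) R \<delta> by (simp add: cball_subset_ball_iff)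
      also have "\<dots> = C0 / \<delta> ^ CARD('n) * (?E / R ^ CARD('n))" by (simp add: power_mult_distrib)
      finally have "\<bar>conv (reg f) (rescale \<Phi> (\<delta> * R)) x0 - P x0\<bar> \<le> C0 / \<delta> ^ CARD('n) * (?E / R ^ CARD('n))" .
      moreover have "\<bar>conv (reg f) (rescale \<Phi> (\<delta> * R)) x0 - F x0\<bar> \<le> C1 * (\<delta> * R)" using R \<delta> by (intro C1(2)) simp
      moreover have "P x0 = c" by (simp add: cq)
      ultimately show ?thesis by linarith
    qed
    have "L1dist_ball f (linear_at ?b x0) x0 R \<le> ?E + (LINT y|lebesgue. indicator (ball x0 R) y * \<bar>P y - linear_at ?b x0 y\<bar>)"
      by (intro L1dist_ball_triangle f smooth_Lp_loc_1 smooth_polys[OF P(1)] smooth_linear_at)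
    also have "(\<lambda>y. P y - linear_at ?b x0 y) = (\<lambda>y. c + linear_at (\<lambda>i. q i - ?b i) x0 y)"
      by (simp add: Pl linear_at_def left_diff_distrib sum_subtractf add_diff_eq)
    then have "(LINT y|lebesgue. indicator (ball x0 R) y * \<bar>P y - linear_at ?b x0 y\<bar>) =
       (LINT y|lebesgue. indicator (ball x0 R) y * \<bar>c + linear_at (\<lambda>i. q i - ?b i) x0 y\<bar>)"
      by (simp add: fun_eq_iff)
    also have "\<dots> \<le> (\<bar>c\<bar> + R * (\<Sum>i\<in>UNIV. \<bar>q i - ?b i\<bar>)) * (R ^ CARD('n) * ?w)"
      by (rule integral_linear_ball[OF R])
    finally have "L1dist_ball f (linear_at ?b x0) x0 R / R ^ ?k \<le> (?E + (\<bar>c\<bar> + R * (\<Sum>i\<in>UNIV. \<bar>q i - ?b i\<bar>)) * (R ^ CARD('n) * ?w)) / R ^ ?k"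
      using R by (intro divide_right_mono) auto
    also have "\<dots> = ?E / R ^ ?k + ?w * (\<bar>c\<bar> / R + (\<Sum>i\<in>UNIV. \<bar>q i - ?b i\<bar>))"
      using R by (simp add: field_simps)
    also have "\<dots> \<le> ?E / R ^ ?k + ?w * ((\<bar>F x0\<bar> / R + C1 * \<delta> + C0 / \<delta> ^ CARD('n) * (?E / R ^ ?k)) +
        (\<Sum>i\<in>UNIV. D i * 2 ^ ?k * (?E / R ^ ?k) + \<bar>?m i R - ?b i\<bar>))"
    proof (intro add_left_mono mult_left_mono add_mono sum_mono slope)
      have "\<bar>c\<bar> / R \<le> (\<bar>F x0\<bar> + C1 * (\<delta> * R) + C0 / \<delta> ^ CARD('n) * (?E / R ^ CARD('n))) / R"
        using center R by (intro divide_right_mono) auto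
      also have "\<dots> = \<bar>F x0\<bar> / R + C1 * \<delta> + C0 / \<delta> ^ CARD('n) * (?E / R ^ ?k)"
        using R by (simp add: add_divide_distrib mult_ac)
      finally show "\<bar>c\<bar> / R \<le> \<bar>F x0\<bar> / R + C1 * \<delta> + C0 / \<delta> ^ CARD('n) * (?E / R ^ ?k)" .
    qed (use w in simp)
    also have "\<dots> = A * (?E / R ^ ?k) + ?w * (\<bar>F x0\<bar> / R + (\<Sum>i\<in>UNIV. \<bar>?m i R - ?b i\<bar>)) + ?w * C1 * \<delta>"
      by (simp only: A_def sum.distrib sum_distrib_right[symmetric] distrib_left distrib_right mult.assoc mult_1_left add_ac)
    also have "\<dots> \<le> G R + e / 2"
    proof -
      have "?E / R ^ ?k \<le> scaled_best 1 f x0 R + 1 / R ^ ?k"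
        using P(2) R by (simp add: scaled_best_def divide_right_mono flip: add_divide_distrib)
      moreover have "0 \<le> A" using w C0(1) D(1) \<delta>
        unfolding A_def by (intro add_nonneg_nonneg mult_nonneg_nonneg sum_nonneg divide_nonneg_nonneg) (auto intro: less_imp_le)
      ultimately have "A * (?E / R ^ ?k) \<le> A * (scaled_best 1 f x0 R + 1 / R ^ ?k)" by (rule mult_left_mono)
      then show ?thesis using \<delta>(3) by (simp add: G_def)
    qed
    also have "\<dots> < e" using elim(1) by simp
    finally show "dist (L1dist_ball f (linear_at ?b x0) x0 R / R ^ ?k) 0 < e"
      using R L1dist_ball_nonneg[of f "linear_at ?b x0" x0 R] by simp
  qed
qed

section \<open>Products at infinity\<close>

lemma integral_cball_le_L1dist:
  assumes "f \<in> Lp_loc 1" "P \<in> Lp_loc 1" "0 < R"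
  shows "(LINT y|lebesgue. indicator (cball x0 R) y * \<bar>f y - P y\<bar>) \<le> L1dist_ball f P x0 (2 * R)"
  unfolding L1dist_ball_def
proof (rule integral_mono)
  show "integrable lebesgue (\<lambda>y. indicator (cball x0 R) y * \<bar>f y - P y\<bar>)"
    using integrable_abs[OF Lp_loc_1_integrable_cball[OF Lp_loc_1_diff[OF assms(1,2)]]] by (simp add: abs_mult)
  show "integrable lebesgue (\<lambda>y. indicator (ball x0 (2 * R)) y * \<bar>f y - P y\<bar>)"
    by (intro integrable_indicator_ball Lp_loc_1_diff assms)
qed (use assms(3) in \<open>auto simp: indicator_def\<close>)

lemma blow_down_cball:
  fixes f \<phi> :: "real ^ 'n::finite \<Rightarrow> real"
  assumes \<phi>: "kernel 0 \<phi>" and so: "summable_osc 1 K f"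
  shows "((\<lambda>R. C / R ^ (CARD('n) + 1) * (LINT y|lebesgue. indicator (cball x0 R) y * \<bar>f y - linear_at (\<lambda>i. lim_moment \<phi> f (munit i)) x0 y\<bar>)) \<longlongrightarrow> 0) at_top"
proof (rule Lim_null_comparison)
  let ?l = "linear_at (\<lambda>i. lim_moment \<phi> f (munit i)) x0" and ?k = "CARD('n) + 1"
  let ?V = "\<lambda>R. L1dist_ball f ?l x0 R / R ^ ?k"
  have "filterlim (\<lambda>R :: real. 2 * R) at_top at_top"
    using filterlim_tendsto_pos_mult_at_top[OF tendsto_const[of "2 :: real"] _ filterlim_ident] by simp
  then have "((\<lambda>R. \<bar>C\<bar> * 2 ^ ?k * ?V (2 * R)) \<longlongrightarrow> \<bar>C\<bar> * 2 ^ ?k * 0) at_top"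
    by (intro tendsto_mult tendsto_const filterlim_compose[OF blow_down[OF \<phi> so]])
  then show "((\<lambda>R. \<bar>C\<bar> * 2 ^ ?k * ?V (2 * R)) \<longlongrightarrow> 0) at_top" by simp
  show "\<forall>\<^sub>F R in at_top. norm (C / R ^ ?k * (LINT y|lebesgue. indicator (cball x0 R) y * \<bar>f y - ?l y\<bar>)) \<le> \<bar>C\<bar> * 2 ^ ?k * ?V (2 * R)"
    using eventually_gt_at_top[of 0]
  proof eventually_elim
    case (elim R)
    have nn: "0 \<le> (LINT y|lebesgue. indicator (cball x0 R) y * \<bar>f y - ?l y\<bar>)"
      by (intro Bochner_Integration.integral_nonneg) auto
    have "norm (C / R ^ ?k * (LINT y|lebesgue. indicator (cball x0 R) y * \<bar>f y - ?l y\<bar>)) =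
       \<bar>C\<bar> / R ^ ?k * (LINT y|lebesgue. indicator (cball x0 R) y * \<bar>f y - ?l y\<bar>)"
      using elim nn by (simp add: abs_mult)
    also have "\<dots> \<le> \<bar>C\<bar> / R ^ ?k * L1dist_ball f ?l x0 (2 * R)"
      using elim by (intro mult_left_mono integral_cball_le_L1dist summable_osc_Lp_loc[OF so] smooth_Lp_loc_1 smooth_linear_at) auto
    also have "\<dots> = \<bar>C\<bar> * 2 ^ ?k * ?V (2 * R)" by (simp add: power_mult_distrib)
    finally show ?case .
  qed
qed

text \<open>After an integration by parts the error is an integral of \<open>f\<close> minus its blow-down against a derivative
  of \<open>\<eta> R\<close>, whose size \<open>R^(-n-1)\<close> matches the rate of the blow-down.\<close>

lemma weak_blow_down:
  fixes f \<phi> h :: "real ^ 'n::finite \<Rightarrow> real" and \<eta> :: "real \<Rightarrow> real ^ 'n \<Rightarrow> real"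
  assumes \<phi>: "kernel 0 \<phi>" and so: "summable_osc 1 K f" and h: "has_wderiv (munit k) f h"
    and \<eta>: "\<And>R. 0 < R \<Longrightarrow> test_fun (\<eta> R)" "\<And>R. 0 < R \<Longrightarrow> supp_cball x0 R (\<eta> R)"
      "\<And>R y. 0 < R \<Longrightarrow> \<bar>partial k (\<eta> R) y\<bar> \<le> C / R ^ (CARD('n) + 1)"
  shows "((\<lambda>R. (LINT y|lebesgue. h y * \<eta> R y) - lim_moment \<phi> f (munit k) * (LINT y|lebesgue. \<eta> R y)) \<longlongrightarrow> 0) at_top"
proof (rule Lim_null_comparison[OF _ blow_down_cball[OF \<phi> so, of C x0]])
  let ?l = "linear_at (\<lambda>i. lim_moment \<phi> f (munit i)) x0"
  note f = summable_osc_Lp_loc[OF so]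
  have lL: "?l \<in> Lp_loc 1" by (rule smooth_Lp_loc_1[OF smooth_linear_at])
  show "\<forall>\<^sub>F R in at_top. norm ((LINT y|lebesgue. h y * \<eta> R y) - lim_moment \<phi> f (munit k) * (LINT y|lebesgue. \<eta> R y))
     \<le> C / R ^ (CARD('n) + 1) * (LINT y|lebesgue. indicator (cball x0 R) y * \<bar>f y - ?l y\<bar>)"
    using eventually_gt_at_top[of 0]
  proof eventually_elim
    case (elim R)
    note t = \<eta>(1)[OF elim]
    have "(LINT y|lebesgue. h y * \<eta> R y) = - (LINT y|lebesgue. f y * partial k (\<eta> R) y)"
      using h t by (simp add: has_wderiv_def mderiv_munit)
    moreover have "lim_moment \<phi> f (munit k) * (LINT y|lebesgue. \<eta> R y) = - (LINT y|lebesgue. ?l y * partial k (\<eta> R) y)"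
      using integral_by_parts[OF smooth_linear_at t, of "\<lambda>i. lim_moment \<phi> f (munit i)" x0 k] by (simp add: partial_linear_at)
    ultimately have "(LINT y|lebesgue. h y * \<eta> R y) - lim_moment \<phi> f (munit k) * (LINT y|lebesgue. \<eta> R y) =
       - (LINT y|lebesgue. (f y - ?l y) * partial k (\<eta> R) y)"
      unfolding left_diff_distrib using f lL t by (simp add: Lp_loc_1_integrable_test test_fun_partial)
    also have "norm \<dots> \<le> C / R ^ (CARD('n) + 1) * (LINT y|lebesgue. indicator (cball x0 R) y * \<bar>f y - ?l y\<bar>)"
      unfolding real_norm_def abs_minus
      by (intro integral_mult_bound Lp_loc_1_diff f lL supp_cball_partial \<eta> elim)
    finally show ?case .
  qed
qed

text \<open>In the integral of \<open>g h\<close> against a derivative \<open>\<psi> R\<close> of the rescaled mollifier, \<open>g\<close> is replaced by its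
  blow-down \<open>l\<close>, since \<open>h\<close> is bounded. The products \<open>l (\<psi> R)\<close> are then test functions to which the weak
  blow-down of \<open>f\<close> applies, and their integrals are a slope of \<open>l\<close>.\<close>

lemma moment_product_tendsto_bounded:
  fixes f g h \<phi> :: "real ^ 'n::finite \<Rightarrow> real"
  assumes \<phi>: "kernel 0 \<phi>" and g: "summable_osc 1 L g" and f: "summable_osc 1 K f"
    and h: "has_wderiv (munit k) f h" and M: "\<And>x. \<bar>h x\<bar> \<le> M"
  shows "((\<lambda>R. moment \<phi> (munit i) x0 R (reg (\<lambda>x. g x * h x))) \<longlongrightarrow> lim_moment \<phi> g (munit i) * lim_moment \<phi> f (munit k)) at_top"
proof -
  define l where "l = linear_at (\<lambda>i. lim_moment \<phi> g (munit i)) x0"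
  define \<psi> where "\<psi> R y = mderiv (munit i) (rescale \<phi> R) (x0 - y)" for R y
  obtain C where C: "0 < C" "\<And>R y. 0 < R \<Longrightarrow> \<bar>mderiv (munit i) (rescale \<phi> R) y\<bar> \<le> C / R ^ (CARD('n) + 1)"
    using mderiv_rescale_bound[OF kernel_test_fun[OF \<phi>], of "munit i"] by auto
  obtain C2 where C2: "0 < C2" "\<And>R y. 0 < R \<Longrightarrow> \<bar>mderiv (\<lambda>j. munit k j + munit i j) (rescale \<phi> R) y\<bar> \<le> C2 / R ^ (CARD('n) + 2)"
    using mderiv_rescale_bound[OF kernel_test_fun[OF \<phi>], of "\<lambda>j. munit k j + munit i j"] by (auto simp: msize_add)
  let ?s = "\<Sum>j\<in>UNIV. \<bar>lim_moment \<phi> g (munit j)\<bar>"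
  have sm: "smooth (rescale \<phi> R)" for R using \<phi> by (intro smooth_rescale) (simp add: kernel_def)
  have t: "test_fun (\<psi> R)" and su: "supp_cball x0 R (\<psi> R)" and \<psi>b: "\<And>y. \<bar>\<psi> R y\<bar> \<le> C / R ^ (CARD('n) + 1)" if "0 < R" for R
  proof -
    show "test_fun (\<psi> R)" unfolding \<psi>_def by (intro test_fun_reflect test_fun_mderiv kernel_test_fun_rescale[OF \<phi> that])
    show "supp_cball x0 R (\<psi> R)"
      using supp_cball_reflect[OF supp_cball_mderiv[OF kernel_supp_rescale[OF \<phi> that]], of x0 "munit i"] by (simp add: \<psi>_def[abs_def])
    show "\<bar>\<psi> R y\<bar> \<le> C / R ^ (CARD('n) + 1)" for y unfolding \<psi>_def by (rule C(2)[OF that])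
  qed
  have d\<psi>: "\<bar>partial k (\<psi> R) y\<bar> \<le> C2 / R ^ (CARD('n) + 2)" if "0 < R" for R y
  proof -
    have "partial k (\<psi> R) = (\<lambda>y. - mderiv (\<lambda>j. munit k j + munit i j) (rescale \<phi> R) (x0 - y))"
      unfolding \<psi>_def[abs_def] partial_reflect[OF smooth_mderiv[OF sm]]
      by (simp only: mderiv_munit[symmetric] mderiv_mderiv[OF sm])
    then show ?thesis using C2(2)[OF that, of "x0 - y"] by simp
  qed
  have lsm: "smooth l" and lL: "l \<in> Lp_loc 1" unfolding l_def by (intro smooth_Lp_loc_1 smooth_linear_at)+
  have gL: "g \<in> Lp_loc 1" by (rule summable_osc_Lp_loc[OF g])
  have hm: "h \<in> borel_measurable lebesgue" using h by (auto simp: has_wderiv_def Lp_loc_def)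
  have M0: "0 \<le> M" using M[of 0] by simp
  have 1: "((\<lambda>R. (LINT y|lebesgue. h y * (l y * \<psi> R y)) - lim_moment \<phi> f (munit k) * (LINT y|lebesgue. l y * \<psi> R y)) \<longlongrightarrow> 0) at_top"
  proof (rule weak_blow_down[OF \<phi> f h])
    fix R :: real assume R: "0 < R"
    show "test_fun (\<lambda>y. l y * \<psi> R y)" by (intro test_fun_mult lsm t R)
    show "supp_cball x0 R (\<lambda>y. l y * \<psi> R y)" by (intro supp_cball_mult su R)
    fix y
    have e: "partial k (\<lambda>y. l y * \<psi> R y) y = lim_moment \<phi> g (munit k) * \<psi> R y + l y * partial k (\<psi> R) y"
      by (subst partial_mult) (auto simp: l_def partial_linear_at intro: smooth_differentiable smooth_linear_at test_fun_smooth t R)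
    have "\<bar>l y * partial k (\<psi> R) y\<bar> \<le> ?s * R * (C2 / R ^ (CARD('n) + 2))"
    proof (cases "dist x0 y \<le> R")
      case True
      have "\<bar>l y\<bar> \<le> ?s * dist x0 y" unfolding l_def by (rule abs_linear_at_le)
      also have "\<dots> \<le> ?s * R" using True by (intro mult_left_mono sum_nonneg) auto
      finally show ?thesis unfolding abs_mult using d\<psi>[OF R, of y] by (intro mult_mono) auto
    next
      case False
      then have "partial k (\<psi> R) y = 0" using supp_cballD[OF supp_cball_partial[OF su[OF R]]] by simp
      then show ?thesis using R C2(1) by (simp add: sum_nonneg)
    qed
    also have "?s * R * (C2 / R ^ (CARD('n) + 2)) = ?s * C2 / R ^ (CARD('n) + 1)"
      using R by (simp add: power_add power2_eq_square)
    finally have "\<bar>partial k (\<lambda>y. l y * \<psi> R y) y\<bar> \<le> \<bar>lim_moment \<phi> g (munit k)\<bar> * (C / R ^ (CARD('n) + 1)) + ?s * C2 / R ^ (CARD('n) + 1)"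
      unfolding e using mult_left_mono[OF \<psi>b[OF R, of y], of "\<bar>lim_moment \<phi> g (munit k)\<bar>"]
      by (simp only: abs_mult[symmetric] abs_ge_zero) (smt (verit) abs_mult abs_triangle_ineq)
    then show "\<bar>partial k (\<lambda>y. l y * \<psi> R y) y\<bar> \<le> (\<bar>lim_moment \<phi> g (munit k)\<bar> * C + ?s * C2) / R ^ (CARD('n) + 1)"
      by (simp add: add_divide_distrib)
  qed
  have lint: "(LINT y|lebesgue. l y * \<psi> R y) = lim_moment \<phi> g (munit i)" if "0 < R" for R
  proof -
    have "(LINT y|lebesgue. l y * \<psi> R y) = conv (reg l) (mderiv (munit i) (rescale \<phi> R)) x0"
      by (simp add: conv_reg \<psi>_def)
    also have "\<dots> = mderiv (munit i) l x0"
      unfolding l_def by (rule kernel_reproduces_mderiv[OF \<phi> linear_at_polys]) (use that in auto)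
    finally show ?thesis by (simp add: l_def mderiv_munit partial_linear_at)
  qed
  have 2: "((\<lambda>R. moment \<phi> (munit i) x0 R (reg (\<lambda>x. g x * h x)) - (LINT y|lebesgue. h y * (l y * \<psi> R y))) \<longlongrightarrow> 0) at_top"
  proof (rule Lim_null_comparison[OF _ blow_down_cball[OF \<phi> g, of "M * C" x0]])
    show "\<forall>\<^sub>F R in at_top. norm (moment \<phi> (munit i) x0 R (reg (\<lambda>x. g x * h x)) - (LINT y|lebesgue. h y * (l y * \<psi> R y)))
      \<le> M * C / R ^ (CARD('n) + 1) * (LINT y|lebesgue. indicator (cball x0 R) y * \<bar>g y - linear_at (\<lambda>i. lim_moment \<phi> g (munit i)) x0 y\<bar>)"
      using eventually_gt_at_top[of 0]
    proof eventually_elim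
      case (elim R)
      have hs: "supp_cball x0 R (\<lambda>y. h y * \<psi> R y)" by (rule supp_cball_mult[OF su[OF elim]])
      have hb: "\<bar>h y * \<psi> R y\<bar> \<le> M * C / R ^ (CARD('n) + 1)" for y
        using mult_mono[OF M[of y] \<psi>b[OF elim, of y] M0 abs_ge_zero] by (simp add: abs_mult)
      have hm2: "(\<lambda>y. h y * \<psi> R y) \<in> borel_measurable lebesgue"
        by (intro borel_measurable_times hm test_fun_measurable_lebesgue t elim)
      have i: "integrable lebesgue (\<lambda>y. g y * (h y * \<psi> R y))" "integrable lebesgue (\<lambda>y. l y * (h y * \<psi> R y))"
        by (rule Lp_loc_1_integrable_mult[OF gL hm2 hs hb], rule Lp_loc_1_integrable_mult[OF lL hm2 hs hb])
      have "moment \<phi> (munit i) x0 R (reg (\<lambda>x. g x * h x)) - (LINT y|lebesgue. h y * (l y * \<psi> R y)) =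
         (LINT y|lebesgue. g y * (h y * \<psi> R y)) - (LINT y|lebesgue. l y * (h y * \<psi> R y))"
        by (simp add: moment_def conv_reg \<psi>_def mult_ac)
      also have "\<dots> = (LINT y|lebesgue. (g y - l y) * (h y * \<psi> R y))"
        unfolding left_diff_distrib by (rule Bochner_Integration.integral_diff[OF i, symmetric])
      also have "norm \<dots> \<le> M * C / R ^ (CARD('n) + 1) * (LINT y|lebesgue. indicator (cball x0 R) y * \<bar>g y - l y\<bar>)"
        unfolding real_norm_def by (rule integral_mult_bound[OF Lp_loc_1_diff[OF gL lL] hs hb])
      finally show ?case by (simp add: l_def)
    qed
  qed
  have "((\<lambda>R. (moment \<phi> (munit i) x0 R (reg (\<lambda>x. g x * h x)) - (LINT y|lebesgue. h y * (l y * \<psi> R y))) +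
     ((LINT y|lebesgue. h y * (l y * \<psi> R y)) - lim_moment \<phi> f (munit k) * (LINT y|lebesgue. l y * \<psi> R y))
     + lim_moment \<phi> f (munit k) * lim_moment \<phi> g (munit i)) \<longlongrightarrow> 0 + 0 + lim_moment \<phi> f (munit k) * lim_moment \<phi> g (munit i)) at_top"
    by (intro tendsto_add 1 2 tendsto_const)
  moreover have "\<forall>\<^sub>F R in at_top. (moment \<phi> (munit i) x0 R (reg (\<lambda>x. g x * h x)) - (LINT y|lebesgue. h y * (l y * \<psi> R y))) +
     ((LINT y|lebesgue. h y * (l y * \<psi> R y)) - lim_moment \<phi> f (munit k) * (LINT y|lebesgue. l y * \<psi> R y))
     + lim_moment \<phi> f (munit k) * lim_moment \<phi> g (munit i) = moment \<phi> (munit i) x0 R (reg (\<lambda>x. g x * h x))"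
    using eventually_gt_at_top[of 0] by eventually_elim (simp add: lint)
  ultimately have "((\<lambda>R. moment \<phi> (munit i) x0 R (reg (\<lambda>x. g x * h x))) \<longlongrightarrow> 0 + 0 + lim_moment \<phi> f (munit k) * lim_moment \<phi> g (munit i)) at_top"
    by (rule Lim_transform_eventually)
  then show ?thesis by (simp add: mult.commute)
qed

lemma summable_osc_ex_wderiv:
  fixes f \<Phi> :: "real ^ 'n::finite \<Rightarrow> real"
  assumes \<Phi>: "kernel N \<Phi>" and so: "summable_osc N K f" and \<alpha>: "msize \<alpha> = N"
  shows "\<exists>h M. has_wderiv \<alpha> f h \<and> (\<forall>x. \<bar>h x\<bar> \<le> M) \<and>
    (\<forall>x. (\<lambda>i. mollified \<Phi> f \<alpha> i x) \<longlonglongrightarrow> h x) \<and> (\<forall>i x. \<bar>mollified \<Phi> f \<alpha> i x\<bar> \<le> M)"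
proof -
  obtain h M where h: "has_wderiv \<alpha> f h" "\<And>x. (\<lambda>i. mollified \<Phi> f \<alpha> i x) \<longlonglongrightarrow> h x" "\<And>i x. \<bar>mollified \<Phi> f \<alpha> i x\<bar> \<le> M"
    using summable_osc_regularity[OF \<Phi>] so \<alpha> by blast
  have "\<bar>h x\<bar> \<le> M" for x
    by (rule LIMSEQ_le_const2[OF tendsto_rabs[OF h(2)]]) (use h(3) in auto)
  then show ?thesis using h by blast
qed

text \<open>Weak derivatives are unique up to null sets, so an arbitrary version can be replaced by the limit of the
  mollified derivatives.\<close>

lemma wderiv_bounded_version:
  fixes f h \<Phi> :: "real ^ 'n::finite \<Rightarrow> real"
  assumes \<Phi>: "kernel N \<Phi>" and so: "summable_osc N K f" and \<alpha>: "msize \<alpha> = N" and h: "has_wderiv \<alpha> f h"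
  shows "\<exists>h' M. has_wderiv \<alpha> f h' \<and> (AE x in lebesgue. h x = h' x) \<and> (\<forall>x. \<bar>h' x\<bar> \<le> M) \<and>
    (\<forall>x. (\<lambda>i. mollified \<Phi> f \<alpha> i x) \<longlonglongrightarrow> h' x) \<and> (\<forall>i x. \<bar>mollified \<Phi> f \<alpha> i x\<bar> \<le> M)"
  using summable_osc_ex_wderiv[OF \<Phi> so \<alpha>] has_wderiv_unique[OF \<Phi> h] by blast

lemma moment_product_tendsto:
  fixes f g h \<phi> :: "real ^ 'n::finite \<Rightarrow> real"
  assumes \<phi>: "kernel 0 \<phi>" and g: "summable_osc 1 L g" and f: "summable_osc 1 K f"
    and h: "has_wderiv (munit k) f h"
  shows "((\<lambda>R. moment \<phi> (munit i) x0 R (reg (\<lambda>x. g x * h x))) \<longlongrightarrow> lim_moment \<phi> g (munit i) * lim_moment \<phi> f (munit k)) at_top"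
proof -
  obtain \<Phi> :: "real ^ 'n \<Rightarrow> real" where \<Phi>: "kernel 1 \<Phi>" using ex_kernel[OF \<phi>] by blast
  obtain h' M where h': "has_wderiv (munit k) f h'" "AE x in lebesgue. h x = h' x" "\<And>x. \<bar>h' x\<bar> \<le> M"
    using wderiv_bounded_version[OF \<Phi> f msize_munit h] by blast
  have m: "g \<in> borel_measurable lebesgue" "h \<in> borel_measurable lebesgue" "h' \<in> borel_measurable lebesgue"
    using summable_osc_Lp_loc[OF g] h h'(1) by (auto simp: has_wderiv_def Lp_loc_def)
  have eq: "moment \<phi> (munit i) x0 R (reg (\<lambda>x. g x * h x)) = moment \<phi> (munit i) x0 R (reg (\<lambda>x. g x * h' x))" if "0 < R" for R
    unfolding moment_def conv_reg
  proof (rule integral_mult_cong_AE)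
    show "AE x in lebesgue. g x * h x = g x * h' x" using h'(2) by eventually_elim simp
    show "(\<lambda>y. mderiv (munit i) (rescale \<phi> R) (x0 - y)) \<in> borel_measurable lebesgue"
      by (intro test_fun_measurable_lebesgue test_fun_reflect test_fun_mderiv kernel_test_fun_rescale[OF \<phi> that])
  qed (intro borel_measurable_times m)+
  show ?thesis
    by (rule Lim_transform_eventually[OF moment_product_tendsto_bounded[OF \<phi> g f h'(1,3)]])
       (use eventually_gt_at_top[of 0] in \<open>eventually_elim, simp add: eq\<close>)
qed

theorem has_Pinf_product:
  fixes f g h \<phi> :: "real ^ 'n::finite \<Rightarrow> real"
  assumes \<phi>: "kernel 0 \<phi>" and g: "summable_osc 1 L g" and f: "summable_osc 1 K f"
    and h: "has_wderiv (munit k) f h"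
  shows "has_Pinf \<phi> 1 (reg (\<lambda>x. g x * h x)) (\<lambda>x. Taylor_inf \<phi> 1 g x * lim_moment \<phi> f (munit k))"
proof -
  have "has_Pinf \<phi> 1 (reg (\<lambda>x. g x * h x))
    (\<lambda>x. \<Sum>\<alpha> | msize \<alpha> = 1. 1 / mfact \<alpha> * (lim_moment \<phi> g \<alpha> * lim_moment \<phi> f (munit k)) * mpower x \<alpha>)"
  proof (rule has_PinfI)
    fix \<alpha> :: "'n mindex" and x0 assume "msize \<alpha> = 1"
    then obtain i where "\<alpha> = munit i" using msize_1_munit by blast
    then show "((\<lambda>r. moment \<phi> \<alpha> x0 r (reg (\<lambda>x. g x * h x))) \<longlongrightarrow> lim_moment \<phi> g \<alpha> * lim_moment \<phi> f (munit k)) at_top"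
      using moment_product_tendsto[OF \<phi> g f h] by simp
  qed
  moreover have "(\<lambda>x. \<Sum>\<alpha> | msize \<alpha> = 1. 1 / mfact \<alpha> * (lim_moment \<phi> g \<alpha> * lim_moment \<phi> f (munit k)) * mpower x \<alpha>) =
    (\<lambda>x. Taylor_inf \<phi> 1 g x * lim_moment \<phi> f (munit k))"
    unfolding Taylor_inf_def sum_distrib_right by (intro ext sum.cong) simp_all
  ultimately show ?thesis by simp
qed

section \<open>Products with a divergence free field\<close>

text \<open>Weak derivatives commute: \<open>\<partial>\<^sub>k v\<^sub>i\<close> tested with \<open>\<partial>\<^sub>i \<eta>\<close> equals \<open>\<partial>\<^sub>i v\<^sub>i\<close> tested with \<open>\<partial>\<^sub>k \<eta>\<close>.\<close>

lemma div_free_weak: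
  fixes v V W :: "'n::finite \<Rightarrow> real ^ 'n \<Rightarrow> real"
  assumes V: "\<And>i. has_wderiv (munit k) (v i) (V i)" and W: "\<And>i. has_wderiv (munit i) (v i) (W i)"
    and div: "AE x in lebesgue. (\<Sum>i\<in>UNIV. W i x) = 0" and \<eta>: "test_fun \<eta>"
  shows "(\<Sum>i\<in>UNIV. LINT x|lebesgue. V i x * partial i \<eta> x) = 0"
proof -
  have "(LINT x|lebesgue. V i x * partial i \<eta> x) = (LINT x|lebesgue. W i x * partial k \<eta> x)" for i
  proof -
    have "(LINT x|lebesgue. V i x * partial i \<eta> x) = - (LINT x|lebesgue. v i x * partial k (partial i \<eta>) x)"
      using V[of i] test_fun_partial[OF \<eta>, of i] by (simp add: has_wderiv_def mderiv_munit)
    also have "\<dots> = - (LINT x|lebesgue. v i x * partial i (partial k \<eta>) x)"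
      by (simp only: partial_commute[OF test_fun_smooth[OF \<eta>], of k i])
    also have "\<dots> = (LINT x|lebesgue. W i x * partial k \<eta> x)"
      using W[of i] test_fun_partial[OF \<eta>, of k] by (simp add: has_wderiv_def mderiv_munit)
    finally show ?thesis .
  qed
  then have "(\<Sum>i\<in>UNIV. LINT x|lebesgue. V i x * partial i \<eta> x) = (\<Sum>i\<in>UNIV. LINT x|lebesgue. W i x * partial k \<eta> x)" by simp
  also have "\<dots> = (LINT x|lebesgue. (\<Sum>i\<in>UNIV. W i x * partial k \<eta> x))"
    using W \<eta> by (intro Bochner_Integration.integral_sum[symmetric] Lp_loc_1_integrable_test test_fun_partial) (auto simp: has_wderiv_def)
  also have "\<dots> = (LINT x :: real ^ 'n|lebesgue. 0)"
  proof (rule integral_cong_AE)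
    have "W i \<in> borel_measurable lebesgue" for i using W[of i] by (auto simp: has_wderiv_def Lp_loc_def)
    moreover have "partial k \<eta> \<in> borel_measurable lebesgue"
      by (intro test_fun_measurable_lebesgue test_fun_partial \<eta>)
    ultimately show "(\<lambda>x. \<Sum>i\<in>UNIV. W i x * partial k \<eta> x) \<in> borel_measurable lebesgue"
      by (intro borel_measurable_sum borel_measurable_times)
    show "AE x in lebesgue. (\<Sum>i\<in>UNIV. W i x * partial k \<eta> x) = 0"
      using div by eventually_elim (simp flip: sum_distrib_right)
  qed simp
  finally show ?thesis by simp
qed

text \<open>The product \<open>f \<psi>\<close> is not a test function, but its mollified version is; the gradients
  converge boundedly, so the weak divergence equation may be tested with \<open>f \<psi>\<close> as well.\<close>

lemma div_free_product:
  fixes v V W h :: "'n::finite \<Rightarrow> real ^ 'n \<Rightarrow> real" and f \<psi> \<phi> :: "real ^ 'n \<Rightarrow> real"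
  assumes \<phi>: "kernel 0 \<phi>" and V: "\<And>i. has_wderiv (munit k) (v i) (V i)" and W: "\<And>i. has_wderiv (munit i) (v i) (W i)"
    and div: "AE x in lebesgue. (\<Sum>i\<in>UNIV. W i x) = 0" and f: "summable_osc 1 K f"
    and h: "\<And>i. has_wderiv (munit i) f (h i)" and \<psi>: "test_fun \<psi>"
  shows "(LINT x|lebesgue. (\<Sum>i\<in>UNIV. V i x * h i x) * \<psi> x) = - (\<Sum>i\<in>UNIV. LINT x|lebesgue. f x * V i x * partial i \<psi> x)"
proof -
  obtain \<Phi> :: "real ^ 'n \<Rightarrow> real" where \<Phi>: "kernel 1 \<Phi>" using ex_kernel[OF \<phi>] by blast
  note fL = summable_osc_Lp_loc[OF f]
  have VL: "V i \<in> Lp_loc 1" "h i \<in> Lp_loc 1" for i using V h by (auto simp: has_wderiv_def)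
  note Vm = VL[THEN Lp_loc_measurable]
  obtain C F where C: "AE x in lebesgue. f x = F x" "Ck (1 - 1) F" "\<And>x j. \<bar>mollified \<Phi> f (\<lambda>j. 0) j x - F x\<bar> \<le> C * K * (1 / 2) ^ j"
    using summable_osc_regularity[OF \<Phi>] f by blast
  have FL: "F \<in> Lp_loc 1" by (rule Lp_loc_1_continuous[OF Ck_imp_continuous[OF C(2)]])
  have CK: "0 \<le> C * K"
    using C(3)[of 0 0] abs_ge_zero[of "mollified \<Phi> f (\<lambda>j. 0) 0 0 - F 0"] by (simp del: abs_ge_zero)
  let ?u = "mollified \<Phi> f (\<lambda>j. 0)"
  have us: "smooth (?u j)" for j by (rule smooth_mollified[OF fL \<Phi>])
  have du: "partial i (?u j) = mollified \<Phi> f (munit i) j" for i j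
    using mderiv_mollified[OF fL \<Phi>, of "munit i" "\<lambda>j. 0" j] by (simp add: mderiv_munit)
  have ulim: "(\<lambda>j. ?u j x) \<longlonglongrightarrow> F x" for x
  proof (rule LIM_zero_cancel, rule Lim_null_comparison)
    have "(\<lambda>j. C * K * (1 / 2) ^ j) \<longlonglongrightarrow> C * K * 0" by (intro tendsto_intros LIMSEQ_power_zero) simp
    then show "(\<lambda>j. C * K * (1 / 2) ^ j) \<longlonglongrightarrow> 0" by simp
    show "\<forall>\<^sub>F j in sequentially. norm (?u j x - F x) \<le> C * K * (1 / 2) ^ j" using C(3) by simp
  qed
  have ub: "\<bar>?u j x\<bar> \<le> \<bar>F x\<bar> + C * K" for j x
  proof -
    have "C * K * (1 / 2) ^ j \<le> C * K * 1" using CK by (intro mult_left_mono power_le_one) auto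
    then show ?thesis using C(3)[of j x] by linarith
  qed
  have lim: "(\<lambda>j. (LINT x|lebesgue. V i x * partial i (\<lambda>x. ?u j x * \<psi> x) x)) \<longlonglongrightarrow>
     (LINT x|lebesgue. V i x * h i x * \<psi> x) + (LINT x|lebesgue. f x * V i x * partial i \<psi> x)" for i
  proof -
    obtain h' B where h': "AE x in lebesgue. h i x = h' x" "\<And>x. (\<lambda>j. mollified \<Phi> f (munit i) j x) \<longlonglongrightarrow> h' x"
      "\<And>j x. \<bar>mollified \<Phi> f (munit i) j x\<bar> \<le> B" "\<And>x. \<bar>h' x\<bar> \<le> B" "has_wderiv (munit i) f h'"
      using wderiv_bounded_version[OF \<Phi> f msize_munit h[of i]] by blast
    have h'm: "h' \<in> borel_measurable lebesgue" using h'(5) by (auto simp: has_wderiv_def Lp_loc_def)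
    have \<psi>m: "\<psi> \<in> borel_measurable lebesgue" "partial i \<psi> \<in> borel_measurable lebesgue"
      using \<psi> by (auto intro: test_fun_measurable_lebesgue test_fun_partial)
    have Fm: "F \<in> borel_measurable lebesgue" "f \<in> borel_measurable lebesgue" using FL fL by (auto simp: Lp_loc_def)
    have Vab: "(\<lambda>x. \<bar>V i x\<bar>) \<in> Lp_loc 1"
    proof (rule Lp_loc_1I)
      show "integrable lebesgue (\<lambda>x. indicator (cball 0 R) x * \<bar>V i x\<bar>)" for R
        using integrable_abs[OF Lp_loc_1_integrable_cball[OF VL(1)[of i], of 0 R]] by (simp add: abs_mult)
    qed (use Vm in measurable)
    obtain R where R: "supp_cball 0 R \<psi>" using test_fun_supp[OF \<psi>] by blast
    obtain D where D: "\<And>x. \<bar>\<psi> x\<bar> \<le> D" by (rule test_fun_bounded[OF \<psi>]) (rule that)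
    have cont: "continuous_on UNIV (\<lambda>x. (\<bar>F x\<bar> + C * K) * \<bar>partial i \<psi> x\<bar>)"
      using Ck_imp_continuous[OF C(2)] smooth_imp_continuous[OF test_fun_smooth[OF test_fun_partial[OF \<psi>, of i]]]
      by (intro continuous_intros)
    have fin1: "integrable lebesgue (\<lambda>x. V i x * h' x * \<psi> x)" for i
    proof -
      have s: "supp_cball 0 R (\<lambda>x. h' x * \<psi> x)" by (rule supp_cball_mult[OF R])
      have b: "\<bar>h' x * \<psi> x\<bar> \<le> B * D" for x
        unfolding abs_mult using h'(4)[of x] D[of x] by (intro mult_mono) (auto intro: order_trans[OF abs_ge_zero])
      have m: "(\<lambda>x. h' x * \<psi> x) \<in> borel_measurable lebesgue" by (intro borel_measurable_times h'm \<psi>m)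
      show ?thesis using Lp_loc_1_integrable_mult[OF VL(1)[of i] m s b] by (simp add: mult.assoc)
    qed
    have fin2: "integrable lebesgue (\<lambda>x. V i x * (F x * partial i \<psi> x))"
      using Ck_imp_continuous[OF C(2)] smooth_imp_continuous[OF test_fun_smooth[OF test_fun_partial[OF \<psi>, of i]]]
      by (intro Lp_loc_1_integrable_continuous[OF VL(1) _ supp_cball_mult[OF supp_cball_partial[OF R]]] continuous_on_mult) auto
    have "(\<lambda>j. (LINT x|lebesgue. V i x * partial i (\<lambda>x. ?u j x * \<psi> x) x)) \<longlonglongrightarrow>
        (LINT x|lebesgue. V i x * h' x * \<psi> x + V i x * (F x * partial i \<psi> x))"
    proof (rule integral_dominated_convergence[where w = "\<lambda>x. \<bar>V i x\<bar> * (B * \<bar>\<psi> x\<bar>) + \<bar>V i x\<bar> * ((\<bar>F x\<bar> + C * K) * \<bar>partial i \<psi> x\<bar>)"])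
      have e: "partial i (\<lambda>x. ?u j x * \<psi> x) x = mollified \<Phi> f (munit i) j x * \<psi> x + ?u j x * partial i \<psi> x" for j x
        by (subst partial_mult) (auto simp: du intro: smooth_differentiable us test_fun_smooth \<psi>)
      show "(\<lambda>x. V i x * h' x * \<psi> x + V i x * (F x * partial i \<psi> x)) \<in> borel_measurable lebesgue"
        by (intro borel_measurable_add borel_measurable_times Vm h'm \<psi>m Fm)
      show "(\<lambda>x. V i x * partial i (\<lambda>x. ?u j x * \<psi> x) x) \<in> borel_measurable lebesgue" for j
        by (intro borel_measurable_times Vm test_fun_measurable_lebesgue test_fun_partial test_fun_mult us \<psi>)
      show "integrable lebesgue (\<lambda>x. \<bar>V i x\<bar> * (B * \<bar>\<psi> x\<bar>) + \<bar>V i x\<bar> * ((\<bar>F x\<bar> + C * K) * \<bar>partial i \<psi> x\<bar>))"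
      proof (intro Bochner_Integration.integrable_add Lp_loc_1_integrable_continuous[OF Vab])
        show "continuous_on UNIV (\<lambda>x. B * \<bar>\<psi> x\<bar>)"
          using smooth_imp_continuous[OF test_fun_smooth[OF \<psi>]] by (intro continuous_intros)
        show "supp_cball 0 R (\<lambda>x. B * \<bar>\<psi> x\<bar>)" using R by (simp add: supp_cball_def)
        show "supp_cball 0 R (\<lambda>x. (\<bar>F x\<bar> + C * K) * \<bar>partial i \<psi> x\<bar>)"
          using supp_cball_partial[OF R, of i] by (simp add: supp_cball_def)
      qed (rule cont)
      have "(\<lambda>j. V i x * (mollified \<Phi> f (munit i) j x * \<psi> x + ?u j x * partial i \<psi> x)) \<longlonglongrightarrow> V i x * (h' x * \<psi> x + F x * partial i \<psi> x)" for x
        by (intro tendsto_intros h' ulim)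
      then show "AE x in lebesgue. (\<lambda>j. V i x * partial i (\<lambda>x. ?u j x * \<psi> x) x) \<longlonglongrightarrow> V i x * h' x * \<psi> x + V i x * (F x * partial i \<psi> x)"
        by (simp add: e distrib_left mult.assoc)
      have "\<bar>V i x * partial i (\<lambda>x. ?u j x * \<psi> x) x\<bar> \<le> \<bar>V i x\<bar> * (B * \<bar>\<psi> x\<bar>) + \<bar>V i x\<bar> * ((\<bar>F x\<bar> + C * K) * \<bar>partial i \<psi> x\<bar>)" for j x
      proof -
        have "\<bar>V i x * partial i (\<lambda>x. ?u j x * \<psi> x) x\<bar> = \<bar>V i x\<bar> * \<bar>mollified \<Phi> f (munit i) j x * \<psi> x + ?u j x * partial i \<psi> x\<bar>"
          by (simp only: e abs_mult)
        also have "\<dots> \<le> \<bar>V i x\<bar> * (\<bar>mollified \<Phi> f (munit i) j x\<bar> * \<bar>\<psi> x\<bar> + \<bar>?u j x\<bar> * \<bar>partial i \<psi> x\<bar>)"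
          by (intro mult_left_mono order_trans[OF abs_triangle_ineq]) (auto simp: abs_mult)
        also have "\<dots> \<le> \<bar>V i x\<bar> * (B * \<bar>\<psi> x\<bar> + (\<bar>F x\<bar> + C * K) * \<bar>partial i \<psi> x\<bar>)"
          by (intro mult_left_mono add_mono mult_right_mono h' ub) auto
        finally show ?thesis by (simp only: distrib_left)
      qed
      then show "AE x in lebesgue. norm (V i x * partial i (\<lambda>x. ?u j x * \<psi> x) x) \<le> \<bar>V i x\<bar> * (B * \<bar>\<psi> x\<bar>) + \<bar>V i x\<bar> * ((\<bar>F x\<bar> + C * K) * \<bar>partial i \<psi> x\<bar>)" for j
        by simp
    qed
    also have "(LINT x|lebesgue. V i x * h' x * \<psi> x + V i x * (F x * partial i \<psi> x)) =
       (LINT x|lebesgue. V i x * h' x * \<psi> x) + (LINT x|lebesgue. V i x * (F x * partial i \<psi> x))"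
      by (rule Bochner_Integration.integral_add[OF fin1 fin2])
    also have "(LINT x|lebesgue. V i x * h' x * \<psi> x) = (LINT x|lebesgue. V i x * h i x * \<psi> x)"
      using h'(1) by (intro integral_cong_AE borel_measurable_times Vm h'm \<psi>m) (auto elim!: eventually_mono)
    also have "(LINT x|lebesgue. V i x * (F x * partial i \<psi> x)) = (LINT x|lebesgue. f x * V i x * partial i \<psi> x)"
      using C(1) by (intro integral_cong_AE borel_measurable_times Vm Fm \<psi>m) (auto elim!: eventually_mono)
    finally show ?thesis .
  qed
  have "(\<lambda>j. \<Sum>i\<in>UNIV. (LINT x|lebesgue. V i x * partial i (\<lambda>x. ?u j x * \<psi> x) x)) \<longlonglongrightarrow>
     (\<Sum>i\<in>UNIV. (LINT x|lebesgue. V i x * h i x * \<psi> x) + (LINT x|lebesgue. f x * V i x * partial i \<psi> x))"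
    by (intro tendsto_sum lim)
  moreover have "(\<Sum>i\<in>UNIV. (LINT x|lebesgue. V i x * partial i (\<lambda>x. ?u j x * \<psi> x) x)) = 0" for j
    by (rule div_free_weak[OF V W div test_fun_mult[OF us \<psi>]])
  ultimately have "(\<Sum>i\<in>UNIV. (LINT x|lebesgue. V i x * h i x * \<psi> x) + (LINT x|lebesgue. f x * V i x * partial i \<psi> x)) = 0"
    by (simp add: LIMSEQ_const_iff)
  then have s: "(\<Sum>i\<in>UNIV. LINT x|lebesgue. V i x * h i x * \<psi> x) = - (\<Sum>i\<in>UNIV. LINT x|lebesgue. f x * V i x * partial i \<psi> x)"
    by (simp add: sum.distrib)
  have "(LINT x|lebesgue. (\<Sum>i\<in>UNIV. V i x * h i x) * \<psi> x) = (LINT x|lebesgue. (\<Sum>i\<in>UNIV. V i x * h i x * \<psi> x))"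
    by (simp add: sum_distrib_right)
  also have "\<dots> = (\<Sum>i\<in>UNIV. LINT x|lebesgue. V i x * h i x * \<psi> x)"
  proof (rule Bochner_Integration.integral_sum)
    fix i
    obtain h' B where h': "AE x in lebesgue. h i x = h' x" "\<And>x. \<bar>h' x\<bar> \<le> B" "has_wderiv (munit i) f h'"
      using wderiv_bounded_version[OF \<Phi> f msize_munit h[of i]] by blast
    have B: "AE x in lebesgue. \<bar>h i x\<bar> \<le> B" using h'(1) by eventually_elim (simp add: h'(2))
    show "integrable lebesgue (\<lambda>x. V i x * h i x * \<psi> x)"
    proof (rule Bochner_Integration.integrable_bound)
      show "integrable lebesgue (\<lambda>x. B * (V i x * \<psi> x))" by (intro integrable_mult_right Lp_loc_1_integrable_test VL \<psi>)
      show "(\<lambda>x. V i x * h i x * \<psi> x) \<in> borel_measurable lebesgue"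
        by (intro borel_measurable_times Vm test_fun_measurable_lebesgue \<psi>)
      show "AE x in lebesgue. norm (V i x * h i x * \<psi> x) \<le> norm (B * (V i x * \<psi> x))"
        using B
      proof eventually_elim
        case (elim x)
        then have "\<bar>h i x\<bar> * \<bar>V i x * \<psi> x\<bar> \<le> \<bar>B\<bar> * \<bar>V i x * \<psi> x\<bar>" by (intro mult_right_mono) auto
        then show ?case by (simp add: abs_mult mult_ac)
      qed
    qed
  qed
  finally show ?thesis using s by simp
qed

text \<open>The preceding identity turns the mollification of the sum into a sum of first order moments of the
  products \<open>f (V i)\<close>. Their limits are known, with \<open>v i\<close> as the differentiated function.\<close>

theorem has_Pinf_div_free_product:
  fixes v V W h :: "'n::finite \<Rightarrow> real ^ 'n \<Rightarrow> real" and f \<phi> :: "real ^ 'n \<Rightarrow> real"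
  assumes \<phi>: "kernel 0 \<phi>" and v: "\<And>i. summable_osc 1 (L i) (v i)"
    and V: "\<And>i. has_wderiv (munit k) (v i) (V i)" and W: "\<And>i. has_wderiv (munit i) (v i) (W i)"
    and div: "AE x in lebesgue. (\<Sum>i\<in>UNIV. W i x) = 0" and f: "summable_osc 1 K f"
    and h: "\<And>i. has_wderiv (munit i) f (h i)"
  shows "has_Pinf \<phi> 0 (reg (\<lambda>x. \<Sum>i\<in>UNIV. V i x * h i x))
    (\<lambda>x. \<Sum>i\<in>UNIV. lim_moment \<phi> (v i) (munit k) * lim_moment \<phi> f (munit i))"
proof -
  let ?c = "\<Sum>i\<in>UNIV. lim_moment \<phi> f (munit i) * lim_moment \<phi> (v i) (munit k)"
  have "has_Pinf \<phi> 0 (reg (\<lambda>x. \<Sum>i\<in>UNIV. V i x * h i x)) (\<lambda>x. \<Sum>\<alpha> | msize \<alpha> = 0. 1 / mfact \<alpha> * ?c * mpower x \<alpha>)"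
  proof (rule has_PinfI)
    fix \<alpha> :: "'n mindex" and x0 :: "real ^ 'n" assume "msize \<alpha> = 0"
    then have \<alpha>: "\<alpha> = (\<lambda>i. 0)" by (simp only: msize_eq_0_iff)
    have "((\<lambda>R. \<Sum>i\<in>UNIV. moment \<phi> (munit i) x0 R (reg (\<lambda>x. f x * V i x))) \<longlongrightarrow> ?c) at_top"
      by (intro tendsto_sum moment_product_tendsto[OF \<phi> f v V])
    moreover have "\<forall>\<^sub>F R in at_top. (\<Sum>i\<in>UNIV. moment \<phi> (munit i) x0 R (reg (\<lambda>x. f x * V i x))) = moment \<phi> \<alpha> x0 R (reg (\<lambda>x. \<Sum>i\<in>UNIV. V i x * h i x))"
      using eventually_gt_at_top[of 0]
    proof eventually_elim
      case (elim R)
      let ?\<psi> = "\<lambda>y. rescale \<phi> R (x0 - y)"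
      have sm: "smooth (rescale \<phi> R)" by (rule test_fun_smooth[OF kernel_test_fun_rescale[OF \<phi> elim]])
      have t: "test_fun ?\<psi>" by (rule test_fun_reflect[OF kernel_test_fun_rescale[OF \<phi> elim]])
      have "moment \<phi> \<alpha> x0 R (reg (\<lambda>x. \<Sum>i\<in>UNIV. V i x * h i x)) = (LINT y|lebesgue. (\<Sum>i\<in>UNIV. V i y * h i y) * ?\<psi> y)"
        by (simp add: moment_def conv_reg \<alpha>)
      also have "\<dots> = - (\<Sum>i\<in>UNIV. LINT y|lebesgue. f y * V i y * partial i ?\<psi> y)"
        by (rule div_free_product[OF \<phi> V W div f h t])
      also have "\<dots> = (\<Sum>i\<in>UNIV. moment \<phi> (munit i) x0 R (reg (\<lambda>x. f x * V i x)))"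
        by (simp add: partial_reflect[OF sm] moment_def conv_reg mderiv_munit sum_negf)
      finally show ?case by simp
    qed
    ultimately show "((\<lambda>R. moment \<phi> \<alpha> x0 R (reg (\<lambda>x. \<Sum>i\<in>UNIV. V i x * h i x))) \<longlongrightarrow> ?c) at_top"
      by (rule Lim_transform_eventually)
  qed
  moreover have "{\<alpha> :: 'n mindex. msize \<alpha> = 0} = {\<lambda>i. 0}" by (auto simp: msize_eq_0_iff)
  ultimately show ?thesis by (simp add: mfact_def mult.commute)
qed

section \<open>Weak derivatives of Lipschitz functions\<close>

text \<open>A positive integrable weight, which also measures the decay of Schwartz functions.\<close>

definition decay :: "real ^ 'n::finite \<Rightarrow> real" where
  "decay x = 1 / max 1 (norm x) ^ (CARD('n) + 1)"

lemma decay_pos: "0 < decay x"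
  by (simp add: decay_def)

lemma continuous_decay: "continuous_on UNIV decay"
  unfolding decay_def by (intro continuous_intros) auto

lemma decay_measurable: "decay \<in> borel_measurable lebesgue"
  by (simp add: measurable_completion borel_measurable_continuous_onI continuous_decay)

text \<open>Decompose the space into dyadic shells; the shell of radius \<open>2^k\<close> contributes \<open>O(2^(-k))\<close>.\<close>

lemma integrable_decay: "integrable lebesgue (decay :: real ^ 'n::finite \<Rightarrow> real)"
proof (rule integrableI_bounded[OF decay_measurable])
  let ?k = "CARD('n) + 1" and ?w = "measure lebesgue (ball (0 :: real ^ 'n) 1)"
  have le: "ennreal (norm (decay x)) \<le> (\<Sum>i. ennreal (2 ^ ?k * (1 / 2 ^ i) ^ ?k) * indicator (ball 0 (2 ^ i)) x)" for x :: "real ^ 'n"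
  proof -
    have "\<exists>i. norm x < 2 ^ i \<and> (2 :: real) ^ i \<le> 2 * max 1 (norm x)"
    proof (cases "1 \<le> norm x")
      case True
      then obtain i where "2 ^ i / 2 \<le> norm x" "norm x < 2 ^ i" using ex_dyadic by blast
      then show ?thesis by (intro exI[of _ i]) auto
    next
      case False then show ?thesis by (intro exI[of _ 0]) auto
    qed
    then obtain i where i: "norm x < 2 ^ i" "(2 :: real) ^ i \<le> 2 * max 1 (norm x)" by blast
    have "decay x \<le> 1 / (2 ^ i / 2) ^ ?k"
      unfolding decay_def using i(2) by (intro divide_left_mono power_mono mult_pos_pos zero_less_power) auto
    also have "\<dots> = 2 ^ ?k * (1 / 2 ^ i) ^ ?k" by (simp add: power_divide)
    finally have "ennreal (norm (decay x)) \<le> ennreal (2 ^ ?k * (1 / 2 ^ i) ^ ?k) * indicator (ball 0 (2 ^ i)) x"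
      using i(1) decay_pos[of x] by (simp add: ennreal_leI)
    also have "\<dots> \<le> (\<Sum>i. ennreal (2 ^ ?k * (1 / 2 ^ i) ^ ?k) * indicator (ball 0 (2 ^ i)) x)"
      using sum_le_suminf[OF summableI, of "{i}" "\<lambda>i. ennreal (2 ^ ?k * (1 / 2 ^ i) ^ ?k) * indicator (ball 0 (2 ^ i)) x"]
      by (simp only: sum.insert[OF finite.emptyI] sum.empty empty_iff not_False_eq_True add_0_right finite.emptyI finite.insertI zero_le)
    finally show ?thesis .
  qed
  have "(\<integral>\<^sup>+x. ennreal (norm (decay (x :: real ^ 'n))) \<partial>lebesgue) \<le> (\<integral>\<^sup>+x. (\<Sum>i. ennreal (2 ^ ?k * (1 / 2 ^ i) ^ ?k) * indicator (ball 0 (2 ^ i)) (x :: real ^ 'n)) \<partial>lebesgue)"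
    by (rule nn_integral_mono) (rule le)
  also have "\<dots> = (\<Sum>i. \<integral>\<^sup>+x. ennreal (2 ^ ?k * (1 / 2 ^ i) ^ ?k) * indicator (ball 0 (2 ^ i)) (x :: real ^ 'n) \<partial>lebesgue)"
    by (intro nn_integral_suminf borel_measurable_times_ennreal borel_measurable_const borel_measurable_indicator)
       (simp add: lmeasurable_ball fmeasurableD)
  also have "\<dots> = (\<Sum>i. ennreal (2 ^ ?k * ?w * (1 / 2) ^ i))"
  proof (rule suminf_cong)
    fix i
    have "(\<integral>\<^sup>+x. ennreal (2 ^ ?k * (1 / 2 ^ i) ^ ?k) * indicator (ball 0 (2 ^ i)) (x :: real ^ 'n) \<partial>lebesgue) =
       ennreal (2 ^ ?k * (1 / 2 ^ i) ^ ?k) * ennreal (measure lebesgue (ball (0 :: real ^ 'n) (2 ^ i)))"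
      unfolding emeasure_ball_lebesgue[symmetric]
      by (rule nn_integral_cmult_indicator) (simp add: lmeasurable_ball fmeasurableD)
    also have "\<dots> = ennreal (2 ^ ?k * (1 / 2 ^ i) ^ ?k * ((2 ^ i) ^ CARD('n) * ?w))"
      unfolding measure_ball_lebesgue[OF zero_less_power[OF zero_less_numeral]] by (rule ennreal_mult[symmetric]) auto
    also have "2 ^ ?k * (1 / 2 ^ i) ^ ?k * ((2 ^ i) ^ CARD('n) * ?w) = 2 ^ ?k * ?w * (1 / 2) ^ i"
      by (simp add: power_divide)
    finally show "(\<integral>\<^sup>+x. ennreal (2 ^ ?k * (1 / 2 ^ i) ^ ?k) * indicator (ball 0 (2 ^ i)) (x :: real ^ 'n) \<partial>lebesgue) = ennreal (2 ^ ?k * ?w * (1 / 2) ^ i)" .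
  qed
  also have "\<dots> = ennreal (\<Sum>i. 2 ^ ?k * ?w * (1 / 2) ^ i)"
    by (intro suminf_ennreal2 summable_mult summable_geometric) auto
  also have "\<dots> < \<infinity>" by simp
  finally show "(\<integral>\<^sup>+x. ennreal (norm (decay (x :: real ^ 'n))) \<partial>lebesgue) < \<infinity>" .
qed

text \<open>Weak compactness of bounded sequences, in the spirit of Mazur: among the functions that satisfy
  the bounds of the tails of the sequence, near minimizers of a weighted \<open>L\<^sup>2\<close> norm form a Cauchy
  sequence by the parallelogram law.\<close>

lemma weak_limit_bounded:
  fixes u :: "nat \<Rightarrow> real ^ 'n::finite \<Rightarrow> real" and \<Lambda> :: "(real ^ 'n \<Rightarrow> real) \<Rightarrow> real"
  assumes um: "\<And>j. u j \<in> borel_measurable lebesgue" and uL: "\<And>j x. \<bar>u j x\<bar> \<le> L"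
    and conv: "\<And>\<psi>. test_fun \<psi> \<Longrightarrow> (\<lambda>j. LINT x|lebesgue. u j x * \<psi> x) \<longlonglongrightarrow> \<Lambda> \<psi>"
  shows "\<exists>h. h \<in> borel_measurable lebesgue \<and> (\<forall>x. \<bar>h x\<bar> \<le> L) \<and> (\<forall>\<psi>. test_fun \<psi> \<longrightarrow> (LINT x|lebesgue. h x * \<psi> x) = \<Lambda> \<psi>)"
proof -
  have L: "0 \<le> L" using uL[of 0 0] by simp
  define BM where "BM = {v \<in> borel_measurable lebesgue. \<forall>x :: real ^ 'n. \<bar>v x\<bar> \<le> L}"
  \<comment> \<open>a convex set, decreasing in \<open>m\<close>: every error bound shared by the tail \<open>u m, u (m + 1), ...\<close> is inherited\<close>
  define T where "T m = {v \<in> BM. \<forall>\<psi> e. test_fun \<psi> \<longrightarrow> (\<forall>j\<ge>m. \<bar>(LINT x|lebesgue. u j x * \<psi> x) - \<Lambda> \<psi>\<bar> \<le> e) \<longrightarrow>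
     \<bar>(LINT x|lebesgue. v x * \<psi> x) - \<Lambda> \<psi>\<bar> \<le> e}" for m :: nat
  define Q where "Q v = (LINT x|lebesgue. (v x)\<^sup>2 * decay x)" for v :: "real ^ 'n \<Rightarrow> real"
  let ?W = "LINT x :: real ^ 'n|lebesgue. decay x"
  have W: "0 \<le> ?W" by (intro Bochner_Integration.integral_nonneg) (auto intro: less_imp_le decay_pos)
  have bi: "integrable lebesgue (\<lambda>x. v x * decay x)" if "v \<in> borel_measurable lebesgue" "\<And>x. \<bar>v x\<bar> \<le> c" for v :: "real ^ 'n \<Rightarrow> real" and c
  proof (rule Bochner_Integration.integrable_bound)
    show "integrable lebesgue (\<lambda>x :: real ^ 'n. c * decay x)" by (intro integrable_mult_right integrable_decay)
    show "(\<lambda>x. v x * decay x) \<in> borel_measurable lebesgue" by (intro borel_measurable_times that decay_measurable)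
    have "\<bar>v x\<bar> * decay x \<le> \<bar>c\<bar> * decay x" for x using that(2)[of x] decay_pos[of x] by (intro mult_right_mono) auto
    then show "AE x in lebesgue. norm (v x * decay x) \<le> norm (c * decay x)"
      by (simp add: abs_mult abs_of_pos[OF decay_pos])
  qed
  have sqb: "(v x)\<^sup>2 \<le> c\<^sup>2" if "\<bar>v x\<bar> \<le> c" for v :: "real ^ 'n \<Rightarrow> real" and c x
    using power_mono[OF that abs_ge_zero, of 2] by simp
  have Qi: "integrable lebesgue (\<lambda>x. (v x)\<^sup>2 * decay x)" if "v \<in> borel_measurable lebesgue" "\<And>x. \<bar>v x\<bar> \<le> c" for v :: "real ^ 'n \<Rightarrow> real" and c
    by (rule bi[of "\<lambda>x. (v x)\<^sup>2" "c\<^sup>2"]) (use that sqb in \<open>auto intro: borel_measurable_power\<close>)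
  have Q0: "0 \<le> Q v" for v
    unfolding Q_def
    by (intro Bochner_Integration.integral_nonneg mult_nonneg_nonneg zero_le_power2 less_imp_le[OF decay_pos])
  have QL: "Q v \<le> L\<^sup>2 * ?W" if "v \<in> BM" for v
  proof -
    have "Q v \<le> (LINT x :: real ^ 'n|lebesgue. L\<^sup>2 * decay x)"
      unfolding Q_def using that sqb[of v _ L]
      by (intro integral_mono Qi[of v L] integrable_mult_right integrable_decay mult_right_mono)
         (auto simp: BM_def intro: less_imp_le decay_pos)
    then show ?thesis by simp
  qed
  have BM_T: "T m \<subseteq> BM" for m by (auto simp: T_def)
  have uT: "u m \<in> T m" for m using um uL by (auto simp: T_def BM_def)
  have T_mono: "T m \<subseteq> T k" if "k \<le> m" for k m using that by (auto simp: T_def)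
  have \<psi>i: "integrable lebesgue (\<lambda>x. v x * \<psi> x)" if "v \<in> BM" "test_fun \<psi>" for v \<psi>
    using that by (intro Lp_loc_1_integrable_test bounded_Lp_loc_1[of v L]) (auto simp: BM_def)
  have mid: "(\<lambda>x. (v x + w x) / 2) \<in> T m" if "v \<in> T m" "w \<in> T m" for v w m
    unfolding T_def
  proof (intro CollectI conjI allI impI)
    have vw: "v \<in> BM" "w \<in> BM" using that BM_T by auto
    have "\<bar>(v x + w x) / 2\<bar> \<le> L" for x
    proof -
      have "\<bar>v x\<bar> \<le> L" "\<bar>w x\<bar> \<le> L" using vw by (auto simp: BM_def)
      then have "\<bar>v x + w x\<bar> \<le> 2 * L" by linarith
      then show ?thesis by simp
    qed
    moreover have "(\<lambda>x. (v x + w x) / 2) \<in> borel_measurable lebesgue"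
      using vw by (intro borel_measurable_divide borel_measurable_add) (auto simp: BM_def)
    ultimately show "(\<lambda>x. (v x + w x) / 2) \<in> BM" by (simp add: BM_def)
    fix \<psi> :: "real ^ 'n \<Rightarrow> real" and e
    assume \<psi>: "test_fun \<psi>" and e: "\<forall>j\<ge>m. \<bar>(LINT x|lebesgue. u j x * \<psi> x) - \<Lambda> \<psi>\<bar> \<le> e"
    have "(LINT x|lebesgue. (v x + w x) / 2 * \<psi> x) = (LINT x|lebesgue. (1 / 2) * (v x * \<psi> x) + (1 / 2) * (w x * \<psi> x))"
      by (intro Bochner_Integration.integral_cong) (auto simp: field_simps)
    also have "\<dots> = (1 / 2) * (LINT x|lebesgue. v x * \<psi> x) + (1 / 2) * (LINT x|lebesgue. w x * \<psi> x)"
      using \<psi>i[OF vw(1) \<psi>] \<psi>i[OF vw(2) \<psi>] by (subst Bochner_Integration.integral_add) auto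
    finally have eq: "(LINT x|lebesgue. (v x + w x) / 2 * \<psi> x) = (1 / 2) * (LINT x|lebesgue. v x * \<psi> x) + (1 / 2) * (LINT x|lebesgue. w x * \<psi> x)" .
    have "\<bar>(LINT x|lebesgue. v x * \<psi> x) - \<Lambda> \<psi>\<bar> \<le> e" "\<bar>(LINT x|lebesgue. w x * \<psi> x) - \<Lambda> \<psi>\<bar> \<le> e"
      using that \<psi> e by (auto simp: T_def)
    then show "\<bar>(LINT x|lebesgue. (v x + w x) / 2 * \<psi> x) - \<Lambda> \<psi>\<bar> \<le> e" unfolding eq by linarith
  qed
  \<comment> \<open>the infima increase and are bounded, so near minimizers become close by the parallelogram law\<close>
  define d where "d m = (INF v\<in>T m. Q v)" for m
  have d_le: "d m \<le> Q v" if "v \<in> T m" for m v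
    unfolding d_def by (rule cINF_lower[OF _ that]) (auto intro!: bdd_belowI Q0)
  have d_mono: "d k \<le> d m" if "k \<le> m" for k m
    unfolding d_def[of m] using uT by (intro cINF_greatest d_le) (use T_mono[OF that] in auto)
  have dL: "d m \<le> L\<^sup>2 * ?W" for m using d_le[OF uT] QL[of "u m"] BM_T uT by (meson order_trans subsetD)
  obtain d0 where d0: "d \<longlonglongrightarrow> d0" "\<And>m. d m \<le> d0"
    using incseq_convergent[of d "L\<^sup>2 * ?W"] d_mono dL by (auto simp: incseq_def)
  have "\<exists>v\<in>T m. Q v < d m + 1 / real (Suc m)" for m
  proof (rule ccontr)
    assume "\<not> ?thesis"
    then have "d m + 1 / real (Suc m) \<le> d m" unfolding d_def using uT by (intro cINF_greatest) (auto simp: not_less)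
    then show False by simp
  qed
  then obtain v where v: "\<And>m. v m \<in> T m" "\<And>m. Q (v m) < d m + 1 / real (Suc m)" by metis
  have vB: "v m \<in> borel_measurable lebesgue" "\<bar>v m x\<bar> \<le> L" for m x using v(1)[of m] BM_T by (auto simp: BM_def)
  define E where "E m = 2 * (d0 - d m) + 4 / real (Suc m)" for m
  have cauchy: "Q (\<lambda>x. v l x - v m x) \<le> E m" if "m \<le> l" for l m
  proof -
    let ?M = "\<lambda>x. (v m x + v l x) / 2"
    have M: "?M \<in> T m" using mid[OF v(1)[of m], of "v l"] T_mono[OF that] v(1)[of l] by auto
    have MB: "?M \<in> borel_measurable lebesgue" "\<And>x. \<bar>?M x\<bar> \<le> L" using M BM_T[of m] by (auto simp: BM_def)
    have DB: "(\<lambda>x. v l x - v m x) \<in> borel_measurable lebesgue" "\<And>x. \<bar>v l x - v m x\<bar> \<le> 2 * L"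
    proof -
      show "(\<lambda>x. v l x - v m x) \<in> borel_measurable lebesgue" by (intro borel_measurable_diff vB)
      show "\<bar>v l x - v m x\<bar> \<le> 2 * L" for x using vB(2)[of l x] vB(2)[of m x] by linarith
    qed
    have "Q (\<lambda>x. v l x - v m x) + 4 * Q ?M = (LINT x|lebesgue. (v l x - v m x)\<^sup>2 * decay x + 4 * ((?M x)\<^sup>2 * decay x))"
      unfolding Q_def using Qi[OF DB] Qi[OF MB] by (subst Bochner_Integration.integral_add) auto
    also have "\<dots> = (LINT x|lebesgue. 2 * ((v m x)\<^sup>2 * decay x) + 2 * ((v l x)\<^sup>2 * decay x))"
      by (intro Bochner_Integration.integral_cong) (auto simp: power2_eq_square field_simps)
    also have "\<dots> = 2 * Q (v m) + 2 * Q (v l)"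
      unfolding Q_def using Qi[OF vB(1) vB(2)] by (subst Bochner_Integration.integral_add) auto
    finally have "Q (\<lambda>x. v l x - v m x) = 2 * Q (v m) + 2 * Q (v l) - 4 * Q ?M" by linarith
    also have "\<dots> \<le> 2 * (d m + 1 / real (Suc m)) + 2 * (d0 + 1 / real (Suc m)) - 4 * d m"
    proof -
      have "1 / real (Suc l) \<le> 1 / real (Suc m)" using that by (intro divide_left_mono) auto
      then have "Q (v l) \<le> d0 + 1 / real (Suc m)" using v(2)[of l] d0(2)[of l] by linarith
      moreover have "Q (v m) \<le> d m + 1 / real (Suc m)" using v(2)[of m] by (rule less_imp_le)
      ultimately show ?thesis using d_le[OF M] by (intro diff_mono add_mono mult_left_mono) simp_all
    qed
    finally show ?thesis by (simp add: E_def)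
  qed
  have "(\<lambda>m. 2 * (d0 - d m) + 4 * inverse (real (Suc m))) \<longlonglongrightarrow> 2 * (d0 - d0) + 4 * 0"
    by (intro tendsto_intros d0(1) LIMSEQ_inverse_real_of_nat)
  then have E0: "E \<longlonglongrightarrow> 0" unfolding E_def by (simp add: divide_inverse)
  have "\<exists>m. \<forall>i\<ge>m. E i < (1 / 4) ^ k" for k
    using order_tendstoD(2)[OF E0, of "(1 / 4) ^ k"] by (auto simp: eventually_sequentially)
  then obtain n where n: "\<And>k i. n k \<le> i \<Longrightarrow> E i < (1 / 4) ^ k" by metis
  \<comment> \<open>a subsequence with summable consecutive distances, which converges almost everywhere\<close>
  define s where "s k = k + (\<Sum>i\<le>k. n i)" for k
  have sn: "n k \<le> s k" for k
    using member_le_sum[of k "{..k}" n] by (simp add: s_def)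
  have s_le: "s k \<le> s (Suc k)" and s_ge: "k \<le> s k" for k by (auto simp: s_def)
  define D where "D k x = v (s (Suc k)) x - v (s k) x" for k x
  have Dm: "D k \<in> borel_measurable lebesgue" for k unfolding D_def by (intro borel_measurable_diff vB)
  have Db: "\<bar>D k x\<bar> \<le> 2 * L" for k x unfolding D_def using vB(2)[of "s (Suc k)" x] vB(2)[of "s k" x] by linarith
  have Di: "integrable lebesgue (\<lambda>x. \<bar>D k x\<bar> * decay x)" for k
    by (rule bi[of _ "2 * L"]) (use Dm Db in \<open>auto intro: borel_measurable_abs\<close>)
  have DI: "(LINT x|lebesgue. \<bar>D k x\<bar> * decay x) \<le> (?W + 1) * (1 / 2) ^ k" for k
  proof -
    let ?a = "(1 / 2 :: real) ^ k"
    have a: "0 < ?a" by simp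
    have "(LINT x|lebesgue. \<bar>D k x\<bar> * decay x) \<le> (LINT x|lebesgue. ?a * decay x + 2 ^ k * ((D k x)\<^sup>2 * decay x))"
    proof (intro integral_mono Di Bochner_Integration.integrable_add integrable_mult_right integrable_decay Qi[OF Dm Db])
      fix x
      \<comment> \<open>\<open>t \<le> a + t\<^sup>2 / a\<close>, to pass from the weighted \<open>L\<^sup>2\<close> norm to the weighted \<open>L\<^sup>1\<close> norm\<close>
      have "\<bar>D k x\<bar> \<le> ?a + 2 ^ k * (D k x)\<^sup>2"
      proof (cases "\<bar>D k x\<bar> \<le> ?a")
        case True then show ?thesis by (simp add: add_increasing2)
      next
        case False
        then have "1 \<le> 2 ^ k * \<bar>D k x\<bar>" using a by (simp add: power_one_over field_simps)
        then have "1 * \<bar>D k x\<bar> \<le> 2 ^ k * \<bar>D k x\<bar> * \<bar>D k x\<bar>" by (intro mult_right_mono) auto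
        also have "\<dots> = 2 ^ k * (D k x)\<^sup>2" by (simp add: power2_eq_square mult.assoc flip: abs_mult)
        finally show ?thesis using a by linarith
      qed
      then have "\<bar>D k x\<bar> * decay x \<le> (?a + 2 ^ k * (D k x)\<^sup>2) * decay x" using decay_pos[of x] by (intro mult_right_mono) auto
      then show "\<bar>D k x\<bar> * decay x \<le> ?a * decay x + 2 ^ k * ((D k x)\<^sup>2 * decay x)" by (simp add: distrib_right mult.assoc)
    qed
    also have "\<dots> = ?a * ?W + 2 ^ k * Q (D k)"
      unfolding Q_def using Qi[OF Dm Db, of k] integrable_decay by (subst Bochner_Integration.integral_add) auto
    also have "\<dots> \<le> ?a * ?W + 2 ^ k * (1 / 4) ^ k"
      using cauchy[OF s_le[of k]] n[OF sn[of k]] unfolding D_def[abs_def] by (intro add_left_mono mult_left_mono) auto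
    also have "(2 :: real) ^ k * (1 / 4) ^ k = ?a" by (simp flip: power_mult_distrib)
    finally show ?thesis by (simp add: algebra_simps)
  qed
  have "(\<integral>\<^sup>+x. (\<Sum>k. ennreal (\<bar>D k x\<bar> * decay x)) \<partial>lebesgue) = (\<Sum>k. \<integral>\<^sup>+x. ennreal (\<bar>D k x\<bar> * decay x) \<partial>lebesgue)"
    using Dm decay_measurable by (intro nn_integral_suminf) measurable
  also have "\<dots> \<le> (\<Sum>k. ennreal ((?W + 1) * (1 / 2) ^ k))"
  proof (intro suminf_le summableI)
    fix k
    have "(\<integral>\<^sup>+x. ennreal (\<bar>D k x\<bar> * decay x) \<partial>lebesgue) = ennreal (LINT x|lebesgue. \<bar>D k x\<bar> * decay x)"
      by (intro nn_integral_eq_integral Di AE_I2 mult_nonneg_nonneg abs_ge_zero less_imp_le[OF decay_pos])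
    also have "\<dots> \<le> ennreal ((?W + 1) * (1 / 2) ^ k)" by (rule ennreal_leI[OF DI])
    finally show "(\<integral>\<^sup>+x. ennreal (\<bar>D k x\<bar> * decay x) \<partial>lebesgue) \<le> ennreal ((?W + 1) * (1 / 2) ^ k)" .
  qed
  also have "\<dots> = ennreal (\<Sum>k. (?W + 1) * (1 / 2) ^ k)"
    using W by (intro suminf_ennreal2 summable_mult summable_geometric) auto
  finally have "(\<integral>\<^sup>+x. (\<Sum>k. ennreal (\<bar>D k x\<bar> * decay x)) \<partial>lebesgue) \<noteq> \<infinity>"
    by (auto simp: top_unique)
  then have "AE x in lebesgue. (\<Sum>k. ennreal (\<bar>D k x\<bar> * decay x)) \<noteq> \<infinity>"
    using Dm decay_measurable by (intro nn_integral_PInf_AE) measurable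
  then have conv_ae: "AE x in lebesgue. convergent (\<lambda>k. v (s k) x)"
  proof eventually_elim
    case (elim x)
    have "summable (\<lambda>k. \<bar>D k x\<bar> * decay x)"
      by (rule summable_suminf_not_top)
         (use elim in \<open>auto intro!: mult_nonneg_nonneg less_imp_le[OF decay_pos]\<close>)
    then have "summable (\<lambda>k. \<bar>D k x\<bar> * decay x * (1 / decay x))" by (rule summable_mult2)
    then have "summable (\<lambda>k. \<bar>D k x\<bar>)" using decay_pos[of x] by simp
    then have "summable (\<lambda>k. D k x)" by (rule summable_rabs_cancel)
    then have "convergent (\<lambda>k. \<Sum>i<k. v (s (Suc i)) x - v (s i) x)" by (simp add: summable_iff_convergent D_def)
    then have "convergent (\<lambda>k. v (s k) x - v (s 0) x)" unfolding sum_lessThan_telescope[of "\<lambda>i. v (s i) x"] .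
    then have "convergent (\<lambda>k. (v (s k) x - v (s 0) x) + v (s 0) x)" by (intro convergent_add convergent_const)
    then show ?case by simp
  qed
  \<comment> \<open>truncated, so that the bound holds at every point\<close>
  define h where "h x = max (- L) (min L (lim (\<lambda>k. v (s k) x)))" for x
  have hL: "\<bar>h x\<bar> \<le> L" for x using L by (auto simp: h_def)
  have "(\<lambda>x. lim (\<lambda>k. v (s k) x)) \<in> borel_measurable lebesgue" by (rule borel_measurable_lim_metric) (rule vB)
  then have hm: "h \<in> borel_measurable lebesgue" unfolding h_def by measurable
  have lim: "AE x in lebesgue. (\<lambda>k. v (s k) x) \<longlonglongrightarrow> h x"
    using conv_ae
  proof eventually_elim
    case (elim x)
    then have l: "(\<lambda>k. v (s k) x) \<longlonglongrightarrow> lim (\<lambda>k. v (s k) x)" by (simp add: convergent_LIMSEQ_iff)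
    have "\<bar>lim (\<lambda>k. v (s k) x)\<bar> \<le> L"
      by (rule LIMSEQ_le_const2[OF tendsto_rabs[OF l]]) (use vB(2) in auto)
    then have "h x = lim (\<lambda>k. v (s k) x)" by (auto simp: h_def)
    then show ?case using l by simp
  qed
  have "(LINT x|lebesgue. h x * \<psi> x) = \<Lambda> \<psi>" if \<psi>: "test_fun \<psi>" for \<psi>
  proof -
    note \<psi>m = test_fun_measurable_lebesgue[OF \<psi>]
    have 1: "(\<lambda>k. LINT x|lebesgue. v (s k) x * \<psi> x) \<longlonglongrightarrow> (LINT x|lebesgue. h x * \<psi> x)"
    proof (rule integral_dominated_convergence[where w = "\<lambda>x. L * \<bar>\<psi> x\<bar>"])
      show "(\<lambda>x. h x * \<psi> x) \<in> borel_measurable lebesgue" "\<And>k. (\<lambda>x. v (s k) x * \<psi> x) \<in> borel_measurable lebesgue"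
        by (intro borel_measurable_times hm vB \<psi>m)+
      show "integrable lebesgue (\<lambda>x. L * \<bar>\<psi> x\<bar>)" by (intro integrable_mult_right integrable_abs test_fun_integrable \<psi>)
      show "AE x in lebesgue. (\<lambda>k. v (s k) x * \<psi> x) \<longlonglongrightarrow> h x * \<psi> x"
        using lim by eventually_elim (intro tendsto_mult tendsto_const)
      show "AE x in lebesgue. norm (v (s k) x * \<psi> x) \<le> L * \<bar>\<psi> x\<bar>" for k
        using vB(2) by (simp add: abs_mult mult_right_mono)
    qed
    have 2: "(\<lambda>k. LINT x|lebesgue. v (s k) x * \<psi> x) \<longlonglongrightarrow> \<Lambda> \<psi>"
    proof (rule LIMSEQ_I)
      fix e :: real assume e: "0 < e"
      obtain m where m: "\<And>j. m \<le> j \<Longrightarrow> \<bar>(LINT x|lebesgue. u j x * \<psi> x) - \<Lambda> \<psi>\<bar> \<le> e / 2"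
        using LIMSEQ_D[OF conv[OF \<psi>], of "e / 2"] e by (auto intro: less_imp_le)
      have "norm ((LINT x|lebesgue. v (s k) x * \<psi> x) - \<Lambda> \<psi>) < e" if "m \<le> k" for k
      proof -
        have "v (s k) \<in> T m" using T_mono[of m "s k"] v(1)[of "s k"] s_ge[of k] that by auto
        then have "\<bar>(LINT x|lebesgue. v (s k) x * \<psi> x) - \<Lambda> \<psi>\<bar> \<le> e / 2"
          unfolding T_def using \<psi> m by blast
        then show ?thesis using e by simp
      qed
      then show "\<exists>no. \<forall>k\<ge>no. norm ((LINT x|lebesgue. v (s k) x * \<psi> x) - \<Lambda> \<psi>) < e" by blast
    qed
    show ?thesis by (rule LIMSEQ_unique[OF 1 2])
  qed
  with hm hL show ?thesis by blast
qed

lemma difference_quotient_tendsto: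
  assumes "smooth \<psi>"
  shows "(\<lambda>m. real (Suc m) * (\<psi> (x + (c * inverse (real (Suc m))) *\<^sub>R axis k 1) - \<psi> x)) \<longlonglongrightarrow> c * partial k \<psi> x"
proof -
  have "((\<lambda>h. \<psi> (x + (c * h) *\<^sub>R axis k 1)) has_derivative
      (\<lambda>r. \<Sum>i\<in>UNIV. ((c * r) *\<^sub>R axis k 1) $ i * partial i \<psi> (x + (c * 0) *\<^sub>R axis k 1))) (at 0)"
    by (rule has_derivative_compose[OF _ smooth_has_derivative[OF assms]]) (auto intro!: derivative_eq_intros)
  moreover have "(\<Sum>i\<in>UNIV. ((c * r) *\<^sub>R axis k 1) $ i * partial i \<psi> (x + (c * 0) *\<^sub>R axis k 1)) = c * partial k \<psi> x * r" for r
  proof -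
    have "(\<Sum>i\<in>UNIV. ((c * r) *\<^sub>R axis k 1) $ i * partial i \<psi> (x + (c * 0) *\<^sub>R axis k 1)) = (\<Sum>i\<in>UNIV. if i = k then c * r * partial i \<psi> x else 0)"
      by (rule sum.cong) (auto simp: axis_def)
    then show ?thesis by simp
  qed
  ultimately have "((\<lambda>h. \<psi> (x + (c * h) *\<^sub>R axis k 1)) has_derivative (\<lambda>r. c * partial k \<psi> x * r)) (at 0)" by simp
  then have "(\<lambda>h. (\<psi> (x + (c * h) *\<^sub>R axis k 1) - \<psi> x) / h) \<midarrow>0\<rightarrow> c * partial k \<psi> x"
    by (simp add: DERIV_def flip: has_field_derivative_def)
  moreover have "filterlim (\<lambda>m. inverse (real (Suc m))) (at 0) sequentially"
    by (simp add: filterlim_at LIMSEQ_inverse_real_of_nat del: of_nat_Suc)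
  ultimately have "(\<lambda>m. (\<psi> (x + (c * inverse (real (Suc m))) *\<^sub>R axis k 1) - \<psi> x) / inverse (real (Suc m))) \<longlonglongrightarrow> c * partial k \<psi> x"
    by (rule filterlim_compose)
  then show ?thesis by (simp add: field_simps)
qed

text \<open>Difference quotients of \<open>g\<close> are bounded by \<open>L\<close>. Their integrals against a test function converge,
  because the translation can be moved to the test function, and their weak limit is the derivative.\<close>

theorem Lipschitz_has_wderiv:
  fixes g :: "real ^ 'n::finite \<Rightarrow> real"
  assumes g: "L-lipschitz_on UNIV g"
  shows "\<exists>h. has_wderiv (munit k) g h \<and> (\<forall>x. \<bar>h x\<bar> \<le> L)"
proof -
  have gc: "continuous_on UNIV g" by (rule lipschitz_on_continuous_on[OF g])
  have gL: "g \<in> Lp_loc 1" by (rule Lp_loc_1_continuous[OF gc])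
  have gm: "g \<in> borel_measurable borel" by (rule borel_measurable_continuous_onI[OF gc])
  define t where "t j = inverse (real (Suc j)) *\<^sub>R (axis k 1 :: real ^ 'n)" for j
  have nt: "norm (t j) = inverse (real (Suc j))" "norm (t j) \<le> 1" for j by (simp_all add: t_def field_simps)
  define u where "u j x = real (Suc j) * (g (x + t j) - g x)" for j x
  have um: "u j \<in> borel_measurable lebesgue" for j
  proof -
    have "u j \<in> borel_measurable borel" unfolding u_def using gm by measurable
    then show ?thesis by (simp add: measurable_completion)
  qed
  have uL: "\<bar>u j x\<bar> \<le> L" for j x
  proof -
    have "\<bar>g (x + t j) - g x\<bar> \<le> L * norm (t j)"
      using lipschitz_onD[OF g, of "x + t j" x] by (simp add: dist_real_def dist_norm)
    then have "real (Suc j) * \<bar>g (x + t j) - g x\<bar> \<le> real (Suc j) * (L * inverse (real (Suc j)))"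
      unfolding nt by (rule mult_left_mono) simp
    also have "\<dots> = L" by (simp del: of_nat_Suc)
    finally show ?thesis by (simp add: u_def abs_mult)
  qed
  have "(\<lambda>j. LINT x|lebesgue. u j x * \<psi> x) \<longlonglongrightarrow> - (LINT x|lebesgue. g x * partial k \<psi> x)" if \<psi>: "test_fun \<psi>" for \<psi>
  proof -
    obtain R where R: "0 < R" "supp_cball 0 R \<psi>" using test_fun_supp[OF \<psi>] .
    obtain K where K: "0 < K" "\<And>z h. \<bar>\<psi> (z + h) - \<psi> z\<bar> \<le> K * norm h"
      by (rule test_fun_lipschitz[OF \<psi>]) (rule that)
    note [measurable] = test_fun_borel[OF \<psi>] gm
    let ?q = "\<lambda>j x. real (Suc j) * (\<psi> (x - t j) - \<psi> x)"
    have shift: "(LINT x|lebesgue. u j x * \<psi> x) = (LINT x|lebesgue. g x * ?q j x)" for j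
    proof -
      have tt: "test_fun (\<lambda>x. \<psi> (x - t j))"
      proof (rule test_funI)
        show "smooth (\<lambda>x. \<psi> (x - t j))" using smooth_affine[OF test_fun_smooth[OF \<psi>], of "- t j" 1] by simp
        show "supp_cball (t j) R (\<lambda>x. \<psi> (x - t j))" using R(2) by (auto simp: supp_cball_def dist_norm norm_minus_commute)
      qed
      have "(\<lambda>x. g (x + t j)) \<in> Lp_loc 1"
        by (intro Lp_loc_1_continuous continuous_on_compose2[OF gc] continuous_intros) auto
      then have i: "integrable lebesgue (\<lambda>x. g (x + t j) * \<psi> x)" "integrable lebesgue (\<lambda>x. g x * \<psi> x)"
         "integrable lebesgue (\<lambda>x. g x * \<psi> (x - t j))"
        by (intro Lp_loc_1_integrable_test gL \<psi> tt; assumption)+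
      have sh: "(LINT x|lebesgue. g (x + t j) * \<psi> x) = (LINT x|lebesgue. g x * \<psi> (x - t j))"
        using lebesgue_integral_translation[of "\<lambda>x. g x * \<psi> (x - t j)" "t j"] by (simp add: add.commute)
      have "(LINT x|lebesgue. u j x * \<psi> x) = (LINT x|lebesgue. real (Suc j) * (g (x + t j) * \<psi> x - g x * \<psi> x))"
        by (simp add: u_def algebra_simps)
      also have "\<dots> = real (Suc j) * ((LINT x|lebesgue. g (x + t j) * \<psi> x) - (LINT x|lebesgue. g x * \<psi> x))"
        using i(1,2) by simp
      also have "\<dots> = real (Suc j) * (LINT x|lebesgue. g x * \<psi> (x - t j) - g x * \<psi> x)"
        unfolding sh using i(2,3) by simp
      also have "\<dots> = (LINT x|lebesgue. real (Suc j) * (g x * \<psi> (x - t j) - g x * \<psi> x))" by simp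
      also have "\<dots> = (LINT x|lebesgue. g x * ?q j x)" by (simp add: algebra_simps)
      finally show ?thesis .
    qed
    have "(\<lambda>j. LINT x|lebesgue. g x * ?q j x) \<longlonglongrightarrow> (LINT x|lebesgue. g x * (- partial k \<psi> x))"
    proof (rule integral_dominated_convergence[where w = "\<lambda>x. K * \<bar>indicator (cball 0 (R + 1)) x * g x\<bar>"])
      have [measurable]: "partial k \<psi> \<in> borel_measurable borel" by (intro test_fun_borel test_fun_partial \<psi>)
      have "(\<lambda>x. g x * (- partial k \<psi> x)) \<in> borel_measurable borel" "(\<lambda>x. g x * ?q j x) \<in> borel_measurable borel" for j by measurable
      then show "(\<lambda>x. g x * (- partial k \<psi> x)) \<in> borel_measurable lebesgue" "(\<lambda>x. g x * ?q j x) \<in> borel_measurable lebesgue" for j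
        by (auto intro: measurable_completion)
      show "integrable lebesgue (\<lambda>x. K * \<bar>indicator (cball 0 (R + 1)) x * g x\<bar>)"
        by (intro integrable_mult_right integrable_abs Lp_loc_1_integrable_cball gL)
      have "(\<lambda>j. ?q j x) \<longlonglongrightarrow> - partial k \<psi> x" for x
        using difference_quotient_tendsto[OF test_fun_smooth[OF \<psi>], of x "-1" k] by (simp add: t_def)
      then show "AE x in lebesgue. (\<lambda>j. g x * ?q j x) \<longlonglongrightarrow> g x * (- partial k \<psi> x)"
        by (intro AE_I2 tendsto_mult tendsto_const)
      have "\<bar>g x * ?q j x\<bar> \<le> K * \<bar>indicator (cball 0 (R + 1)) x * g x\<bar>" for j x
      proof (cases "norm x \<le> R + 1")
        case True
        have "\<bar>\<psi> (x - t j) - \<psi> x\<bar> \<le> K * norm (t j)" using K(2)[of x "- t j"] by simp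
        then have "real (Suc j) * \<bar>\<psi> (x - t j) - \<psi> x\<bar> \<le> real (Suc j) * (K * inverse (real (Suc j)))"
          unfolding nt by (rule mult_left_mono) simp
        also have "\<dots> = K" by (simp del: of_nat_Suc)
        finally have "\<bar>?q j x\<bar> \<le> K" by (simp add: abs_mult)
        then have "\<bar>g x\<bar> * \<bar>?q j x\<bar> \<le> \<bar>g x\<bar> * K" by (rule mult_left_mono) simp
        then show ?thesis using True by (simp add: abs_mult mult.commute)
      next
        case False
        have "norm x - norm (t j) \<le> norm (x - t j)" by (rule norm_triangle_ineq2)
        then have "R < norm (x - t j)" using False nt(2)[of j] by linarith
        then have "\<psi> (x - t j) = 0" "\<psi> x = 0" using False R(1) by (auto intro!: supp_cballD[OF R(2)])
        then show ?thesis using K(1) by simp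
      qed
      then show "AE x in lebesgue. norm (g x * ?q j x) \<le> K * \<bar>indicator (cball 0 (R + 1)) x * g x\<bar>" for j by simp
    qed
    then show ?thesis by (simp add: shift)
  qed
  from weak_limit_bounded[OF um uL this] obtain h where h: "h \<in> borel_measurable lebesgue" "\<And>x. \<bar>h x\<bar> \<le> L"
    "\<And>\<psi>. test_fun \<psi> \<Longrightarrow> (LINT x|lebesgue. h x * \<psi> x) = - (LINT x|lebesgue. g x * partial k \<psi> x)" by blast
  have "h \<in> Lp_loc 1" by (rule bounded_Lp_loc_1[OF h(1,2)])
  then have "has_wderiv (munit k) g h" using gL h(3) by (simp add: has_wderiv_def mderiv_munit)
  then show ?thesis using h(2) by blast
qed

section \<open>The distribution \<open>g \<partial>\<^sub>k f\<close> for Lipschitz \<open>g\<close> and bounded \<open>f\<close>\<close>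

lemma schwartz_smooth: "\<psi> \<in> schwartz \<Longrightarrow> smooth \<psi>"
  by (simp add: schwartz_def)

lemma schwartz_seminorm_upper:
  fixes \<psi> :: "real ^ 'n::finite \<Rightarrow> real"
  assumes \<psi>: "\<psi> \<in> schwartz" and "msize \<alpha> \<le> m" "msize \<beta> \<le> m"
  shows "\<bar>mpower x \<alpha> * mderiv \<beta> \<psi> x\<bar> \<le> (\<Sum>\<alpha> | msize \<alpha> \<le> m. \<Sum>\<beta> | msize \<beta> \<le> m. (SUP x. \<bar>mpower x \<alpha> * mderiv \<beta> \<psi> x\<bar>))"
proof -
  let ?s = "\<lambda>\<alpha> \<beta>. SUP x. \<bar>mpower x \<alpha> * mderiv \<beta> \<psi> x\<bar>"
  have bd: "\<bar>mpower x \<alpha> * mderiv \<beta> \<psi> x\<bar> \<le> ?s \<alpha> \<beta>" for x \<alpha> \<beta>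
  proof (rule cSUP_upper)
    obtain B where "\<And>x. \<bar>mpower x \<alpha> * mderiv \<beta> \<psi> x\<bar> \<le> B"
      using \<psi> by (force simp: schwartz_def bounded_iff)
    then show "bdd_above (range (\<lambda>x. \<bar>mpower x \<alpha> * mderiv \<beta> \<psi> x\<bar>))" by (rule bdd_aboveI2)
  qed simp
  have nn: "0 \<le> ?s \<alpha> \<beta>" for \<alpha> \<beta> using bd[of 0 \<alpha> \<beta>] abs_ge_zero order_trans by blast
  have "\<bar>mpower x \<alpha> * mderiv \<beta> \<psi> x\<bar> \<le> ?s \<alpha> \<beta>" by (rule bd)
  also have "\<dots> \<le> (\<Sum>\<beta> | msize \<beta> \<le> m. ?s \<alpha> \<beta>)" using assms nn by (intro member_le_sum) auto
  also have "\<dots> \<le> (\<Sum>\<alpha> | msize \<alpha> \<le> m. \<Sum>\<beta> | msize \<beta> \<le> m. ?s \<alpha> \<beta>)"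
    using assms nn by (intro member_le_sum[of \<alpha> _ "\<lambda>\<alpha>. \<Sum>\<beta> | msize \<beta> \<le> m. ?s \<alpha> \<beta>"] sum_nonneg) auto
  finally show ?thesis .
qed

text \<open>The norm of \<open>x\<close> is at most the dimension times its largest coordinate, so one monomial controls a power
  of the norm.\<close>

lemma schwartz_decay:
  fixes \<psi> :: "real ^ 'n::finite \<Rightarrow> real"
  assumes \<psi>: "\<psi> \<in> schwartz" and p: "p \<le> m" and \<beta>: "msize \<beta> \<le> m"
  shows "max 1 (norm x) ^ p * \<bar>mderiv \<beta> \<psi> x\<bar> \<le>
    real CARD('n) ^ p * (\<Sum>\<alpha> | msize \<alpha> \<le> m. \<Sum>\<beta> | msize \<beta> \<le> m. (SUP x. \<bar>mpower x \<alpha> * mderiv \<beta> \<psi> x\<bar>))" (is "_ \<le> _ * ?S")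
proof (cases "norm x \<le> 1")
  case True
  have "\<bar>mderiv \<beta> \<psi> x\<bar> \<le> ?S" using schwartz_seminorm_upper[OF \<psi>, of "\<lambda>i. 0" m \<beta> x] \<beta> by simp
  moreover have "1 * ?S \<le> real CARD('n) ^ p * ?S"
    using order_trans[OF abs_ge_zero \<open>\<bar>mderiv \<beta> \<psi> x\<bar> \<le> ?S\<close>] by (intro mult_right_mono one_le_power) auto
  ultimately show ?thesis using True by (simp add: max_absorb1)
next
  case False
  have "Max (range (\<lambda>j. \<bar>x $ j\<bar>)) \<in> range (\<lambda>j. \<bar>x $ j\<bar>)" by (intro Max_in) auto
  then obtain i where i: "Max (range (\<lambda>j. \<bar>x $ j\<bar>)) = \<bar>x $ i\<bar>" by blast
  have "\<bar>x $ j\<bar> \<le> \<bar>x $ i\<bar>" for j unfolding i[symmetric] by (intro Max_ge) auto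
  then have "(\<Sum>j\<in>UNIV. \<bar>x $ j\<bar>) \<le> real CARD('n) * \<bar>x $ i\<bar>" by (intro sum_bounded_above)
  then have "norm x \<le> real CARD('n) * \<bar>x $ i\<bar>" using norm_le_l1_cart[of x] by linarith
  then have "norm x ^ p \<le> (real CARD('n) * \<bar>x $ i\<bar>) ^ p" by (intro power_mono) auto
  also have "\<dots> = real CARD('n) ^ p * \<bar>mpower x (\<lambda>j. if j = i then p else 0)\<bar>"
  proof -
    have "mpower x (\<lambda>j. if j = i then p else 0) = (\<Prod>j\<in>UNIV. if j = i then (x $ j) ^ p else 1)"
      unfolding mpower_def by (rule prod.cong) auto
    then show ?thesis by (simp add: power_mult_distrib power_abs)
  qed
  finally have "norm x ^ p * \<bar>mderiv \<beta> \<psi> x\<bar> \<le> real CARD('n) ^ p * \<bar>mpower x (\<lambda>j. if j = i then p else 0)\<bar> * \<bar>mderiv \<beta> \<psi> x\<bar>"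
    by (rule mult_right_mono) simp
  also have "\<dots> = real CARD('n) ^ p * \<bar>mpower x (\<lambda>j. if j = i then p else 0) * mderiv \<beta> \<psi> x\<bar>" by (simp add: abs_mult)
  also have "\<dots> \<le> real CARD('n) ^ p * ?S"
  proof (intro mult_left_mono schwartz_seminorm_upper[OF \<psi> _ \<beta>])
    show "msize (\<lambda>j. if j = i then p else 0) \<le> m" using p by (simp add: msize_def)
  qed simp
  finally show ?thesis using False by (simp add: max_absorb2)
qed

lemma integral_decay_bound:
  fixes u :: "real ^ 'n::finite \<Rightarrow> real"
  assumes m: "u \<in> borel_measurable lebesgue" and b: "AE x in lebesgue. \<bar>u x\<bar> \<le> c * decay x"
  shows "integrable lebesgue u" "\<bar>LINT x|lebesgue. u x\<bar> \<le> c * (LINT x :: real ^ 'n|lebesgue. decay x)"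
proof -
  have i: "integrable lebesgue (\<lambda>x :: real ^ 'n. c * decay x)" by (intro integrable_mult_right integrable_decay)
  show u: "integrable lebesgue u"
    by (rule Bochner_Integration.integrable_bound[OF i m]) (use b in \<open>eventually_elim, auto\<close>)
  have "\<bar>LINT x|lebesgue. u x\<bar> \<le> (LINT x|lebesgue. \<bar>u x\<bar>)" by (rule integral_abs_bound)
  also have "\<dots> \<le> (LINT x :: real ^ 'n|lebesgue. c * decay x)"
    by (intro integral_mono_AE integrable_abs u i b)
  finally show "\<bar>LINT x|lebesgue. u x\<bar> \<le> c * (LINT x :: real ^ 'n|lebesgue. decay x)" by simp
qed

lemma Lipschitz_growth:
  assumes "L-lipschitz_on UNIV (g :: real ^ 'n::finite \<Rightarrow> real)" shows "\<bar>g x\<bar> \<le> (\<bar>g 0\<bar> + L) * max 1 (norm x)"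
proof -
  have L: "0 \<le> L" using assms by (simp add: lipschitz_on_nonneg)
  have "\<bar>g x\<bar> \<le> \<bar>g 0\<bar> + L * norm x" using lipschitz_onD[OF assms, of x 0] by (simp add: dist_real_def)
  also have "\<dots> \<le> \<bar>g 0\<bar> * max 1 (norm x) + L * max 1 (norm x)"
    using L by (intro add_mono mult_left_mono) (auto simp: mult_le_cancel_left1)
  finally show ?thesis by (simp add: distrib_right)
qed

text \<open>Since \<open>g\<close> grows linearly, \<open>\<partial>\<^sub>k \<psi>\<close> has to decay by one power more than the integrable weight, and
  \<open>\<psi>\<close> just like it; hence the order \<open>n + 2\<close> of the Schwartz seminorms.\<close>

lemma tempered_mult_dpartial:
  fixes g f :: "real ^ 'n::finite \<Rightarrow> real"
  assumes g: "L-lipschitz_on UNIV g" and w: "wderiv (munit k) g \<in> borel_measurable lebesgue" "AE x in lebesgue. \<bar>wderiv (munit k) g x\<bar> \<le> L"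
    and f: "f \<in> borel_measurable lebesgue" "AE x in lebesgue. \<bar>f x\<bar> \<le> B"
  shows "tempered (mult_dpartial g k f)"
proof -
  let ?w = "wderiv (munit k) g" and ?n = "CARD('n)" and ?m = "CARD('n) + 2" and ?G = "\<bar>g 0\<bar> + L"
  let ?S = "\<lambda>\<psi> :: real ^ 'n \<Rightarrow> real. \<Sum>\<alpha> | msize \<alpha> \<le> ?m. \<Sum>\<beta> | msize \<beta> \<le> ?m. (SUP x. \<bar>mpower x \<alpha> * mderiv \<beta> \<psi> x\<bar>)"
  let ?W = "LINT x :: real ^ 'n|lebesgue. decay x"
  have L: "0 \<le> L" using g by (simp add: lipschitz_on_nonneg)
  have gm: "g \<in> borel_measurable lebesgue"
    by (simp add: measurable_completion borel_measurable_continuous_onI lipschitz_on_continuous_on[OF g])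
  have T: "mult_dpartial g k f \<psi> = - (LINT x|lebesgue. g x * f x * partial k \<psi> x) - (LINT x|lebesgue. ?w x * f x * \<psi> x)" for \<psi>
    by (simp add: mult_dpartial_def dderiv_def reg_def mderiv_munit)
  have pm: "\<psi> \<in> borel_measurable lebesgue" "partial k \<psi> \<in> borel_measurable lebesgue" if "\<psi> \<in> schwartz" for \<psi> :: "real ^ 'n \<Rightarrow> real"
    using schwartz_smooth[OF that] by (auto intro: smooth_measurable_lebesgue smooth_partial)
  have b1: "AE x in lebesgue. \<bar>g x * f x * partial k \<psi> x\<bar> \<le> ?G * B * (real ?n ^ ?m * ?S \<psi>) * decay x" if \<psi>: "\<psi> \<in> schwartz" for \<psi>
    using f(2)
  proof eventually_elim
    case (elim x)
    let ?M = "max 1 (norm x)"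
    have M: "0 < ?M" by simp
    have "?M ^ ?m * \<bar>partial k \<psi> x\<bar> \<le> real ?n ^ ?m * ?S \<psi>"
      using schwartz_decay[OF \<psi> order_refl, of "munit k" ?m x] by (simp add: mderiv_munit)
    then have d: "?M * \<bar>partial k \<psi> x\<bar> \<le> real ?n ^ ?m * ?S \<psi> * decay x"
      using M by (simp add: decay_def field_simps)
    have "\<bar>g x * f x * partial k \<psi> x\<bar> = \<bar>g x\<bar> * \<bar>f x\<bar> * \<bar>partial k \<psi> x\<bar>" by (simp add: abs_mult)
    also have "\<dots> \<le> (?G * ?M) * B * \<bar>partial k \<psi> x\<bar>"
      using elim L by (intro mult_right_mono mult_mono Lipschitz_growth g) auto
    also have "\<dots> = ?G * B * (?M * \<bar>partial k \<psi> x\<bar>)" by simp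
    also have "\<dots> \<le> ?G * B * (real ?n ^ ?m * ?S \<psi> * decay x)"
      using elim L by (intro mult_left_mono d mult_nonneg_nonneg) auto
    finally show ?case by (simp add: mult.assoc)
  qed
  have b2: "AE x in lebesgue. \<bar>?w x * f x * \<psi> x\<bar> \<le> L * B * (real ?n ^ (?n + 1) * ?S \<psi>) * decay x" if \<psi>: "\<psi> \<in> schwartz" for \<psi>
    using f(2) w(2)
  proof eventually_elim
    case (elim x)
    let ?M = "max 1 (norm x)"
    have "?M ^ (?n + 1) * \<bar>\<psi> x\<bar> \<le> real ?n ^ (?n + 1) * ?S \<psi>"
      using schwartz_decay[OF \<psi>, of "?n + 1" ?m "\<lambda>i. 0" x] by simp
    then have d: "\<bar>\<psi> x\<bar> \<le> real ?n ^ (?n + 1) * ?S \<psi> * decay x"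
      by (simp add: decay_def field_simps)
    have "\<bar>?w x * f x * \<psi> x\<bar> = \<bar>?w x\<bar> * \<bar>f x\<bar> * \<bar>\<psi> x\<bar>" by (simp add: abs_mult)
    also have "\<dots> \<le> L * B * (real ?n ^ (?n + 1) * ?S \<psi> * decay x)"
      using elim L d by (intro mult_mono) auto
    finally show ?case by (simp add: mult.assoc)
  qed
  have i1: "integrable lebesgue (\<lambda>x. g x * f x * partial k \<psi> x)" if "\<psi> \<in> schwartz" for \<psi>
    by (rule integral_decay_bound(1)[OF _ b1[OF that]]) (intro borel_measurable_times gm f pm that)
  have i2: "integrable lebesgue (\<lambda>x. ?w x * f x * \<psi> x)" if "\<psi> \<in> schwartz" for \<psi>
    by (rule integral_decay_bound(1)[OF _ b2[OF that]]) (intro borel_measurable_times w f pm that)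
  have eq: "a1 * a2 * (a3 * s) * a4 + b1 * a2 * (b3 * s) * a4 = (a1 * a2 * a3 * a4 + b1 * a2 * b3 * a4) * s"
    for a1 a2 a3 a4 b1 b3 s :: real
    by (simp add: algebra_simps)
  show ?thesis
    unfolding tempered_def
  proof (intro conjI ballI allI exI)
    fix \<psi> \<eta> :: "real ^ 'n \<Rightarrow> real" and a b assume s: "\<psi> \<in> schwartz" "\<eta> \<in> schwartz"
    have "partial k (\<lambda>x. a * \<psi> x + b * \<eta> x) = (\<lambda>x. a * partial k \<psi> x + b * partial k \<eta> x)"
      using mderiv_add[OF smooth_cmult smooth_cmult, of \<psi> \<eta> "munit k" a b] s[THEN schwartz_smooth]
      by (simp add: mderiv_munit mderiv_cmult[of _ "munit k", unfolded mderiv_munit])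
    then have "mult_dpartial g k f (\<lambda>x. a * \<psi> x + b * \<eta> x) =
      - (LINT x|lebesgue. a * (g x * f x * partial k \<psi> x) + b * (g x * f x * partial k \<eta> x)) -
        (LINT x|lebesgue. a * (?w x * f x * \<psi> x) + b * (?w x * f x * \<eta> x))"
      by (simp add: T algebra_simps)
    also have "\<dots> = a * mult_dpartial g k f \<psi> + b * mult_dpartial g k f \<eta>"
      unfolding T using i1[OF s(1)] i1[OF s(2)] i2[OF s(1)] i2[OF s(2)] by (simp add: algebra_simps)
    finally show "mult_dpartial g k f (\<lambda>x. a * \<psi> x + b * \<eta> x) = a * mult_dpartial g k f \<psi> + b * mult_dpartial g k f \<eta>" .
  next
    fix \<psi> :: "real ^ 'n \<Rightarrow> real" assume s: "\<psi> \<in> schwartz"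
    have "\<bar>LINT x|lebesgue. g x * f x * partial k \<psi> x\<bar> \<le> ?G * B * (real ?n ^ ?m * ?S \<psi>) * ?W"
      by (rule integral_decay_bound(2)[OF _ b1[OF s]]) (intro borel_measurable_times gm f pm s)
    moreover have "\<bar>LINT x|lebesgue. ?w x * f x * \<psi> x\<bar> \<le> L * B * (real ?n ^ (?n + 1) * ?S \<psi>) * ?W"
      by (rule integral_decay_bound(2)[OF _ b2[OF s]]) (intro borel_measurable_times w f pm s)
    ultimately have "\<bar>mult_dpartial g k f \<psi>\<bar> \<le> ?G * B * (real ?n ^ ?m * ?S \<psi>) * ?W + L * B * (real ?n ^ (?n + 1) * ?S \<psi>) * ?W"
      unfolding T by linarith
    also have "\<dots> = (?G * B * real ?n ^ ?m * ?W + L * B * real ?n ^ (?n + 1) * ?W) * ?S \<psi>"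
      by (rule eq)
    finally show "\<bar>mult_dpartial g k f \<psi>\<bar> \<le> (?G * B * real ?n ^ ?m * ?W + L * B * real ?n ^ (?n + 1) * ?W) * ?S \<psi>" .
  qed
qed

text \<open>Blow-down at order zero: a nearly best constant on a large ball is close to the mollification of \<open>f\<close> at
  that scale, which tends to the constant at infinity.\<close>

lemma blow_down_constant:
  fixes f \<phi> :: "real ^ 'n::finite \<Rightarrow> real"
  assumes \<phi>: "kernel 0 \<phi>" and so: "summable_osc 0 K f"
  shows "((\<lambda>R. C / R ^ CARD('n) * (LINT y|lebesgue. indicator (cball x0 R) y * \<bar>f y - lim_moment \<phi> f (\<lambda>i. 0)\<bar>)) \<longlongrightarrow> 0) at_top"
proof -
  let ?c = "lim_moment \<phi> f (\<lambda>i. 0)" and ?w = "measure lebesgue (ball (0 :: real ^ 'n) 1)" and ?n = "CARD('n)"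
  note f = summable_osc_Lp_loc[OF so]
  obtain D where D: "0 < D" "\<And>f N P r x z R. f \<in> Lp_loc 1 \<and> P \<in> polys N \<and> N \<le> 0 + msize (\<lambda>i :: 'n. 0) \<and> 0 < r \<and> cball x r \<subseteq> ball z R \<Longrightarrow>
    \<bar>conv (reg f) (mderiv (\<lambda>i. 0) (rescale \<phi> r)) x - mderiv (\<lambda>i. 0) P x\<bar> \<le> D / r ^ (CARD('n) + msize (\<lambda>i :: 'n. 0)) * L1dist_ball f P z R"
    using mollified_derivative_near_poly[OF \<phi>, of "\<lambda>i. 0"] by metis
  have w: "0 < ?w" by (rule measure_unit_ball_pos)
  let ?m = "\<lambda>R. moment \<phi> (\<lambda>i. 0) x0 R (reg f)"
  let ?b = "\<lambda>R. \<bar>C\<bar> * 2 ^ ?n * ((1 + D * ?w) * (scaled_best 0 f x0 (2 * R) + 1 / (2 * R) ^ ?n) + ?w * \<bar>?m R - ?c\<bar>)"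
  have dbl: "filterlim (\<lambda>R :: real. 2 * R) at_top at_top"
    using filterlim_tendsto_pos_mult_at_top[OF tendsto_const[of "2 :: real"] _ filterlim_ident] by simp
  have inv: "((\<lambda>R :: real. 1 / R ^ ?n) \<longlongrightarrow> 0) at_top"
    by (intro tendsto_divide_0[OF tendsto_const] filterlim_at_top_imp_at_infinity filterlim_pow_at_top filterlim_ident) simp
  have "(?b \<longlongrightarrow> \<bar>C\<bar> * 2 ^ ?n * ((1 + D * ?w) * (0 + 0) + ?w * 0)) at_top"
    by (intro tendsto_add tendsto_mult tendsto_const filterlim_compose[OF scaled_best_tendsto_0[OF so] dbl]
        filterlim_compose[OF inv dbl] tendsto_rabs_zero LIM_zero moment_tendsto_lim_moment[OF \<phi> so]) simp
  then have lim: "(?b \<longlongrightarrow> 0) at_top" by simp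
  show ?thesis
  proof (rule Lim_null_comparison[OF _ lim])
    show "\<forall>\<^sub>F R in at_top. norm (C / R ^ ?n * (LINT y|lebesgue. indicator (cball x0 R) y * \<bar>f y - ?c\<bar>)) \<le> ?b R"
      using eventually_gt_at_top[of 0]
    proof eventually_elim
      case (elim R)
      obtain P where P: "P \<in> polys 0" "L1dist_ball f P x0 (2 * R) < best_L1 0 f x0 (2 * R) + 1"
        using ex_near_best[of 1 0 f x0 "2 * R"] by auto
      let ?E = "L1dist_ball f P x0 (2 * R)"
      have Pc: "P = (\<lambda>y. P x0)" using polys_0_const[OF P(1)] by blast
      have "\<bar>?m R - P x0\<bar> \<le> D / R ^ ?n * ?E"
        using D(2)[of f P 0 R x0 x0 "2 * R"] f P(1) elim by (simp add: moment_def cball_subset_ball_iff)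
      then have c: "\<bar>P x0 - ?c\<bar> \<le> D / R ^ ?n * ?E + \<bar>?m R - ?c\<bar>" by linarith
      have cl: "(\<lambda>y. ?c) \<in> Lp_loc 1" by (intro smooth_Lp_loc_1 smooth_const)
      have "(LINT y|lebesgue. indicator (cball x0 R) y * \<bar>f y - ?c\<bar>) \<le>
          (LINT y|lebesgue. indicator (cball x0 R) y * \<bar>f y - P y\<bar> + indicator (cball x0 R) y * \<bar>P y - ?c\<bar>)"
      proof (intro integral_mono Bochner_Integration.integrable_add)
        have i: "integrable lebesgue (\<lambda>y. indicator (cball x0 R) y * \<bar>u y - v y\<bar>)" if "u \<in> Lp_loc 1" "v \<in> Lp_loc 1" for u v :: "real ^ 'n \<Rightarrow> real"
          using integrable_abs[OF Lp_loc_1_integrable_cball[OF Lp_loc_1_diff[OF that]]] by (simp add: abs_mult)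
        show "integrable lebesgue (\<lambda>y. indicator (cball x0 R) y * \<bar>f y - ?c\<bar>)" by (rule i[OF f cl])
        show "integrable lebesgue (\<lambda>y. indicator (cball x0 R) y * \<bar>f y - P y\<bar>)" by (rule i[OF f smooth_Lp_loc_1[OF smooth_polys[OF P(1)]]])
        show "integrable lebesgue (\<lambda>y. indicator (cball x0 R) y * \<bar>P y - ?c\<bar>)" by (rule i[OF smooth_Lp_loc_1[OF smooth_polys[OF P(1)]] cl])
      qed (auto simp: indicator_def)
      also have "\<dots> = (LINT y|lebesgue. indicator (cball x0 R) y * \<bar>f y - P y\<bar>) + (LINT y|lebesgue. indicator (cball x0 R) y * \<bar>P y - ?c\<bar>)"
      proof (rule Bochner_Integration.integral_add)
        have i: "integrable lebesgue (\<lambda>y. indicator (cball x0 R) y * \<bar>u y - v y\<bar>)" if "u \<in> Lp_loc 1" "v \<in> Lp_loc 1" for u v :: "real ^ 'n \<Rightarrow> real"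
          using integrable_abs[OF Lp_loc_1_integrable_cball[OF Lp_loc_1_diff[OF that]]] by (simp add: abs_mult)
        show "integrable lebesgue (\<lambda>y. indicator (cball x0 R) y * \<bar>f y - P y\<bar>)" by (rule i[OF f smooth_Lp_loc_1[OF smooth_polys[OF P(1)]]])
        show "integrable lebesgue (\<lambda>y. indicator (cball x0 R) y * \<bar>P y - ?c\<bar>)" by (rule i[OF smooth_Lp_loc_1[OF smooth_polys[OF P(1)]] cl])
      qed
      also have "\<dots> \<le> ?E + \<bar>P x0 - ?c\<bar> * (R ^ ?n * ?w)"
      proof (intro add_mono)
        show "(LINT y|lebesgue. indicator (cball x0 R) y * \<bar>f y - P y\<bar>) \<le> ?E"
          by (intro integral_cball_le_L1dist f smooth_Lp_loc_1 smooth_polys[OF P(1)] elim)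
        have "(\<lambda>y. P y - ?c) \<in> Lp_loc 1" by (intro Lp_loc_1_diff smooth_Lp_loc_1 smooth_polys[OF P(1)] smooth_const)
        moreover have "\<bar>P y - ?c\<bar> \<le> \<bar>P x0 - ?c\<bar>" for y by (subst Pc) simp
        ultimately show "(LINT y|lebesgue. indicator (cball x0 R) y * \<bar>P y - ?c\<bar>) \<le> \<bar>P x0 - ?c\<bar> * (R ^ ?n * ?w)"
          by (intro integral_indicator_cball_le elim) auto
      qed
      also have "\<dots> \<le> ?E + (D / R ^ ?n * ?E + \<bar>?m R - ?c\<bar>) * (R ^ ?n * ?w)"
        using w elim by (intro add_left_mono mult_right_mono c) auto
      also have "\<dots> = (1 + D * ?w) * ?E + ?w * \<bar>?m R - ?c\<bar> * R ^ ?n"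
        using elim by (simp add: distrib_right)
      also have "\<dots> \<le> (1 + D * ?w) * (best_L1 0 f x0 (2 * R) + 1) + ?w * \<bar>?m R - ?c\<bar> * R ^ ?n"
        using D(1) w P(2) by (intro add_right_mono mult_left_mono) auto
      finally have main: "(LINT y|lebesgue. indicator (cball x0 R) y * \<bar>f y - ?c\<bar>) \<le>
         (1 + D * ?w) * (best_L1 0 f x0 (2 * R) + 1) + ?w * \<bar>?m R - ?c\<bar> * R ^ ?n" .
      have nn: "0 \<le> (LINT y|lebesgue. indicator (cball x0 R) y * \<bar>f y - ?c\<bar>)"
        by (intro Bochner_Integration.integral_nonneg) auto
      have "norm (C / R ^ ?n * (LINT y|lebesgue. indicator (cball x0 R) y * \<bar>f y - ?c\<bar>)) =
         \<bar>C\<bar> / R ^ ?n * (LINT y|lebesgue. indicator (cball x0 R) y * \<bar>f y - ?c\<bar>)"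
        using elim nn by (simp add: abs_mult)
      also have "\<dots> \<le> \<bar>C\<bar> / R ^ ?n * ((1 + D * ?w) * (best_L1 0 f x0 (2 * R) + 1) + ?w * \<bar>?m R - ?c\<bar> * R ^ ?n)"
        using elim by (intro mult_left_mono main) auto
      also have "\<dots> = \<bar>C\<bar> * (2 ^ ?n * ((1 + D * ?w) * (scaled_best 0 f x0 (2 * R) + 1 / (2 * R) ^ ?n)) + ?w * \<bar>?m R - ?c\<bar>)"
        using elim by (simp add: scaled_best_def power_mult_distrib field_simps)
      also have "\<dots> \<le> ?b R"
      proof -
        have "1 * (?w * \<bar>?m R - ?c\<bar>) \<le> 2 ^ ?n * (?w * \<bar>?m R - ?c\<bar>)" using w by (intro mult_right_mono) auto
        then have "2 ^ ?n * ((1 + D * ?w) * (scaled_best 0 f x0 (2 * R) + 1 / (2 * R) ^ ?n)) + ?w * \<bar>?m R - ?c\<bar> \<le>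
           2 ^ ?n * ((1 + D * ?w) * (scaled_best 0 f x0 (2 * R) + 1 / (2 * R) ^ ?n) + ?w * \<bar>?m R - ?c\<bar>)"
          unfolding distrib_left[of "2 ^ ?n"] by linarith
        then show ?thesis by (simp only: mult.assoc mult_left_mono abs_ge_zero)
      qed
      finally show ?case .
    qed
  qed
qed

text \<open>If \<open>f\<close> is replaced by its limit at infinity, the distribution vanishes on test functions, by the
  definition of the weak derivative of \<open>g\<close>; the error is controlled by the blow-down of \<open>f\<close>, because
  \<open>g\<close> grows at most linearly.\<close>

theorem mult_dpartial_tendsto_0:
  fixes g f \<phi> :: "real ^ 'n::finite \<Rightarrow> real"
  assumes \<phi>: "kernel 0 \<phi>" and so: "summable_osc 0 K f" and g: "L-lipschitz_on UNIV g"
    and w: "has_wderiv (munit k) g w'" "\<And>x. \<bar>w' x\<bar> \<le> L" and ae: "AE x in lebesgue. wderiv (munit k) g x = w' x"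
    and wm: "wderiv (munit k) g \<in> borel_measurable lebesgue"
  shows "Pdot_tendsto \<phi> 0 0 (mult_dpartial g k f) (\<lambda>x. 0)"
proof -
  let ?c = "lim_moment \<phi> f (\<lambda>i. 0)" and ?n = "CARD('n)" and ?G = "\<bar>g 0\<bar> + L"
  note f = summable_osc_Lp_loc[OF so]
  have L: "0 \<le> L" using g by (simp add: lipschitz_on_nonneg)
  have gc: "continuous_on UNIV g" by (rule lipschitz_on_continuous_on[OF g])
  have gL: "g \<in> Lp_loc 1" by (rule Lp_loc_1_continuous[OF gc])
  have gm: "g \<in> borel_measurable lebesgue" by (rule Lp_loc_measurable[OF gL])
  have wL: "w' \<in> Lp_loc 1" using w(1) by (simp add: has_wderiv_def)
  have w'm: "w' \<in> borel_measurable lebesgue" by (rule Lp_loc_measurable[OF wL])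
  have fm: "f \<in> borel_measurable lebesgue" by (rule Lp_loc_measurable[OF f])
  have fc: "(\<lambda>y. f y - ?c) \<in> Lp_loc 1" by (intro Lp_loc_1_diff f smooth_Lp_loc_1 smooth_const)
  obtain C0 where C0: "0 < C0" "\<And>r y. 0 < r \<Longrightarrow> \<bar>rescale \<phi> r y\<bar> \<le> C0 / r ^ ?n"
    using kernel_rescale_bound[OF \<phi>] by metis
  obtain C1 where C1: "0 < C1" "\<And>R y. 0 < R \<Longrightarrow> \<bar>mderiv (munit k) (rescale \<phi> R) y\<bar> \<le> C1 / R ^ (?n + 1)"
    using mderiv_rescale_bound[OF kernel_test_fun[OF \<phi>], of "munit k"] by auto
  have "((\<lambda>R. moment \<phi> (\<lambda>i. 0) 0 R (mult_dpartial g k f)) \<longlongrightarrow> 0) at_top"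
  proof (rule Lim_null_comparison[OF _ blow_down_constant[OF \<phi> so, of "?G * C1 + L * C0" 0]])
    show "\<forall>\<^sub>F R in at_top. norm (moment \<phi> (\<lambda>i. 0) 0 R (mult_dpartial g k f)) \<le>
      (?G * C1 + L * C0) / R ^ ?n * (LINT y|lebesgue. indicator (cball 0 R) y * \<bar>f y - ?c\<bar>)"
      using eventually_ge_at_top[of 1]
    proof eventually_elim
      case (elim R)
      have R: "0 < R" using elim by simp
      define \<psi> where "\<psi> y = rescale \<phi> R (0 - y)" for y
      have t0: "test_fun (rescale \<phi> R)" by (rule kernel_test_fun_rescale[OF \<phi> R])
      have t: "test_fun \<psi>" unfolding \<psi>_def by (rule test_fun_reflect[OF t0])
      have su: "supp_cball 0 R \<psi>"
        using supp_cball_reflect[OF kernel_supp_rescale[OF \<phi> R], of 0] by (simp add: \<psi>_def[abs_def])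
      have b0: "\<bar>\<psi> y\<bar> \<le> C0 / R ^ ?n" for y unfolding \<psi>_def by (rule C0(2)[OF R])
      have b1: "\<bar>partial k \<psi> y\<bar> \<le> C1 / R ^ (?n + 1)" for y
      proof -
        have "partial k \<psi> y = - mderiv (munit k) (rescale \<phi> R) (0 - y)"
          unfolding \<psi>_def[abs_def] partial_reflect[OF test_fun_smooth[OF t0]] mderiv_munit ..
        then show ?thesis using C1(2)[OF R, of "0 - y"] by simp
      qed
      note \<psi>m = test_fun_measurable_lebesgue[OF t] test_fun_measurable_lebesgue[OF test_fun_partial[OF t, of k]]
      have m: "(\<lambda>y. g y * partial k \<psi> y) \<in> borel_measurable lebesgue" "(\<lambda>y. w' y * \<psi> y) \<in> borel_measurable lebesgue"
        by (intro borel_measurable_times gm w'm \<psi>m)+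
      have s: "supp_cball 0 R (\<lambda>y. g y * partial k \<psi> y)" "supp_cball 0 R (\<lambda>y. w' y * \<psi> y)"
        by (intro supp_cball_mult supp_cball_partial su)+
      have b: "\<bar>g y * partial k \<psi> y\<bar> \<le> ?G * C1 / R ^ ?n" "\<bar>w' y * \<psi> y\<bar> \<le> L * C0 / R ^ ?n" for y
      proof -
        show "\<bar>g y * partial k \<psi> y\<bar> \<le> ?G * C1 / R ^ ?n"
        proof (cases "norm y \<le> R")
          case True
          have "\<bar>g y\<bar> \<le> ?G * max 1 (norm y)" by (rule Lipschitz_growth[OF g])
          also have "\<dots> \<le> ?G * R" using True elim L by (intro mult_left_mono) auto
          finally have "\<bar>g y\<bar> * \<bar>partial k \<psi> y\<bar> \<le> (?G * R) * (C1 / R ^ (?n + 1))"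
            using b1[of y] L R by (intro mult_mono) auto
          also have "\<dots> = ?G * C1 / R ^ ?n" using R by simp
          finally show ?thesis by (simp add: abs_mult)
        next
          case False
          then have "partial k \<psi> y = 0" using supp_cballD[OF supp_cball_partial[OF su], of y k] by simp
          then show ?thesis using L C1(1) R by simp
        qed
        show "\<bar>w' y * \<psi> y\<bar> \<le> L * C0 / R ^ ?n"
          using mult_mono[OF w(2)[of y] b0[of y] L abs_ge_zero] by (simp add: abs_mult)
      qed
      have i: "integrable lebesgue (\<lambda>y. u y * (g y * partial k \<psi> y))" "integrable lebesgue (\<lambda>y. u y * (w' y * \<psi> y))"
        if "u \<in> Lp_loc 1" for u
        by (rule Lp_loc_1_integrable_mult[OF that m(1) s(1) b(1)], rule Lp_loc_1_integrable_mult[OF that m(2) s(2) b(2)])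
      have one: "(\<lambda>y. 1) \<in> Lp_loc 1" by (intro smooth_Lp_loc_1 smooth_const)
      have zero: "(LINT y|lebesgue. g y * partial k \<psi> y) + (LINT y|lebesgue. w' y * \<psi> y) = 0"
        using w(1) t by (simp add: has_wderiv_def mderiv_munit)
      have split: "(LINT y|lebesgue. f y * q y) = (LINT y|lebesgue. (f y - ?c) * q y) + ?c * (LINT y|lebesgue. q y)"
        if "integrable lebesgue (\<lambda>y. (f y - ?c) * q y)" "integrable lebesgue q" for q :: "real ^ 'n \<Rightarrow> real"
      proof -
        have "(LINT y|lebesgue. f y * q y) = (LINT y|lebesgue. (f y - ?c) * q y + ?c * q y)" by (simp add: algebra_simps)
        also have "\<dots> = (LINT y|lebesgue. (f y - ?c) * q y) + (LINT y|lebesgue. ?c * q y)"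
          by (intro Bochner_Integration.integral_add integrable_mult_right that)
        finally show ?thesis by simp
      qed
      have "moment \<phi> (\<lambda>i. 0) 0 R (mult_dpartial g k f) = - (LINT y|lebesgue. f y * (g y * partial k \<psi> y)) - (LINT y|lebesgue. wderiv (munit k) g y * f y * \<psi> y)"
        by (simp add: moment_def conv_def mult_dpartial_def dderiv_def reg_def mderiv_munit \<psi>_def[abs_def] mult_ac)
      also have "(LINT y|lebesgue. wderiv (munit k) g y * f y * \<psi> y) = (LINT y|lebesgue. f y * (w' y * \<psi> y))"
        using ae by (intro integral_cong_AE borel_measurable_times wm w'm fm \<psi>m) (auto elim!: eventually_mono)
      also have "(LINT y|lebesgue. f y * (g y * partial k \<psi> y)) = (LINT y|lebesgue. (f y - ?c) * (g y * partial k \<psi> y)) + ?c * (LINT y|lebesgue. g y * partial k \<psi> y)"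
        using i(1)[OF fc] i(1)[OF one] by (intro split) auto
      also have "(LINT y|lebesgue. f y * (w' y * \<psi> y)) = (LINT y|lebesgue. (f y - ?c) * (w' y * \<psi> y)) + ?c * (LINT y|lebesgue. w' y * \<psi> y)"
        using i(2)[OF fc] i(2)[OF one] by (intro split) auto
      also have "- ((LINT y|lebesgue. (f y - ?c) * (g y * partial k \<psi> y)) + ?c * (LINT y|lebesgue. g y * partial k \<psi> y)) -
          ((LINT y|lebesgue. (f y - ?c) * (w' y * \<psi> y)) + ?c * (LINT y|lebesgue. w' y * \<psi> y)) =
          - (LINT y|lebesgue. (f y - ?c) * (g y * partial k \<psi> y)) - (LINT y|lebesgue. (f y - ?c) * (w' y * \<psi> y))
          - ?c * ((LINT y|lebesgue. g y * partial k \<psi> y) + (LINT y|lebesgue. w' y * \<psi> y))"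
        by (simp add: algebra_simps)
      finally have mom: "moment \<phi> (\<lambda>i. 0) 0 R (mult_dpartial g k f) =
          - (LINT y|lebesgue. (f y - ?c) * (g y * partial k \<psi> y)) - (LINT y|lebesgue. (f y - ?c) * (w' y * \<psi> y))"
        by (simp add: zero)
      let ?I = "LINT y|lebesgue. indicator (cball 0 R) y * \<bar>f y - ?c\<bar>"
      have "\<bar>LINT y|lebesgue. (f y - ?c) * (g y * partial k \<psi> y)\<bar> \<le> ?G * C1 / R ^ ?n * ?I"
        by (rule integral_mult_bound[OF fc s(1) b(1)])
      moreover have "\<bar>LINT y|lebesgue. (f y - ?c) * (w' y * \<psi> y)\<bar> \<le> L * C0 / R ^ ?n * ?I"
        by (rule integral_mult_bound[OF fc s(2) b(2)])
      ultimately have "\<bar>moment \<phi> (\<lambda>i. 0) 0 R (mult_dpartial g k f)\<bar> \<le> ?G * C1 / R ^ ?n * ?I + L * C0 / R ^ ?n * ?I"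
        unfolding mom by linarith
      then show ?case by (simp only: real_norm_def add_divide_distrib distrib_right)
    qed
  qed
  then have "Pdot_tendsto \<phi> 0 0 (mult_dpartial g k f) (\<lambda>x. \<Sum>\<alpha> | msize (\<alpha> :: 'n mindex) = 0. 1 / mfact \<alpha> * 0 * mpower x \<alpha>)"
    by (intro Pdot_tendstoI) (simp only: msize_eq_0_iff)
  then show ?thesis by simp
qed

section \<open>Embeddings and limits at infinity\<close>

lemma Lp_norm_infinity_le:
  fixes h :: "real ^ 'n::finite \<Rightarrow> real"
  assumes "h \<in> borel_measurable lebesgue" "AE x in lebesgue. \<bar>h x\<bar> \<le> B"
  shows "Lp_norm \<infinity> UNIV h \<le> ennreal B"
proof -
  have "restrict_space lebesgue (UNIV :: (real ^ 'n) set) = lebesgue"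
    by (rule measure_eqI) (simp_all add: sets_restrict_space emeasure_restrict_space)
  moreover have "esssup lebesgue (\<lambda>x. ennreal \<bar>h x\<bar>) \<le> ennreal B"
    using assms(2) by (intro esssup_I borel_measurable_abs measurable_compose[OF _ measurable_ennreal] assms(1))
      (auto elim!: eventually_mono intro: ennreal_leI)
  ultimately show ?thesis by (simp add: Lp_norm_def)
qed

lemma lip_seminorm_le:
  assumes "L-lipschitz_on UNIV F" shows "lip_seminorm F \<le> ennreal L"
  unfolding lip_seminorm_def
proof (rule SUP_least, clarify)
  fix x y :: "real ^ 'a" assume "x \<noteq> y"
  then show "ennreal (\<bar>F x - F y\<bar> / dist x y) \<le> ennreal L"
    using lipschitz_onD[OF assms, of x y] by (intro ennreal_leI) (simp add: dist_real_def divide_le_eq)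
qed

text \<open>The regularity estimates involve the bound of the oscillation sums and the \<open>L\<^sup>1\<close> norm on the unit ball.
  Hoelder's inequality bounds both by the norm of the Campanato space.\<close>

lemma dyadic_data_le_camp_norm:
  fixes p :: ennreal
  assumes p: "1 \<le> p" and C: "0 \<le> C"
  shows "\<exists>c\<ge>0. \<forall>f :: real ^ 'n::finite \<Rightarrow> real. f \<in> camp p N \<longrightarrow>
    ennreal (C * (measure lebesgue (ball (0 :: real ^ 'n) 1) * enn2real (camp_seminorm p N f) + L1dist_ball f (\<lambda>x. 0) 0 1))
      \<le> ennreal c * camp_norm p N f"
proof -
  let ?w = "measure lebesgue (ball (0 :: real ^ 'n) 1)" let ?v = "?w powr (1 - enn2real (inverse p))"
  have w: "0 \<le> ?w" "0 \<le> ?v" by auto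
  have main: "ennreal (C * (?w * enn2real (camp_seminorm p N f) + L1dist_ball f (\<lambda>x. 0) 0 1)) \<le> ennreal (C * (?w + ?v)) * camp_norm p N f"
    if f: "f \<in> camp p N" for f :: "real ^ 'n \<Rightarrow> real"
  proof -
    let ?S = "camp_seminorm p N f" and ?A = "L1dist_ball f (\<lambda>x. 0) 0 1" and ?L = "Lp_norm p (ball 0 1) f"
    have S: "?S < \<infinity>" and fl: "f \<in> Lp_loc p" using f by (auto simp: camp_def)
    have A: "0 \<le> ?A" by (rule L1dist_ball_nonneg)
    have z: "(\<lambda>x :: real ^ 'n. 0 :: real) \<in> Lp_loc 1" by (intro smooth_Lp_loc_1 smooth_const)
    have AL: "ennreal ?A \<le> ennreal ?v * ?L"
      using L1dist_ball_le_Lp_norm[OF p Lp_loc_subset_1[OF p fl] z, of 1 0] by simp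
    have "ennreal (?w * enn2real ?S) = ennreal ?w * ?S"
      using S w by (simp add: ennreal_mult)
    then have "ennreal (?w * enn2real ?S + ?A) \<le> ennreal ?w * ?S + ennreal ?v * ?L"
      using A w AL by (simp add: ennreal_plus add_left_mono)
    also have "\<dots> \<le> ennreal (?w + ?v) * ?S + ennreal (?w + ?v) * ?L"
      using w by (intro add_mono mult_right_mono ennreal_leI) auto
    also have "\<dots> = ennreal (?w + ?v) * camp_norm p N f"
      by (simp add: camp_norm_def distrib_left)
    finally have "ennreal C * ennreal (?w * enn2real ?S + ?A) \<le> ennreal C * (ennreal (?w + ?v) * camp_norm p N f)"
      by (rule mult_left_mono) simp
    then show ?thesis using C w A by (simp add: ennreal_mult mult.assoc)
  qed
  show ?thesis by (rule exI[of _ "C * (?w + ?v)"]) (use main C w in auto)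
qed

lemma camp_has_wderiv:
  fixes p :: ennreal and \<phi> f :: "real ^ 'n::finite \<Rightarrow> real"
  assumes p: "1 \<le> p" and \<phi>: "kernel 0 \<phi>" and f: "f \<in> camp p N" and \<alpha>: "msize \<alpha> = N"
  shows "has_wderiv \<alpha> f (wderiv \<alpha> f)"
proof -
  obtain \<Phi> :: "real ^ 'n \<Rightarrow> real" where \<Phi>: "kernel N \<Phi>" using ex_kernel[OF \<phi>] by blast
  have "\<exists>h. has_wderiv \<alpha> f h"
    using summable_osc_ex_wderiv[OF \<Phi> camp_summable_osc[OF p f] \<alpha>] by blast
  then show ?thesis using has_wderiv_wderiv by blast
qed

theorem camp_embedding:
  fixes p :: ennreal and \<Phi> :: "real ^ 'n::finite \<Rightarrow> real"
  assumes p: "1 \<le> p" and \<Phi>: "kernel N \<Phi>"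
  shows "\<exists>c. \<forall>f :: real ^ 'n \<Rightarrow> real. f \<in> camp p N \<longrightarrow>
    (1 \<le> N \<longrightarrow> (\<exists>F\<in>Ck1 (N - 1). (AE x in lebesgue. f x = F x) \<and> Ck1_norm (N - 1) F \<le> ennreal c * camp_norm p N f)) \<and>
    (\<forall>\<alpha> h. msize \<alpha> = N \<longrightarrow> has_wderiv \<alpha> f h \<longrightarrow> Lp_norm \<infinity> UNIV h \<le> ennreal c * camp_norm p N f)"
proof -
  let ?K = "\<lambda>f :: real ^ 'n \<Rightarrow> real. measure lebesgue (ball (0 :: real ^ 'n) 1) * enn2real (camp_seminorm p N f)"
  let ?A = "\<lambda>f :: real ^ 'n \<Rightarrow> real. L1dist_ball f (\<lambda>x. 0) 0 1"
  obtain C where C: "C > 0" and reg: "\<forall>f K. summable_osc N K f \<longrightarrow>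
    (\<forall>\<alpha>. msize \<alpha> = N \<longrightarrow> (\<exists>h. has_wderiv \<alpha> f h \<and> (\<forall>x. (\<lambda>i. mollified \<Phi> f \<alpha> i x) \<longlonglongrightarrow> h x) \<and>
       (\<forall>i x. \<bar>mollified \<Phi> f \<alpha> i x\<bar> \<le> C * (K + L1dist_ball f (\<lambda>x. 0) 0 1)))) \<and>
    (1 \<le> N \<longrightarrow> (\<exists>F. Ck (N - 1) F \<and> (AE x in lebesgue. f x = F x) \<and>
      (\<forall>\<alpha>. msize \<alpha> \<le> N - 1 \<longrightarrow> \<bar>mderiv \<alpha> F 0\<bar> \<le> C * (K + L1dist_ball f (\<lambda>x. 0) 0 1)) \<and>
      (\<forall>\<alpha>. msize \<alpha> = N - 1 \<longrightarrow> (C * (K + L1dist_ball f (\<lambda>x. 0) 0 1))-lipschitz_on UNIV (mderiv \<alpha> F)) \<and>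
      (\<forall>x i. \<bar>mollified \<Phi> f (\<lambda>j. 0) i x - F x\<bar> \<le> C * K * (1 / 2) ^ i)))"
    using summable_osc_regularity[OF \<Phi>] by auto
  obtain c where c: "0 \<le> c" "\<And>f :: real ^ 'n \<Rightarrow> real. f \<in> camp p N \<Longrightarrow> ennreal (C * (?K f + ?A f)) \<le> ennreal c * camp_norm p N f"
    using dyadic_data_le_camp_norm[OF p, of C N] C by auto
  \<comment> \<open>the number of summands of the norm of \<open>F\<close>, and one more for the weak derivatives\<close>
  define m where "m = card {\<alpha> :: 'n mindex. msize \<alpha> \<le> N - 1} + card {\<alpha> :: 'n mindex. msize \<alpha> = N - 1} + 1"
  have scale: "of_nat j * ennreal (C * (?K f + ?A f)) \<le> ennreal (real m * c) * camp_norm p N f"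
    if "f \<in> camp p N" "j \<le> m" for f j
  proof -
    have "of_nat j * ennreal (C * (?K f + ?A f)) \<le> of_nat m * (ennreal c * camp_norm p N f)"
      using that by (intro mult_mono c) auto
    also have "\<dots> = ennreal (real m * c) * camp_norm p N f"
      using c(1) by (simp add: ennreal_mult ennreal_of_nat_eq_real_of_nat mult.assoc)
    finally show ?thesis .
  qed
  show ?thesis
  proof (rule exI[of _ "real m * c"], intro allI impI conjI)
    fix f :: "real ^ 'n \<Rightarrow> real" assume f: "f \<in> camp p N"
    note so = camp_summable_osc[OF p f]
    let ?B = "C * (?K f + ?A f)"
    {
      assume N: "1 \<le> N"
      then obtain F where F: "Ck (N - 1) F" "AE x in lebesgue. f x = F x" "\<And>\<alpha>. msize \<alpha> \<le> N - 1 \<Longrightarrow> \<bar>mderiv \<alpha> F 0\<bar> \<le> ?B"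
        "\<And>\<alpha>. msize \<alpha> = N - 1 \<Longrightarrow> ?B-lipschitz_on UNIV (mderiv \<alpha> F)"
        using reg[rule_format, OF so] by blast
      have "Ck1_norm (N - 1) F \<le> (\<Sum>\<alpha> | msize (\<alpha> :: 'n mindex) \<le> N - 1. ennreal ?B) + (\<Sum>\<alpha> | msize (\<alpha> :: 'n mindex) = N - 1. ennreal ?B)"
        unfolding Ck1_norm_def using F(3,4) by (intro add_mono sum_mono ennreal_leI lip_seminorm_le) auto
      also have "\<dots> = of_nat (card {\<alpha> :: 'n mindex. msize \<alpha> \<le> N - 1} + card {\<alpha> :: 'n mindex. msize \<alpha> = N - 1}) * ennreal ?B"
        by (simp add: distrib_right)
      also have "\<dots> \<le> ennreal (real m * c) * camp_norm p N f" by (rule scale[OF f]) (simp add: m_def)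
      finally show "\<exists>F\<in>Ck1 (N - 1). (AE x in lebesgue. f x = F x) \<and> Ck1_norm (N - 1) F \<le> ennreal (real m * c) * camp_norm p N f"
        using F by (intro bexI[of _ F]) (auto simp: Ck1_def)
    next
      fix \<alpha> h assume \<alpha>: "msize \<alpha> = N" and h: "has_wderiv \<alpha> f h"
      obtain h' where h': "has_wderiv \<alpha> f h'" "\<And>x. (\<lambda>i. mollified \<Phi> f \<alpha> i x) \<longlonglongrightarrow> h' x" "\<And>i x. \<bar>mollified \<Phi> f \<alpha> i x\<bar> \<le> ?B"
        using reg[rule_format, OF so] \<alpha> by blast
      have "\<bar>h' x\<bar> \<le> ?B" for x
        by (rule tendsto_upperbound[OF tendsto_rabs[OF h'(2)]] always_eventually allI h'(3) trivial_limit_sequentially)+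
      then have "AE x in lebesgue. \<bar>h x\<bar> \<le> ?B"
        using has_wderiv_unique[OF \<Phi> h h'(1)] by (auto elim!: eventually_mono)
      moreover have "h \<in> Lp_loc 1" using h by (simp add: has_wderiv_def)
      ultimately have "Lp_norm \<infinity> UNIV h \<le> ennreal ?B"
        by (intro Lp_norm_infinity_le Lp_loc_measurable)
      also have "\<dots> = of_nat 1 * ennreal ?B" by simp
      also have "\<dots> \<le> ennreal (real m * c) * camp_norm p N f" by (rule scale[OF f]) (simp add: m_def)
      finally show "Lp_norm \<infinity> UNIV h \<le> ennreal (real m * c) * camp_norm p N f" .
    }
  qed
qed

text \<open>The function \<open>f\<close> is its own weak derivative of order zero, hence bounded by the regularity theorem; the
  temperedness relies on this bound.\<close>

theorem Lipschitz_times_derivative_vanishes_at_infinity: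
  fixes p :: ennreal and \<phi> :: "real ^ 'n::finite \<Rightarrow> real"
  assumes p: "1 \<le> p" and \<phi>: "kernel 0 \<phi>" and g: "g \<in> Ck1 0" and f: "f \<in> camp p 0"
  shows "has_wderiv (munit k) g (wderiv (munit k) g)" "tempered (mult_dpartial g k f)"
    "Pdot_tendsto \<phi> 0 0 (mult_dpartial g k f) (\<lambda>x. 0)"
proof -
  note so = camp_summable_osc[OF p f]
  note fl = summable_osc_Lp_loc[OF so]
  obtain L where L: "L-lipschitz_on UNIV g"
    using g by (auto simp: Ck1_def msize_eq_0_iff)
  obtain w where w: "has_wderiv (munit k) g w" "\<And>x. \<bar>w x\<bar> \<le> L" using Lipschitz_has_wderiv[OF L] by blast
  show wd: "has_wderiv (munit k) g (wderiv (munit k) g)" by (rule has_wderiv_wderiv[OF w(1)])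
  have ae: "AE x in lebesgue. wderiv (munit k) g x = w x" by (rule has_wderiv_unique[OF \<phi> wd w(1)])
  have "wderiv (munit k) g \<in> Lp_loc 1" using wd by (simp add: has_wderiv_def)
  then have wm: "wderiv (munit k) g \<in> borel_measurable lebesgue" by (rule Lp_loc_measurable)
  show "Pdot_tendsto \<phi> 0 0 (mult_dpartial g k f) (\<lambda>x. 0)"
    by (rule mult_dpartial_tendsto_0[OF \<phi> so L w ae wm])
  have "has_wderiv (\<lambda>i. 0) f f" using fl by (simp add: has_wderiv_def)
  then obtain f' B where B: "AE x in lebesgue. f x = f' x" "\<And>x. \<bar>f' x\<bar> \<le> B"
    using wderiv_bounded_version[OF \<phi> so] by (metis msize_eq_0_iff)
  show "tempered (mult_dpartial g k f)"
  proof (rule tempered_mult_dpartial[OF L wm _ Lp_loc_measurable[OF fl]])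
    show "AE x in lebesgue. \<bar>wderiv (munit k) g x\<bar> \<le> L" using ae w(2) by (auto elim!: eventually_mono)
    show "AE x in lebesgue. \<bar>f x\<bar> \<le> B" using B by (auto elim!: eventually_mono)
  qed
qed

theorem theorem3p6:
  fixes p :: ennreal and \<phi> :: "real ^ 'n::finite \<Rightarrow> real"
  assumes p: "1 \<le> p" and \<phi>: "mollifier \<phi>"
  shows
    \<comment> \<open>1.\<close>
    "(\<forall>N\<ge>1. \<exists>c::real. \<forall>f :: real ^ 'n \<Rightarrow> real. f \<in> camp p N \<longrightarrow>
        (\<exists>F\<in>Ck1 (N - 1). (AE x in lebesgue. f x = F x) \<and>
           Ck1_norm (N - 1) F \<le> ennreal c * camp_norm p N f) \<and>
        (\<forall>\<alpha>. msize \<alpha> = N \<longrightarrow> has_wderiv \<alpha> f (wderiv \<alpha> f) \<and>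
           Lp_norm \<infinity> UNIV (wderiv \<alpha> f) \<le> ennreal c * camp_norm p N f))
   \<and> (\<exists>c::real. \<forall>f :: real ^ 'n \<Rightarrow> real. f \<in> camp p 0 \<longrightarrow>
        Lp_norm \<infinity> UNIV f \<le> ennreal c * camp_norm p 0 f)
   \<and> \<comment> \<open>2.\<close>
     (\<forall>N. (\<forall>f :: real ^ 'n \<Rightarrow> real. f \<in> camp p N \<longrightarrow> (\<exists>!Q. has_Pinf \<phi> N (reg f) Q)) \<and>
        linear_projection (camp p N) (hpolys N) (\<lambda>f. Pinf \<phi> N (reg f)) \<and>
        (\<forall>f\<in>camp p N. \<forall>\<alpha>. msize \<alpha> \<le> N \<longrightarrow>
           Pinf_exists \<phi> (N - msize \<alpha>) (dderiv \<alpha> (reg f)) \<and>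
           mderiv \<alpha> (Pinf \<phi> N (reg f)) = Pinf \<phi> (N - msize \<alpha>) (dderiv \<alpha> (reg f))))
   \<and> \<comment> \<open>3.\<close>
     (\<forall>g\<in>camp p 1. \<forall>f\<in>camp p 1. \<forall>k.
        Pinf_exists \<phi> 1 (reg (\<lambda>x. g x * wderiv (munit k) f x)) \<and>
        Pinf_exists \<phi> 0 (reg (wderiv (munit k) f)) \<and>
        Pinf \<phi> 1 (reg (\<lambda>x. g x * wderiv (munit k) f x))
          = (\<lambda>x. Pinf \<phi> 1 (reg g) x * partial k (Pinf \<phi> 1 (reg f)) x) \<and>
        Pinf \<phi> 1 (reg (\<lambda>x. g x * wderiv (munit k) f x))
          = (\<lambda>x. Pinf \<phi> 1 (reg g) x * Pinf \<phi> 0 (reg (wderiv (munit k) f)) x))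
   \<and> (\<forall>g\<in>Ck1 0. \<forall>f\<in>camp p 0. \<forall>k.
        has_wderiv (munit k) g (wderiv (munit k) g) \<and>
        tempered (mult_dpartial g k f) \<and>
        Pdot_tendsto \<phi> 0 0 (mult_dpartial g k f) (\<lambda>x. 0))
   \<and> \<comment> \<open>4.\<close>
     (\<forall>v :: real ^ 'n \<Rightarrow> real ^ 'n. \<forall>f\<in>camp p 1.
        (\<forall>i. (\<lambda>x. v x $ i) \<in> camp p 1) \<and>
        (AE x in lebesgue. (\<Sum>i\<in>UNIV. wderiv (munit i) (\<lambda>y. v y $ i) x) = 0) \<longrightarrow>
        (\<forall>k. Pinf_exists \<phi> 0
               (reg (\<lambda>x. \<Sum>i\<in>UNIV. wderiv (munit k) (\<lambda>y. v y $ i) x * wderiv (munit i) f x)) \<and>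
             (\<forall>i. Pinf_exists \<phi> 0 (reg (wderiv (munit k) (\<lambda>y. v y $ i))) \<and>
                  Pinf_exists \<phi> 0 (reg (wderiv (munit i) f))) \<and>
             Pinf \<phi> 0
               (reg (\<lambda>x. \<Sum>i\<in>UNIV. wderiv (munit k) (\<lambda>y. v y $ i) x * wderiv (munit i) f x))
               = (\<lambda>x. \<Sum>i\<in>UNIV. Pinf \<phi> 0 (reg (wderiv (munit k) (\<lambda>y. v y $ i))) x *
                               Pinf \<phi> 0 (reg (wderiv (munit i) f)) x)))"
proof (intro conjI allI impI ballI)
  note \<phi>0 = kernel_mollifier[OF \<phi>]
  note so = camp_summable_osc[OF p]
  note wd = camp_has_wderiv[OF p \<phi>0 _ msize_munit]
  {
    fix N :: nat assume N: "1 \<le> N"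
    obtain \<Phi> :: "real ^ 'n \<Rightarrow> real" where \<Phi>: "kernel N \<Phi>" using ex_kernel[OF \<phi>0] by blast
    show "\<exists>c::real. \<forall>f :: real ^ 'n \<Rightarrow> real. f \<in> camp p N \<longrightarrow>
        (\<exists>F\<in>Ck1 (N - 1). (AE x in lebesgue. f x = F x) \<and>
           Ck1_norm (N - 1) F \<le> ennreal c * camp_norm p N f) \<and>
        (\<forall>\<alpha>. msize \<alpha> = N \<longrightarrow> has_wderiv \<alpha> f (wderiv \<alpha> f) \<and>
           Lp_norm \<infinity> UNIV (wderiv \<alpha> f) \<le> ennreal c * camp_norm p N f)"
      by (rule ex_forward[OF camp_embedding[OF p \<Phi>]]) (use N camp_has_wderiv[OF p \<phi>0] in blast)
  next
    have "has_wderiv (\<lambda>i. 0) f f" if "f \<in> camp p 0" for f :: "real ^ 'n \<Rightarrow> real"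
      using summable_osc_Lp_loc[OF so[OF that]] by (simp add: has_wderiv_def)
    then show "\<exists>c::real. \<forall>f :: real ^ 'n \<Rightarrow> real. f \<in> camp p 0 \<longrightarrow> Lp_norm \<infinity> UNIV f \<le> ennreal c * camp_norm p 0 f"
      using camp_embedding[OF p \<phi>0] by (simp add: msize_eq_0_iff) meson
  next
    fix N and f :: "real ^ 'n \<Rightarrow> real" assume "f \<in> camp p N"
    then show "\<exists>!Q. has_Pinf \<phi> N (reg f) Q" by (rule has_Pinf_imp_ex1[OF has_Pinf_reg[OF \<phi>0 so]])
  next
    fix N show "linear_projection (camp p N) (hpolys N) (\<lambda>f. Pinf \<phi> N (reg f))"
      by (rule linear_projection_Pinf[OF p \<phi>0])
  next
    fix N and f :: "real ^ 'n \<Rightarrow> real" and \<alpha> :: "'n mindex" assume f: "f \<in> camp p N" and \<alpha>: "msize \<alpha> \<le> N"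
    note D = has_Pinf_dderiv[OF \<phi>0 so[OF f] \<alpha>]
    show "Pinf_exists \<phi> (N - msize \<alpha>) (dderiv \<alpha> (reg f))" by (rule has_Pinf_imp_exists[OF D])
    show "mderiv \<alpha> (Pinf \<phi> N (reg f)) = Pinf \<phi> (N - msize \<alpha>) (dderiv \<alpha> (reg f))"
      by (simp add: has_Pinf_imp_Pinf[OF D] has_Pinf_imp_Pinf[OF has_Pinf_reg[OF \<phi>0 so[OF f]]])
  next
    fix f g :: "real ^ 'n \<Rightarrow> real" and k assume g: "g \<in> camp p 1" and f: "f \<in> camp p 1"
    note P = has_Pinf_product[OF \<phi>0 so[OF g] so[OF f] wd[OF f, of k]]
    note D = has_Pinf_wderiv[OF \<phi>0 so[OF f] wd[OF f, of k]]
    note F = has_Pinf_reg[OF \<phi>0 so[OF f]] and G = has_Pinf_reg[OF \<phi>0 so[OF g]]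
    show "Pinf_exists \<phi> 1 (reg (\<lambda>x. g x * wderiv (munit k) f x))" by (rule has_Pinf_imp_exists[OF P])
    show "Pinf_exists \<phi> 0 (reg (wderiv (munit k) f))" by (rule has_Pinf_imp_exists[OF D])
    show "Pinf \<phi> 1 (reg (\<lambda>x. g x * wderiv (munit k) f x)) = (\<lambda>x. Pinf \<phi> 1 (reg g) x * partial k (Pinf \<phi> 1 (reg f)) x)"
      unfolding has_Pinf_imp_Pinf[OF P] has_Pinf_imp_Pinf[OF F] has_Pinf_imp_Pinf[OF G] partial_Taylor_inf_1 ..
    show "Pinf \<phi> 1 (reg (\<lambda>x. g x * wderiv (munit k) f x)) = (\<lambda>x. Pinf \<phi> 1 (reg g) x * Pinf \<phi> 0 (reg (wderiv (munit k) f)) x)"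
      unfolding has_Pinf_imp_Pinf[OF P] has_Pinf_imp_Pinf[OF D] has_Pinf_imp_Pinf[OF G] partial_Taylor_inf_1 ..
  next
    fix f g :: "real ^ 'n \<Rightarrow> real" and k assume "g \<in> Ck1 0" "f \<in> camp p 0"
    note * = Lipschitz_times_derivative_vanishes_at_infinity[OF p \<phi>0 this, of k]
    show "has_wderiv (munit k) g (wderiv (munit k) g)" "tempered (mult_dpartial g k f)"
      "Pdot_tendsto \<phi> 0 0 (mult_dpartial g k f) (\<lambda>x. 0)" by (fact *)+
  next
    fix v :: "real ^ 'n \<Rightarrow> real ^ 'n" and f :: "real ^ 'n \<Rightarrow> real" and k :: 'n
    assume f: "f \<in> camp p 1" and A: "(\<forall>i. (\<lambda>x. v x $ i) \<in> camp p 1) \<and>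
        (AE x in lebesgue. (\<Sum>i\<in>UNIV. wderiv (munit i) (\<lambda>y. v y $ i) x) = 0)"
    then have v: "\<And>i. (\<lambda>x. v x $ i) \<in> camp p 1" and div: "AE x in lebesgue. (\<Sum>i\<in>UNIV. wderiv (munit i) (\<lambda>y. v y $ i) x) = 0"
      by auto
    note P = has_Pinf_div_free_product[OF \<phi>0 so[OF v] wd[OF v] wd[OF v] div so[OF f] wd[OF f], of k]
    have V: "has_Pinf \<phi> 0 (reg (wderiv (munit k) (\<lambda>y. v y $ i))) (\<lambda>x. lim_moment \<phi> (\<lambda>y. v y $ i) (munit k))" for i
      using has_Pinf_wderiv[OF \<phi>0 so[OF v] wd[OF v]] by (simp only: partial_Taylor_inf_1)
    have F: "has_Pinf \<phi> 0 (reg (wderiv (munit i) f)) (\<lambda>x. lim_moment \<phi> f (munit i))" for i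
      using has_Pinf_wderiv[OF \<phi>0 so[OF f] wd[OF f]] by (simp only: partial_Taylor_inf_1)
    show "Pinf_exists \<phi> 0 (reg (\<lambda>x. \<Sum>i\<in>UNIV. wderiv (munit k) (\<lambda>y. v y $ i) x * wderiv (munit i) f x))"
      by (rule has_Pinf_imp_exists[OF P])
    show "Pinf_exists \<phi> 0 (reg (wderiv (munit k) (\<lambda>y. v y $ i)))" for i by (rule has_Pinf_imp_exists[OF V])
    show "Pinf_exists \<phi> 0 (reg (wderiv (munit i) f))" for i by (rule has_Pinf_imp_exists[OF F])
    show "Pinf \<phi> 0 (reg (\<lambda>x. \<Sum>i\<in>UNIV. wderiv (munit k) (\<lambda>y. v y $ i) x * wderiv (munit i) f x)) =
        (\<lambda>x. \<Sum>i\<in>UNIV. Pinf \<phi> 0 (reg (wderiv (munit k) (\<lambda>y. v y $ i))) x * Pinf \<phi> 0 (reg (wderiv (munit i) f)) x)"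
      unfolding has_Pinf_imp_Pinf[OF P] has_Pinf_imp_Pinf[OF V] has_Pinf_imp_Pinf[OF F] ..
  }
qed

end
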